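(* For every integer $n\ge 1$, \[\left.\langle\nabla e_n,h_1^n\rangle\right|_{q=-1}=t^{\lfloor n^2/4\rfloor}E_n(t),\] where $E_n(t)=\sum_{\sigma\in\mathfrak A_n}t^{31\text{-}2(\sigma)}$ is the $t$-analogue of the Euler numbers counting $31$-$2$ patterns in alternating permutations.
   Context: Symmetric functions. $\Lambda$ is the algebra of symmetric functions over $\mathbb Q(q,t)$ with the Hall scalar product $\langle\,,\rangle$ (Schur functions are orthonormal); $e_n$, $h_n$ are the elementary and complete homogeneous symmetric functions. For a partition $\mu\vdash n$, $\tilde H_\mu=\tilde H_\mu[X;q,t]=\sum_{\lambda\vdash n}K_{\lambda\mu}(q,1/t)\,t^{n(\mu)}s_\lambda$ is the modified Macdonald polynomial, where $K_{\lambda\mu}(q,t)$ are the Macdonald $q,t$-Kostka coefficients and $n(\mu)=\sum_i(i-1)\mu_i$; equivalently, $\tilde H_\mu$ is characterised by $\tilde H_\mu[X(1-q)]\in\mathrm{span}\{s_\lambda:\lambda\ge\mu\}$, $\tilde H_\mu[X(1-t)]\in\mathrm{span}\{s_\lambda:\lambda\ge\mu'\}$ (dominance order, plethystic notation $p_r[X(1-u)]=(1-u^r)p_r$) and $\langle\tilde H_\mu,s_{(n)}\rangle=1$. The $\tilde H_\mu$ form a basis of $\Lambda$, and $\nabla:\Lambda\to\Lambda$ is the linear operator with $\nabla\tilde H_\mu=q^{n(\mu')}t^{n(\mu)}\tilde H_\mu$, where $\mu'$ is the conjugate partition. The coefficient $\langle\nabla e_n,h_1^n\rangle$ is a polynomial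 in $q,t$ (it is the bigraded Hilbert series of diagonal harmonics). Permutations. $\mathfrak A_n$ is the set of alternating permutations, i.e. $\sigma\in\mathfrak S_n$ with $\sigma_1>\sigma_2<\sigma_3>\cdots$. A $31$-$2$ pattern in $\sigma\in\mathfrak S_n$ is a pair of indices $(i,j)$ with $1\le i<i+1<j\le n$ and $\sigma_i>\sigma_j>\sigma_{i+1}$; $31\text{-}2(\sigma)$ is the number of such patterns. *)

theory Defs
  imports
    "HOL-Library.Multiset"
    "HOL-Library.FuncSet"
    "HOL-Combinatorics.Permutations"
    "HOL-Computational_Algebra.Polynomial_Factorial"
begin

section \<open>The coefficient field\<close>

text \<open>\<open>\<rat>(q,t)\<close> is the fraction field of \<open>\<rat>[t][q]\<close>: in \<^typ>\<open>rat poly poly\<close> the outer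
  polynomial variable is \<open>q\<close> and the inner one is \<open>t\<close>.\<close>

type_synonym qt = "rat poly poly fract"

definition q_var :: qt where
  "q_var = to_fract [:0, 1:]"

definition t_var :: qt where
  "t_var = to_fract [:[:0, 1:]:]"


section \<open>The algebra of symmetric functions\<close>

text \<open>A monomial in the variables \<open>x\<^sub>0, x\<^sub>1, \<dots>\<close> is the multiset of the indices of its
  variables; a formal power series is its coefficient function. Symmetric functions are the
  symmetric power series of bounded degree.\<close>

lemma finite_submultisets: "finite {A. A \<subseteq># M}"
proof (induction M)
  case (add x M)
  have "{A. A \<subseteq># add_mset x M} \<subseteq> {A. A \<subseteq># M} \<union> add_mset x ` {A. A \<subseteq># M}"
  proof
    fix A assume "A \<in> {A. A \<subseteq># add_mset x M}"
    then have A: "A \<subseteq># add_mset x M" by simp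
    show "A \<in> {A. A \<subseteq># M} \<union> add_mset x ` {A. A \<subseteq># M}"
    proof (cases "x \<in># A")
      case True
      then obtain B where "A = add_mset x B" by (metis insert_DiffM)
      with A show ?thesis by auto
    next
      case False
      with A have "A \<subseteq># M"
        by (metis Diff_eq_empty_iff_mset add_mset_remove_trivial diff_single_trivial
            minus_add_mset_if_not_in_lhs subset_eq_diff_conv union_mset_add_mset_right)
      then show ?thesis by simp
    qed
  qed
  then show ?case using add by (meson finite_UnI finite_imageI finite_subset)
qed simp

lemma count_image_mset_inj: "inj f \<Longrightarrow> count (image_mset f M) (f x) = count M x"
  by (induction M) (auto simp: inj_eq)

typedef (overloaded) 'a symfun =
  "{f :: nat multiset \<Rightarrow> 'a :: comm_ring_1.
      (\<forall>\<pi> M. bij \<pi> \<longrightarrow> f (image_mset \<pi> M) = f M) \<and> (\<exists>d. \<forall>M. d < size M \<longrightarrow> f M = 0)}"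
  morphisms mcoeff Abs_symfun
  by (rule exI[of _ "\<lambda>_. 0"]) auto

setup_lifting type_definition_symfun

lemma double_diff_mset: "A \<subseteq># M \<Longrightarrow> M - (M - A) = A"
  by (metis add_diff_cancel_right' subset_mset.add_diff_inverse)

lemma conv_invariant:
  fixes f g :: "nat multiset \<Rightarrow> 'a :: comm_ring_1"
  assumes "\<And>M. f (image_mset \<pi> M) = f M" "\<And>M. g (image_mset \<pi> M) = g M" and "bij \<pi>"
  shows "(\<Sum>A | A \<subseteq># image_mset \<pi> M. f A * g (image_mset \<pi> M - A)) =
         (\<Sum>A | A \<subseteq># M. f A * g (M - A))"
proof -
  have inv1: "image_mset \<pi> (image_mset (inv \<pi>) A) = A" for A
    using assms(3) by (simp add: multiset.map_comp bij_is_surj surj_iff[THEN iffD1])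
  have inv2: "image_mset (inv \<pi>) (image_mset \<pi> A) = A" for A
    using assms(3) by (simp add: multiset.map_comp bij_is_inj)
  show ?thesis
  proof (rule sum.reindex_bij_witness[of _ "image_mset \<pi>" "image_mset (inv \<pi>)"])
    fix A assume "A \<in> {A. A \<subseteq># image_mset \<pi> M}"
    then have A: "A \<subseteq># image_mset \<pi> M" by simp
    show "image_mset \<pi> (image_mset (inv \<pi>) A) = A" by (rule inv1)
    have *: "image_mset (inv \<pi>) A \<subseteq># M"
      using image_mset_subseteq_mono[OF A, of "inv \<pi>"] by (simp only: inv2)
    then show "image_mset (inv \<pi>) A \<in> {A. A \<subseteq># M}" by simp
    have "f (image_mset (inv \<pi>) A) = f A" by (metis assms(1) inv1)
    moreover have "g (M - image_mset (inv \<pi>) A) = g (image_mset \<pi> M - A)"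
      using image_mset_Diff[OF *, of \<pi>] assms(2)[of "M - image_mset (inv \<pi>) A"]
      by (simp only: inv1)
    ultimately show "f (image_mset (inv \<pi>) A) * g (M - image_mset (inv \<pi>) A) =
      f A * g (image_mset \<pi> M - A)" by simp
  qed (auto simp only: inv2 mem_Collect_eq image_mset_subseteq_mono)
qed

instantiation symfun :: (comm_ring_1) comm_ring_1
begin

lift_definition zero_symfun :: "'a symfun" is "\<lambda>_. 0" by auto

lift_definition one_symfun :: "'a symfun" is "\<lambda>M. if M = {#} then 1 else 0" by auto

lift_definition plus_symfun :: "'a symfun \<Rightarrow> 'a symfun \<Rightarrow> 'a symfun" is "\<lambda>f g M. f M + g M"
proof -
  fix f g :: "nat multiset \<Rightarrow> 'a :: comm_ring_1"
  assume f: "(\<forall>\<pi> M. bij \<pi> \<longrightarrow> f (image_mset \<pi> M) = f M) \<and> (\<exists>d. \<forall>M. d < size M \<longrightarrow> f M = 0)"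
    and g: "(\<forall>\<pi> M. bij \<pi> \<longrightarrow> g (image_mset \<pi> M) = g M) \<and> (\<exists>d. \<forall>M. d < size M \<longrightarrow> g M = 0)"
  then obtain d d' where "\<forall>M. d < size M \<longrightarrow> f M = 0" "\<forall>M. d' < size M \<longrightarrow> g M = 0" by blast
  then have "\<forall>M. max d d' < size M \<longrightarrow> f M + g M = 0" by simp
  with f g show "(\<forall>\<pi> M. bij \<pi> \<longrightarrow> f (image_mset \<pi> M) + g (image_mset \<pi> M) = f M + g M) \<and>
    (\<exists>d. \<forall>M. d < size M \<longrightarrow> f M + g M = 0)" by (metis (no_types, lifting))
qed

lift_definition uminus_symfun :: "'a symfun \<Rightarrow> 'a symfun" is "\<lambda>f M. - f M" by simp

definition minus_symfun :: "'a symfun \<Rightarrow> 'a symfun \<Rightarrow> 'a symfun" where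
  "minus_symfun f g = f + - g"

lift_definition times_symfun :: "'a symfun \<Rightarrow> 'a symfun \<Rightarrow> 'a symfun"
  is "\<lambda>f g M. \<Sum>A | A \<subseteq># M. f A * g (M - A)"
proof -
  fix f g :: "nat multiset \<Rightarrow> 'a :: comm_ring_1"
  assume f: "(\<forall>\<pi> M. bij \<pi> \<longrightarrow> f (image_mset \<pi> M) = f M) \<and> (\<exists>d. \<forall>M. d < size M \<longrightarrow> f M = 0)"
    and g: "(\<forall>\<pi> M. bij \<pi> \<longrightarrow> g (image_mset \<pi> M) = g M) \<and> (\<exists>d. \<forall>M. d < size M \<longrightarrow> g M = 0)"
  then obtain d d' where d: "\<And>M. d < size M \<Longrightarrow> f M = 0" "\<And>M. d' < size M \<Longrightarrow> g M = 0" by blast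
  have "(\<Sum>A | A \<subseteq># M. f A * g (M - A)) = 0" if "d + d' < size M" for M
  proof (rule sum.neutral, safe)
    fix A assume "A \<subseteq># M"
    then have "size M = size A + size (M - A)" by (metis size_union subset_mset.add_diff_inverse)
    with that have "d < size A \<or> d' < size (M - A)" by linarith
    with d show "f A * g (M - A) = 0" by auto
  qed
  moreover have "(\<Sum>A | A \<subseteq># image_mset \<pi> M. f A * g (image_mset \<pi> M - A)) =
         (\<Sum>A | A \<subseteq># M. f A * g (M - A))" if "bij \<pi>" for \<pi> M
    using conv_invariant[of f \<pi> g M] f g that by blast
  ultimately show "(\<forall>\<pi> M. bij \<pi> \<longrightarrow> (\<Sum>A | A \<subseteq># image_mset \<pi> M. f A * g (image_mset \<pi> M - A)) =
         (\<Sum>A | A \<subseteq># M. f A * g (M - A))) \<and>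
      (\<exists>d. \<forall>M. d < size M \<longrightarrow> (\<Sum>A | A \<subseteq># M. f A * g (M - A)) = 0)"
    by blast
qed

instance
proof
  fix a b c :: "'a symfun"
  show "a + b + c = a + (b + c)" by transfer (simp add: add.assoc)
  show "a + b = b + a" by transfer (simp add: add.commute)
  show "0 + a = a" by transfer simp
  show "- a + a = 0" by transfer simp
  show "a - b = a + - b" by (rule minus_symfun_def)
  show "(a + b) * c = a * c + b * c"
    by transfer (simp add: sum.distrib distrib_right)
  show "a * b = b * a"
  proof (transfer, rule ext)
    fix f g :: "nat multiset \<Rightarrow> 'a :: comm_ring_1" and M
    show "(\<Sum>A | A \<subseteq># M. f A * g (M - A)) = (\<Sum>A | A \<subseteq># M. g A * f (M - A))"
      by (rule sum.reindex_bij_witness[of _ "\<lambda>A. M - A" "\<lambda>A. M - A"])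
        (auto simp: mult.commute double_diff_mset)
  qed
  show "1 * a = a"
  proof (transfer, rule ext)
    fix f :: "nat multiset \<Rightarrow> 'a :: comm_ring_1" and M
    have "(\<Sum>A | A \<subseteq># M. (if A = {#} then 1 else 0) * f (M - A)) =
      (\<Sum>A | A \<subseteq># M. if A = {#} then f M else 0)"
      by (rule sum.cong) auto
    then show "(\<Sum>A | A \<subseteq># M. (if A = {#} then 1 else 0) * f (M - A)) = f M"
      using finite_submultisets[of M] by (simp add: sum.delta')
  qed
  show "a * b * c = a * (b * c)"
  proof (transfer, rule ext)
    fix f g h :: "nat multiset \<Rightarrow> 'a :: comm_ring_1" and M
    have "(\<Sum>A | A \<subseteq># M. (\<Sum>B | B \<subseteq># A. f B * g (A - B)) * h (M - A)) =
      (\<Sum>(A, B) \<in> (SIGMA A:{A. A \<subseteq># M}. {B. B \<subseteq># A}). f B * g (A - B) * h (M - A))"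
      by (simp add: sum_distrib_right sum.Sigma finite_submultisets)
    also have "\<dots> = (\<Sum>(B, C) \<in> (SIGMA B:{B. B \<subseteq># M}. {C. C \<subseteq># M - B}).
        f B * (g C * h (M - B - C)))"
      by (rule sum.reindex_bij_witness[of _ "\<lambda>(B, C). (B + C, B)" "\<lambda>(A, B). (B, A - B)"])
        (auto simp: subset_mset.le_diff_conv2 subset_mset.diff_add add.commute mult.assoc
          intro: subset_mset.order_trans)
    also have "\<dots> = (\<Sum>A | A \<subseteq># M. f A * (\<Sum>B | B \<subseteq># M - A. g B * h (M - A - B)))"
      by (simp add: sum_distrib_left sum.Sigma finite_submultisets)
    finally show "(\<Sum>A | A \<subseteq># M. (\<Sum>B | B \<subseteq># A. f B * g (A - B)) * h (M - A)) =
      (\<Sum>A | A \<subseteq># M. f A * (\<Sum>B | B \<subseteq># M - A. g B * h (M - A - B)))" .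
  qed
  show "(0 :: 'a symfun) \<noteq> 1"
    by transfer (metis zero_neq_one)
qed

end

lift_definition scale_sym :: "'a :: comm_ring_1 \<Rightarrow> 'a symfun \<Rightarrow> 'a symfun" is "\<lambda>c f M. c * f M"
  by (metis (no_types, lifting) mult_zero_right)

interpretation symfun: vector_space "scale_sym :: 'a :: field \<Rightarrow> _"
  by standard (transfer; simp add: algebra_simps)+

lift_definition elementary_sym :: "nat \<Rightarrow> 'a :: comm_ring_1 symfun"
  is "\<lambda>n M. if size M = n \<and> (\<forall>i. count M i \<le> 1) then 1 else 0"
proof (intro conjI allI impI)
  fix n and \<pi> :: "nat \<Rightarrow> nat" and M assume "bij \<pi>"
  then have "count (image_mset \<pi> M) (\<pi> i) = count M i" for i
    by (intro count_image_mset_inj) (rule bij_is_inj)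
  then have "(\<forall>i. count (image_mset \<pi> M) i \<le> 1) \<longleftrightarrow> (\<forall>i. count M i \<le> 1)"
    using \<open>bij \<pi>\<close> by (metis bij_pointE)
  then show "(if size (image_mset \<pi> M) = n \<and> (\<forall>i. count (image_mset \<pi> M) i \<le> 1) then 1 else 0) =
    (if size M = n \<and> (\<forall>i. count M i \<le> 1) then 1 else 0 :: 'a)" by simp
qed auto

lift_definition complete_sym :: "nat \<Rightarrow> 'a :: comm_ring_1 symfun"
  is "\<lambda>n M. if size M = n then 1 else 0"
  by (intro conjI exI) auto

lift_definition power_sum_sym :: "nat \<Rightarrow> 'a :: comm_ring_1 symfun"
  is "\<lambda>r M. if \<exists>i. M = replicate_mset r i then 1 else 0"
proof (intro conjI allI impI)
  fix r and \<pi> :: "nat \<Rightarrow> nat" and M assume "bij \<pi>"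
  have "(\<exists>i. image_mset \<pi> M = replicate_mset r i) \<longleftrightarrow> (\<exists>i. M = replicate_mset r i)"
  proof
    assume "\<exists>i. image_mset \<pi> M = replicate_mset r i"
    then obtain i where "image_mset \<pi> M = replicate_mset r i" ..
    then have "image_mset (inv \<pi>) (image_mset \<pi> M) = replicate_mset r (inv \<pi> i)" by simp
    moreover have "image_mset (inv \<pi>) (image_mset \<pi> M) = M"
      using \<open>bij \<pi>\<close> by (simp add: multiset.map_comp bij_is_inj)
    ultimately show "\<exists>i. M = replicate_mset r i" by auto
  qed auto
  then show "(if \<exists>i. image_mset \<pi> M = replicate_mset r i then 1 else 0) =
    (if \<exists>i. M = replicate_mset r i then 1 else 0 :: 'a)" by simp
next
  fix r
  show "\<exists>d. \<forall>M. d < size M \<longrightarrow> (if \<exists>i. M = replicate_mset r i then 1 else 0) = (0 :: 'a)"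
    by (rule exI[of _ r]) auto
qed

section \<open>Schur functions and the Hall scalar product\<close>

lemma bij_agrees_with_permutation:
  assumes "bij \<pi>" "finite A"
  obtains \<sigma> S where "\<sigma> permutes S" "finite S" "\<And>x. x \<in> A \<Longrightarrow> \<sigma> x = \<pi> x"
proof -
  let ?S = "A \<union> \<pi> ` A"
  have inj: "inj_on \<pi> A" using assms(1) by (meson bij_is_inj inj_on_subset top_greatest)
  have fin: "finite (?S - A)" "finite (?S - \<pi> ` A)" using assms(2) by auto
  have "card (?S - A) = card (?S - \<pi> ` A)"
    using assms(2) card_image[OF inj] by (simp add: card_Diff_subset)
  then obtain h where h: "bij_betw h (?S - A) (?S - \<pi> ` A)"
    using fin finite_same_card_bij by blast
  define \<sigma> where "\<sigma> x = (if x \<in> A then \<pi> x else if x \<in> ?S then h x else x)" for x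
  have "bij_betw \<sigma> A (\<pi> ` A)"
    using inj by (auto simp: bij_betw_def \<sigma>_def inj_on_def)
  moreover have "bij_betw \<sigma> (?S - A) (?S - \<pi> ` A)"
    using h by (subst bij_betw_cong[of _ _ h]) (auto simp: \<sigma>_def)
  ultimately have "bij_betw \<sigma> (A \<union> (?S - A)) (\<pi> ` A \<union> (?S - \<pi> ` A))"
    by (rule bij_betw_combine) auto
  moreover have "A \<union> (?S - A) = ?S" "\<pi> ` A \<union> (?S - \<pi> ` A) = ?S" by auto
  ultimately have "bij_betw \<sigma> ?S ?S" by simp
  then have "\<sigma> permutes ?S" by (rule bij_imp_permutes) (auto simp: \<sigma>_def)
  then show thesis using assms(2) by (intro that[of \<sigma> ?S]) (auto simp: \<sigma>_def)
qed

lemma invariant_if_adjacent: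
  fixes f :: "nat multiset \<Rightarrow> 'b"
  assumes adj: "\<And>k M. f (image_mset (transpose k (Suc k)) M) = f M" and "bij \<pi>"
  shows "f (image_mset \<pi> M) = f M"
proof -
  have tr: "f (image_mset (transpose i (i + d)) M) = f M" for i d M
  proof (induction d arbitrary: M)
    case (Suc d)
    show ?case
    proof (cases "d = 0")
      case True
      then show ?thesis using adj by simp
    next
      case False
      let ?s = "transpose (i + d) (Suc (i + d))"
      have "transpose i (i + Suc d) = ?s \<circ> transpose i (i + d) \<circ> ?s"
        using False by (auto simp: fun_eq_iff transpose_def)
      then have "image_mset (transpose i (i + Suc d)) M =
        image_mset ?s (image_mset (transpose i (i + d)) (image_mset ?s M))"
        by (simp only: multiset.map_comp comp_assoc)
      then show ?thesis by (simp only: adj Suc)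
    qed
  qed simp
  have tr2: "f (image_mset (transpose i j) M) = f M" for i j M
    by (metis tr le_Suc_ex linorder_linear transpose_commute)
  obtain \<sigma> S where \<sigma>: "\<sigma> permutes S" "finite S" "\<And>x. x \<in> set_mset M \<Longrightarrow> \<sigma> x = \<pi> x"
    using bij_agrees_with_permutation[OF assms(2) finite_set_mset] by blast
  have "f (image_mset \<sigma> M) = f M" for M
    using \<sigma>(1,2)
  proof (induction arbitrary: M rule: permutes_induct)
    case (swap a b p)
    have "image_mset (transpose a b \<circ> p) M = image_mset (transpose a b) (image_mset p M)"
      by (simp add: multiset.map_comp)
    then show ?case by (simp only: tr2 swap)
  qed simp
  then show ?thesis using \<sigma>(3) by (metis image_mset_cong)
qed

definition diagram :: "nat list \<Rightarrow> (nat \<times> nat) set" where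
  "diagram \<mu> = {(i, j). i < length \<mu> \<and> j < \<mu> ! i}"

definition semistandard_tableaux :: "nat list \<Rightarrow> (nat \<times> nat \<Rightarrow> nat) set" where
  "semistandard_tableaux \<mu> = {T \<in> extensional (diagram \<mu>).
     (\<forall>i j. (i, Suc j) \<in> diagram \<mu> \<longrightarrow> T (i, j) \<le> T (i, Suc j)) \<and>
     (\<forall>i j. (Suc i, j) \<in> diagram \<mu> \<longrightarrow> T (i, j) < T (Suc i, j))}"

definition tableau_content :: "nat list \<Rightarrow> (nat \<times> nat \<Rightarrow> nat) \<Rightarrow> nat multiset" where
  "tableau_content \<mu> T = image_mset T (mset_set (diagram \<mu>))"

lemma diagram_Sigma: "diagram \<mu> = (SIGMA i:{..<length \<mu>}. {..<\<mu> ! i})"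
  by (auto simp: diagram_def)

lemma finite_diagram [simp]: "finite (diagram \<mu>)"
  by (simp add: diagram_Sigma)

lemma size_tableau_content [simp]: "size (tableau_content \<mu> T) = card (diagram \<mu>)"
  by (simp add: tableau_content_def)

lemma count_tableau_content: "count (tableau_content \<mu> T) c = card {x \<in> diagram \<mu>. T x = c}"
  unfolding tableau_content_def
  by (subst count_image_mset)
    (auto simp: vimage_def Collect_conj_eq Int_commute count_mset_set' 
      intro!: arg_cong[of _ _ card])

text \<open>Row \<open>i\<close> of a semistandard tableau is determined by the numbers \<open>a i c\<close> of its entries
  smaller than \<open>c\<close>.\<close>

definition thresholds ::
    "nat list \<Rightarrow> (nat \<times> nat \<Rightarrow> nat) \<Rightarrow> (nat \<Rightarrow> nat \<Rightarrow> nat) \<Rightarrow> bool" where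
  "thresholds \<mu> T a \<longleftrightarrow>
     (\<forall>i j c. (i, j) \<in> diagram \<mu> \<longrightarrow> (T (i, j) < c \<longleftrightarrow> j < a i c)) \<and>
     (\<forall>i c. i < length \<mu> \<longrightarrow> a i c \<le> \<mu> ! i) \<and>
     (\<forall>i c. length \<mu> \<le> i \<longrightarrow> a i c = 0) \<and>
     (\<forall>i c. a (Suc i) (Suc c) \<le> a i c)"

lemma down_closed_nat:
  assumes "\<And>j. Suc j < n \<Longrightarrow> P (Suc j) \<Longrightarrow> P j"
  shows "\<exists>m\<le>n. \<forall>j<n. P j \<longleftrightarrow> j < (m :: nat)"
  using assms
proof (induction n)
  case (Suc n)
  then obtain m where m: "m \<le> n" "\<forall>j<n. P j \<longleftrightarrow> j < m" by auto
  show ?case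
  proof (cases "P n")
    case True
    have "m = n"
    proof (cases n)
      case (Suc k)
      with True Suc.prems[of k] m show ?thesis by auto
    qed (use m in simp)
    with True m show ?thesis by (intro exI[of _ "Suc n"]) (auto simp: less_Suc_eq)
  next
    case False
    with m show ?thesis by (intro exI[of _ m]) (auto simp: less_Suc_eq)
  qed
qed simp

lemma ex_thresholds:
  assumes "T \<in> semistandard_tableaux \<mu>" and sorted: "sorted_wrt (\<ge>) \<mu>"
  shows "\<exists>a. thresholds \<mu> T a"
proof -
  have row: "T (i, j) \<le> T (i, Suc j)" if "(i, Suc j) \<in> diagram \<mu>" for i j
    using assms(1) that by (auto simp: semistandard_tableaux_def)
  have col: "T (i, j) < T (Suc i, j)" if "(Suc i, j) \<in> diagram \<mu>" for i j
    using assms(1) that by (auto simp: semistandard_tableaux_def)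
  have "\<exists>m\<le>\<mu> ! i. \<forall>j<\<mu> ! i. T (i, j) < c \<longleftrightarrow> j < m" if "i < length \<mu>" for i c
    by (rule down_closed_nat) (use row that in \<open>fastforce simp: diagram_def\<close>)
  then obtain b where b: "\<And>i c. i < length \<mu> \<Longrightarrow> b i c \<le> \<mu> ! i"
    "\<And>i c j. i < length \<mu> \<Longrightarrow> j < \<mu> ! i \<Longrightarrow> T (i, j) < c \<longleftrightarrow> j < b i c"
    by metis
  define a where "a i c = (if i < length \<mu> then b i c else 0)" for i c
  have "a (Suc i) (Suc c) \<le> a i c" for i c
  proof (cases "Suc i < length \<mu>")
    case True
    have le: "\<mu> ! Suc i \<le> \<mu> ! i" using sorted_wrt_nth_less[OF sorted, of i "Suc i"] True by simp
    show ?thesis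
    proof (rule ccontr)
      assume "\<not> ?thesis"
      then have lt: "a i c < a (Suc i) (Suc c)" by simp
      define j where "j = a i c"
      have j: "j < \<mu> ! Suc i" using lt b(1)[OF True, of "Suc c"] True by (simp add: j_def a_def)
      then have "T (Suc i, j) < Suc c" using b(2)[OF True] lt True by (simp add: j_def a_def)
      moreover have "T (i, j) < T (Suc i, j)" using col True j by (simp add: diagram_def)
      ultimately have "T (i, j) < c" by simp
      then have "j < a i c" using b(2)[of i j c] True le j by (simp add: a_def)
      then show False by (simp add: j_def)
    qed
  qed (simp add: a_def)
  then have "thresholds \<mu> T a" using b by (auto simp: thresholds_def a_def diagram_def)
  then show ?thesis by blast
qed

lemma semistandard_if_thresholds:
  assumes "thresholds \<mu> T a" "T \<in> extensional (diagram \<mu>)" and sorted: "sorted_wrt (\<ge>) \<mu>"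
  shows "T \<in> semistandard_tableaux \<mu>"
proof -
  have a: "T (i, j) < c \<longleftrightarrow> j < a i c" if "(i, j) \<in> diagram \<mu>" for i j c
    using assms(1) that by (auto simp: thresholds_def)
  have le: "a (Suc i) (Suc c) \<le> a i c" for i c
    using assms(1) by (auto simp: thresholds_def)
  have "T (i, j) \<le> T (i, Suc j)" if "(i, Suc j) \<in> diagram \<mu>" for i j
  proof -
    have "(i, j) \<in> diagram \<mu>" using that by (auto simp: diagram_def)
    then show ?thesis using a[OF that, of "Suc (T (i, Suc j))"] a[of i j "Suc (T (i, Suc j))"] by simp
  qed
  moreover have "T (i, j) < T (Suc i, j)" if "(Suc i, j) \<in> diagram \<mu>" for i j
  proof -
    have "\<mu> ! Suc i \<le> \<mu> ! i"
      using sorted_wrt_nth_less[OF sorted, of i "Suc i"] that by (simp add: diagram_def)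
    then have "(i, j) \<in> diagram \<mu>" using that by (auto simp: diagram_def)
    moreover have "j < a (Suc i) (Suc (T (Suc i, j)))" using a[OF that] by blast
    ultimately show ?thesis using a le[of i "T (Suc i, j)"] by (meson order.strict_trans2)
  qed
  ultimately show ?thesis using assms(2) by (simp add: semistandard_tableaux_def)
qed

lemma count_tableau_content_thresholds:
  assumes "thresholds \<mu> T a"
  shows "count (tableau_content \<mu> T) c = (\<Sum>i<length \<mu>. a i (Suc c) - a i c)"
proof -
  have "{x \<in> diagram \<mu>. T x = c} = (SIGMA i:{..<length \<mu>}. {a i c..<a i (Suc c)})"
  proof (rule set_eqI)
    fix x :: "nat \<times> nat"
    obtain i j where x: "x = (i, j)" by fastforce
    have "T (i, j) = c \<longleftrightarrow> \<not> T (i, j) < c \<and> T (i, j) < Suc c" by auto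
    then have "T (i, j) = c \<longleftrightarrow> \<not> j < a i c \<and> j < a i (Suc c)" if "(i, j) \<in> diagram \<mu>"
      using assms that by (simp add: thresholds_def)
    moreover have "a i (Suc c) \<le> \<mu> ! i" if "i < length \<mu>"
      using assms that by (simp add: thresholds_def)
    ultimately show "x \<in> {x \<in> diagram \<mu>. T x = c} \<longleftrightarrow>
        x \<in> (SIGMA i:{..<length \<mu>}. {a i c..<a i (Suc c)})"
      unfolding x diagram_def by auto
  qed
  then show ?thesis by (simp add: count_tableau_content)
qed

lemma threshold_mono:
  assumes "thresholds \<mu> T a" "c \<le> d"
  shows "a i c \<le> a i d"
proof (rule ccontr)
  assume "\<not> ?thesis"
  then have lt: "a i d < a i c" by simp
  then have i: "i < length \<mu>" using assms(1) by (cases "i < length \<mu>") (auto simp: thresholds_def)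
  moreover have "a i c \<le> \<mu> ! i" using assms(1) i by (auto simp: thresholds_def)
  ultimately have "(i, a i d) \<in> diagram \<mu>" using lt by (auto simp: diagram_def)
  then have "T (i, a i d) < c" "\<not> T (i, a i d) < d" using assms(1) lt by (auto simp: thresholds_def)
  with assms(2) show False by simp
qed

text \<open>The Bender--Knuth involution exchanging the numbers of entries \<open>k\<close> and \<open>k + 1\<close>: in row \<open>i\<close> the
  number of entries \<open>\<le> k\<close> may vary, independently of the other rows, in an interval that is
  determined by the entries different from \<open>k, k + 1\<close>. It is reflected in that interval.\<close>

definition reflected :: "(nat \<Rightarrow> nat \<Rightarrow> nat) \<Rightarrow> nat \<Rightarrow> nat \<Rightarrow> nat" where
  "reflected a k i = max (a i k) (a (Suc i) (k + 2)) +
     (if i = 0 then a i (k + 2) else min (a i (k + 2)) (a (i - 1) k)) - a i (k + 1)"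

definition row_counts :: "nat list \<Rightarrow> (nat \<times> nat \<Rightarrow> nat) \<Rightarrow> nat \<Rightarrow> nat \<Rightarrow> nat" where
  "row_counts \<mu> T = (SOME a. thresholds \<mu> T a)"

definition bender_knuth :: "nat list \<Rightarrow> nat \<Rightarrow> (nat \<times> nat \<Rightarrow> nat) \<Rightarrow> nat \<times> nat \<Rightarrow> nat" where
  "bender_knuth \<mu> k T = (\<lambda>(i, j) \<in> diagram \<mu>.
     if T (i, j) = k \<or> T (i, j) = Suc k
     then if j < reflected (row_counts \<mu> T) k i then k else Suc k
     else T (i, j))"

lemma thresholds_unique:
  assumes "thresholds \<mu> T a" "thresholds \<mu> T b"
  shows "a = b"
proof (intro ext)
  fix i c
  show "a i c = b i c"
  proof (cases "i < length \<mu>")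
    case True
    have *: "j < a i c \<longleftrightarrow> j < b i c" if "j < \<mu> ! i" for j
      using assms True that unfolding thresholds_def diagram_def by blast
    have "a i c \<le> \<mu> ! i" "b i c \<le> \<mu> ! i" using assms True by (auto simp: thresholds_def)
    with *[of "a i c"] *[of "b i c"] show ?thesis by (metis less_irrefl linorder_neqE_nat order.strict_trans2)
  next
    case False
    then show ?thesis using assms by (simp add: thresholds_def)
  qed
qed

lemma row_counts:
  assumes "T \<in> semistandard_tableaux \<mu>" "sorted_wrt (\<ge>) \<mu>"
  shows "thresholds \<mu> T (row_counts \<mu> T)"
  unfolding row_counts_def using ex_thresholds[OF assms] by (rule someI_ex)

lemma reflected_bounds:
  assumes "thresholds \<mu> T a"
  shows "max (a i k) (a (Suc i) (k + 2)) \<le> a i (k + 1)"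
    and "a i (k + 1) \<le> (if i = 0 then a i (k + 2) else min (a i (k + 2)) (a (i - 1) k))"
proof -
  have le: "a (Suc i) (Suc c) \<le> a i c" for i c
    using assms by (auto simp: thresholds_def)
  have mono: "a i k \<le> a i (k + 1)" "a i (k + 1) \<le> a i (k + 2)"
    using threshold_mono[OF assms] by simp_all
  show "max (a i k) (a (Suc i) (k + 2)) \<le> a i (k + 1)"
    using le[of i "k + 1"] mono by simp
  show "a i (k + 1) \<le> (if i = 0 then a i (k + 2) else min (a i (k + 2)) (a (i - 1) k))"
    using le[of "i - 1" k] mono by (cases i) auto
qed

lemma bender_knuth_thresholds:
  assumes "T \<in> semistandard_tableaux \<mu>" "sorted_wrt (\<ge>) \<mu>"
  defines "a \<equiv> row_counts \<mu> T"
  shows "thresholds \<mu> (bender_knuth \<mu> k T) (\<lambda>i. (a i)(k + 1 := reflected a k i))"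
proof -
  have a: "thresholds \<mu> T a" unfolding a_def using row_counts assms(1,2) by blast
  have thr: "T (i, j) < c \<longleftrightarrow> j < a i c" if "(i, j) \<in> diagram \<mu>" for i j c
    using a that by (auto simp: thresholds_def)
  have le: "a (Suc i) (Suc c) \<le> a i c" for i c
    using a by (auto simp: thresholds_def)
  have upper: "a i c \<le> \<mu> ! i" if "i < length \<mu>" for i c
    using a that by (auto simp: thresholds_def)
  have zero: "a i c = 0" if "length \<mu> \<le> i" for i c
    using a that by (auto simp: thresholds_def)
  note bounds = reflected_bounds[OF a, of _ k]
  have r1: "max (a i k) (a (Suc i) (k + 2)) \<le> reflected a k i" for i
    using bounds[of i] unfolding reflected_def by linarith
  have r2: "reflected a k i \<le> (if i = 0 then a i (k + 2) else min (a i (k + 2)) (a (i - 1) k))" for i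
    using bounds[of i] unfolding reflected_def by linarith
  have r3: "reflected a k i \<le> a i (k + 2)" for i using r2[of i] by (auto split: if_splits)
  have main: "bender_knuth \<mu> k T (i, j) < c \<longleftrightarrow> j < ((a i)(k + 1 := reflected a k i)) c"
    if "(i, j) \<in> diagram \<mu>" for i j c
  proof -
    note t = thr[OF that]
    have *: "T (i, j) = k \<or> T (i, j) = Suc k \<longleftrightarrow> \<not> T (i, j) < k \<and> T (i, j) < k + 2" by linarith
    have val: "bender_knuth \<mu> k T (i, j) = (if T (i, j) = k \<or> T (i, j) = Suc k
     then if j < reflected a k i then k else Suc k else T (i, j))"
      using that by (simp add: bender_knuth_def a_def)
    consider "c \<le> k" | "c = k + 1" | "k + 2 \<le> c" by linarith
    then show ?thesis
    proof cases
      case 1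
      then have "bender_knuth \<mu> k T (i, j) < c \<longleftrightarrow> T (i, j) < c" unfolding val by auto
      with 1 show ?thesis by (simp add: t)
    next
      case 2
      have "bender_knuth \<mu> k T (i, j) < c \<longleftrightarrow>
          T (i, j) < k \<or> (\<not> T (i, j) < k \<and> T (i, j) < k + 2 \<and> j < reflected a k i)"
        unfolding val 2 using * by auto
      also have "\<dots> \<longleftrightarrow> j < reflected a k i" using r1[of i] r3[of i] by (auto simp: t)
      finally show ?thesis using 2 by simp
    next
      case 3
      then have "bender_knuth \<mu> k T (i, j) < c \<longleftrightarrow> T (i, j) < c" unfolding val by auto
      with 3 show ?thesis by (simp add: t)
    qed
  qed
  show ?thesis
    unfolding thresholds_def
  proof (intro conjI allI impI)
    fix i c
    show "((a i)(k + 1 := reflected a k i)) c \<le> \<mu> ! i" if "i < length \<mu>"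
      using upper[OF that] r3[of i] order.trans by auto
    show "((a i)(k + 1 := reflected a k i)) c = 0" if "length \<mu> \<le> i"
      using zero[OF that] r3[of i] by auto
    show "((a (Suc i))(k + 1 := reflected a k (Suc i))) (Suc c) \<le> ((a i)(k + 1 := reflected a k i)) c"
      using le[of i c] r1[of i] r2[of "Suc i"] by auto
  qed (rule main)
qed

lemma bender_knuth:
  assumes "T \<in> semistandard_tableaux \<mu>" "sorted_wrt (\<ge>) \<mu>"
  shows "bender_knuth \<mu> k T \<in> semistandard_tableaux \<mu>"
    and "row_counts \<mu> (bender_knuth \<mu> k T) =
      (\<lambda>i. (row_counts \<mu> T i)(k + 1 := reflected (row_counts \<mu> T) k i))"
proof -
  show *: "bender_knuth \<mu> k T \<in> semistandard_tableaux \<mu>"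
    by (rule semistandard_if_thresholds[OF bender_knuth_thresholds])
      (use assms in \<open>auto simp: bender_knuth_def\<close>)
  show "row_counts \<mu> (bender_knuth \<mu> k T) =
      (\<lambda>i. (row_counts \<mu> T i)(k + 1 := reflected (row_counts \<mu> T) k i))"
    using thresholds_unique row_counts[OF * assms(2)] bender_knuth_thresholds[OF assms] by blast
qed

lemma bender_knuth_involution:
  assumes "T \<in> semistandard_tableaux \<mu>" "sorted_wrt (\<ge>) \<mu>"
  shows "bender_knuth \<mu> k (bender_knuth \<mu> k T) = T"
proof (intro ext)
  fix x :: "nat \<times> nat"
  obtain i j where x: "x = (i, j)" by fastforce
  let ?a = "row_counts \<mu> T"
  have a: "thresholds \<mu> T ?a" using row_counts assms by blast
  show "bender_knuth \<mu> k (bender_knuth \<mu> k T) x = T x"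
  proof (cases "x \<in> diagram \<mu>")
    case True
    have "reflected (row_counts \<mu> (bender_knuth \<mu> k T)) k i =
        max (?a i k) (?a (Suc i) (k + 2)) +
        (if i = 0 then ?a i (k + 2) else min (?a i (k + 2)) (?a (i - 1) k)) - reflected ?a k i"
      unfolding bender_knuth(2)[OF assms] by (simp add: reflected_def[of "\<lambda>i. (_ i)(_ := _ i)"])
    also have "\<dots> = ?a i (k + 1)"
      using reflected_bounds[OF a, of i k] unfolding reflected_def by linarith
    finally have r: "reflected (row_counts \<mu> (bender_knuth \<mu> k T)) k i = ?a i (k + 1)" .
    have "T (i, j) < k + 1 \<longleftrightarrow> j < ?a i (k + 1)"
      using a True by (simp add: thresholds_def x)
    then show ?thesis using True r by (auto simp: bender_knuth_def x)
  next
    case False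
    then show ?thesis
      using assms(1) by (simp add: x bender_knuth_def semistandard_tableaux_def extensional_def)
  qed
qed

lemma sum_reflected:
  assumes "thresholds \<mu> T a"
  shows "(\<Sum>i<length \<mu>. reflected a k i + a i (k + 1)) = (\<Sum>i<length \<mu>. a i k + a i (k + 2))"
proof -
  let ?lo = "\<lambda>i. max (a i k) (a (Suc i) (k + 2))"
  let ?hi = "\<lambda>i. if i = 0 then a i (k + 2) else min (a i (k + 2)) (a (i - 1) k)"
  have "(\<Sum>i<m. ?lo i + ?hi i) + ?hi m = (\<Sum>i<m. a i k + a i (k + 2)) + a m (k + 2)" for m
    by (induction m) (auto simp: max_def min_def)
  from this[of "length \<mu>"] have "(\<Sum>i<length \<mu>. ?lo i + ?hi i) = (\<Sum>i<length \<mu>. a i k + a i (k + 2))"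
    using assms by (auto simp: thresholds_def split: if_splits)
  moreover have "reflected a k i + a i (k + 1) = ?lo i + ?hi i" for i
    using reflected_bounds[OF assms, of i k] unfolding reflected_def by linarith
  ultimately show ?thesis by simp
qed

lemma tableau_content_bender_knuth:
  assumes "T \<in> semistandard_tableaux \<mu>" "sorted_wrt (\<ge>) \<mu>"
  shows "tableau_content \<mu> (bender_knuth \<mu> k T) = image_mset (transpose k (Suc k)) (tableau_content \<mu> T)"
proof -
  have k: "count (tableau_content \<mu> (bender_knuth \<mu> k T)) k = count (tableau_content \<mu> T) (Suc k)"
    if T: "T \<in> semistandard_tableaux \<mu>" for T
  proof -
    let ?a = "row_counts \<mu> T"
    let ?b = "\<lambda>i. (?a i)(k + 1 := reflected ?a k i)"
    have a: "thresholds \<mu> T ?a" using row_counts T assms(2) by blast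
    have b: "thresholds \<mu> (bender_knuth \<mu> k T) ?b" using bender_knuth_thresholds T assms(2) by blast
    have le: "?a i (k + 1) \<le> ?a i (k + 2)" for i by (rule threshold_mono[OF a]) simp
    have le': "?a i k \<le> reflected ?a k i" for i
      using threshold_mono[OF b, of k "k + 1" i] by simp
    have "(\<Sum>i<length \<mu>. reflected ?a k i - ?a i k) + (\<Sum>i<length \<mu>. ?a i k + ?a i (k + 1)) =
      (\<Sum>i<length \<mu>. reflected ?a k i + ?a i (k + 1))"
      using le' by (simp flip: sum.distrib)
    moreover have "(\<Sum>i<length \<mu>. ?a i (k + 2) - ?a i (k + 1)) + (\<Sum>i<length \<mu>. ?a i k + ?a i (k + 1)) =
      (\<Sum>i<length \<mu>. ?a i k + ?a i (k + 2))"
      using le by (simp flip: sum.distrib add: add.left_commute)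
    ultimately show ?thesis
      using sum_reflected[OF a, of k]
      by (simp add: count_tableau_content_thresholds[OF a] count_tableau_content_thresholds[OF b])
  qed
  have Suc_k: "count (tableau_content \<mu> (bender_knuth \<mu> k T)) (Suc k) = count (tableau_content \<mu> T) k"
    using k[OF bender_knuth(1)[OF assms], of k] bender_knuth_involution[OF assms] by simp
  have other: "count (tableau_content \<mu> (bender_knuth \<mu> k T)) c = count (tableau_content \<mu> T) c"
    if "c \<noteq> k" "c \<noteq> Suc k" for c
    unfolding count_tableau_content using that
    by (intro arg_cong[of _ _ card]) (auto simp: bender_knuth_def split: if_splits)
  show ?thesis
  proof (rule multiset_eqI)
    fix c
    have "count (image_mset (transpose k (Suc k)) (tableau_content \<mu> T)) (transpose k (Suc k) d) =
      count (tableau_content \<mu> T) d" for d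
      by (rule count_image_mset_inj) simp
    from this[of "transpose k (Suc k) c"]
    have "count (image_mset (transpose k (Suc k)) (tableau_content \<mu> T)) c =
      count (tableau_content \<mu> T) (transpose k (Suc k) c)" by simp
    then show "count (tableau_content \<mu> (bender_knuth \<mu> k T)) c =
      count (image_mset (transpose k (Suc k)) (tableau_content \<mu> T)) c"
      using k[OF assms(1)] Suc_k other[of c] by (auto simp: transpose_def)
  qed
qed

lemma card_semistandard_tableaux_invariant:
  assumes "sorted_wrt (\<ge>) \<mu>" "bij \<pi>"
  shows "card {T \<in> semistandard_tableaux \<mu>. tableau_content \<mu> T = image_mset \<pi> M} =
    card {T \<in> semistandard_tableaux \<mu>. tableau_content \<mu> T = M}"
proof -
  have inv: "image_mset (transpose k (Suc k)) (image_mset (transpose k (Suc k)) M) = M"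
    for k and M :: "nat multiset"
    by (simp add: multiset.map_comp)
  have "bij_betw (bender_knuth \<mu> k)
      {T \<in> semistandard_tableaux \<mu>. tableau_content \<mu> T = image_mset (transpose k (Suc k)) M}
      {T \<in> semistandard_tableaux \<mu>. tableau_content \<mu> T = M}" for k M
    by (rule bij_betw_byWitness[where f' = "bender_knuth \<mu> k"])
      (use assms(1) in \<open>auto simp: bender_knuth_involution bender_knuth(1) tableau_content_bender_knuth inv\<close>)
  from bij_betw_same_card[OF this] show ?thesis
    by (rule invariant_if_adjacent[where f = "\<lambda>M. card {T \<in> semistandard_tableaux \<mu>. tableau_content \<mu> T = M}",
        OF _ assms(2)])
qed

text \<open>\<open>s\<^sub>\<mu>\<close> is the generating function of the semistandard tableaux of shape \<open>\<mu>\<close>. Shapes are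
  weakly decreasing lists; trailing zeros do not change the diagram.\<close>

lift_definition schur :: "nat list \<Rightarrow> 'a :: comm_ring_1 symfun"
  is "\<lambda>\<mu> M. if sorted_wrt (\<ge>) \<mu>
        then of_nat (card {T \<in> semistandard_tableaux \<mu>. tableau_content \<mu> T = M}) else 0"
proof (intro conjI allI impI)
  fix \<mu> and \<pi> :: "nat \<Rightarrow> nat" and M assume "bij \<pi>"
  then show "(if sorted_wrt (\<ge>) \<mu>
      then of_nat (card {T \<in> semistandard_tableaux \<mu>. tableau_content \<mu> T = image_mset \<pi> M}) else 0) =
    (if sorted_wrt (\<ge>) \<mu>
      then of_nat (card {T \<in> semistandard_tableaux \<mu>. tableau_content \<mu> T = M}) else 0 :: 'a)"
    using card_semistandard_tableaux_invariant[of \<mu> \<pi> M] by presburger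
next
  fix \<mu>
  have "card {T \<in> semistandard_tableaux \<mu>. tableau_content \<mu> T = M} = 0"
    if "card (diagram \<mu>) < size M" for M
    using that by (auto simp: card_eq_0_iff)
  then have "\<forall>M. card (diagram \<mu>) < size M \<longrightarrow> (if sorted_wrt (\<ge>) \<mu>
      then of_nat (card {T \<in> semistandard_tableaux \<mu>. tableau_content \<mu> T = M}) else 0) = (0 :: 'a)"
    by simp
  then show "\<exists>d. \<forall>M. d < size M \<longrightarrow> (if sorted_wrt (\<ge>) \<mu>
      then of_nat (card {T \<in> semistandard_tableaux \<mu>. tableau_content \<mu> T = M}) else 0) = (0 :: 'a)"
    by blast
qed

definition partitions :: "nat \<Rightarrow> nat list set" where
  "partitions n = {\<mu>. sorted_wrt (\<ge>) \<mu> \<and> 0 \<notin> set \<mu> \<and> sum_list \<mu> = n}"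

definition is_hall_product :: "(qt symfun \<Rightarrow> qt symfun \<Rightarrow> qt) \<Rightarrow> bool" where
  "is_hall_product B \<longleftrightarrow>
     (\<forall>f. Vector_Spaces.linear scale_sym (*) (B f)) \<and>
     (\<forall>g. Vector_Spaces.linear scale_sym (*) (\<lambda>f. B f g)) \<and>
     (\<forall>m n. \<forall>\<mu>\<in>partitions m. \<forall>\<nu>\<in>partitions n. B (schur \<mu>) (schur \<nu>) = of_bool (\<mu> = \<nu>))"

definition hall :: "qt symfun \<Rightarrow> qt symfun \<Rightarrow> qt" where
  "hall = (THE B. is_hall_product B)"


section \<open>Modified Macdonald polynomials and the nabla operator\<close>

text \<open>The plethysm \<open>f \<mapsto> f[X(1-u)]\<close> is the endomorphism of the \<open>\<rat>(q,t)\<close>-algebra of symmetric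
  functions that maps every \<open>p\<^sub>r\<close> to \<open>(1 - u\<^sup>r) p\<^sub>r\<close>.\<close>

definition plethysm_one_minus :: "qt \<Rightarrow> qt symfun \<Rightarrow> qt symfun" where
  "plethysm_one_minus u = (THE \<phi>. Vector_Spaces.linear scale_sym scale_sym \<phi> \<and>
     \<phi> 1 = 1 \<and> (\<forall>f g. \<phi> (f * g) = \<phi> f * \<phi> g) \<and>
     (\<forall>r\<ge>1. \<phi> (power_sum_sym r) = scale_sym (1 - u ^ r) (power_sum_sym r)))"

definition conjugate_partition :: "nat list \<Rightarrow> nat list" where
  "conjugate_partition \<mu> = map (\<lambda>j. card {i. i < length \<mu> \<and> j < \<mu> ! i}) [0..<(if \<mu> = [] then 0 else hd \<mu>)]"

text \<open>List positions start at 0, so this is \<open>\<Sum>\<^sub>i (i - 1) \<mu>\<^sub>i\<close> in the usual numbering of parts.\<close>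

definition part_stat :: "nat list \<Rightarrow> nat" where
  "part_stat \<mu> = (\<Sum>i<length \<mu>. i * \<mu> ! i)"

definition dominates :: "nat list \<Rightarrow> nat list \<Rightarrow> bool" where
  "dominates \<nu> \<mu> \<longleftrightarrow> (\<forall>k. sum_list (take k \<mu>) \<le> sum_list (take k \<nu>))"

definition dominance_span :: "nat list \<Rightarrow> qt symfun set" where
  "dominance_span \<mu> =
     symfun.span (schur ` {\<nu> \<in> partitions (sum_list \<mu>). dominates \<nu> \<mu>})"

definition macdonald :: "nat list \<Rightarrow> qt symfun" where
  "macdonald \<mu> = (THE H.
     plethysm_one_minus q_var H \<in> dominance_span \<mu> \<and>
     plethysm_one_minus t_var H \<in> dominance_span (conjugate_partition \<mu>) \<and>
     hall H (schur [sum_list \<mu>]) = 1)"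

definition nabla :: "qt symfun \<Rightarrow> qt symfun" where
  "nabla = (THE F. Vector_Spaces.linear scale_sym scale_sym F \<and>
     (\<forall>n. \<forall>\<mu>\<in>partitions n. F (macdonald \<mu>) =
        scale_sym (q_var ^ part_stat (conjugate_partition \<mu>) * t_var ^ part_stat \<mu>) (macdonald \<mu>)))"


section \<open>Alternating permutations\<close>

definition alternating_permutations :: "nat \<Rightarrow> (nat \<Rightarrow> nat) set" where
  "alternating_permutations n = {\<sigma>. \<sigma> permutes {1..n} \<and>
     (\<forall>i. 1 \<le> i \<and> i < n \<longrightarrow>
        (if odd i then \<sigma> i > \<sigma> (i + 1) else \<sigma> i < \<sigma> (i + 1)))}"

definition patterns_31_2 :: "nat \<Rightarrow> (nat \<Rightarrow> nat) \<Rightarrow> (nat \<times> nat) set" where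
  "patterns_31_2 n \<sigma> = {(i, j). 1 \<le> i \<and> i + 1 < j \<and> j \<le> n \<and> \<sigma> i > \<sigma> j \<and> \<sigma> j > \<sigma> (i + 1)}"

text \<open>A polynomial in \<open>t\<close>.\<close>

definition euler_poly :: "nat \<Rightarrow> rat poly" where
  "euler_poly n = (\<Sum>\<sigma>\<in>alternating_permutations n. monom 1 (card (patterns_31_2 n \<sigma>)))"

end

theory Submission
 imports Defs "HOL-Computational_Algebra.Formal_Power_Series"
begin

text \<open>The operators \<open>D\<^sub>0\<close> and its \<open>(q, t) \<mapsto> (1/q, 1/t)\<close> dual become triangular in dominance order after either of
 the substitutions \<open>X \<mapsto> X(1 - q)\<close>, \<open>X \<mapsto> X(1 - t)\<close>, so the \<open>H\<^sub>\<mu>\<close> are their common eigenvectors. The commutators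
 of these operators with \<open>\<partial> = \<partial>/\<partial>p\<^sub>1\<close> show that \<open>\<partial>\<close> removes one box from \<open>\<mu>\<close> and that
 \<open>\<partial>\<nabla> = \<nabla> D\<^sub>-\<^sub>1 / ((1 - q) (1 - t))\<close>. Hence \<open>\<langle>\<nabla>e\<^sub>n, h\<^sub>1\<^sup>n\<rangle>\<close> is the constant obtained by applying
 \<open>D\<^sub>-\<^sub>1 / ((1 - q) (1 - t))\<close> \<open>n\<close> times to \<open>e\<^sub>n\<close>, which makes sense for \<open>q = -1\<close>. There the operator only sees odd
 power sums and maps the family \<open>e\<^sub>m[X (1 - t\<^sup>k) / (1 - t)]\<close> to itself; the resulting recursion in \<open>k\<close> and \<open>m\<close> is
 solved in terms of weighted lattice paths, and removing the largest letter of an alternating permutation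
 produces the same weighted paths.\<close>


section \<open>The Pieri rule\<close>

text \<open>The objects are given by \<open>THE\<close>, so their existence has to be proved, and
  the delicate point is the normalisation of \<open>macdonald\<close>: a common eigenvector can be
  normalised only if its product with s_(n) is nonzero, which triangularity does not show. This is
  proved by comparison with q = 1 and t a large integer, where the operator becomes a derivation
  with explicit eigenvectors and distinct eigenvalues. Eigenvectors themselves cannot be
  specialised, since nothing is known about their denominators. What is specialised is a calculus of
  words: on products of elementary functions the operators act by a recursion (\<open>quo\<close>)
  whose coefficients are polynomials in q and t, so every constant extracted from it is a
  polynomial. The same device gives q = -1. There the alphabet (1 - q^r) (1 - t^r) vanishes for even
  r, which explains why only odd power sums matter. Closing the family requires division by 1 - t^r
  and 1 + t^k, so the final identity in Q[t] is checked at the integers t >= 2.\<close>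

text \<open>Shapes with at most \<open>L\<close> rows, as functions on row indices.\<close>

definition shapes :: "nat => (nat => nat) set" where
 "shapes L = {\<mu>. (\<forall>i. \<mu> (Suc i) \<le> \<mu> i) \<and> (\<forall>i\<ge>L. \<mu> i = 0)}"

text \<open>\<open>interlace \<nu> \<mu>\<close> says that \<open>\<nu>/\<mu>\<close> is a horizontal strip.\<close>

definition interlace :: "(nat => nat) => (nat => nat) => bool" where
 "interlace \<nu> \<mu> \<longleftrightarrow> (\<forall>i. \<mu> i \<le> \<nu> i \<and> \<nu> (Suc i) \<le> \<mu> i)"

abbreviation shape_list :: "nat => (nat => nat) => nat list" where
 "shape_list L \<mu> \<equiv> map \<mu> [0..<L]"

lemma shapes_antimono: "\<mu> \<in> shapes L ==> i \<le> j ==> \<mu> j \<le> \<mu> i"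
 by (auto simp: shapes_def intro: lift_Suc_antimono_le)

lemma sorted_shape_list: "\<mu> \<in> shapes L ==> sorted_wrt (\<ge>) (shape_list L \<mu>)"
 by (auto simp: sorted_wrt_iff_nth_less intro: shapes_antimono)

lemma diagram_shape_list:
 assumes "\<mu> \<in> shapes L"
 shows "diagram (shape_list L \<mu>) = {(i, j). j < \<mu> i}"
proof -
 have "i < L" if "j < \<mu> i" for i j using that assms by (auto simp: shapes_def intro: ccontr)
 then show ?thesis by (fastforce simp: diagram_def)
qed

lemma interlace_shapes_lower: "interlace \<nu> \<mu> ==> \<nu> \<in> shapes L ==> \<mu> \<in> shapes L"
 unfolding interlace_def shapes_def by (auto intro: order_trans) (metis le_zero_eq)

lemma interlace_shapes_upper:
 assumes "interlace \<nu> \<mu>" "\<mu> \<in> shapes L"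
 shows "\<nu> \<in> shapes (Suc L)"
proof -
 have "\<nu> i = 0" if "Suc L \<le> i" for i using assms that unfolding interlace_def shapes_def
  by (cases i) (auto, metis le_zero_eq)
 moreover have "\<nu> (Suc i) \<le> \<nu> i" for i using assms unfolding interlace_def by (meson order_trans)
 ultimately show ?thesis by (auto simp: shapes_def)
qed

lemma finite_shapes: "finite {\<mu> \<in> shapes L. \<forall>i. \<mu> i \<le> n}"
proof -
 have "{\<mu> \<in> shapes L. \<forall>i. \<mu> i \<le> n} \<subseteq> {f. \<forall>i. (i \<in> {..<L} --> f i \<in> {..n}) \<and> (i \<notin> {..<L} --> f i = 0)}"
  by (auto simp: shapes_def)
 then show ?thesis by (rule finite_subset) (rule finite_set_of_finite_funs, auto)
qed

lemma finite_interlace_lower: "\<nu> \<in> shapes L ==> finite {\<mu>. interlace \<nu> \<mu> \<and> P \<mu>}"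
 by (rule finite_subset[OF _ finite_shapes[of L "\<nu> 0"]])
  (auto intro: interlace_shapes_lower, metis interlace_def le_trans shapes_antimono zero_le)

lemma finite_interlace_upper:
 assumes "\<mu> \<in> shapes L"
 shows "finite {\<nu>. interlace \<nu> \<mu> \<and> sum \<nu> {..<Suc L} = n}"
proof (rule finite_subset[OF _ finite_shapes[of "Suc L" n]], safe)
 fix \<nu> i assume *: "interlace \<nu> \<mu>" "n = sum \<nu> {..<Suc L}"
 show "\<nu> \<in> shapes (Suc L)" using * assms interlace_shapes_upper by blast
 then have "\<nu> i \<le> \<nu> 0" using shapes_antimono by blast
 also have "\<dots> \<le> sum \<nu> {..<Suc L}" by (rule member_le_sum) auto
 finally show "\<nu> i \<le> sum \<nu> {..<Suc L}" .
qed

section \<open>Removing the largest entry of a tableau\<close>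

lemma finite_tableaux: "finite {T \<in> semistandard_tableaux \<mu>. tableau_content \<mu> T = M}"
proof (rule finite_subset)
 show "{T \<in> semistandard_tableaux \<mu>. tableau_content \<mu> T = M} \<subseteq> PiE (diagram \<mu>) (%_. set_mset M)"
  by (auto simp: semistandard_tableaux_def tableau_content_def PiE_def extensional_def)
qed (auto intro: finite_PiE)

lemma tableau_entry_in_content:
 "x \<in> diagram \<mu> ==> T x \<in># tableau_content \<mu> T"
 by (auto simp: tableau_content_def)

lemma tableau_content_split:
 assumes "A \<subseteq> diagram \<mu>" "diagram \<rho> = A" "\<And>x. x \<in> A ==> T' x = T x" "\<And>x. x \<in> diagram \<mu> - A ==> T x = m"
 shows "tableau_content \<mu> T = tableau_content \<rho> T' + replicate_mset (card (diagram \<mu> - A)) m"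
proof -
 have fin: "finite A" using assms(1) finite_subset finite_diagram by blast
 have "mset_set (diagram \<mu>) = mset_set A + mset_set (diagram \<mu> - A)"
  using assms(1) by (metis Diff_disjoint Diff_partition fin finite_Diff finite_diagram mset_set_Union)
 then have "tableau_content \<mu> T = image_mset T (mset_set A) + image_mset T (mset_set (diagram \<mu> - A))"
  by (simp add: tableau_content_def)
 also have "image_mset T (mset_set A) = tableau_content \<rho> T'"
  unfolding tableau_content_def assms(2) using fin by (intro image_mset_cong) (auto simp: assms(3))
 also have "image_mset T (mset_set (diagram \<mu> - A)) = image_mset (%_. m) (mset_set (diagram \<mu> - A))"
  by (intro image_mset_cong) (auto simp: assms(4))
 finally show ?thesis by (simp add: image_mset_const_eq)
qed

lemma card_diagram_shape_list: "\<mu> \<in> shapes L ==> card (diagram (shape_list L \<mu>)) = sum \<mu> {..<L}"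
 by (simp add: diagram_Sigma)

text \<open>The cells with the largest entry \<open>m\<close> form a horizontal strip: rows increase
  weakly, so they sit at the row ends, and columns increase strictly. Deleting them and refilling
  them with \<open>m\<close> are inverse to each other.\<close>

lemma branching_card:
 assumes \<mu>: "\<mu> \<in> shapes L" and M: "\<And>x. x \<in># M ==> x < m"
 shows "card {T \<in> semistandard_tableaux (shape_list L \<mu>).
   tableau_content (shape_list L \<mu>) T = M + replicate_mset c m} =
  (\<Sum>\<rho> | interlace \<mu> \<rho> \<and> sum \<mu> {..<L} = sum \<rho> {..<L} + c.
   card {T \<in> semistandard_tableaux (shape_list L \<rho>). tableau_content (shape_list L \<rho>) T = M})"
proof -
 define R where "R = {\<rho>. interlace \<mu> \<rho> \<and> sum \<mu> {..<L} = sum \<rho> {..<L} + c}"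
 define S where "S = {T \<in> semistandard_tableaux (shape_list L \<mu>).
   tableau_content (shape_list L \<mu>) T = M + replicate_mset c m}"
 define S' where "S' \<rho> = {T \<in> semistandard_tableaux (shape_list L \<rho>). tableau_content (shape_list L \<rho>) T = M}" for \<rho>
 define ext where "ext = (%(\<rho> :: nat => nat, T :: nat \<times> nat => nat).
  restrict (%(i, j). if j < \<rho> i then T (i, j) else m) {(i, j). j < \<mu> i})"
 \<comment> \<open>The threshold of row \<open>i\<close> at \<open>m\<close> is the number of
   entries below \<open>m\<close>, that is, the length of the row once the entries \<open>m\<close>
   are deleted.\<close>
 define res where "res T = (let \<rho> = (%i. row_counts (shape_list L \<mu>) T i m) in
  (\<rho>, restrict T {(i, j). j < \<rho> i}))" for T
 note d\<mu> = diagram_shape_list[OF \<mu>]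
 have R: "\<rho> \<in> shapes L" "diagram (shape_list L \<rho>) = {(i, j). j < \<rho> i}" "\<rho> i \<le> \<mu> i" "\<mu> (Suc i) \<le> \<rho> i"
  "card (diagram (shape_list L \<mu>) - {(i, j). j < \<rho> i}) = c" if "\<rho> \<in> R" for \<rho> i
 proof -
  show 1: "\<rho> \<in> shapes L" using that \<mu> interlace_shapes_lower R_def by blast
  show 2: "diagram (shape_list L \<rho>) = {(i, j). j < \<rho> i}" using diagram_shape_list 1 by blast
  show "\<rho> i \<le> \<mu> i" "\<mu> (Suc i) \<le> \<rho> i" using that by (auto simp: R_def interlace_def)
  have "diagram (shape_list L \<rho>) \<subseteq> diagram (shape_list L \<mu>)"
   using that unfolding 2 d\<mu> by (auto simp: R_def interlace_def intro: less_le_trans)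
  then show "card (diagram (shape_list L \<mu>) - {(i, j). j < \<rho> i}) = c"
   using that unfolding 2[symmetric]
   by (simp add: card_Diff_subset card_diagram_shape_list[OF \<mu>] card_diagram_shape_list[OF 1] R_def)
 qed
 have "bij_betw ext (Sigma R S') S"
 proof (rule bij_betw_byWitness[of _ res])
  show ext_S: "ext ` Sigma R S' \<subseteq> S"
  proof clarify
   fix \<rho> T assume \<rho>: "\<rho> \<in> R" and T: "T \<in> S' \<rho>"
   note r = R[OF \<rho>]
   have lt: "T (i, j) < m" if "j < \<rho> i" for i j
    using T that M tableau_entry_in_content[of "(i, j)" "shape_list L \<rho>" T]
    by (auto simp: S'_def r(2))
   have T1: "T (i, j) \<le> T (i, Suc j)" if "Suc j < \<rho> i" for i j
    using T that unfolding S'_def semistandard_tableaux_def r(2) by auto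
   have T2: "T (i, j) < T (Suc i, j)" if "j < \<rho> (Suc i)" for i j
    using T that unfolding S'_def semistandard_tableaux_def r(2) by auto
   have "ext (\<rho>, T) \<in> semistandard_tableaux (shape_list L \<mu>)"
    unfolding semistandard_tableaux_def d\<mu>
   proof (intro CollectI conjI allI impI)
    show "ext (\<rho>, T) \<in> extensional {(i, j). j < \<mu> i}" by (simp add: ext_def)
    fix i j
    show "ext (\<rho>, T) (i, j) \<le> ext (\<rho>, T) (i, Suc j)" if "(i, Suc j) \<in> {(i, j). j < \<mu> i}"
     using that T1 lt by (auto simp: ext_def less_imp_le)
    assume "(Suc i, j) \<in> {(i, j). j < \<mu> i}"
    then have *: "j < \<mu> (Suc i)" by simp
    then have "j < \<rho> i" using r(4)[of i] by linarith
    moreover from this have "j < \<mu> i" using r(3)[of i] by linarith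
    ultimately show "ext (\<rho>, T) (i, j) < ext (\<rho>, T) (Suc i, j)"
     using * T2 lt by (auto simp: ext_def)
   qed
   moreover have "tableau_content (shape_list L \<mu>) (ext (\<rho>, T)) = tableau_content (shape_list L \<rho>) T +
     replicate_mset (card (diagram (shape_list L \<mu>) - {(i, j). j < \<rho> i})) m"
    by (rule tableau_content_split) (use r in \<open>auto simp: d\<mu> ext_def intro: less_le_trans\<close>)
   ultimately show "ext (\<rho>, T) \<in> S" using T r(5) by (simp add: S_def S'_def)
  qed
  have res_props: "fst (res T) \<in> R \<and> snd (res T) \<in> S' (fst (res T)) \<and> ext (res T) = T" if T: "T \<in> S" for T
  proof -
   define a where "a = row_counts (shape_list L \<mu>) T"
   define \<rho> where "\<rho> i = a i m" for i
   have Tss: "T \<in> semistandard_tableaux (shape_list L \<mu>)" using T by (simp add: S_def)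
   have a: "thresholds (shape_list L \<mu>) T a"
    unfolding a_def using row_counts Tss sorted_shape_list[OF \<mu>] by blast
   have le: "T (i, j) \<le> m" if "j < \<mu> i" for i j
   proof -
    have "T (i, j) \<in># M + replicate_mset c m"
     using T that tableau_entry_in_content[of "(i, j)" "shape_list L \<mu>" T] by (simp add: S_def d\<mu>)
    then show ?thesis using M[of "T (i, j)"] by (auto split: if_splits)
   qed
   have thr: "T (i, j) < x \<longleftrightarrow> j < a i x" if "j < \<mu> i" for i j x
    using a that unfolding thresholds_def d\<mu> by auto
   have aub: "a i x \<le> \<mu> i" for i x
    using a \<mu> unfolding thresholds_def shapes_def by (cases "i < L") auto
   \<comment> \<open>No entry exceeds \<open>m\<close>, so the threshold at \<open>m + 1\<close> is
     the full row; the inequality between the thresholds of adjacent rows then becomes the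
     interlacing condition.\<close>
   have alast: "a i (Suc m) = \<mu> i" for i
   proof (rule ccontr)
    assume "a i (Suc m) \<noteq> \<mu> i"
    then have "a i (Suc m) < \<mu> i" using aub[of i "Suc m"] by linarith
    then show False using thr[of "a i (Suc m)" i "Suc m"] le[of "a i (Suc m)" i] by simp
   qed
   have adj: "a (Suc i) (Suc x) \<le> a i x" for i x using a by (auto simp: thresholds_def)
   have il: "interlace \<mu> \<rho>" using aub adj[of _ m] unfolding alast interlace_def \<rho>_def by auto
   have \<rho>s: "\<rho> \<in> shapes L" using interlace_shapes_lower[OF il \<mu>] .
   note d\<rho> = diagram_shape_list[OF \<rho>s]
   define T' where "T' = restrict T {(i, j). j < \<rho> i}"
   have res: "res T = (\<rho>, T')" by (simp add: res_def T'_def \<rho>_def[abs_def] a_def)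
   have T1: "T (i, j) \<le> T (i, Suc j)" if "Suc j < \<mu> i" for i j
    using Tss that unfolding semistandard_tableaux_def d\<mu> by auto
   have T2: "T (i, j) < T (Suc i, j)" if "j < \<mu> (Suc i)" for i j
    using Tss that unfolding semistandard_tableaux_def d\<mu> by auto
   have \<rho>le: "\<rho> i \<le> \<mu> i" for i using il by (auto simp: interlace_def)
   have T'ss: "T' \<in> semistandard_tableaux (shape_list L \<rho>)"
    unfolding semistandard_tableaux_def d\<rho>
   proof (intro CollectI conjI allI impI)
    fix i j
    show "T' (i, j) \<le> T' (i, Suc j)" if "(i, Suc j) \<in> {(i, j). j < \<rho> i}"
     using that T1[of j i] \<rho>le[of i] by (auto simp: T'_def)
    assume "(Suc i, j) \<in> {(i, j). j < \<rho> i}"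
    then show "T' (i, j) < T' (Suc i, j)"
     using T2[of j i] \<rho>le[of "Suc i"] shapes_antimono[OF \<rho>s, of i "Suc i"] by (auto simp: T'_def)
   qed (simp add: T'_def)
   have T_eq: "T x = m" if "x \<in> diagram (shape_list L \<mu>) - {(i, j). j < \<rho> i}" for x
    using that thr le unfolding d\<mu> \<rho>_def by (force simp: not_less)
   have cont: "tableau_content (shape_list L \<mu>) T = tableau_content (shape_list L \<rho>) T' +
     replicate_mset (card (diagram (shape_list L \<mu>) - {(i, j). j < \<rho> i})) m"
    by (rule tableau_content_split) (use \<rho>le T_eq in \<open>auto simp: d\<mu> d\<rho> T'_def intro: less_le_trans\<close>)
   have lt': "x < m" if x: "x \<in># tableau_content (shape_list L \<rho>) T'" for x
   proof -
    obtain y where "y \<in> diagram (shape_list L \<rho>)" "x = T' y"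
     using x by (auto simp: tableau_content_def)
    then obtain i j where *: "j < \<rho> i" "x = T (i, j)" unfolding d\<rho> by (auto simp: T'_def)
    then show ?thesis using thr[of j i m] \<rho>le[of i] by (simp add: \<rho>_def)
   qed
   have rep: "filter_mset (%x. x < m) (replicate_mset c m) = {#}" for c by (induction c) auto
   have "filter_mset (%x. x < m) M = M" using M by (subst filter_mset_eq_conv) auto
   then have "filter_mset (%x. x < m) (M + replicate_mset c m) = M" by (simp add: rep)
   moreover have "filter_mset (%x. x < m) (tableau_content (shape_list L \<rho>) T') = tableau_content (shape_list L \<rho>) T'"
    using lt' by (subst filter_mset_eq_conv) auto
   then have "filter_mset (%x. x < m) (tableau_content (shape_list L \<mu>) T) = tableau_content (shape_list L \<rho>) T'"
    unfolding cont by (simp add: rep)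
   ultimately have c': "tableau_content (shape_list L \<rho>) T' = M" using T by (simp add: S_def)
   have "size (tableau_content (shape_list L \<mu>) T) = size M + c" using T by (simp add: S_def)
   then have "sum \<mu> {..<L} = size M + c" by (simp add: card_diagram_shape_list[OF \<mu>])
   moreover have "size (tableau_content (shape_list L \<rho>) T') = size M" using c' by simp
   then have "sum \<rho> {..<L} = size M" by (simp add: card_diagram_shape_list[OF \<rho>s])
   ultimately have "\<rho> \<in> R" using il by (simp add: R_def)
   moreover have "T' \<in> S' \<rho>" using c' T'ss by (simp add: S'_def)
   moreover have "ext (\<rho>, T') = T"
   proof
    fix x :: "nat \<times> nat"
    obtain i j where x: "x = (i, j)" by fastforce
    show "ext (\<rho>, T') x = T x"
     using T_eq[of x] Tss unfolding x ext_def T'_def d\<mu> semistandard_tableaux_def extensional_def by auto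
   qed
   ultimately show ?thesis by (simp add: res)
  qed
  show "\<forall>T\<in>S. ext (res T) = T" using res_props by blast
  show "res ` S \<subseteq> Sigma R S'"
  proof (rule image_subsetI)
   fix T assume "T \<in> S"
   then show "res T \<in> Sigma R S'" using res_props[of T] by (cases "res T") auto
  qed
  show "\<forall>x\<in>Sigma R S'. res (ext x) = x"
  proof clarify
   fix \<rho> T assume \<rho>: "\<rho> \<in> R" and T: "T \<in> S' \<rho>"
   note r = R[OF \<rho>]
   have "ext (\<rho>, T) \<in> S" using ext_S \<rho> T by blast
   then have Tss: "ext (\<rho>, T) \<in> semistandard_tableaux (shape_list L \<mu>)" by (simp add: S_def)
   define a where "a = row_counts (shape_list L \<mu>) (ext (\<rho>, T))"
   have a: "thresholds (shape_list L \<mu>) (ext (\<rho>, T)) a"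
    unfolding a_def using row_counts Tss sorted_shape_list[OF \<mu>] by blast
   have thr: "ext (\<rho>, T) (i, j) < x \<longleftrightarrow> j < a i x" if "j < \<mu> i" for i j x
    using a that unfolding thresholds_def d\<mu> by auto
   have aub: "a i x \<le> \<mu> i" for i x
    using a \<mu> unfolding thresholds_def shapes_def by (cases "i < L") auto
   have lt: "T (i, j) < m" if "j < \<rho> i" for i j
    using T that M tableau_entry_in_content[of "(i, j)" "shape_list L \<rho>" T]
    by (auto simp: S'_def r(2))
   have "j < a i m \<longleftrightarrow> j < \<rho> i" if "j < \<mu> i" for i j
    using thr[OF that, of m] that lt by (auto simp: ext_def split: if_splits)
   then have am: "a i m = \<rho> i" for i
    using aub[of i m] r(3)[of i] by (metis linorder_neqE_nat order.strict_trans2 less_irrefl)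
   have "restrict (ext (\<rho>, T)) {(i, j). j < \<rho> i} = T"
   proof
    fix x :: "nat \<times> nat"
    obtain i j where x: "x = (i, j)" by fastforce
    show "restrict (ext (\<rho>, T)) {(i, j). j < \<rho> i} x = T x"
     using T r(3)[of i] unfolding x ext_def S'_def r(2) semistandard_tableaux_def extensional_def by auto
   qed
   then show "res (ext (\<rho>, T)) = (\<rho>, T)" using am by (simp add: res_def a_def)
  qed
 qed
 then have "card S = card (Sigma R S')" by (simp add: bij_betw_same_card)
 also have "\<dots> = (\<Sum>\<rho>\<in>R. card (S' \<rho>))"
  by (intro card_SigmaI) (auto simp: S'_def finite_tableaux R_def intro: finite_interlace_lower[OF \<mu>])
 finally show ?thesis by (simp add: S_def S'_def R_def)
qed

lemma mcoeff_schur_branching: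
 assumes "\<mu> \<in> shapes L" "\<And>x. x \<in># M ==> x < m"
 shows "mcoeff (schur (shape_list L \<mu>)) (M + replicate_mset c m) =
  (\<Sum>\<rho> | interlace \<mu> \<rho> \<and> sum \<mu> {..<L} = sum \<rho> {..<L} + c. mcoeff (schur (shape_list L \<rho>)) M)"
proof -
 have "sorted_wrt (\<ge>) (shape_list L \<rho>)" if "interlace \<mu> \<rho>" for \<rho>
  using interlace_shapes_lower[OF that assms(1)] by (rule sorted_shape_list)
 then show ?thesis
  using branching_card[OF assms, where c = c] sorted_shape_list[OF assms(1)] by (simp add: schur.rep_eq)
qed

lemma mcoeff_complete_times:
 "mcoeff (complete_sym k * f) M = (\<Sum>A | A \<subseteq># M \<and> size A = k. mcoeff f (M - A))"
proof -
 have "mcoeff (complete_sym k * f) M = (\<Sum>A | A \<subseteq># M. (if size A = k then 1 else 0) * mcoeff f (M - A))"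
  by (simp add: times_symfun.rep_eq complete_sym.rep_eq)
 also have "\<dots> = (\<Sum>A | A \<subseteq># M \<and> size A = k. mcoeff f (M - A))"
  by (rule sum.mono_neutral_cong_right) (auto simp: finite_submultisets)
 finally show ?thesis .
qed

text \<open>The index \<open>i\<close> is the number of copies of the largest variable that are
  taken from the factor h_k; the other k - i variables of that factor come from
  \<open>M\<close>.\<close>

lemma mcoeff_complete_times_split:
 assumes "\<And>x. x \<in># M ==> x < m"
 shows "mcoeff (complete_sym k * f) (M + replicate_mset c m) =
  (\<Sum>i\<le>min k c. \<Sum>B | B \<subseteq># M \<and> size B = k - i. mcoeff f (M - B + replicate_mset (c - i) m))"
proof -
 have m: "m \<notin># M" using assms by blast
 then have m': "m \<notin># B" if "B \<subseteq># M" for B using that by (meson mset_subset_eqD)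
 have split: "A = filter_mset (%x. x < m) A + replicate_mset (count A m) m"
  "filter_mset (%x. x < m) A \<subseteq># M" "count A m \<le> c" if "A \<subseteq># M + replicate_mset c m" for A
 proof -
  have 1: "count A x \<le> count (M + replicate_mset c m) x" for x by (rule mset_subset_eq_count[OF that])
  show "count A m \<le> c" using 1[of m] m by (simp add: not_in_iff)
  have 2: "count A x = 0" if "x > m" for x using 1[of x] that assms[of x]
   by (cases "x \<in># M") (auto simp: not_in_iff)
  then show "A = filter_mset (%x. x < m) A + replicate_mset (count A m) m"
   by (intro multiset_eqI) (auto simp: not_less dest: le_neq_implies_less)
  show "filter_mset (%x. x < m) A \<subseteq># M"
  proof (rule mset_subset_eqI)
   fix x show "count (filter_mset (%x. x < m) A) x \<le> count M x" using 1[of x] by (auto split: if_splits)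
  qed
 qed
 have diff: "M + replicate_mset c m - (B + replicate_mset i m) = M - B + replicate_mset (c - i) m"
  if "B \<subseteq># M" "i \<le> c" for B i
 proof (rule multiset_eqI)
  fix x show "count (M + replicate_mset c m - (B + replicate_mset i m)) x =
    count (M - B + replicate_mset (c - i) m) x" using m m'[OF that(1)] that by (auto simp: not_in_iff)
 qed
 have "mcoeff (complete_sym k * f) (M + replicate_mset c m) =
  (\<Sum>(i, B)\<in>(SIGMA i:{..min k c}. {B. B \<subseteq># M \<and> size B = k - i}). mcoeff f (M - B + replicate_mset (c - i) m))"
  unfolding mcoeff_complete_times
 proof (rule sum.reindex_bij_witness[of _ "%(i, B). B + replicate_mset i m"
   "%A. (count A m, filter_mset (%x. x < m) A)"], goal_cases)
  case (1 A)
  then show ?case using split by auto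
 next
  case (2 A)
  then have "size A = size (filter_mset (%x. x < m) A) + count A m"
   using split[of A] by (metis (no_types, lifting) mem_Collect_eq size_replicate_mset size_union)
  with 2 show ?case using split[of A] by auto
 next
  case (3 b)
  then obtain i B where b: "b = (i, B)" "B \<subseteq># M" "size B = k - i" "i \<le> min k c" by auto
  have "filter_mset (%x. x < m) B = B"
   using assms b(2) by (simp add: filter_mset_eq_conv) (meson mset_subset_eqD)
  then show ?case using b m' by (simp add: not_in_iff)
 next
  case (4 b)
  then obtain i B where b: "b = (i, B)" "B \<subseteq># M" "size B = k - i" "i \<le> min k c" by auto
  have "replicate_mset i m \<subseteq># replicate_mset c m" using b(4) by (intro mset_subset_eqI) auto
  then show ?case using b by (auto intro: subset_mset.add_mono)
 next
  case (5 A)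
  then show ?case using split[of A] diff[of "filter_mset (%x. x < m) A" "count A m"] by simp
 qed
 also have "\<dots> = (\<Sum>i\<le>min k c. \<Sum>B | B \<subseteq># M \<and> size B = k - i. mcoeff f (M - B + replicate_mset (c - i) m))"
  by (rule sum.Sigma[symmetric]) (auto intro: finite_subset[OF _ finite_submultisets])
 finally show ?thesis .
qed

lemma max_plus_min: "max a b + min a b = a + (b :: nat)" by auto

text \<open>Fomin's local rule: in every row the intervals in which \<open>\<nu>\<close> and \<open>\<sigma>\<close> may vary are the same, up to a shift
 of the row index; only the first row of \<open>\<nu>\<close> is unbounded.\<close>

lemma local_rule:
 assumes \<mu>: "\<mu> \<in> shapes L"
 fixes F :: "(nat => nat) => 'b :: comm_monoid_add"
 shows "(\<Sum>\<nu> | interlace \<nu> \<mu> \<and> sum \<nu> {..<Suc L} = sum \<mu> {..<L} + k.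
   \<Sum>\<rho> | interlace \<nu> \<rho> \<and> sum \<nu> {..<Suc L} = sum \<rho> {..<Suc L} + c. F \<rho>) =
  (\<Sum>i\<le>min k c. \<Sum>\<sigma> | interlace \<mu> \<sigma> \<and> sum \<mu> {..<L} = sum \<sigma> {..<L} + (c - i).
   \<Sum>\<rho> | interlace \<rho> \<sigma> \<and> sum \<rho> {..<Suc L} = sum \<sigma> {..<L} + (k - i). F \<rho>)"
proof -
 define N where "N = {\<nu>. interlace \<nu> \<mu> \<and> sum \<nu> {..<Suc L} = sum \<mu> {..<L} + k}"
 define R where "R \<nu> = {\<rho>. interlace \<nu> \<rho> \<and> sum \<nu> {..<Suc L} = sum \<rho> {..<Suc L} + c}" for \<nu>
 define S where "S i = {\<sigma>. interlace \<mu> \<sigma> \<and> sum \<mu> {..<L} = sum \<sigma> {..<L} + (c - i)}" for i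
 define R' where "R' i \<sigma> = {\<rho>. interlace \<rho> \<sigma> \<and> sum \<rho> {..<Suc L} = sum \<sigma> {..<L} + (k - i)}" for i \<sigma>
 \<comment> \<open>Row \<open>i + 1\<close> of \<nu> and row \<open>i\<close> of \<sigma> vary in
   the same interval, and \<open>refl\<close> reflects it. The first row of \<nu> is bounded only
   from below; its excess over that bound becomes the outer summation index on the right
   side.\<close>
 define refl where "refl \<rho> f i = max (\<mu> (Suc i)) (\<rho> (Suc i)) + min (\<mu> i) (\<rho> i) - f" for \<rho> :: "nat => nat" and f i :: nat
 define to where "to = (%(\<nu> :: nat => nat, \<rho>). (\<nu> 0 - max (\<mu> 0) (\<rho> 0), (%i. refl \<rho> (\<nu> (Suc i)) i, \<rho>)))"
 define bwd where "bwd = (%(i, (\<sigma> :: nat => nat, \<rho>)).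
  (%j. case j of 0 => max (\<mu> 0) (\<rho> 0) + i | Suc j => refl \<rho> (\<sigma> j) j, \<rho>))"
 have \<mu>L: "\<mu> L = 0" using \<mu> by (simp add: shapes_def)
 \<comment> \<open>Since max + min is the sum, the maxima of rows i + 1 and the minima of rows i add
   up to the sizes of \<mu> and \<rho>, up to the maximum in row 0.\<close>
 have sums: "sum \<sigma> {..<L} + sum \<nu> {..<Suc L} + max (\<mu> 0) (\<rho> 0) = sum \<mu> {..<L} + sum \<rho> {..<Suc L} + \<nu> 0"
  if "\<And>i. \<sigma> i + \<nu> (Suc i) = max (\<mu> (Suc i)) (\<rho> (Suc i)) + min (\<mu> i) (\<rho> i)" for \<sigma> \<nu> \<rho> :: "nat => nat"
 proof -
  have "sum \<sigma> {..<L} + sum \<nu> {..<Suc L} + max (\<mu> 0) (\<rho> 0) =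
    (\<Sum>i<L. \<sigma> i + \<nu> (Suc i)) + \<nu> 0 + max (\<mu> 0) (\<rho> 0)"
   by (subst sum.lessThan_Suc_shift) (simp add: sum.distrib)
  also have "\<dots> = (\<Sum>i<L. max (\<mu> (Suc i)) (\<rho> (Suc i))) + max (\<mu> 0) (\<rho> 0) + (\<Sum>i<L. min (\<mu> i) (\<rho> i)) + \<nu> 0"
   by (simp add: that sum.distrib)
  also have "(\<Sum>i<L. max (\<mu> (Suc i)) (\<rho> (Suc i))) + max (\<mu> 0) (\<rho> 0) = (\<Sum>i<Suc L. max (\<mu> i) (\<rho> i))"
   by (subst sum.lessThan_Suc_shift) simp
  also have "(\<Sum>i<L. min (\<mu> i) (\<rho> i)) = (\<Sum>i<Suc L. min (\<mu> i) (\<rho> i))"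
   by (simp add: \<mu>L)
  also have "(\<Sum>i<Suc L. max (\<mu> i) (\<rho> i)) + (\<Sum>i<Suc L. min (\<mu> i) (\<rho> i)) = (\<Sum>i<Suc L. \<mu> i + \<rho> i)"
   by (simp only: sum.distrib[symmetric] max_plus_min)
  finally show ?thesis by (simp add: sum.distrib \<mu>L)
 qed
 have to_props: "bwd (to (\<nu>, \<rho>)) = (\<nu>, \<rho>) \<and> to (\<nu>, \<rho>) \<in> (SIGMA i:{..min k c}. Sigma (S i) (R' i))"
  if "\<nu> \<in> N" "\<rho> \<in> R \<nu>" for \<nu> \<rho>
 proof -
  have il: "interlace \<nu> \<mu>" "interlace \<nu> \<rho>" using that by (auto simp: N_def R_def)
  have i0: "\<nu> 0 \<ge> max (\<mu> 0) (\<rho> 0)" using il by (auto simp: interlace_def)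
  have bds: "max (\<mu> (Suc i)) (\<rho> (Suc i)) \<le> \<nu> (Suc i)" "\<nu> (Suc i) \<le> min (\<mu> i) (\<rho> i)" for i
   using il by (auto simp: interlace_def)
  define \<sigma> where "\<sigma> i = refl \<rho> (\<nu> (Suc i)) i" for i
  have bds': "max (\<mu> (Suc i)) (\<rho> (Suc i)) \<le> \<sigma> i" "\<sigma> i \<le> min (\<mu> i) (\<rho> i)" for i
   using bds[of i] unfolding \<sigma>_def refl_def by linarith+
  have add: "\<sigma> i + \<nu> (Suc i) = max (\<mu> (Suc i)) (\<rho> (Suc i)) + min (\<mu> i) (\<rho> i)" for i
   using bds[of i] unfolding \<sigma>_def refl_def by linarith
  have to: "to (\<nu>, \<rho>) = (\<nu> 0 - max (\<mu> 0) (\<rho> 0), (\<sigma>, \<rho>))" by (simp add: to_def \<sigma>_def[abs_def])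
  have "bwd (to (\<nu>, \<rho>)) = (\<nu>, \<rho>)"
  proof -
   have "refl \<rho> (\<sigma> j) j = \<nu> (Suc j)" for j using add[of j] by (simp add: refl_def)
   then show ?thesis using i0 by (auto simp: to bwd_def fun_eq_iff split: nat.split)
  qed
  moreover have "interlace \<mu> \<sigma>" "interlace \<rho> \<sigma>" using bds' by (auto simp: interlace_def)
  moreover note sums[of \<sigma> \<nu> \<rho>, OF add] i0
  moreover have "sum \<nu> {..<Suc L} = sum \<mu> {..<L} + k" "sum \<nu> {..<Suc L} = sum \<rho> {..<Suc L} + c"
   using that by (auto simp: N_def R_def)
  moreover have "sum \<sigma> {..<L} \<le> sum \<mu> {..<L}" using bds' by (intro sum_mono) auto
  moreover have "sum \<sigma> {..<L} \<le> sum \<rho> {..<Suc L}"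
   using bds' by (intro order_trans[OF sum_mono[of _ \<sigma> \<rho>]]) auto
  ultimately show ?thesis unfolding to S_def R'_def by auto
 qed
 have bwd_props: "to (bwd (i, \<sigma>, \<rho>)) = (i, \<sigma>, \<rho>) \<and> bwd (i, \<sigma>, \<rho>) \<in> Sigma N R"
  if "i \<le> min k c" "\<sigma> \<in> S i" "\<rho> \<in> R' i \<sigma>" for i \<sigma> \<rho>
 proof -
  have il: "interlace \<mu> \<sigma>" "interlace \<rho> \<sigma>" using that by (auto simp: S_def R'_def)
  have bds: "max (\<mu> (Suc i)) (\<rho> (Suc i)) \<le> \<sigma> i" "\<sigma> i \<le> min (\<mu> i) (\<rho> i)" for i
   using il by (auto simp: interlace_def)
  define \<nu> where "\<nu> j = (case j of 0 => max (\<mu> 0) (\<rho> 0) + i | Suc j => refl \<rho> (\<sigma> j) j)" for j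
  have \<nu>0: "\<nu> 0 = max (\<mu> 0) (\<rho> 0) + i" and \<nu>Suc: "\<nu> (Suc j) = refl \<rho> (\<sigma> j) j" for j
   by (simp_all add: \<nu>_def)
  have bds': "max (\<mu> (Suc i)) (\<rho> (Suc i)) \<le> \<nu> (Suc i)" "\<nu> (Suc i) \<le> min (\<mu> i) (\<rho> i)" for i
   using bds[of i] unfolding \<nu>Suc refl_def by linarith+
  have add: "\<sigma> i + \<nu> (Suc i) = max (\<mu> (Suc i)) (\<rho> (Suc i)) + min (\<mu> i) (\<rho> i)" for i
   using bds[of i] unfolding \<nu>Suc refl_def by linarith
  have bwd: "bwd (i, \<sigma>, \<rho>) = (\<nu>, \<rho>)" by (simp add: bwd_def \<nu>_def[abs_def])
  have "to (bwd (i, \<sigma>, \<rho>)) = (i, \<sigma>, \<rho>)"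
  proof -
   have "refl \<rho> (\<nu> (Suc j)) j = \<sigma> j" for j using add[of j] by (simp add: refl_def)
   then show ?thesis by (simp add: to_def bwd \<nu>0)
  qed
  moreover have "interlace \<nu> \<mu>" "interlace \<nu> \<rho>" unfolding interlace_def
  proof (safe)
   fix j
   show "\<mu> j \<le> \<nu> j" "\<rho> j \<le> \<nu> j" using bds'(1)[of "j - 1"] \<nu>0 by (cases j; simp)+
   show "\<nu> (Suc j) \<le> \<mu> j" "\<nu> (Suc j) \<le> \<rho> j" using bds'(2)[of j] by auto
  qed
  moreover note sums[of \<sigma> \<nu> \<rho>, OF add] \<nu>0
  moreover have "sum \<mu> {..<L} = sum \<sigma> {..<L} + (c - i)" "sum \<rho> {..<Suc L} = sum \<sigma> {..<L} + (k - i)"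
   using that by (auto simp: S_def R'_def)
  ultimately show ?thesis using that(1) unfolding bwd N_def R_def by auto
 qed
 have "(\<Sum>\<nu>\<in>N. \<Sum>\<rho>\<in>R \<nu>. F \<rho>) = (\<Sum>(\<nu>, \<rho>)\<in>Sigma N R. F \<rho>)"
  unfolding N_def R_def by (intro sum.Sigma ballI finite_interlace_upper[OF \<mu>])
   (auto intro: finite_interlace_lower interlace_shapes_upper[OF _ \<mu>])
 also have "\<dots> = (\<Sum>(i, \<sigma>, \<rho>)\<in>(SIGMA i:{..min k c}. Sigma (S i) (R' i)). F \<rho>)"
 proof (rule sum.reindex_bij_witness[of _ bwd to], goal_cases)
  case (3 b) then show ?case using bwd_props by (cases b) auto
 next
  case (4 b) then show ?case using bwd_props by (cases b) auto
 next
  case (5 a) then show ?case by (cases a) (simp add: to_def)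
 qed (use to_props in auto)
 also have "\<dots> = (\<Sum>i\<le>min k c. \<Sum>\<sigma>\<in>S i. \<Sum>\<rho>\<in>R' i \<sigma>. F \<rho>)"
 proof -
  have fS: "finite (S i)" for i unfolding S_def by (rule finite_interlace_lower[OF \<mu>])
  have fR: "finite (R' i \<sigma>)" if "\<sigma> \<in> S i" for i \<sigma>
   unfolding R'_def by (rule finite_interlace_upper) (use that in \<open>auto simp: S_def intro: interlace_shapes_lower[OF _ \<mu>]\<close>)
  have "(\<Sum>i\<le>min k c. \<Sum>\<sigma>\<in>S i. \<Sum>\<rho>\<in>R' i \<sigma>. F \<rho>) = (\<Sum>i\<le>min k c. \<Sum>(\<sigma>, \<rho>)\<in>Sigma (S i) (R' i). F \<rho>)"
   using fS fR by (intro sum.cong refl sum.Sigma) auto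
  also have "\<dots> = (\<Sum>(i, \<sigma>, \<rho>)\<in>(SIGMA i:{..min k c}. Sigma (S i) (R' i)). F \<rho>)"
   using fS fR by (subst sum.Sigma) (auto simp: case_prod_unfold)
  finally show ?thesis by simp
 qed
 finally show ?thesis unfolding N_def R_def S_def R'_def .
qed

text \<open>Induction on the monomial. The largest variable is split off from both sides by the
  branching rules; the two sides then differ only in the order in which one strip is added and
  another removed, which is \<open>local_rule\<close>.\<close>

theorem pieri:
 assumes "\<mu> \<in> shapes L"
 shows "complete_sym k * schur (shape_list L \<mu>) =
  (\<Sum>\<nu> | interlace \<nu> \<mu> \<and> sum \<nu> {..<Suc L} = sum \<mu> {..<L} + k. schur (shape_list (Suc L) \<nu>))"
proof -
 have mc_sum: "mcoeff (sum f A) M = (\<Sum>x\<in>A. mcoeff (f x) M)" for f :: "'b => 'a symfun" and A M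
  by (induction A rule: infinite_finite_induct) (simp_all add: zero_symfun.rep_eq plus_symfun.rep_eq)
 have main: "mcoeff (complete_sym k * schur (shape_list L \<mu>)) M =
  (\<Sum>\<nu> | interlace \<nu> \<mu> \<and> sum \<nu> {..<Suc L} = sum \<mu> {..<L} + k.
   mcoeff (schur (shape_list (Suc L) \<nu>) :: 'a symfun) M)" if "\<mu> \<in> shapes L" for M k L \<mu>
  using that
 proof (induction "size M" arbitrary: M k L \<mu> rule: less_induct)
  case less
  note \<mu> = less.prems
  show ?case
  proof (cases "M = {#}")
   case True
   have L: "mcoeff (complete_sym k * schur (shape_list L \<mu>) :: 'a symfun) {#} =
    (if k = 0 then mcoeff (schur (shape_list L \<mu>)) {#} else 0)"
   proof -
    have "{A. A \<subseteq># {#} \<and> size A = k} = (if k = 0 then {{#} :: nat multiset} else {})" by auto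
    then show ?thesis unfolding mcoeff_complete_times by simp
   qed
   have schur_empty: "mcoeff (schur (shape_list L \<mu>) :: 'a symfun) {#} = (if sum \<mu> {..<L} = 0 then 1 else 0)"
    if "\<mu> \<in> shapes L" for L \<mu>
   proof -
    have "{T \<in> semistandard_tableaux (shape_list L \<mu>). tableau_content (shape_list L \<mu>) T = {#}} =
     (if sum \<mu> {..<L} = 0 then {%_. undefined} else {})"
    proof (cases "sum \<mu> {..<L} = 0")
     case True
     then have "diagram (shape_list L \<mu>) = {}" by (auto simp: diagram_def)
     then show ?thesis using True by (auto simp: semistandard_tableaux_def tableau_content_def)
    next
     case False
     then have "size (tableau_content (shape_list L \<mu>) T) \<noteq> 0" for T
      by (simp add: card_diagram_shape_list[OF that])
     then have "tableau_content (shape_list L \<mu>) T \<noteq> {#}" for T by (metis size_empty)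
     then show ?thesis using False by simp
    qed
    then show ?thesis using sorted_shape_list[OF that] by (simp add: schur.rep_eq)
   qed
   have up: "\<nu> \<in> shapes (Suc L)" if "interlace \<nu> \<mu>" for \<nu> using interlace_shapes_upper[OF that \<mu>] .
   show ?thesis
   proof (cases "k = 0 \<and> sum \<mu> {..<L} = 0")
    case True
    then have "\<mu> = (%_. 0)" using \<mu> by (auto simp: shapes_def fun_eq_iff) (metis lessThan_iff not_less)
    have "{\<nu>. interlace \<nu> \<mu> \<and> sum \<nu> {..<Suc L} = sum \<mu> {..<L} + k} = {%_. 0}"
    proof (intro equalityI subsetI)
     fix \<nu> assume "\<nu> \<in> {\<nu>. interlace \<nu> \<mu> \<and> sum \<nu> {..<Suc L} = sum \<mu> {..<L} + k}"
     then have *: "interlace \<nu> \<mu>" "sum \<nu> {..<Suc L} = sum \<mu> {..<L} + k" by auto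
     then have "sum \<nu> {..<Suc L} = 0" using True by simp
     then have "\<forall>j<Suc L. \<nu> j = 0" by (simp del: sum.lessThan_Suc)
     then have "\<nu> i = 0" for i using up[OF *(1)] by (cases "i < Suc L") (auto simp: shapes_def)
     then show "\<nu> \<in> {%_. 0}" by auto
    qed (use True \<open>\<mu> = _\<close> in \<open>auto simp: interlace_def\<close>)
    moreover have "(%_. 0) \<in> shapes (Suc L)" by (simp add: shapes_def)
    ultimately show ?thesis using schur_empty[OF \<mu>] schur_empty[of "%_. 0" "Suc L"] True
     unfolding \<open>M = {#}\<close> L by (simp del: upt_Suc sum.lessThan_Suc)
   next
    case False
    have "(\<Sum>\<nu> | interlace \<nu> \<mu> \<and> sum \<nu> {..<Suc L} = sum \<mu> {..<L} + k.
      mcoeff (schur (shape_list (Suc L) \<nu>) :: 'a symfun) M) = 0"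
     using False up unfolding \<open>M = {#}\<close>
     by (intro sum.neutral ballI) (auto simp add: schur_empty simp del: upt_Suc sum.lessThan_Suc)
    then show ?thesis using False schur_empty[OF \<mu>] unfolding \<open>M = {#}\<close> L
     by (auto simp del: upt_Suc sum.lessThan_Suc)
   qed
  next
   case False
   define m where "m = Max (set_mset M)"
   define c where "c = count M m"
   define M' where "M' = filter_mset (%x. x < m) M"
   have mM: "m \<in># M" using False by (simp add: m_def)
   have le: "x \<le> m" if "x \<in># M" for x using that by (simp add: m_def)
   have lt: "x < m" if "x \<in># M'" for x using that by (simp add: M'_def)
   have M: "M = M' + replicate_mset c m"
   proof (rule multiset_eqI)
    fix x show "count M x = count (M' + replicate_mset c m) x"
     using le[of x] by (cases "x < m") (auto simp: M'_def c_def not_less count_eq_zero_iff)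
   qed
   have c: "c > 0" using mM by (simp add: c_def)
   then have size: "size M' < size M" unfolding M by simp
   have up: "\<nu> \<in> shapes (Suc L)" if "interlace \<nu> \<mu>" for \<nu> using interlace_shapes_upper[OF that \<mu>] .
   have down: "\<sigma> \<in> shapes L" if "interlace \<mu> \<sigma>" for \<sigma> using interlace_shapes_lower[OF that \<mu>] .
   have lt': "x < m" if "B \<subseteq># M'" "x \<in># M' - B" for x B using that lt by (meson in_diffD)
   have "mcoeff (complete_sym k * schur (shape_list L \<mu>) :: 'a symfun) M =
    (\<Sum>i\<le>min k c. \<Sum>B | B \<subseteq># M' \<and> size B = k - i.
     mcoeff (schur (shape_list L \<mu>)) (M' - B + replicate_mset (c - i) m))"
    unfolding M by (rule mcoeff_complete_times_split) (rule lt)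
   also have "\<dots> = (\<Sum>i\<le>min k c. \<Sum>B | B \<subseteq># M' \<and> size B = k - i.
     \<Sum>\<sigma> | interlace \<mu> \<sigma> \<and> sum \<mu> {..<L} = sum \<sigma> {..<L} + (c - i). mcoeff (schur (shape_list L \<sigma>)) (M' - B))"
    by (intro sum.cong refl mcoeff_schur_branching \<mu>) (use lt' in auto)
   also have "\<dots> = (\<Sum>i\<le>min k c. \<Sum>\<sigma> | interlace \<mu> \<sigma> \<and> sum \<mu> {..<L} = sum \<sigma> {..<L} + (c - i).
     mcoeff (complete_sym (k - i) * schur (shape_list L \<sigma>)) M')"
    unfolding mcoeff_complete_times by (intro sum.cong refl sum.swap)
   also have "\<dots> = (\<Sum>i\<le>min k c. \<Sum>\<sigma> | interlace \<mu> \<sigma> \<and> sum \<mu> {..<L} = sum \<sigma> {..<L} + (c - i).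
     \<Sum>\<rho> | interlace \<rho> \<sigma> \<and> sum \<rho> {..<Suc L} = sum \<sigma> {..<L} + (k - i).
      mcoeff (schur (shape_list (Suc L) \<rho>)) M')"
    by (intro sum.cong refl less.hyps[OF size]) (use down in auto)
   also have "\<dots> = (\<Sum>\<nu> | interlace \<nu> \<mu> \<and> sum \<nu> {..<Suc L} = sum \<mu> {..<L} + k.
     \<Sum>\<rho> | interlace \<nu> \<rho> \<and> sum \<nu> {..<Suc L} = sum \<rho> {..<Suc L} + c.
      mcoeff (schur (shape_list (Suc L) \<rho>)) M')" by (rule local_rule[OF \<mu>, symmetric])
   also have "\<dots> = (\<Sum>\<nu> | interlace \<nu> \<mu> \<and> sum \<nu> {..<Suc L} = sum \<mu> {..<L} + k.
     mcoeff (schur (shape_list (Suc L) \<nu>)) M)"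
    unfolding M by (intro sum.cong refl mcoeff_schur_branching[symmetric]) (use up lt in auto)
   finally show ?thesis .
  qed
 qed
 show ?thesis by (rule mcoeff_inject[THEN iffD1], rule ext) (simp only: main[OF assms] mc_sum)
qed

section \<open>Kostka expansion of products of complete symmetric functions\<close>

abbreviation complete_list :: "nat list => 'a :: comm_ring_1 symfun" where
 "complete_list \<alpha> \<equiv> prod_list (map complete_sym \<alpha>)"

definition list_monomial :: "nat list => nat multiset" where
 "list_monomial \<alpha> = (\<Sum>i<length \<alpha>. replicate_mset (\<alpha> ! i) i)"

lemma list_monomial_Nil [simp]: "list_monomial [] = {#}" by (simp add: list_monomial_def)

lemma list_monomial_snoc:
 "list_monomial (\<alpha> @ [b]) = list_monomial \<alpha> + replicate_mset b (length \<alpha>)"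
 by (simp add: list_monomial_def nth_append)

lemma count_list_monomial:
 "count (list_monomial \<alpha>) i = (if i < length \<alpha> then \<alpha> ! i else 0)"
 by (induction \<alpha> rule: rev_induct) (auto simp: list_monomial_snoc nth_append)

lemma set_list_monomial: "x \<in># list_monomial \<alpha> ==> x < length \<alpha>"
 by (rule ccontr) (simp add: count_list_monomial flip: count_greater_zero_iff)

lemma size_list_monomial: "size (list_monomial \<alpha>) = sum_list \<alpha>"
 by (induction \<alpha> rule: rev_induct) (auto simp: list_monomial_snoc)

lemma mcoeff_sum: "mcoeff (sum f A) M = (\<Sum>x\<in>A. mcoeff (f x) M)"
 by (induction A rule: infinite_finite_induct) (simp_all add: zero_symfun.rep_eq plus_symfun.rep_eq)

lemma symfun_eqI: "(\<And>M. mcoeff f M = mcoeff g M) ==> f = g"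
 by (rule mcoeff_inject[THEN iffD1]) auto

lemma scale_sym_sum: "scale_sym c (sum f A) = (\<Sum>x\<in>A. scale_sym c (f x))"
 by (rule symfun_eqI) (simp add: scale_sym.rep_eq mcoeff_sum sum_distrib_left)

lemma sum_scale_sym: "(\<Sum>x\<in>A. scale_sym (f x) g) = scale_sym (sum f A) g"
 by (rule symfun_eqI) (simp add: scale_sym.rep_eq mcoeff_sum sum_distrib_right)

lemma scale_sym_times: "scale_sym c f * g = scale_sym c (f * g)" "f * scale_sym c g = scale_sym c (f * g)"
 by (rule symfun_eqI; simp add: scale_sym.rep_eq times_symfun.rep_eq sum_distrib_left mult.assoc mult.left_commute)+

lemma tableau_entry_ge_row:
 assumes "T \<in> semistandard_tableaux \<mu>" "sorted_wrt (\<ge>) \<mu>" "(i, j) \<in> diagram \<mu>"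
 shows "i \<le> T (i, j)" using assms(3)
proof (induction i)
 case (Suc i)
 have "\<mu> ! Suc i \<le> \<mu> ! i"
  using sorted_wrt_nth_less[OF assms(2), of i "Suc i"] Suc.prems by (simp add: diagram_def)
 then have "(i, j) \<in> diagram \<mu>" using Suc.prems by (auto simp: diagram_def)
 then have "i \<le> T (i, j)" by (rule Suc.IH)
 also have "\<dots> < T (Suc i, j)" using assms(1) Suc.prems by (auto simp: semistandard_tableaux_def)
 finally show ?case by simp
qed simp

lemma card_first_rows: "card {x \<in> diagram \<mu>. fst x < k} = sum_list (take k \<mu>)"
proof -
 have "{x \<in> diagram \<mu>. fst x < k} = (SIGMA i:{..<min k (length \<mu>)}. {..<\<mu> ! i})"
  by (auto simp: diagram_def)
 then have "card {x \<in> diagram \<mu>. fst x < k} = (\<Sum>i<min k (length \<mu>). \<mu> ! i)" by simp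
 also have "\<dots> = sum_list (take k \<mu>)"
  by (subst sum_list_sum_nth) (auto simp: atLeast0LessThan min.commute intro!: sum.cong)
 finally show ?thesis .
qed

text \<open>Columns increase strictly, so row \<open>i\<close> has no entry below \<open>i\<close>:
  all entries below \<open>k\<close> lie in the first \<open>k\<close> rows.\<close>

lemma tableau_content_dominance:
 assumes "T \<in> semistandard_tableaux \<mu>" "sorted_wrt (\<ge>) \<mu>"
 shows "(\<Sum>c<k. count (tableau_content \<mu> T) c) \<le> sum_list (take k \<mu>)"
proof -
 have "(\<Sum>c<k. count (tableau_content \<mu> T) c) = (\<Sum>c<k. card {x \<in> diagram \<mu>. T x = c})"
  by (simp add: count_tableau_content)
 also have "\<dots> = card (\<Union>c<k. {x \<in> diagram \<mu>. T x = c})" by (subst card_UN_disjoint) auto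
 also have "\<dots> \<le> card {x \<in> diagram \<mu>. fst x < k}"
  using tableau_entry_ge_row[OF assms] by (intro card_mono) force+
 finally show ?thesis by (simp add: card_first_rows)
qed

lemma sum_list_take_monomial: "(\<Sum>c<k. count (list_monomial \<alpha>) c) = sum_list (take k \<alpha>)"
proof -
 have "(\<Sum>c<k. count (list_monomial \<alpha>) c) = (\<Sum>c<min k (length \<alpha>). \<alpha> ! c)"
  by (rule sum.mono_neutral_cong_right) (auto simp: count_list_monomial)
 also have "\<dots> = sum_list (take k \<alpha>)"
  by (subst sum_list_sum_nth) (auto simp: atLeast0LessThan min.commute intro!: sum.cong)
 finally show ?thesis .
qed

lemma mcoeff_schur_tableau:
 assumes "mcoeff (schur \<mu> :: 'a :: comm_ring_1 symfun) M \<noteq> 0"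
 obtains T where "sorted_wrt (\<ge>) \<mu>" "T \<in> semistandard_tableaux \<mu>" "tableau_content \<mu> T = M"
proof -
 have "sorted_wrt (\<ge>) \<mu>" using assms by (simp add: schur.rep_eq split: if_splits)
 moreover have "{T \<in> semistandard_tableaux \<mu>. tableau_content \<mu> T = M} \<noteq> {}"
 proof
  assume *: "{T \<in> semistandard_tableaux \<mu>. tableau_content \<mu> T = M} = {}"
  have "mcoeff (schur \<mu> :: 'a symfun) M = 0" unfolding schur.rep_eq * card.empty by simp
  with assms show False by blast
 qed
 ultimately show thesis using that by blast
qed

lemma mcoeff_schur_dominates:
 assumes "mcoeff (schur \<mu> :: 'a :: comm_ring_1 symfun) (list_monomial \<alpha>) \<noteq> 0"
 shows "dominates \<mu> \<alpha>" using assms unfolding dominates_def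
 by (metis mcoeff_schur_tableau tableau_content_dominance sum_list_take_monomial)

lemma mcoeff_schur_size:
 assumes "mcoeff (schur \<mu> :: 'a :: comm_ring_1 symfun) M \<noteq> 0"
 shows "size M = sum_list \<mu>"
proof -
 have "{x \<in> diagram \<mu>. fst x < length \<mu>} = diagram \<mu>" by (auto simp: diagram_def)
 then have "card (diagram \<mu>) = sum_list \<mu>" using card_first_rows[of \<mu> "length \<mu>"] by simp
 then show ?thesis using mcoeff_schur_tableau[OF assms] by (metis size_tableau_content)
qed

lemma schur_cong_diagram:
 assumes "diagram \<mu> = diagram \<nu>" "sorted_wrt (\<ge>) \<mu> = sorted_wrt (\<ge>) \<nu>"
 shows "schur \<mu> = schur \<nu>"
 by (rule symfun_eqI) (simp add: schur.rep_eq semistandard_tableaux_def tableau_content_def assms)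

lemma schur_append_zeros: "schur (\<mu> @ replicate m 0) = schur \<mu>"
proof (rule schur_cong_diagram)
 show "diagram (\<mu> @ replicate m 0) = diagram \<mu>" by (auto simp: diagram_def nth_append split: if_splits)
 show "sorted_wrt (\<ge>) (\<mu> @ replicate m 0) = sorted_wrt (\<ge>) \<mu>"
  by (auto simp: sorted_wrt_append intro: sorted_wrt01)
   (auto simp: sorted_wrt_iff_nth_less)
qed

text \<open>Multiplying by one more h_b (Pieri) and deleting the entries equal to the new largest
  letter (branching) run over the same pairs of interlacing shapes, so the coefficients are the
  Kostka numbers.\<close>

lemma complete_list_shapes:
 "(complete_list \<alpha> :: 'a :: comm_ring_1 symfun) =
  (\<Sum>\<mu> | \<mu> \<in> shapes (length \<alpha>) \<and> sum \<mu> {..<length \<alpha>} = sum_list \<alpha>.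
   scale_sym (mcoeff (schur (shape_list (length \<alpha>) \<mu>)) (list_monomial \<alpha>)) (schur (shape_list (length \<alpha>) \<mu>)))"
proof (induction \<alpha> rule: rev_induct)
 case Nil
 have "{\<mu> \<in> shapes 0. sum \<mu> {..<0} = 0} = {%_. 0}" by (auto simp: shapes_def)
 moreover have "schur [] = (1 :: 'a symfun)"
 proof (rule symfun_eqI)
  fix M
  have "{T \<in> semistandard_tableaux []. tableau_content [] T = M} = (if M = {#} then {%_. undefined} else {})"
   by (auto simp: semistandard_tableaux_def tableau_content_def diagram_def)
  then show "mcoeff (schur []) M = mcoeff (1 :: 'a symfun) M" by (simp add: schur.rep_eq one_symfun.rep_eq)
 qed
 ultimately show ?case by (simp add: one_symfun.rep_eq scale_sym.rep_eq symfun_eqI)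
next
 case (snoc b \<alpha>)
 define L where "L = length \<alpha>"
 define S where "S L n = {\<mu>. \<mu> \<in> shapes L \<and> sum \<mu> {..<L} = n}" for L n
 define K where "K \<mu> = mcoeff (schur (shape_list L \<mu>) :: 'a symfun) (list_monomial \<alpha>)" for \<mu>
 have fin: "finite (S L n)" for L n
 proof (rule finite_subset[OF _ finite_shapes[of L n]], intro subsetI CollectI conjI allI)
  fix \<mu> i assume *: "\<mu> \<in> S L n"
  then show "\<mu> \<in> shapes L" by (simp add: S_def)
  have "\<mu> i \<le> sum \<mu> {..<L}" if "i < L" using that by (intro member_le_sum) auto
  then show "\<mu> i \<le> n" using * by (cases "i < L") (auto simp: S_def shapes_def)
 qed
 have "(complete_list (\<alpha> @ [b]) :: 'a symfun) =
   (\<Sum>\<mu>\<in>S L (sum_list \<alpha>). scale_sym (K \<mu>) (complete_sym b * schur (shape_list L \<mu>)))"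
  by (simp add: snoc S_def K_def L_def sum_distrib_left scale_sym_times mult.commute[of _ "complete_sym b"])
 also have "\<dots> = (\<Sum>\<mu>\<in>S L (sum_list \<alpha>). \<Sum>\<nu> | interlace \<nu> \<mu> \<and> sum \<nu> {..<Suc L} = sum_list \<alpha> + b.
   scale_sym (K \<mu>) (schur (shape_list (Suc L) \<nu>)))"
  by (intro sum.cong refl) (auto simp: S_def pieri scale_sym_sum)
 also have "\<dots> = (\<Sum>\<mu>\<in>S L (sum_list \<alpha>). \<Sum>\<nu> | \<nu> \<in> S (Suc L) (sum_list \<alpha> + b) \<and> interlace \<nu> \<mu>.
   scale_sym (K \<mu>) (schur (shape_list (Suc L) \<nu>)))"
  by (intro sum.cong refl) (auto simp: S_def interlace_shapes_upper)
 also have "\<dots> = (\<Sum>\<nu>\<in>S (Suc L) (sum_list \<alpha> + b). \<Sum>\<mu> | \<mu> \<in> S L (sum_list \<alpha>) \<and> interlace \<nu> \<mu>.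
   scale_sym (K \<mu>) (schur (shape_list (Suc L) \<nu>)))" by (rule sum.swap_restrict) (rule fin)+
 also have "\<dots> = (\<Sum>\<nu>\<in>S (Suc L) (sum_list \<alpha> + b).
   scale_sym (mcoeff (schur (shape_list (Suc L) \<nu>)) (list_monomial (\<alpha> @ [b]))) (schur (shape_list (Suc L) \<nu>)))"
 proof (rule sum.cong[OF refl])
  fix \<nu> assume \<nu>: "\<nu> \<in> S (Suc L) (sum_list \<alpha> + b)"
  have "mcoeff (schur (shape_list (Suc L) \<nu>) :: 'a symfun) (list_monomial (\<alpha> @ [b])) =
   (\<Sum>\<rho> | interlace \<nu> \<rho> \<and> sum \<nu> {..<Suc L} = sum \<rho> {..<Suc L} + b.
    mcoeff (schur (shape_list (Suc L) \<rho>)) (list_monomial \<alpha>))"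
   unfolding list_monomial_snoc L_def[symmetric]
   by (rule mcoeff_schur_branching) (use \<nu> in \<open>auto simp: S_def L_def dest: set_list_monomial\<close>)
  also have "\<dots> = (\<Sum>\<mu> | \<mu> \<in> S L (sum_list \<alpha>) \<and> interlace \<nu> \<mu>. K \<mu>)"
  proof (rule sum.mono_neutral_cong_right)
   show "finite {\<rho>. interlace \<nu> \<rho> \<and> sum \<nu> {..<Suc L} = sum \<rho> {..<Suc L} + b}"
    by (rule finite_interlace_lower[of _ "Suc L"]) (use \<nu> in \<open>simp add: S_def\<close>)
   have L0: "sum \<rho> {..<Suc L} = sum \<rho> {..<L}" if "\<rho> \<in> shapes L" for \<rho>
    using that by (simp add: shapes_def)
   show "{\<mu> \<in> S L (sum_list \<alpha>). interlace \<nu> \<mu>} \<subseteq> {\<rho>. interlace \<nu> \<rho> \<and> sum \<nu> {..<Suc L} = sum \<rho> {..<Suc L} + b}"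
    using \<nu> L0 unfolding S_def by auto
   \<comment> \<open>The branching rule runs over shapes with \<open>L + 1\<close> rows. If row
     \<open>L\<close> is not empty, its first entry is at least \<open>L\<close>, but the content
     has only letters below \<open>L\<close>.\<close>
   show "\<forall>\<rho>\<in>{\<rho>. interlace \<nu> \<rho> \<and> sum \<nu> {..<Suc L} = sum \<rho> {..<Suc L} + b} - {\<mu> \<in> S L (sum_list \<alpha>). interlace \<nu> \<mu>}.
    mcoeff (schur (shape_list (Suc L) \<rho>)) (list_monomial \<alpha>) = (0 :: 'a)"
   proof (rule ballI, rule ccontr)
    fix \<rho> assume that: "\<rho> \<in> {\<rho>. interlace \<nu> \<rho> \<and> sum \<nu> {..<Suc L} = sum \<rho> {..<Suc L} + b} - {\<mu> \<in> S L (sum_list \<alpha>). interlace \<nu> \<mu>}"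
    assume *: "mcoeff (schur (shape_list (Suc L) \<rho>)) (list_monomial \<alpha>) \<noteq> (0 :: 'a)"
    then obtain T where T: "sorted_wrt (\<ge>) (shape_list (Suc L) \<rho>)" "T \<in> semistandard_tableaux (shape_list (Suc L) \<rho>)"
     "tableau_content (shape_list (Suc L) \<rho>) T = list_monomial \<alpha>" by (rule mcoeff_schur_tableau)
    have \<rho>: "\<rho> \<in> shapes (Suc L)" using that \<nu> interlace_shapes_lower by (auto simp: S_def)
    have "\<not> 0 < \<rho> L"
    proof
     assume "0 < \<rho> L"
     then have d: "(L, 0) \<in> diagram (shape_list (Suc L) \<rho>)" by (simp add: diagram_shape_list[OF \<rho>] del: upt_Suc)
     have "T (L, 0) \<in># list_monomial \<alpha>" using tableau_entry_in_content[OF d] T(3) by metis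
     then have "T (L, 0) < L" unfolding L_def by (rule set_list_monomial)
     with tableau_entry_ge_row[OF T(2,1) d] show False by simp
    qed
    then have "\<rho> \<in> shapes L" using \<rho> unfolding shapes_def by (auto simp: Suc_le_eq) (metis le_neq_implies_less)
    then show False using that \<nu> L0[of \<rho>] by (auto simp: S_def shapes_def)
   qed
   show "mcoeff (schur (shape_list (Suc L) \<mu>)) (list_monomial \<alpha>) = K \<mu>" if "\<mu> \<in> {\<mu> \<in> S L (sum_list \<alpha>). interlace \<nu> \<mu>}" for \<mu>
   proof -
    have "\<mu> L = 0" using that by (simp add: S_def shapes_def)
    then have "shape_list (Suc L) \<mu> = shape_list L \<mu> @ replicate 1 0" by simp
    then show ?thesis by (simp only: schur_append_zeros K_def)
   qed
  qed
  finally show "(\<Sum>\<mu> | \<mu> \<in> S L (sum_list \<alpha>) \<and> interlace \<nu> \<mu>. scale_sym (K \<mu>) (schur (shape_list (Suc L) \<nu>))) =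
   scale_sym (mcoeff (schur (shape_list (Suc L) \<nu>)) (list_monomial (\<alpha> @ [b]))) (schur (shape_list (Suc L) \<nu>))"
   by (simp only: sum_scale_sym)
 qed
 finally show ?case by (simp only: S_def L_def length_append_singleton sum_list_append sum_list.Nil sum_list.Cons add_0_right)
qed

lemma finite_partitions [simp]: "finite (partitions n)"
proof (rule finite_subset[OF _ finite_lists_length_le[of "{..n}" n]])
 have "length \<mu> \<le> sum_list \<mu>" if "0 \<notin> set \<mu>" for \<mu> :: "nat list"
  using that by (induction \<mu>) auto
 then show "partitions n \<subseteq> {xs. set xs \<subseteq> {..n} \<and> length xs \<le> n}"
  by (auto simp: partitions_def intro: member_le_sum_list)
qed simp

lemma sorted_filter_zeros:
 "sorted_wrt (\<ge>) xs ==> filter (%x. x \<noteq> 0) xs @ replicate (length xs - length (filter (%x. x \<noteq> 0) xs)) 0 = (xs :: nat list)"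
proof (induction xs)
 case (Cons x xs)
 show ?case
 proof (cases "x = 0")
  case True
  then have "\<forall>y\<in>set xs. y = 0" using Cons.prems by simp
  then have "filter (%x. x \<noteq> 0) xs = []" "replicate (length xs) 0 = xs" by (auto intro: replicate_eqI[symmetric])
  then show ?thesis using True by simp
 next
  case False
  have "length (filter (%x. x \<noteq> 0) xs) \<le> length xs" by simp
  then show ?thesis using False Cons by (simp add: Suc_diff_le)
 qed
qed simp

text \<open>Shapes padded to \<open>L\<close> rows correspond to partitions with at most
  \<open>L\<close> parts. The longer partitions contribute zero: a partition with nonzero
  coefficient dominates \<alpha>, so it has no part beyond the first \<open>L\<close>.\<close>

theorem complete_list_schur:
 assumes n: "sum_list \<alpha> = n"
 shows "(complete_list \<alpha> :: 'a :: comm_ring_1 symfun) =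
  (\<Sum>\<mu>\<in>partitions n. scale_sym (mcoeff (schur \<mu>) (list_monomial \<alpha>)) (schur \<mu>))"
proof -
 define L where "L = length \<alpha>"
 define F where "F \<mu> = scale_sym (mcoeff (schur \<mu>) (list_monomial \<alpha>)) (schur \<mu> :: 'a symfun)" for \<mu>
 have F0: "F (\<mu> @ replicate m 0) = F \<mu>" for \<mu> m by (simp add: F_def schur_append_zeros)
 define row where "row \<mu> i = (if i < length \<mu> then \<mu> ! i else 0)" for \<mu> :: "nat list" and i
 define strip where "strip f = filter (%x. x \<noteq> 0) (shape_list L f)" for f
 have strip: "strip f @ replicate (L - length (strip f)) 0 = shape_list L f" if "f \<in> shapes L" for f
  unfolding strip_def using sorted_filter_zeros[OF sorted_shape_list[OF that]] by simp
 have row: "row (strip f) = f" if "f \<in> shapes L" for f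
 proof
  fix i
  have "length (strip f) \<le> L" unfolding strip_def by (rule order_trans[OF length_filter_le]) simp
  moreover have "(strip f @ replicate (L - length (strip f)) 0) ! i = shape_list L f ! i" using strip[OF that] by simp
  ultimately show "row (strip f) i = f i" using that
   by (cases "i < L") (auto simp: row_def nth_append shapes_def split: if_splits)
 qed
 have shl: "shape_list L (row \<mu>) = \<mu> @ replicate (L - length \<mu>) 0" if "length \<mu> \<le> L" for \<mu>
  using that by (intro nth_equalityI) (auto simp: row_def nth_append)
 have part: "strip f \<in> partitions n" "length (strip f) \<le> L" if "f \<in> shapes L" "sum f {..<L} = n" for f
 proof -
  have "sum_list (strip f @ replicate (L - length (strip f)) 0) = n"
   unfolding strip[OF that(1)] using that(2) by (simp add: sum_list_sum_nth atLeast0LessThan)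
  then have "sum_list (strip f) = n" by (simp add: sum_list_replicate)
  moreover have "sorted_wrt (\<ge>) (strip f)"
   unfolding strip_def by (rule sorted_wrt_filter) (rule sorted_shape_list[OF that(1)])
  ultimately show "strip f \<in> partitions n" by (auto simp: partitions_def strip_def)
  show "length (strip f) \<le> L" unfolding strip_def by (rule order_trans[OF length_filter_le]) simp
 qed
 have part': "row \<mu> \<in> shapes L" "sum (row \<mu>) {..<L} = n" "strip (row \<mu>) = \<mu>" if "\<mu> \<in> partitions n" "length \<mu> \<le> L" for \<mu>
 proof -
  show "row \<mu> \<in> shapes L" using that sorted_wrt_nth_less[of "(\<ge>)" \<mu>]
   by (auto simp: shapes_def row_def partitions_def)
  have "sum (row \<mu>) {..<L} = sum_list (shape_list L (row \<mu>))" by (simp add: sum_list_sum_nth atLeast0LessThan)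
  also have "\<dots> = n" unfolding shl[OF that(2)] using that(1) by (simp add: partitions_def sum_list_replicate)
  finally show "sum (row \<mu>) {..<L} = n" .
  have "filter (%x. x \<noteq> 0) \<mu> = \<mu>" using that(1) by (intro filter_True) (auto simp: partitions_def intro!: Nat.gr0I)
  then show "strip (row \<mu>) = \<mu>" by (simp add: strip_def shl[OF that(2)])
 qed
 have "complete_list \<alpha> = (\<Sum>f | f \<in> shapes L \<and> sum f {..<L} = n. F (shape_list L f))"
  using complete_list_shapes[of \<alpha>, where 'a = 'a] by (simp add: L_def F_def n)
 also have "\<dots> = (\<Sum>\<mu> | \<mu> \<in> partitions n \<and> length \<mu> \<le> L. F \<mu>)"
 proof (rule sum.reindex_bij_witness[of _ row strip])
  fix f assume "f \<in> {f \<in> shapes L. sum f {..<L} = n}"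
  then have f: "f \<in> shapes L" "sum f {..<L} = n" by auto
  show "row (strip f) = f" by (rule row[OF f(1)])
  show "strip f \<in> {\<mu> \<in> partitions n. length \<mu> \<le> L}" using part[OF f] by simp
  show "F (strip f) = F (shape_list L f)" using F0 strip[OF f(1)] by metis
 qed (use part' in auto)
 also have "\<dots> = (\<Sum>\<mu>\<in>partitions n. F \<mu>)"
 proof (rule sum.mono_neutral_left)
  show "\<forall>\<mu>\<in>partitions n - {\<mu> \<in> partitions n. length \<mu> \<le> L}. F \<mu> = 0"
  proof (rule ballI, rule ccontr)
   fix \<mu> assume \<mu>: "\<mu> \<in> partitions n - {\<mu> \<in> partitions n. length \<mu> \<le> L}" and "F \<mu> \<noteq> 0"
   then have "mcoeff (schur \<mu> :: 'a symfun) (list_monomial \<alpha>) \<noteq> 0"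
    unfolding F_def by (metis scale_sym.rep_eq mult_zero_left symfun_eqI zero_symfun.rep_eq)
   then have "sum_list (take L \<alpha>) \<le> sum_list (take L \<mu>)" using mcoeff_schur_dominates by (auto simp: dominates_def)
   then have "n \<le> sum_list (take L \<mu>)" by (simp add: L_def n)
   moreover have "sum_list (take L \<mu>) + sum_list (drop L \<mu>) = n"
    using \<mu> by (metis (mono_tags, lifting) DiffD1 append_take_drop_id mem_Collect_eq partitions_def sum_list_append)
   ultimately have "sum_list (drop L \<mu>) = 0" by linarith
   moreover have "drop L \<mu> \<noteq> []" "0 \<notin> set (drop L \<mu>)" using \<mu> by (auto simp: partitions_def dest: in_set_dropD)
   ultimately show False by (cases "drop L \<mu>") auto
  qed
 qed auto
 finally show ?thesis by (simp add: F_def)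
qed

section \<open>Triangular bases\<close>

lemma ex_bij_extending:
 fixes f :: "nat => nat"
 assumes "finite A" "inj_on f A"
 obtains \<pi> where "bij \<pi>" "\<And>x. x \<in> A ==> \<pi> x = f x"
proof -
 let ?S = "A \<union> f ` A"
 have "card (?S - A) = card (?S - f ` A)" using assms card_image[OF assms(2)] by (simp add: card_Diff_subset)
 then obtain h where h: "bij_betw h (?S - A) (?S - f ` A)"
  using assms(1) finite_same_card_bij[of "?S - A" "?S - f ` A"] by auto
 define \<pi> where "\<pi> x = (if x \<in> A then f x else if x \<in> ?S then h x else x)" for x
 have "bij_betw \<pi> A (f ` A)" using assms(2) by (auto simp: bij_betw_def \<pi>_def inj_on_def)
 moreover have "bij_betw \<pi> (?S - A) (?S - f ` A)"
  using h by (subst bij_betw_cong[of _ _ h]) (auto simp: \<pi>_def)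
 ultimately have "bij_betw \<pi> (A \<union> (?S - A)) (f ` A \<union> (?S - f ` A))"
  by (rule bij_betw_combine) auto
 moreover have "A \<union> (?S - A) = ?S" "f ` A \<union> (?S - f ` A) = ?S" by auto
 ultimately have 1: "bij_betw \<pi> ?S ?S" by simp
 have "bij_betw \<pi> (- ?S) (- ?S)" by (subst bij_betw_cong[of _ _ id]) (auto simp: \<pi>_def)
 then have "bij_betw \<pi> (?S \<union> - ?S) (?S \<union> - ?S)" by (rule bij_betw_combine[OF 1]) (rule Compl_disjoint)
 then have "bij \<pi>" by (simp only: Compl_partition)
 then show thesis by (rule that) (simp add: \<pi>_def)
qed

lemma mcoeff_image: "bij \<pi> ==> mcoeff f (image_mset \<pi> M) = mcoeff f M"
 using mcoeff[of f] by simp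

text \<open>Sorting the exponents of \<open>M\<close> decreasingly gives \<mu>; a bijection of the
  variables carries the monomial of \<mu> to \<open>M\<close>, and coefficients are invariant under
  it.\<close>

lemma mcoeff_partition:
 obtains \<mu> where "\<mu> \<in> partitions (size M)" "\<And>f. mcoeff f M = mcoeff f (list_monomial \<mu>)"
proof -
 define xs where "xs = rev (sort_key (count M) (sorted_list_of_set (set_mset M)))"
 define \<mu> where "\<mu> = map (count M) xs"
 have xs: "distinct xs" "set xs = set_mset M" by (simp_all add: xs_def)
 have "inj_on (%i. xs ! i) {..<length xs}" using xs by (simp add: inj_on_nth)
 then obtain \<pi> where \<pi>: "bij \<pi>" "\<And>i. i < length xs ==> \<pi> i = xs ! i"
  by (rule ex_bij_extending[rotated]) auto
 have M: "image_mset \<pi> (list_monomial \<mu>) = M"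
 proof (rule multiset_eqI)
  fix x
  obtain i where x: "x = \<pi> i" using \<pi>(1) by (metis bij_pointE)
  have "count (image_mset \<pi> (list_monomial \<mu>)) x = count (list_monomial \<mu>) i"
   unfolding x using \<pi>(1) by (intro count_image_mset_inj) (rule bij_is_inj)
  also have "\<dots> = count M x"
  proof (cases "i < length xs")
   case True
   then show ?thesis using \<pi>(2) by (simp add: count_list_monomial \<mu>_def x)
  next
   case False
   have "x \<notin># M"
   proof
    assume "x \<in># M"
    then obtain j where j: "j < length xs" "xs ! j = x" using xs(2) by (metis in_set_conv_nth)
    then have "\<pi> j = \<pi> i" using \<pi>(2) x by simp
    then show False using False j(1) \<pi>(1) by (metis bij_is_inj inj_eq)
   qed
   then show ?thesis using False by (simp add: count_list_monomial \<mu>_def not_in_iff)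
  qed
  finally show "count (image_mset \<pi> (list_monomial \<mu>)) x = count M x" .
 qed
 have "sorted (rev \<mu>)" by (simp add: \<mu>_def xs_def rev_map)
 then have "sorted_wrt (\<ge>) \<mu>" by (simp add: sorted_wrt_rev)
 moreover have "0 \<notin> set \<mu>" using xs(2) by (auto simp: \<mu>_def not_in_iff[symmetric])
 moreover have "sum_list \<mu> = size M" using M by (metis size_image_mset size_list_monomial)
 ultimately have "\<mu> \<in> partitions (size M)" by (simp add: partitions_def)
 then show thesis
 proof (rule that)
  fix f show "mcoeff f M = mcoeff f (list_monomial \<mu>)"
   using mcoeff_image[OF \<pi>(1), of f "list_monomial \<mu>"] by (simp add: M)
 qed
qed

definition all_partitions :: "nat list set" where
 "all_partitions = (\<Union>n. partitions n)"

lemma all_partitions_iff: "\<mu> \<in> all_partitions \<longleftrightarrow> \<mu> \<in> partitions (sum_list \<mu>)"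
 by (auto simp: all_partitions_def partitions_def)

lemma symfun_eq_0I:
 assumes "\<And>\<mu>. \<mu> \<in> all_partitions ==> mcoeff f (list_monomial \<mu>) = 0"
 shows "f = 0"
proof (rule symfun_eqI)
 fix M :: "nat multiset"
 obtain \<mu> where "\<mu> \<in> partitions (size M)" "mcoeff f M = mcoeff f (list_monomial \<mu>)"
  using mcoeff_partition by metis
 then show "mcoeff f M = mcoeff 0 M" using assms by (auto simp: all_partitions_def zero_symfun.rep_eq)
qed

lemma mcoeff_diff [simp]: "mcoeff (f - g) M = mcoeff f M - mcoeff g M"
 unfolding minus_symfun_def plus_symfun.rep_eq uminus_symfun.rep_eq by simp

text \<open>The rank \<open>r\<close> will be n(\<mu>) for Schur functions and size minus length for
  products of power sums.\<close>

context
 fixes F :: "nat list => 'a :: field symfun" and r :: "nat list => nat"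
 assumes diag: "\<And>\<mu>. \<mu> \<in> all_partitions ==> mcoeff (F \<mu>) (list_monomial \<mu>) \<noteq> 0"
  and tri: "\<And>\<mu> \<nu>. \<mu> \<in> all_partitions ==> \<nu> \<in> all_partitions ==>
   mcoeff (F \<mu>) (list_monomial \<nu>) \<noteq> 0 ==> \<mu> \<noteq> \<nu> ==> r \<mu> < r \<nu>"
  and homog: "\<And>\<mu> M. \<mu> \<in> all_partitions ==> mcoeff (F \<mu>) M \<noteq> 0 ==> size M = sum_list \<mu>"
begin

lemma triangular_inj: "inj_on F all_partitions" by (rule inj_onI) (metis diag tri less_asym)

text \<open>At an index of least rank in the support, only the corresponding member of the family
  has a nonzero coefficient.\<close>

lemma triangular_independent: "symfun.independent (F ` all_partitions)"
 unfolding symfun.independent_explicit_finite_subsets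
proof (intro allI impI ballI, rule ccontr)
 fix S u v assume S: "S \<subseteq> F ` all_partitions" "finite S" and 0: "(\<Sum>v\<in>S. scale_sym (u v) v) = 0"
  and v: "v \<in> S" "u v \<noteq> 0"
 obtain J where J: "J \<subseteq> all_partitions" "finite J" "S = F ` J" using finite_subset_image[OF S(2,1)] by blast
 have inj: "inj_on F J" using triangular_inj J(1) inj_on_subset by blast
 define N where "N = {i \<in> J. u (F i) \<noteq> 0}"
 have "N \<noteq> {}" using v J(3) by (auto simp: N_def)
 then obtain i where i: "i \<in> N" "\<And>j. j \<in> N ==> r i \<le> r j"
  using ex_has_least_nat[of "%i. i \<in> N" _ r] by auto
 have "0 = mcoeff (\<Sum>v\<in>S. scale_sym (u v) v) (list_monomial i)" by (simp add: 0 zero_symfun.rep_eq)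
 also have "\<dots> = (\<Sum>j\<in>J. u (F j) * mcoeff (F j) (list_monomial i))"
  unfolding J(3) sum.reindex[OF inj] by (simp add: mcoeff_sum scale_sym.rep_eq)
 also have "\<dots> = (\<Sum>j\<in>{i}. u (F j) * mcoeff (F j) (list_monomial i))"
 proof (rule sum.mono_neutral_right)
  show "\<forall>j\<in>J - {i}. u (F j) * mcoeff (F j) (list_monomial i) = 0"
  proof (rule ballI, rule ccontr)
   fix j assume j: "j \<in> J - {i}" and "u (F j) * mcoeff (F j) (list_monomial i) \<noteq> 0"
   then have "j \<in> N" "mcoeff (F j) (list_monomial i) \<noteq> 0" by (auto simp: N_def)
   moreover from this j J(1) i(1) have "r j < r i" by (intro tri) (auto simp: N_def)
   ultimately show False using i(2)[of j] by simp
  qed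
 qed (use J i in \<open>auto simp: N_def\<close>)
 finally show False using diag[of i] i(1) J(1) by (auto simp: N_def)
qed

text \<open>Elimination by increasing rank. Finitely many degrees bound the ranks by
  \<open>B\<close>; \<open>k\<close> is the number of ranks in which \<open>f\<close> may still have
  nonzero coefficients.\<close>

lemma triangular_span_degrees:
 assumes "finite D" and f: "\<And>M. size M \<notin> D ==> mcoeff f M = 0"
 shows "f \<in> symfun.span (F ` {\<mu> \<in> all_partitions. sum_list \<mu> \<in> D})"
proof -
 define J where "J = {\<mu> \<in> all_partitions. sum_list \<mu> \<in> D}"
 have "J = (\<Union>n\<in>D. partitions n)" by (auto simp: J_def all_partitions_def partitions_def)
 then have finJ: "finite J" using assms(1) by simp
 define B where "B = Suc (Max (r ` J))"
 have B: "r i < B" if "i \<in> J" for i using finJ that by (simp add: B_def less_Suc_eq_le)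
 have "f \<in> symfun.span (F ` J)"
  if "\<And>M. size M \<notin> D ==> mcoeff f M = 0" "\<And>i. i \<in> J ==> r i < B - k ==> mcoeff f (list_monomial i) = 0" "k \<le> B" for k f
  using that
 proof (induction k arbitrary: f)
  case 0
  have "f = 0"
  proof (rule symfun_eq_0I)
   fix \<mu> assume "\<mu> \<in> all_partitions"
   then show "mcoeff f (list_monomial \<mu>) = 0"
    using 0 B by (cases "\<mu> \<in> J") (auto simp: J_def size_list_monomial)
  qed
  then show ?case by (simp add: symfun.span_zero)
 next
  case (Suc k)
  define R where "R = {i \<in> J. r i = B - Suc k}"
  define c where "c i = mcoeff f (list_monomial i) / mcoeff (F i) (list_monomial i)" for i
  define g where "g = f - (\<Sum>i\<in>R. scale_sym (c i) (F i))"
  have g: "mcoeff g M = mcoeff f M - (\<Sum>i\<in>R. c i * mcoeff (F i) M)" for M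
   by (simp add: g_def mcoeff_sum scale_sym.rep_eq)
  have "g \<in> symfun.span (F ` J)"
  proof (rule Suc.IH)
   show "mcoeff g M = 0" if "size M \<notin> D" for M
   proof -
    have "mcoeff (F i) M = 0" if "i \<in> R" for i
     using that homog[of i M] \<open>size M \<notin> D\<close> unfolding R_def J_def by (cases "mcoeff (F i) M = 0") auto
    then show ?thesis using that Suc.prems(1) by (simp add: g)
   qed
   show "mcoeff g (list_monomial j) = 0" if j: "j \<in> J" "r j < B - k" for j
   proof -
    have *: "mcoeff (F i) (list_monomial j) = 0" if "i \<in> R" "i \<noteq> j" for i
    proof (rule ccontr)
     assume "mcoeff (F i) (list_monomial j) \<noteq> 0"
     then have "r i < r j" using that j by (intro tri) (auto simp: R_def J_def)
     then show False using that j Suc.prems(3) by (simp add: R_def)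
    qed
    show ?thesis
    proof (cases "j \<in> R")
     case True
     have "(\<Sum>i\<in>R. c i * mcoeff (F i) (list_monomial j)) = (\<Sum>i\<in>{j}. c i * mcoeff (F i) (list_monomial j))"
      using True * finJ by (intro sum.mono_neutral_right) (auto simp: R_def)
     also have "\<dots> = mcoeff f (list_monomial j)" using diag[of j] j by (simp add: c_def J_def)
     finally show ?thesis by (simp add: g)
    next
     case False
     then have "r j < B - Suc k" using j Suc.prems(3) by (auto simp: R_def)
     moreover have "(\<Sum>i\<in>R. c i * mcoeff (F i) (list_monomial j)) = 0"
      using False * by (intro sum.neutral) auto
     ultimately show ?thesis using Suc.prems(2) j by (simp add: g)
    qed
   qed
  qed (use Suc.prems in simp)
  moreover have "(\<Sum>i\<in>R. scale_sym (c i) (F i)) \<in> symfun.span (F ` J)"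
   by (intro symfun.span_sum symfun.span_scale symfun.span_base) (auto simp: R_def)
  ultimately have "g + (\<Sum>i\<in>R. scale_sym (c i) (F i)) \<in> symfun.span (F ` J)" by (rule symfun.span_add)
  then show ?case by (simp add: g_def)
 qed
 from this[of f B] f show ?thesis by (simp add: J_def)
qed

lemma triangular_span: "symfun.span (F ` all_partitions) = UNIV"
proof (intro equalityI subsetI UNIV_I)
 fix f :: "'a symfun"
 obtain d where "\<forall>M. d < size M --> mcoeff f M = 0" using mcoeff[of f] by auto
 then have "f \<in> symfun.span (F ` {\<mu> \<in> all_partitions. sum_list \<mu> \<in> {..d}})"
  by (intro triangular_span_degrees) auto
 also have "\<dots> \<subseteq> symfun.span (F ` all_partitions)" by (intro symfun.span_mono) auto
 finally show "f \<in> symfun.span (F ` all_partitions)" .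
qed

end

section \<open>The Schur basis and the Hall product\<close>

text \<open>As a sum of the tails n - (\<mu>_1 + ... + \<mu>_(k+1)) the statistic visibly decreases
  when a partition goes up in dominance order. This makes it a rank for inductions.\<close>

lemma part_stat_alt:
 assumes "length \<mu> \<le> N"
 shows "part_stat \<mu> = (\<Sum>k<N. sum_list \<mu> - sum_list (take (Suc k) \<mu>))"
proof -
 have *: "sum_list \<mu> - sum_list (take (Suc k) \<mu>) = (\<Sum>i<length \<mu>. if k < i then \<mu> ! i else 0)" for k
 proof -
  have "sum_list \<mu> = sum_list (take (Suc k) \<mu>) + sum_list (drop (Suc k) \<mu>)"
   by (metis append_take_drop_id sum_list_append)
  then have "sum_list \<mu> - sum_list (take (Suc k) \<mu>) = (\<Sum>i<length \<mu> - Suc k. \<mu> ! (Suc k + i))"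
   by (simp add: sum_list_sum_nth atLeast0LessThan)
  also have "\<dots> = (\<Sum>i | i < length \<mu> \<and> k < i. \<mu> ! i)"
   by (rule sum.reindex_bij_witness[of _ "%i. i - Suc k" "%i. i + Suc k"]) (auto simp: add.commute)
  also have "\<dots> = (\<Sum>i<length \<mu>. if k < i then \<mu> ! i else 0)"
   by (rule sum.mono_neutral_cong_left) auto
  finally show ?thesis .
 qed
 have "(\<Sum>k<N. if k < i then \<mu> ! i else 0) = i * \<mu> ! i" if "i < length \<mu>" for i
 proof -
  have "(\<Sum>k<N. if k < i then \<mu> ! i else 0) = (\<Sum>k<i. \<mu> ! i)"
   using that assms by (intro sum.mono_neutral_cong_right) auto
  then show ?thesis by simp
 qed
 then show ?thesis unfolding part_stat_def * by (subst sum.swap) simp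
qed

lemma take_sums_inj:
 fixes \<mu> \<nu> :: "nat list"
 assumes "\<And>k. sum_list (take k \<mu>) = sum_list (take k \<nu>)" "0 \<notin> set \<mu>" "0 \<notin> set \<nu>"
 shows "\<mu> = \<nu>" using assms
proof (induction \<mu> arbitrary: \<nu>)
 case Nil
 then show ?case using Nil(1)[of 1] by (cases \<nu>) auto
next
 case (Cons x \<mu>)
 show ?case
 proof (cases \<nu>)
  case Nil
  then show ?thesis using Cons.prems(1)[of 1] Cons.prems(2) by auto
 next
  case (Cons y \<nu>')
  then have [simp]: "x = y" using Cons.prems(1)[of 1] by simp
  have "sum_list (take k \<mu>) = sum_list (take k \<nu>')" for k
   using Cons.prems(1)[of "Suc k"] Cons by simp
  then show ?thesis using Cons.prems Cons Cons.IH[of \<nu>'] by simp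
 qed
qed

lemma dominates_part_stat:
 assumes "\<mu> \<in> partitions n" "\<nu> \<in> partitions n" "dominates \<mu> \<nu>"
 shows "part_stat \<mu> \<le> part_stat \<nu>" and "\<mu> \<noteq> \<nu> ==> part_stat \<mu> < part_stat \<nu>"
proof -
 define N where "N = length \<mu> + length \<nu>"
 have n: "sum_list \<mu> = n" "sum_list \<nu> = n" using assms by (auto simp: partitions_def)
 have st: "part_stat \<mu> = (\<Sum>k<N. n - sum_list (take (Suc k) \<mu>))" "part_stat \<nu> = (\<Sum>k<N. n - sum_list (take (Suc k) \<nu>))"
  using part_stat_alt[of \<mu> N] part_stat_alt[of \<nu> N] n by (simp_all add: N_def)
 have le: "n - sum_list (take (Suc k) \<mu>) \<le> n - sum_list (take (Suc k) \<nu>)" for k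
  using assms(3) by (simp add: dominates_def diff_le_mono2)
 then show "part_stat \<mu> \<le> part_stat \<nu>" unfolding st by (intro sum_mono)
 assume "\<mu> \<noteq> \<nu>"
 then obtain k where k: "sum_list (take k \<mu>) \<noteq> sum_list (take k \<nu>)"
  using take_sums_inj[of \<mu> \<nu>] assms by (auto simp: partitions_def)
 have "\<not> Suc N \<le> k"
 proof
  assume "Suc N \<le> k"
  then have "take k \<mu> = \<mu>" "take k \<nu> = \<nu>" by (simp_all add: N_def)
  then show False using k n by simp
 qed
 then have "k < Suc N" by simp
 moreover have "k \<noteq> 0" using k by (intro notI) simp
 ultimately obtain l where l: "k = Suc l" "l < N" by (cases k) auto
 have "sum_list (take k \<nu>) < sum_list (take k \<mu>)" using k assms(3) by (simp add: dominates_def le_neq_implies_less)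
 moreover have "sum_list (take k \<mu>) \<le> n" using n by (metis append_take_drop_id le_add1 sum_list_append)
 ultimately have "n - sum_list (take (Suc l) \<mu>) < n - sum_list (take (Suc l) \<nu>)" unfolding l by linarith
 then show "part_stat \<mu> < part_stat \<nu>" unfolding st using l(2) le by (intro sum_strict_mono_ex1) auto
qed

lemma mcoeff_schur_diag:
 assumes "\<mu> \<in> partitions n"
 shows "mcoeff (schur \<mu> :: 'a :: field_char_0 symfun) (list_monomial \<mu>) \<noteq> 0"
proof -
 \<comment> \<open>Filling row \<open>i\<close> with \<open>i\<close> gives a tableau of content
   \<mu>.\<close>
 define T where "T = restrict fst (diagram \<mu>)"
 have sorted: "sorted_wrt (\<ge>) \<mu>" using assms by (simp add: partitions_def)
 have 1: "(i, j) \<in> diagram \<mu>" if "(Suc i, j) \<in> diagram \<mu>" for i j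
  using that sorted_wrt_nth_less[OF sorted, of i "Suc i"] by (auto simp: diagram_def)
 have 2: "(i, j) \<in> diagram \<mu>" if "(i, Suc j) \<in> diagram \<mu>" for i j
  using that by (auto simp: diagram_def)
 have "T \<in> semistandard_tableaux \<mu>" unfolding semistandard_tableaux_def T_def
 proof (intro CollectI conjI allI impI)
  fix i j
  show "restrict fst (diagram \<mu>) (i, j) \<le> restrict fst (diagram \<mu>) (i, Suc j)" if "(i, Suc j) \<in> diagram \<mu>"
   using that 2[OF that] by simp
  show "restrict fst (diagram \<mu>) (i, j) < restrict fst (diagram \<mu>) (Suc i, j)" if "(Suc i, j) \<in> diagram \<mu>"
   using that 1[OF that] by simp
 qed simp
 moreover have "tableau_content \<mu> T = list_monomial \<mu>"
 proof (rule multiset_eqI)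
  fix c
  have "{x \<in> diagram \<mu>. T x = c} = (if c < length \<mu> then {c} \<times> {..<\<mu> ! c} else {})"
   by (auto simp: T_def diagram_def)
  then show "count (tableau_content \<mu> T) c = count (list_monomial \<mu>) c"
   by (simp add: count_tableau_content count_list_monomial)
 qed
 ultimately have "T \<in> {T \<in> semistandard_tableaux \<mu>. tableau_content \<mu> T = list_monomial \<mu>}" by simp
 then have "card {T \<in> semistandard_tableaux \<mu>. tableau_content \<mu> T = list_monomial \<mu>} \<noteq> 0"
  using finite_tableaux[of \<mu> "list_monomial \<mu>"] by (metis card_0_eq empty_iff)
 then show ?thesis using sorted by (simp add: schur.rep_eq)
qed

lemma schur_triangular:
 assumes "\<mu> \<in> all_partitions" "\<nu> \<in> all_partitions"
  "mcoeff (schur \<mu> :: 'a :: field_char_0 symfun) (list_monomial \<nu>) \<noteq> 0" "\<mu> \<noteq> \<nu>"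
 shows "part_stat \<mu> < part_stat \<nu>"
proof -
 have "sum_list \<nu> = sum_list \<mu>" using mcoeff_schur_size[OF assms(3)] by (simp add: size_list_monomial)
 then show ?thesis
  using dominates_part_stat(2)[of \<mu> "sum_list \<mu>" \<nu>] mcoeff_schur_dominates[OF assms(3)] assms
  by (simp add: all_partitions_iff)
qed

lemma mcoeff_schur_diag': "\<mu> \<in> all_partitions ==> mcoeff (schur \<mu> :: 'a :: field_char_0 symfun) (list_monomial \<mu>) \<noteq> 0"
 using mcoeff_schur_diag by (auto simp: all_partitions_def)

lemmas schur_basis_rules = mcoeff_schur_diag' schur_triangular mcoeff_schur_size

lemma inj_schur: "inj_on (schur :: _ => 'a :: field_char_0 symfun) all_partitions"
 by (rule triangular_inj[where r = part_stat]) (rule schur_basis_rules; assumption)+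

lemma independent_schur: "symfun.independent (schur ` all_partitions :: 'a :: field_char_0 symfun set)"
 by (rule triangular_independent[where r = part_stat]) (rule schur_basis_rules; assumption)+

lemma span_schur: "symfun.span (schur ` all_partitions :: 'a :: field_char_0 symfun set) = UNIV"
 by (rule triangular_span[where r = part_stat]) (rule schur_basis_rules; assumption)+

lemma span_schur_degree:
 assumes "\<And>M. size M \<noteq> n ==> mcoeff f M = 0"
 shows "f \<in> symfun.span (schur ` partitions n :: 'a :: field_char_0 symfun set)"
proof -
 have "f \<in> symfun.span (schur ` {\<mu> \<in> all_partitions. sum_list \<mu> \<in> {n}})"
  by (rule triangular_span_degrees[where r = part_stat]) (assumption | rule schur_basis_rules | simp add: assms)+
 moreover have "{\<mu> \<in> all_partitions. sum_list \<mu> \<in> {n}} = partitions n"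
  by (auto simp: all_partitions_def partitions_def)
 ultimately show ?thesis by simp
qed

lemma vector_space_field: "vector_space ((*) :: 'a :: field => _)"
 by standard (simp_all add: algebra_simps)

lemma vector_space_scale_sym: "vector_space (scale_sym :: 'a :: field => _)"
 by (rule symfun.vector_space_axioms)

lemma is_hall_product_linear:
 assumes "is_hall_product B"
 shows "B (f + f') g = B f g + B f' g" "B (scale_sym c f) g = c * B f g"
  "B f (g + g') = B f g + B f g'" "B f (scale_sym c g) = c * B f g" "B 0 g = 0" "B f 0 = 0"
proof -
 show *: "B (f + f') g = B f g + B f' g" "B (scale_sym c f) g = c * B f g"
  "B f (g + g') = B f g + B f g'" "B f (scale_sym c g) = c * B f g" for f f' g g' c
  using assms unfolding is_hall_product_def Vector_Spaces.linear_iff by blast+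
 show "B 0 g = 0" "B f 0 = 0" using *(1)[of 0 0 g] *(3)[of f 0 0] by simp_all
qed

lemma is_hall_product_unique:
 assumes "is_hall_product B" "is_hall_product B'"
 shows "B = B'"
proof (intro ext)
 fix f g :: "qt symfun"
 note lin = is_hall_product_linear[OF assms(1)] is_hall_product_linear[OF assms(2)]
 have orth: "B (schur \<mu>) (schur \<nu>) = B' (schur \<mu>) (schur \<nu>)"
  if "\<mu> \<in> all_partitions" "\<nu> \<in> all_partitions" for \<mu> \<nu>
  using assms that unfolding is_hall_product_def all_partitions_def by auto
 have 1: "B f (schur \<nu>) = B' f (schur \<nu>)" if "\<nu> \<in> all_partitions" for f \<nu>
 proof -
  have "f \<in> symfun.span (schur ` all_partitions)" by (simp add: span_schur)
  then show ?thesis by (induction rule: symfun.span_induct_alt) (auto simp: lin orth[OF _ that])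
 qed
 have "g \<in> symfun.span (schur ` all_partitions)" by (simp add: span_schur)
 then show "B f g = B' f g" by (induction rule: symfun.span_induct_alt) (auto simp: lin 1)
qed

lemma ex_hall_product: "\<exists>B. is_hall_product B"
proof -
 define S where "S = (schur ` all_partitions :: qt symfun set)"
 define R where "R = symfun.representation S"
 have ind: "symfun.independent S" unfolding S_def by (rule independent_schur)
 have sp: "f \<in> symfun.span S" for f unfolding S_def by (simp add: span_schur)
 have fin: "finite {b. R f b \<noteq> 0}" for f unfolding R_def by (rule symfun.finite_representation)
 have add: "R (f + g) b = R f b + R g b" for f g b
  unfolding R_def using symfun.representation_add[OF ind sp sp] by simp
 have scale: "R (scale_sym c f) b = c * R f b" for c f b
  unfolding R_def using symfun.representation_scale[OF ind sp] by simp
 define B where "B f g = (\<Sum>b | R g b \<noteq> 0. R g b * R f b)" for f g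
 have sym: "B f g = B g f" for f g
 proof -
  have "B f g = (\<Sum>b | R g b \<noteq> 0 \<and> R f b \<noteq> 0. R g b * R f b)"
   unfolding B_def by (rule sum.mono_neutral_right) (use fin in auto)
  also have "\<dots> = B g f" unfolding B_def by (rule sum.mono_neutral_cong_left) (use fin in auto)
  finally show ?thesis .
 qed
 have lin: "Vector_Spaces.linear scale_sym (*) (%f. B f g)" for g
  unfolding Vector_Spaces.linear_iff B_def using vector_space_field vector_space_scale_sym
  by (auto simp: add scale algebra_simps sum.distrib sum_distrib_left)
 moreover from this have "Vector_Spaces.linear scale_sym (*) (B f)" for f by (subst sym[of f, abs_def])
 moreover have "B (schur \<mu>) (schur \<nu>) = of_bool (\<mu> = \<nu>)" if "\<mu> \<in> partitions m" "\<nu> \<in> partitions n" for m n \<mu> \<nu>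
 proof -
  have mem: "\<mu> \<in> all_partitions" "\<nu> \<in> all_partitions" using that by (auto simp: all_partitions_def)
  then have "schur \<mu> \<in> S" "schur \<nu> \<in> S" by (auto simp: S_def)
  then have "R (schur \<mu>) = (%v. if v = schur \<mu> then 1 else 0)" "R (schur \<nu>) = (%v. if v = schur \<nu> then 1 else 0)"
   unfolding R_def by (simp_all only: symfun.representation_basis[OF ind])
  then show ?thesis using inj_schur[unfolded inj_on_def, rule_format, OF mem] by (auto simp: B_def)
 qed
 ultimately show ?thesis unfolding is_hall_product_def by blast
qed

lemma is_hall_product_hall: "is_hall_product hall"
 unfolding hall_def using ex_hall_product is_hall_product_unique by (metis theI)

lemmas hall_linear = is_hall_product_linear[OF is_hall_product_hall]

lemma hall_sum_right: "hall f (sum g A) = (\<Sum>x\<in>A. hall f (g x))"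
 by (induction A rule: infinite_finite_induct) (simp_all add: hall_linear)

lemma hall_schur: "\<mu> \<in> all_partitions ==> \<nu> \<in> all_partitions ==> hall (schur \<mu>) (schur \<nu>) = of_bool (\<mu> = \<nu>)"
 using is_hall_product_hall unfolding is_hall_product_def all_partitions_def by auto

text \<open>The h_\<alpha> are dual to the monomials: both sides are linear in \<open>f\<close>, and
  for Schur functions this is the Kostka expansion of h_\<alpha>. Hall products thereby become
  coefficients.\<close>

theorem hall_complete_list: "hall f (complete_list \<alpha>) = mcoeff f (list_monomial \<alpha>)"
proof -
 have "f \<in> symfun.span (schur ` all_partitions)" by (simp add: span_schur)
 then show ?thesis
 proof (induction rule: symfun.span_induct_alt)
  case base show ?case by (simp add: hall_linear zero_symfun.rep_eq)
 next
  case (step c x y)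
  then obtain \<mu> where \<mu>: "x = schur \<mu>" "\<mu> \<in> all_partitions" by auto
  have "hall x (complete_list \<alpha>) =
    (\<Sum>\<nu>\<in>partitions (sum_list \<alpha>). mcoeff (schur \<nu>) (list_monomial \<alpha>) * hall x (schur \<nu>))"
   unfolding complete_list_schur[OF refl] by (simp add: hall_sum_right hall_linear)
  also have "\<dots> = (\<Sum>\<nu>\<in>partitions (sum_list \<alpha>). if \<nu> = \<mu> then mcoeff (schur \<mu>) (list_monomial \<alpha>) else 0)"
  proof (rule sum.cong[OF refl])
   fix \<nu> assume "\<nu> \<in> partitions (sum_list \<alpha>)"
   then have "\<nu> \<in> all_partitions" by (auto simp: all_partitions_def)
   then show "mcoeff (schur \<nu>) (list_monomial \<alpha>) * hall x (schur \<nu>) =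
     (if \<nu> = \<mu> then mcoeff (schur \<mu>) (list_monomial \<alpha>) else 0)"
    using \<mu> by (simp add: hall_schur)
  qed
  also have "\<dots> = mcoeff x (list_monomial \<alpha>)"
   using mcoeff_schur_size[of \<mu> "list_monomial \<alpha>", where 'a = qt] \<mu>
   by (cases "mcoeff (schur \<mu>) (list_monomial \<alpha>) = (0 :: qt)") (auto simp: all_partitions_iff size_list_monomial)
  finally show ?case using step by (simp add: hall_linear plus_symfun.rep_eq scale_sym.rep_eq)
 qed
qed

section \<open>Spans in dominance order and triangular operators\<close>

definition strict_span :: "nat list => qt symfun set" where
 "strict_span \<mu> =
   symfun.span (schur ` {\<nu> \<in> partitions (sum_list \<mu>). dominates \<nu> \<mu> \<and> \<nu> \<noteq> \<mu>})"

lemma dominates_refl [simp]: "dominates \<mu> \<mu>" by (simp add: dominates_def)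

lemma dominates_trans: "dominates \<kappa> \<mu> ==> dominates \<mu> \<nu> ==> dominates \<kappa> \<nu>"
 by (meson dominates_def order_trans)

lemma dominates_antisym:
 "\<mu> \<in> partitions n ==> \<nu> \<in> partitions n ==> dominates \<mu> \<nu> ==> dominates \<nu> \<mu> ==> \<mu> = \<nu>"
 by (metis dominates_part_stat(2) less_asym)

lemma sum_list_partition: "\<mu> \<in> partitions n ==> sum_list \<mu> = n"
 by (simp add: partitions_def)

lemma dominance_span_mono:
 assumes "\<mu> \<in> partitions n" "\<nu> \<in> partitions n" "dominates \<mu> \<nu>"
 shows "dominance_span \<mu> \<subseteq> dominance_span \<nu>" unfolding dominance_span_def using assms
 by (intro symfun.span_mono) (auto simp: sum_list_partition intro: dominates_trans)

lemma dominance_span_subset_strict: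
 assumes "\<mu> \<in> partitions n" "\<nu> \<in> partitions n" "dominates \<mu> \<nu>" "\<mu> \<noteq> \<nu>"
 shows "dominance_span \<mu> \<subseteq> strict_span \<nu>"
 unfolding dominance_span_def strict_span_def using assms
 by (intro symfun.span_mono image_mono) (auto simp: sum_list_partition intro: dominates_trans dominates_antisym)

lemma strict_span_subset: "strict_span \<mu> \<subseteq> dominance_span \<mu>"
 unfolding dominance_span_def strict_span_def by (intro symfun.span_mono) auto

lemma schur_in_dominance_span: "\<mu> \<in> partitions n ==> schur \<mu> \<in> dominance_span \<mu>"
 unfolding dominance_span_def by (intro symfun.span_base) (auto simp: sum_list_partition)

lemma schur_in_strict_span:
 "\<mu> \<in> partitions n ==> \<nu> \<in> partitions n ==> dominates \<mu> \<nu> ==> \<mu> \<noteq> \<nu> ==> schur \<mu> \<in> strict_span \<nu>"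
 using dominance_span_subset_strict schur_in_dominance_span by blast

lemma scale_sym_0 [simp]: "scale_sym 0 f = 0"
 by (rule symfun_eqI) (simp add: scale_sym.rep_eq zero_symfun.rep_eq)

text \<open>Here \<open>xs\<close> is a composition. Its Schur constituents dominate
  \<open>xs\<close>, hence \<mu>, and the strict inequality at \<open>k\<close> excludes \<mu>
  itself.\<close>

lemma complete_list_in_strict_span:
 assumes "\<mu> \<in> partitions n" "sum_list xs = n" "dominates xs \<mu>" "sum_list (take k \<mu>) < sum_list (take k xs)"
 shows "complete_list xs \<in> strict_span \<mu>"
 unfolding complete_list_schur[OF assms(2)] strict_span_def
proof (rule symfun.span_sum)
 fix \<nu> assume \<nu>: "\<nu> \<in> partitions n"
 show "scale_sym (mcoeff (schur \<nu>) (list_monomial xs)) (schur \<nu> :: qt symfun)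
     \<in> symfun.span (schur ` {\<nu> \<in> partitions (sum_list \<mu>). dominates \<nu> \<mu> \<and> \<nu> \<noteq> \<mu>})"
 proof (cases "mcoeff (schur \<nu> :: qt symfun) (list_monomial xs) = 0")
  case True
  then show ?thesis by (simp add: symfun.span_zero)
 next
  case False
  then have *: "dominates \<nu> xs" using mcoeff_schur_dominates by blast
  then have "dominates \<nu> \<mu>" using assms(3) dominates_trans by blast
  moreover have "\<nu> \<noteq> \<mu>" using * assms(4) by (auto simp: dominates_def not_le[symmetric])
  ultimately show ?thesis using \<nu> assms(1)
   by (intro symfun.span_scale symfun.span_base) (auto simp: sum_list_partition)
 qed
qed

lemma dominance_span_add: "f \<in> dominance_span \<mu> ==> g \<in> dominance_span \<mu> ==> f + g \<in> dominance_span \<mu>"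
 and dominance_span_diff: "f \<in> dominance_span \<mu> ==> g \<in> dominance_span \<mu> ==> f - g \<in> dominance_span \<mu>"
 and dominance_span_scale: "f \<in> dominance_span \<mu> ==> scale_sym c f \<in> dominance_span \<mu>"
 and strict_span_add:
  "f \<in> strict_span \<mu> ==> g \<in> strict_span \<mu> ==> f + g \<in> strict_span \<mu>"
 and strict_span_diff:
  "f \<in> strict_span \<mu> ==> g \<in> strict_span \<mu> ==> f - g \<in> strict_span \<mu>"
 and strict_span_scale: "f \<in> strict_span \<mu> ==> scale_sym c f \<in> strict_span \<mu>"
 unfolding dominance_span_def strict_span_def
 by (simp_all add: symfun.span_add symfun.span_diff symfun.span_scale)

abbreviation sym_linear :: "('a :: field symfun => 'a symfun) => bool" where
 "sym_linear \<equiv> Vector_Spaces.linear scale_sym scale_sym"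

text \<open>Operators are computed on the products h_\<mu>, while the spans are defined by Schur
  functions. As h_\<mu> is a nonzero multiple of s_\<mu> plus terms above \<mu>, induction on
  n(\<mu>) transfers triangularity.\<close>

lemma triangular_on_schur:
 assumes lin: "sym_linear T"
  and tri: "\<And>\<mu>. \<mu> \<in> partitions n ==> T (complete_list \<mu>) - scale_sym (e \<mu>) (complete_list \<mu>) \<in> strict_span \<mu>"
  and \<mu>: "\<mu> \<in> partitions n"
 shows "T (schur \<mu>) - scale_sym (e \<mu>) (schur \<mu>) \<in> strict_span \<mu>" using \<mu>
proof (induction "part_stat \<mu>" arbitrary: \<mu> rule: less_induct)
 case less
 interpret T: Vector_Spaces.linear scale_sym scale_sym T by (rule lin)
 define K where "K \<nu> = mcoeff (schur \<nu> :: qt symfun) (list_monomial \<mu>)" for \<nu>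
 have K: "K \<mu> \<noteq> 0" unfolding K_def by (rule mcoeff_schur_diag[OF less.prems])
 define R where "R = (\<Sum>\<nu>\<in>partitions n - {\<mu>}. scale_sym (K \<nu>) (schur \<nu>))"
 have "complete_list \<mu> = scale_sym (K \<mu>) (schur \<mu>) + R"
  unfolding complete_list_schur[OF sum_list_partition[OF less.prems]] R_def K_def using less.prems
  by (simp add: sum.remove)
 then have h: "scale_sym (K \<mu>) (schur \<mu>) = complete_list \<mu> - R" by simp
 have *: "T (schur \<nu>) - scale_sym (e \<mu>) (schur \<nu>) \<in> strict_span \<mu>" if "\<nu> \<in> partitions n - {\<mu>}" "K \<nu> \<noteq> 0" for \<nu>
 proof -
  have d: "dominates \<nu> \<mu>" using that(2) unfolding K_def by (rule mcoeff_schur_dominates)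
  then have "part_stat \<nu> < part_stat \<mu>" using dominates_part_stat(2) that less.prems by blast
  then have "T (schur \<nu>) - scale_sym (e \<nu>) (schur \<nu>) \<in> strict_span \<nu>" using that by (intro less.hyps) auto
  then have 1: "T (schur \<nu>) - scale_sym (e \<nu>) (schur \<nu>) \<in> strict_span \<mu>"
   using dominance_span_subset_strict[of \<nu> n \<mu>] strict_span_subset[of \<nu>] that less.prems d by blast
  have 2: "schur \<nu> \<in> strict_span \<mu>" using that less.prems d by (intro schur_in_strict_span) auto
  have "T (schur \<nu>) - scale_sym (e \<mu>) (schur \<nu>) =
   (T (schur \<nu>) - scale_sym (e \<nu>) (schur \<nu>)) + scale_sym (e \<nu>) (schur \<nu>) - scale_sym (e \<mu>) (schur \<nu>)" by simp
  then show ?thesis using 1 2 by (metis strict_span_add strict_span_diff strict_span_scale)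
 qed
 have "T R - scale_sym (e \<mu>) R = (\<Sum>\<nu>\<in>partitions n - {\<mu>}. scale_sym (K \<nu>) (T (schur \<nu>) - scale_sym (e \<mu>) (schur \<nu>)))"
  unfolding R_def by (simp add: T.sum T.scale scale_sym_sum sum_subtractf symfun.scale_right_diff_distrib mult.commute)
 also have "\<dots> \<in> strict_span \<mu>" unfolding strict_span_def
 proof (rule symfun.span_sum)
  fix \<nu> assume "\<nu> \<in> partitions n - {\<mu>}"
  then show "scale_sym (K \<nu>) (T (schur \<nu>) - scale_sym (e \<mu>) (schur \<nu>)) \<in>
    symfun.span (schur ` {\<nu> \<in> partitions (sum_list \<mu>). dominates \<nu> \<mu> \<and> \<nu> \<noteq> \<mu>})"
   using * by (cases "K \<nu> = 0") (auto simp: symfun.span_zero strict_span_def intro: symfun.span_scale)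
 qed
 finally have R: "T R - scale_sym (e \<mu>) R \<in> strict_span \<mu>" .
 have "scale_sym (K \<mu>) (T (schur \<mu>) - scale_sym (e \<mu>) (schur \<mu>)) =
   T (scale_sym (K \<mu>) (schur \<mu>)) - scale_sym (e \<mu>) (scale_sym (K \<mu>) (schur \<mu>))"
  by (simp add: T.scale symfun.scale_right_diff_distrib mult.commute)
 also have "\<dots> = (T (complete_list \<mu>) - scale_sym (e \<mu>) (complete_list \<mu>)) - (T R - scale_sym (e \<mu>) R)"
  unfolding h by (simp add: T.diff symfun.scale_right_diff_distrib)
 also have "\<dots> \<in> strict_span \<mu>" by (intro strict_span_diff tri less.prems R)
 finally have "scale_sym (inverse (K \<mu>)) (scale_sym (K \<mu>) (T (schur \<mu>) - scale_sym (e \<mu>) (schur \<mu>))) \<in> strict_span \<mu>"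
  by (rule strict_span_scale)
 then show ?case using K by simp
qed

section \<open>Power sums\<close>

abbreviation power_sum_list :: "nat list => 'a :: comm_ring_1 symfun" where
 "power_sum_list \<alpha> \<equiv> prod_list (map power_sum_sym \<alpha>)"

lemma replicate_mset_subseteq: "replicate_mset r x \<subseteq># M \<longleftrightarrow> r \<le> count M x"
proof
 assume "replicate_mset r x \<subseteq># M"
 from mset_subset_eq_count[OF this, of x] show "r \<le> count M x" by simp
qed (auto intro: mset_subset_eqI)

lemma mcoeff_power_sum_times:
 assumes "r \<ge> 1"
 shows "mcoeff (power_sum_sym r * f) M = (\<Sum>x | r \<le> count M x. mcoeff f (M - replicate_mset r x))"
proof -
 have "mcoeff (power_sum_sym r * f) M =
   (\<Sum>A | A \<subseteq># M. (if \<exists>i. A = replicate_mset r i then 1 else 0) * mcoeff f (M - A))"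
  by (simp add: times_symfun.rep_eq power_sum_sym.rep_eq)
 also have "\<dots> = (\<Sum>A | A \<subseteq># M \<and> (\<exists>i. A = replicate_mset r i). mcoeff f (M - A))"
  by (rule sum.mono_neutral_cong_right) (auto simp: finite_submultisets)
 also have "{A. A \<subseteq># M \<and> (\<exists>i. A = replicate_mset r i)} = replicate_mset r ` {x. r \<le> count M x}"
  by (auto simp: replicate_mset_subseteq)
 also have "(\<Sum>A\<in>\<dots>. mcoeff f (M - A)) = (\<Sum>x | r \<le> count M x. mcoeff f (M - replicate_mset r x))"
 proof (rule sum.reindex_cong[OF _ refl refl])
  have "x = y" if "replicate_mset r x = replicate_mset r y" for x y :: nat
  proof -
   have "count (replicate_mset r x) x = count (replicate_mset r y) x" using that by simp
   then show ?thesis using assms by (simp split: if_splits)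
  qed
  then show "inj_on (replicate_mset r) {x. r \<le> count M x}" by (auto intro: inj_onI)
 qed
 finally show ?thesis .
qed

lemma finite_count_ge: "r \<ge> 1 ==> finite {x. r \<le> count M x}"
 by (rule finite_subset[of _ "set_mset M"]) (auto simp flip: count_greater_zero_iff)

definition exponents :: "nat multiset => nat multiset" where
 "exponents M = image_mset (count M) (mset_set (set_mset M))"

lemma size_exponents: "size (exponents M) = card (set_mset M)" by (simp add: exponents_def)

lemma exponents_remove:
 assumes "count M x = r" "r \<ge> 1"
 shows "exponents M = add_mset r (exponents (M - replicate_mset r x))"
  and "set_mset (M - replicate_mset r x) = set_mset M - {x}"
proof -
 show *: "set_mset (M - replicate_mset r x) = set_mset M - {x}"
 proof (rule set_eqI)
  fix y show "y \<in># M - replicate_mset r x \<longleftrightarrow> y \<in> set_mset M - {x}"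
   using assms by (cases "y = x") (simp_all add: count_greater_zero_iff[symmetric] del: count_greater_zero_iff)
 qed
 have "x \<in># M" using assms by (simp flip: count_greater_zero_iff)
 then have "mset_set (set_mset M) = add_mset x (mset_set (set_mset M - {x}))" by (simp add: mset_set.remove)
 then have "exponents M = add_mset r (image_mset (count M) (mset_set (set_mset M - {x})))"
  using assms by (simp add: exponents_def)
 also have "image_mset (count M) (mset_set (set_mset M - {x})) = exponents (M - replicate_mset r x)"
  unfolding exponents_def * by (rule image_mset_cong) auto
 finally show "exponents M = add_mset r (exponents (M - replicate_mset r x))" .
qed

text \<open>Multiplication by p_r adds \<open>r\<close> to one exponent. So a monomial has at most
  as many variables as there are factors, with equality only if no two factors hit the same
  variable.\<close>

lemma mcoeff_power_sum_list_nonzero: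
 assumes "0 \<notin> set \<alpha>" "mcoeff (power_sum_list \<alpha> :: 'a :: comm_ring_1 symfun) M \<noteq> 0"
 shows "size M = sum_list \<alpha> \<and> card (set_mset M) \<le> length \<alpha> \<and>
  (card (set_mset M) = length \<alpha> --> exponents M = mset \<alpha>)" using assms
proof (induction \<alpha> arbitrary: M)
 case Nil
 then have "M = {#}" by (simp add: one_symfun.rep_eq split: if_splits)
 then show ?case by (simp add: exponents_def)
next
 case (Cons r \<alpha>)
 then have r: "r \<ge> 1" by simp
 have "(\<Sum>x | r \<le> count M x. mcoeff (power_sum_list \<alpha> :: 'a symfun) (M - replicate_mset r x)) \<noteq> 0"
  using Cons.prems(2) r by (simp add: mcoeff_power_sum_times)
 then obtain x where x: "r \<le> count M x" "mcoeff (power_sum_list \<alpha> :: 'a symfun) (M - replicate_mset r x) \<noteq> 0"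
  by (metis (mono_tags, lifting) mem_Collect_eq sum.neutral)
 define M' where "M' = M - replicate_mset r x"
 have IH: "size M' = sum_list \<alpha>" "card (set_mset M') \<le> length \<alpha>"
  "card (set_mset M') = length \<alpha> ==> exponents M' = mset \<alpha>"
  using Cons.IH[of M'] x Cons.prems(1) by (auto simp: M'_def)
 have "M = M' + replicate_mset r x" using x(1) by (simp add: M'_def replicate_mset_subseteq)
 then have "size M = size M' + r" by simp
 moreover have "x \<in># M" using x(1) r by (simp flip: count_greater_zero_iff)
 ultimately show ?case
 proof (cases "count M x = r")
  case True
  have "card (set_mset M) = Suc (card (set_mset M'))" unfolding M'_def exponents_remove(2)[OF True r]
   using card_Suc_Diff1[of "set_mset M" x] \<open>x \<in># M\<close> by simp
  then show ?thesis using exponents_remove(1)[OF True r] IH \<open>size M = size M' + r\<close> by (simp add: M'_def)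
 next
  case False
  have "y \<in># M' \<longleftrightarrow> y \<in># M" for y using x(1) False unfolding M'_def
   by (cases "y = x") (simp_all add: count_greater_zero_iff[symmetric] del: count_greater_zero_iff)
  then have "set_mset M' = set_mset M" by blast
  then show ?thesis using IH \<open>size M = size M' + r\<close> by auto
 qed
qed

text \<open>The coefficients count choices, so they cannot cancel; in characteristic 0 a positive
  count is nonzero.\<close>

lemma mcoeff_power_sum_list_of_nat:
 assumes "0 \<notin> set \<alpha>"
 shows "\<exists>k. mcoeff (power_sum_list \<alpha> :: 'a :: comm_ring_1 symfun) M = of_nat k \<and> (exponents M = mset \<alpha> --> k > 0)"
 using assms
proof (induction \<alpha> arbitrary: M)
 case Nil
 have "M = {#}" if "exponents M = {#}"
 proof -
  have "card (set_mset M) = 0" using that by (metis size_empty size_exponents)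
  then show ?thesis by simp
 qed
 then show ?case by (auto simp: one_symfun.rep_eq intro: exI[of _ 1] exI[of _ 0])
next
 case (Cons r \<alpha>)
 then have r: "r \<ge> 1" by simp
 obtain k where k: "\<And>M. mcoeff (power_sum_list \<alpha> :: 'a symfun) M = of_nat (k M)"
  "\<And>M. exponents M = mset \<alpha> ==> k M > 0" using Cons by (metis list.set_intros(2))
 have "mcoeff (power_sum_list (r # \<alpha>) :: 'a symfun) M = of_nat (\<Sum>x | r \<le> count M x. k (M - replicate_mset r x))"
  using r by (simp add: mcoeff_power_sum_times k(1))
 moreover have "(\<Sum>x | r \<le> count M x. k (M - replicate_mset r x)) > 0" if e: "exponents M = mset (r # \<alpha>)"
 proof -
  have "r \<in># exponents M" using e by simp
  then obtain x where x: "x \<in># M" "count M x = r" unfolding exponents_def by auto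
  have "exponents (M - replicate_mset r x) = mset \<alpha>" using exponents_remove(1)[OF x(2) r] e by simp
  then have "k (M - replicate_mset r x) > 0" by (rule k(2))
  then show ?thesis using x r by (intro sum_pos2[OF finite_count_ge, of r x]) auto
 qed
 ultimately show ?case by blast
qed

lemma exponents_list_monomial: "0 \<notin> set \<mu> ==> exponents (list_monomial \<mu>) = mset \<mu>"
proof -
 assume 0: "0 \<notin> set \<mu>"
 have s: "set_mset (list_monomial \<mu>) = {0..<length \<mu>}"
 proof (rule set_eqI)
  fix y show "y \<in># list_monomial \<mu> \<longleftrightarrow> y \<in> {0..<length \<mu>}"
   using 0 nth_mem[of y \<mu>] by (cases "y < length \<mu>"; cases "\<mu> ! y")
    (simp_all add: count_greater_zero_iff[symmetric] count_list_monomial del: count_greater_zero_iff)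
 qed
 have "exponents (list_monomial \<mu>) = image_mset (%i. \<mu> ! i) (mset_set {0..<length \<mu>})"
  unfolding exponents_def s by (rule image_mset_cong) (simp add: count_list_monomial)
 also have "\<dots> = mset (map (%i. \<mu> ! i) [0..<length \<mu>])" by (simp add: mset_upt)
 finally show ?thesis by (simp add: map_nth)
qed

lemma partition_eqI:
 assumes "\<mu> \<in> all_partitions" "\<nu> \<in> all_partitions" "mset \<mu> = mset \<nu>"
 shows "\<mu> = \<nu>"
proof -
 have "sorted (rev \<mu>)" "sorted (rev \<nu>)"
  using assms by (auto simp: all_partitions_def partitions_def sorted_wrt_rev)
 then have "rev \<mu> = rev \<nu>" using assms(3) by (metis mset_rev properties_for_sort)
 then show ?thesis by simp
qed

lemma power_sum_basis_rules:
 shows "\<mu> \<in> all_partitions ==> mcoeff (power_sum_list \<mu> :: 'a :: field_char_0 symfun) (list_monomial \<mu>) \<noteq> 0"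
  and "\<mu> \<in> all_partitions ==> \<nu> \<in> all_partitions ==>
   mcoeff (power_sum_list \<mu> :: 'a :: field_char_0 symfun) (list_monomial \<nu>) \<noteq> 0 ==>
   \<mu> \<noteq> \<nu> ==> sum_list \<mu> - length \<mu> < sum_list \<nu> - length \<nu>"
  and "\<mu> \<in> all_partitions ==> mcoeff (power_sum_list \<mu> :: 'a :: field_char_0 symfun) M \<noteq> 0 ==> size M = sum_list \<mu>"
proof -
 have 0: "0 \<notin> set \<mu>" if "\<mu> \<in> all_partitions" for \<mu> using that by (auto simp: all_partitions_def partitions_def)
 have len: "length \<mu> \<le> sum_list \<mu>" if "0 \<notin> set \<mu>" for \<mu> :: "nat list"
  using that by (induction \<mu>) auto
 show "mcoeff (power_sum_list \<mu> :: 'a symfun) (list_monomial \<mu>) \<noteq> 0" if mu: "\<mu> \<in> all_partitions"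
 proof -
  obtain k where "mcoeff (power_sum_list \<mu> :: 'a symfun) (list_monomial \<mu>) = of_nat k" "k > 0"
   using mcoeff_power_sum_list_of_nat[OF 0[OF mu]] exponents_list_monomial[OF 0[OF mu]] by blast
  then show ?thesis by simp
 qed
 show "size M = sum_list \<mu>" if "\<mu> \<in> all_partitions" "mcoeff (power_sum_list \<mu> :: 'a symfun) M \<noteq> 0"
  using mcoeff_power_sum_list_nonzero[OF 0[OF that(1)] that(2)] by simp
 show "sum_list \<mu> - length \<mu> < sum_list \<nu> - length \<nu>" if "\<mu> \<in> all_partitions" "\<nu> \<in> all_partitions"
   "mcoeff (power_sum_list \<mu> :: 'a symfun) (list_monomial \<nu>) \<noteq> 0" "\<mu> \<noteq> \<nu>"
 proof -
  note z = 0[OF that(1)] 0[OF that(2)]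
  have "card (set_mset (list_monomial \<nu>)) = length \<nu>"
   using exponents_list_monomial[OF z(2)] by (metis size_exponents size_mset)
  then have "sum_list \<nu> = sum_list \<mu>" "length \<nu> \<le> length \<mu>" "length \<nu> = length \<mu> ==> mset \<nu> = mset \<mu>"
   using mcoeff_power_sum_list_nonzero[OF z(1) that(3)] exponents_list_monomial[OF z(2)]
   by (auto simp: size_list_monomial)
  moreover have "mset \<nu> \<noteq> mset \<mu>" using partition_eqI that by metis
  ultimately show ?thesis using len[OF z(1)] by linarith
 qed
qed

lemma inj_power_sum_list: "inj_on (power_sum_list :: _ => 'a :: field_char_0 symfun) all_partitions"
 by (rule triangular_inj[where r = "%\<mu>. sum_list \<mu> - length \<mu>"]) (rule power_sum_basis_rules; assumption)+

lemma independent_power_sum_list: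
 "symfun.independent (power_sum_list ` all_partitions :: 'a :: field_char_0 symfun set)"
 by (rule triangular_independent[where r = "%\<mu>. sum_list \<mu> - length \<mu>"]) (rule power_sum_basis_rules; assumption)+

lemma span_power_sum_list:
 "symfun.span (power_sum_list ` all_partitions :: 'a :: field_char_0 symfun set) = UNIV"
 by (rule triangular_span[where r = "%\<mu>. sum_list \<mu> - length \<mu>"]) (rule power_sum_basis_rules; assumption)+

text \<open>Many identities between operators are proved below by comparing how the two sides
  commute with multiplication by a power sum.\<close>

lemma sym_induct [case_names one power_sum add scale]:
 fixes f :: "'a :: field_char_0 symfun"
 assumes one: "P 1" and power_sum: "\<And>r f. r \<ge> 1 ==> P f ==> P (power_sum_sym r * f)"
  and add: "\<And>f g. P f ==> P g ==> P (f + g)" and scale: "\<And>c f. P f ==> P (scale_sym c f)"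
 shows "P f"
proof -
 have "P (power_sum_list \<alpha>)" if "0 \<notin> set \<alpha>" for \<alpha>
  using that by (induction \<alpha>) (auto intro: one power_sum)
 then have 1: "P x" if "x \<in> power_sum_list ` all_partitions" for x
  using that by (auto simp: all_partitions_def partitions_def)
 have "P 0" using scale[OF one, of 0] by simp
 have "f \<in> symfun.span (power_sum_list ` all_partitions)" by (simp add: span_power_sum_list)
 then show ?thesis by (induction rule: symfun.span_induct_alt) (auto intro: add scale 1 \<open>P 0\<close>)
qed

section \<open>Algebra homomorphisms out of the symmetric functions\<close>

definition is_ring_hom :: "('a :: comm_ring_1 => 'b :: comm_ring_1) => bool" where
 "is_ring_hom \<iota> \<longleftrightarrow> \<iota> 1 = 1 \<and> (\<forall>a b. \<iota> (a + b) = \<iota> a + \<iota> b) \<and> (\<forall>a b. \<iota> (a * b) = \<iota> a * \<iota> b)"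

text \<open>Linearity is taken along a ring homomorphism \<iota> of the coefficients, so that the
  target can be the symmetric functions, polynomials over them, or the field.\<close>

definition is_sym_hom :: "('a :: comm_ring_1 => 'b :: comm_ring_1) => ('a symfun => 'b) => bool" where
 "is_sym_hom \<iota> \<phi> \<longleftrightarrow> \<phi> 1 = 1 \<and> (\<forall>f g. \<phi> (f + g) = \<phi> f + \<phi> g) \<and> (\<forall>f g. \<phi> (f * g) = \<phi> f * \<phi> g) \<and>
   (\<forall>c f. \<phi> (scale_sym c f) = \<iota> c * \<phi> f)"

lemma is_sym_homD:
 assumes "is_sym_hom \<iota> \<phi>"
 shows "\<phi> 1 = 1" "\<phi> (f + g) = \<phi> f + \<phi> g" "\<phi> (f * g) = \<phi> f * \<phi> g" "\<phi> (scale_sym c f) = \<iota> c * \<phi> f"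
  "\<phi> 0 = 0"
proof -
 show *: "\<phi> 1 = 1" "\<phi> (f + g) = \<phi> f + \<phi> g" "\<phi> (f * g) = \<phi> f * \<phi> g" "\<phi> (scale_sym c f) = \<iota> c * \<phi> f" for f g c
  using assms by (auto simp: is_sym_hom_def)
 show "\<phi> 0 = 0" using *(2)[of 0 0] by simp
qed

lemma sym_hom_unique:
 fixes \<phi> \<psi> :: "'a :: field_char_0 symfun => 'b :: comm_ring_1"
 assumes "is_sym_hom \<iota> \<phi>" "is_sym_hom \<iota> \<psi>" "\<And>r. r \<ge> 1 ==> \<phi> (power_sum_sym r) = \<psi> (power_sum_sym r)"
 shows "\<phi> f = \<psi> f"
 by (induction f rule: sym_induct) (simp_all add: is_sym_homD[OF assms(1)] is_sym_homD[OF assms(2)] assms(3))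

text \<open>Power sums are free generators. The map is defined linearly on the basis of the products
  p_\<mu>; it is multiplicative because the product of two basis elements belongs to the
  concatenated list.\<close>

theorem ex_sym_hom:
 fixes \<iota> :: "'a :: field_char_0 => 'b :: comm_ring_1"
 assumes \<iota>: "is_ring_hom \<iota>"
 shows "\<exists>\<phi>. is_sym_hom \<iota> \<phi> \<and> (\<forall>r\<ge>1. \<phi> (power_sum_sym r) = y r)"
proof -
 define B where "B = (power_sum_list ` all_partitions :: 'a symfun set)"
 interpret V: vector_space "%c x. \<iota> c * x :: 'b"
  by standard (use \<iota> in \<open>simp_all add: is_ring_hom_def algebra_simps\<close>)
 interpret P: vector_space_pair "scale_sym :: 'a => _" "%c x. \<iota> c * x :: 'b" ..
 have ind: "symfun.independent B" unfolding B_def by (rule independent_power_sum_list)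
 have sp: "f \<in> symfun.span B" for f unfolding B_def by (simp add: span_power_sum_list)
 define F where "F b = prod_list (map y (the_inv_into all_partitions power_sum_list b))" for b :: "'a symfun"
 obtain \<phi> where \<phi>: "Vector_Spaces.linear scale_sym (%c x. \<iota> c * x) \<phi>" "\<And>b. b \<in> B ==> \<phi> b = F b"
  using P.linear_independent_extend[OF ind, of F] by blast
 have add: "\<phi> (f + g) = \<phi> f + \<phi> g" and scale: "\<phi> (scale_sym c f) = \<iota> c * \<phi> f" for f g c
  using \<phi>(1) unfolding Vector_Spaces.linear_iff by auto
 have 0: "\<phi> 0 = 0" using add[of 0 0] by simp
 \<comment> \<open>Values are prescribed for weakly decreasing lists; sorting extends the formula to
   all lists of positive numbers, which concatenation requires.\<close>
 have \<phi>p: "\<phi> (power_sum_list \<alpha>) = prod_list (map y \<alpha>)" if "0 \<notin> set \<alpha>" for \<alpha>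
 proof -
  define \<mu> where "\<mu> = rev (sort \<alpha>)"
  have "\<mu> \<in> all_partitions" using that by (auto simp: \<mu>_def all_partitions_def partitions_def sorted_wrt_rev)
  moreover from this have "the_inv_into all_partitions power_sum_list (power_sum_list \<mu> :: 'a symfun) = \<mu>"
   by (intro the_inv_into_f_f inj_power_sum_list)
  ultimately have "\<phi> (power_sum_list \<mu>) = prod_list (map y \<mu>)" using \<phi>(2) by (simp add: B_def F_def)
  moreover have "mset \<mu> = mset \<alpha>" by (simp add: \<mu>_def)
  then have "prod_list (map g \<mu>) = prod_list (map g \<alpha>)" for g :: "nat => 'c :: comm_ring_1"
   by (metis prod_mset_prod_list mset_map)
  note this[of power_sum_sym] this[of y]
  ultimately show ?thesis by metis
 qed
 have mult1: "\<phi> (f * g) = \<phi> f * \<phi> g" if f: "f \<in> B" for f g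
 proof -
  obtain \<mu> where \<mu>: "f = power_sum_list \<mu>" "\<mu> \<in> all_partitions" using f by (auto simp: B_def)
  show ?thesis using sp[of g]
  proof (induction rule: symfun.span_induct_alt)
   case (step c x z)
   then obtain \<nu> where \<nu>: "x = power_sum_list \<nu>" "\<nu> \<in> all_partitions" by (auto simp: B_def)
   have "f * x = power_sum_list (\<mu> @ \<nu>)" by (simp add: \<mu> \<nu>)
   moreover have z: "0 \<notin> set \<mu>" "0 \<notin> set \<nu>" using \<mu> \<nu> by (auto simp: all_partitions_def partitions_def)
   moreover from z have "0 \<notin> set (\<mu> @ \<nu>)" by simp
   ultimately have "\<phi> (f * x) = \<phi> f * \<phi> x" using \<phi>p \<mu> \<nu> by (metis map_append prod_list.append)
   then show ?case using step by (simp add: distrib_left scale_sym_times add scale mult.left_commute)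
  qed (simp add: 0)
 qed
 have mult: "\<phi> (f * g) = \<phi> f * \<phi> g" for f g using sp[of f]
 proof (induction rule: symfun.span_induct_alt)
  case (step c x z)
  then show ?case by (simp add: distrib_right scale_sym_times add scale mult1 mult.assoc)
 qed (simp add: 0)
 have "\<phi> (power_sum_sym r) = y r" if "r \<ge> 1" for r using \<phi>p[of "[r]"] that by simp
 moreover have "\<phi> 1 = 1" using \<phi>p[of "[]"] by simp
 ultimately show ?thesis using add scale mult by (auto simp: is_sym_hom_def)
qed

section \<open>Plethystic exponentials\<close>

text \<open>\<open>is_exp y g\<close> says that \<open>\<Sum> g\<^sub>n z\<^sup>n = exp (\<Sum> y\<^sub>r z\<^sup>r / r)\<close>.\<close>

definition is_exp :: "(nat => 'a :: comm_ring_1) => (nat => 'a) => bool" where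
 "is_exp y g \<longleftrightarrow> g 0 = 1 \<and> (\<forall>n. of_nat (Suc n) * g (Suc n) = (\<Sum>i\<le>n. y (Suc i) * g (n - i)))"

lemma is_exp_fps:
 "is_exp y g \<longleftrightarrow> g 0 = 1 \<and> fps_deriv (Abs_fps g) = Abs_fps (%n. y (Suc n)) * Abs_fps g"
 unfolding is_exp_def fps_eq_iff by (simp add: fps_mult_nth atLeast0AtMost)

lemma is_exp_mult:
 assumes "is_exp y g" "is_exp z h"
 shows "is_exp (%i. y i + z i) (%n. \<Sum>i\<le>n. g i * h (n - i))"
proof -
 have *: "Abs_fps (%n. \<Sum>i\<le>n. g i * h (n - i)) = Abs_fps g * Abs_fps h"
  by (simp add: fps_eq_iff fps_mult_nth atLeast0AtMost)
 have "Abs_fps (%n. y (Suc n) + z (Suc n)) = Abs_fps (%n. y (Suc n)) + Abs_fps (%n. z (Suc n))"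
  by (simp add: fps_eq_iff)
 then show ?thesis using assms unfolding is_exp_fps * by (simp add: algebra_simps)
qed

lemma is_exp_unique:
 fixes g h :: "nat => 'a :: comm_ring_1"
 assumes "is_exp y g" "is_exp y h"
  and cancel: "\<And>n (a :: 'a) b. of_nat (Suc n) * a = of_nat (Suc n) * b ==> a = b"
 shows "g n = h n"
proof (induction n rule: less_induct)
 case (less n)
 show ?case
 proof (cases n)
  case 0 then show ?thesis using assms by (simp add: is_exp_def)
 next
  case (Suc m)
  have "of_nat (Suc m) * g (Suc m) = of_nat (Suc m) * h (Suc m)"
   using assms(1,2) less by (simp add: is_exp_def Suc)
  then show ?thesis unfolding Suc by (rule cancel)
 qed
qed

lemma is_exp_cong: "(\<And>i. i \<ge> 1 ==> y i = z i) ==> is_exp y g \<longleftrightarrow> is_exp z g"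
 by (simp add: is_exp_def)

lemma is_exp_scale:
 assumes "is_exp y g"
 shows "is_exp (%i. c ^ i * y i) (%n. c ^ n * g n)" unfolding is_exp_def
proof (intro conjI allI)
 show "c ^ 0 * g 0 = 1" using assms by (simp add: is_exp_def)
 fix n
 have "of_nat (Suc n) * (c ^ Suc n * g (Suc n)) = c ^ Suc n * (of_nat (Suc n) * g (Suc n))"
  by (simp only: mult.left_commute)
 also have "\<dots> = c ^ Suc n * (\<Sum>i\<le>n. y (Suc i) * g (n - i))" using assms by (simp add: is_exp_def)
 also have "\<dots> = (\<Sum>i\<le>n. c ^ Suc i * y (Suc i) * (c ^ (n - i) * g (n - i)))"
  unfolding sum_distrib_left
 proof (rule sum.cong[OF refl])
  fix i assume "i \<in> {..n}"
  then have "c ^ Suc n = c ^ Suc i * c ^ (n - i)" by (simp add: mult.assoc power_add[symmetric])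
  then show "c ^ Suc n * (y (Suc i) * g (n - i)) = c ^ Suc i * y (Suc i) * (c ^ (n - i) * g (n - i))"
   by (simp add: mult_ac)
 qed
 finally show "of_nat (Suc n) * (c ^ Suc n * g (Suc n)) = \<dots>" .
qed

lemma is_exp_zero: "is_exp (%_. 0) (%n. if n = 0 then 1 else 0)" by (simp add: is_exp_def)

text \<open>The series 1 / (1 - c z); its inverse 1 - c z is treated next.\<close>

lemma is_exp_geometric: "is_exp (%i. c ^ i) (%n. c ^ n)"
proof -
 have "of_nat (Suc n) * c ^ Suc n = (\<Sum>i\<le>n. c ^ Suc i * c ^ (n - i))" for n
 proof -
  have "(\<Sum>i\<le>n. c ^ Suc i * c ^ (n - i)) = (\<Sum>i\<le>n. c ^ Suc n)"
   by (rule sum.cong) (auto simp: mult.assoc power_add[symmetric])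
  then show ?thesis by simp
 qed
 then show ?thesis by (simp add: is_exp_def)
qed

lemma is_exp_neg_geometric: "is_exp (%i. - (c ^ i)) (%n. if n = 0 then 1 else if n = 1 then - c else 0)"
proof -
 let ?g = "%n. if n = 0 then 1 else if n = 1 then - c else (0 :: 'a)"
 have "(\<Sum>i\<le>n. - (c ^ Suc i) * ?g (n - i)) = (if n = 0 then - c else 0)" for n
 proof (cases n)
  case (Suc m)
  have "(\<Sum>i\<le>n. - (c ^ Suc i) * ?g (n - i)) = (\<Sum>i\<in>{m, n}. - (c ^ Suc i) * ?g (n - i))"
   by (rule sum.mono_neutral_right) (auto simp: Suc)
  then show ?thesis by (simp add: Suc)
 qed simp
 then show ?thesis by (simp add: is_exp_def)
qed

fun scalar_exp :: "(nat => 'a :: field_char_0) => nat => 'a" where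
 "scalar_exp y 0 = 1"
| "scalar_exp y (Suc n) = (\<Sum>i\<le>n. y (Suc i) * scalar_exp y (n - i)) / of_nat (Suc n)"

text \<open>The image of h_n under p_r -> c_r p_r, by Newton's recursion: c = 1 gives h_n and c = -1
  gives (-1)^n e_n.\<close>

fun sym_exp :: "(nat => 'a :: field_char_0) => nat => 'a symfun" where
 "sym_exp c 0 = 1"
| "sym_exp c (Suc n) = scale_sym (1 / of_nat (Suc n))
  (\<Sum>i\<le>n. scale_sym (c (Suc i)) (power_sum_sym (Suc i) * sym_exp c (n - i)))"

lemma of_nat_symfun: "of_nat n * f = scale_sym (of_nat n :: 'a :: field) f"
proof (induction n)
 case (Suc n)
 then show ?case by (simp only: of_nat_Suc distrib_right mult_1 symfun.scale_left_distrib symfun.scale_one)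
qed simp

lemma scalar_exp: "is_exp y (scalar_exp y)" by (simp add: is_exp_def del: of_nat_Suc)

lemma sym_exp: "is_exp (%i. scale_sym (c i) (power_sum_sym i)) (sym_exp c)"
 by (simp add: is_exp_def of_nat_symfun scale_sym_times del: of_nat_Suc)

lemma scalar_exp_unique:
 "is_exp y g ==> (\<And>i. i \<ge> 1 ==> y i = z i) ==> scalar_exp z n = g n"
 by (rule is_exp_unique[OF scalar_exp is_exp_cong[THEN iffD1]]) (auto simp del: of_nat_Suc)

lemma sym_exp_unique:
 fixes g :: "nat => 'a :: field_char_0 symfun"
 assumes "is_exp y g" "\<And>i. i \<ge> 1 ==> y i = scale_sym (c i) (power_sum_sym i)"
 shows "sym_exp c n = g n"
proof (rule is_exp_unique[OF sym_exp])
 show "is_exp (%i. scale_sym (c i) (power_sum_sym i)) g"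
  by (rule is_exp_cong[THEN iffD1, OF _ assms(1)]) (rule assms(2))
 show "a = b" if "of_nat (Suc n) * a = of_nat (Suc n) * b" for n and a b :: "'a symfun"
 proof -
  have "scale_sym (inverse (of_nat (Suc n))) (of_nat (Suc n) * a) = scale_sym (inverse (of_nat (Suc n))) (of_nat (Suc n) * b)"
   using that by simp
  then show ?thesis by (simp add: of_nat_symfun del: of_nat_Suc)
 qed
qed

lemma sym_exp_cong: "(\<And>i. i \<ge> 1 ==> c i = d i) ==> sym_exp c n = sym_exp d n"
 by (rule sym_exp_unique[OF sym_exp]) simp

lemma sym_exp_mult: "(\<Sum>i\<le>n. sym_exp c i * sym_exp d (n - i)) = sym_exp (%i. c i + d i) n"
 by (rule sym_exp_unique[OF is_exp_mult[OF sym_exp sym_exp], symmetric]) (simp add: symfun.scale_left_distrib)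

lemma scale_sym_eq_mult: "scale_sym c f = scale_sym c 1 * f" by (simp add: scale_sym_times)

lemma scale_sym_power: "scale_sym c 1 ^ n = scale_sym (c ^ n) (1 :: 'a :: field symfun)"
 by (induction n) (simp_all add: scale_sym_times mult.commute)

lemma sym_exp_scale: "sym_exp (%i. s ^ i * c i) n = scale_sym (s ^ n) (sym_exp c n)"
proof -
 have "sym_exp (%i. s ^ i * c i) n = scale_sym s 1 ^ n * sym_exp c n"
  by (rule sym_exp_unique[OF is_exp_scale[OF sym_exp]]) (simp add: scale_sym_power scale_sym_times)
 then show ?thesis by (simp add: scale_sym_power scale_sym_times)
qed

lemma sym_exp_zero: "sym_exp (%_. 0) n = (if n = 0 then 1 else 0)"
 by (rule sym_exp_unique[OF is_exp_zero]) simp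

lemma is_sym_hom_sum: "is_sym_hom \<iota> \<phi> ==> \<phi> (sum f A) = (\<Sum>x\<in>A. \<phi> (f x))"
 by (induction A rule: infinite_finite_induct) (simp_all add: is_sym_homD)

lemma is_sym_hom_of_nat: "is_sym_hom \<iota> \<phi> ==> \<phi> (of_nat n) = of_nat n"
 by (induction n) (simp_all add: is_sym_homD)

lemma is_exp_hom:
 assumes "is_sym_hom \<iota> \<phi>"
 shows "is_exp (%i. \<iota> (c i) * \<phi> (power_sum_sym i)) (%n. \<phi> (sym_exp c n))"
 unfolding is_exp_def
proof (intro conjI allI)
 show "\<phi> (sym_exp c 0) = 1" by (simp add: is_sym_homD[OF assms])
 fix n
 have "of_nat (Suc n) * \<phi> (sym_exp c (Suc n)) = \<phi> (of_nat (Suc n) * sym_exp c (Suc n))"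
  by (simp only: is_sym_homD[OF assms] is_sym_hom_of_nat[OF assms])
 also have "of_nat (Suc n) * sym_exp c (Suc n) = (\<Sum>i\<le>n. scale_sym (c (Suc i)) (power_sum_sym (Suc i)) * sym_exp c (n - i))"
  using sym_exp[of c] by (simp add: is_exp_def del: of_nat_Suc)
 also have "\<phi> \<dots> = (\<Sum>i\<le>n. \<iota> (c (Suc i)) * \<phi> (power_sum_sym (Suc i)) * \<phi> (sym_exp c (n - i)))"
  by (simp add: is_sym_hom_sum[OF assms] is_sym_homD[OF assms])
 finally show "of_nat (Suc n) * \<phi> (sym_exp c (Suc n)) = \<dots>" .
qed

lemma sym_exp_hom:
 assumes "is_sym_hom (%c. scale_sym c 1) \<phi>" "\<And>r. r \<ge> 1 ==> \<phi> (power_sum_sym r) = scale_sym (b r) (power_sum_sym r)"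
 shows "\<phi> (sym_exp c n) = sym_exp (%i. c i * b i) n"
 by (rule sym_exp_unique[OF is_exp_hom[OF assms(1)], symmetric]) (simp add: assms(2) scale_sym_times)

lemma mcoeff_of_nat_times: "mcoeff (of_nat n * f) M = (of_nat n :: 'a :: field) * mcoeff f M"
 by (simp add: of_nat_symfun scale_sym.rep_eq)

text \<open>Newton's identity. In the coefficient of a monomial of size n + 1 the right side counts
  pairs of a variable and a positive number up to its exponent; there are n + 1 of them.\<close>

lemma complete_sym_eq_exp: "complete_sym n = sym_exp (%_. 1 :: 'a :: field_char_0) n"
proof (rule sym_exp_unique[symmetric])
 show "is_exp power_sum_sym (complete_sym :: nat => 'a symfun)" unfolding is_exp_def
 proof (intro conjI allI)
  show "complete_sym 0 = (1 :: 'a symfun)" by (rule symfun_eqI) (simp add: complete_sym.rep_eq one_symfun.rep_eq)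
  fix n
  show "of_nat (Suc n) * complete_sym (Suc n) = (\<Sum>i\<le>n. power_sum_sym (Suc i) * complete_sym (n - i) :: 'a symfun)"
  proof (rule symfun_eqI)
   fix M
   have 1: "mcoeff (power_sum_sym (Suc i) * complete_sym (n - i) :: 'a symfun) M =
     (if size M = Suc n then of_nat (card {x. Suc i \<le> count M x}) else 0)" if "i \<le> n" for i
   proof -
    have "size (M - replicate_mset (Suc i) x) = n - i \<longleftrightarrow> size M = Suc n" if "Suc i \<le> count M x" for x
    proof -
     have "size (M - replicate_mset (Suc i) x) = size M - Suc i"
      using that replicate_mset_subseteq[of "Suc i" x M] by (simp add: size_Diff_submset)
     moreover have "Suc i \<le> size M" using that count_le_size[of M x] by linarith
     ultimately show ?thesis using \<open>i \<le> n\<close> by auto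
    qed
    then show ?thesis by (simp add: mcoeff_power_sum_times complete_sym.rep_eq)
   qed
   have "mcoeff (\<Sum>i\<le>n. power_sum_sym (Suc i) * complete_sym (n - i) :: 'a symfun) M =
     (if size M = Suc n then of_nat (\<Sum>i\<le>n. card {x. Suc i \<le> count M x}) else 0)"
    by (simp add: mcoeff_sum 1)
   moreover have "(\<Sum>i\<le>n. card {x. Suc i \<le> count M x}) = Suc n" if s: "size M = Suc n"
   proof -
    have "(\<Sum>i\<le>n. card {x. Suc i \<le> count M x}) = (\<Sum>i\<le>n. \<Sum>x\<in>set_mset M. if Suc i \<le> count M x then 1 else 0)"
    proof (rule sum.cong[OF refl])
     fix i
     have "{x. Suc i \<le> count M x} \<subseteq> set_mset M" by (auto simp flip: count_greater_zero_iff)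
     then have "card {x. Suc i \<le> count M x} = (\<Sum>x\<in>{x. Suc i \<le> count M x}. 1)" "{x. Suc i \<le> count M x} = {x \<in> set_mset M. Suc i \<le> count M x}"
      by auto
     then show "card {x. Suc i \<le> count M x} = (\<Sum>x\<in>set_mset M. if Suc i \<le> count M x then 1 else 0)"
      by (simp add: sum.If_cases Int_def)
    qed
    also have "\<dots> = (\<Sum>x\<in>set_mset M. \<Sum>i\<le>n. if Suc i \<le> count M x then 1 else 0)" by (rule sum.swap)
    also have "\<dots> = (\<Sum>x\<in>set_mset M. count M x)"
    proof (rule sum.cong[OF refl])
     fix x
     have "count M x \<le> Suc n"  using count_le_size[of M x] s by linarith
     then have "{..n} \<inter> {i. Suc i \<le> count M x} = {..<count M x}" by auto
     then show "(\<Sum>i\<le>n. if Suc i \<le> count M x then 1 else 0) = count M x" by (simp add: sum.If_cases)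
    qed
    also have "\<dots> = Suc n" using s by (simp add: size_multiset_overloaded_eq)
    finally show ?thesis .
   qed
   ultimately show "mcoeff (of_nat (Suc n) * complete_sym (Suc n)) M =
     mcoeff (\<Sum>i\<le>n. power_sum_sym (Suc i) * complete_sym (n - i) :: 'a symfun) M"
    by (simp add: mcoeff_of_nat_times complete_sym.rep_eq del: of_nat_Suc)
  qed
 qed
qed simp

lemma sum_Pow_alternating:
 assumes "finite A"
 shows "(\<Sum>S\<in>Pow A. (- 1) ^ card S) = (if A = {} then 1 else (0 :: 'a :: comm_ring_1))" using assms
proof (induction A)
 case (insert x A)
 have inj: "inj_on (insert x) (Pow A)" using insert.hyps(2) by (auto simp: inj_on_def)
 have "(\<Sum>S\<in>Pow (insert x A). (- 1) ^ card S) =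
   (\<Sum>S\<in>Pow A. (- 1) ^ card S) + (\<Sum>S\<in>insert x ` Pow A. (- 1) ^ card S :: 'a)"
  unfolding Pow_insert using insert.hyps by (intro sum.union_disjoint) auto
 also have "(\<Sum>S\<in>insert x ` Pow A. (- 1) ^ card S :: 'a) = (\<Sum>S\<in>Pow A. - ((- 1) ^ card S))"
  unfolding sum.reindex[OF inj] o_def
 proof (rule sum.cong[OF refl])
  fix S assume "S \<in> Pow A"
  then have "finite S" "x \<notin> S" using insert.hyps finite_subset by auto
  then show "(- 1) ^ card (insert x S) = - ((- 1) ^ card S :: 'a)" by simp
 qed
 finally show ?case by (simp add: sum_negf)
qed simp

text \<open>Both series are inverse to the series of the h_n. For the elementary functions this is
  an alternating sum over the sets of variables of a monomial.\<close>

lemma elementary_sym_eq_exp: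
 "scale_sym ((- 1) ^ n) (elementary_sym n) = sym_exp (%_. - 1 :: 'a :: field_char_0) n"
proof -
 define E where "E n = scale_sym ((- 1) ^ n) (elementary_sym n :: 'a symfun)" for n
 have conv: "(\<Sum>i\<le>n. E i * sym_exp (%_. 1) (n - i)) = (if n = 0 then 1 else 0)" for n
 proof (rule symfun_eqI)
  fix M
  define sf where "sf A \<longleftrightarrow> (\<forall>i. count A i \<le> 1)" for A :: "nat multiset"
  have "mcoeff (\<Sum>i\<le>n. E i * sym_exp (%_. 1) (n - i)) M =
   (\<Sum>i\<le>n. \<Sum>A | A \<subseteq># M. (if size A = i \<and> sf A then (- 1) ^ i else 0) * (if size (M - A) = n - i then 1 else 0))"
   by (simp add: mcoeff_sum times_symfun.rep_eq E_def scale_sym.rep_eq elementary_sym.rep_eq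
     complete_sym_eq_exp[symmetric] complete_sym.rep_eq sf_def cong: if_cong) (intro sum.cong refl, auto)
  also have "\<dots> = (\<Sum>A | A \<subseteq># M. \<Sum>i\<le>n. (if size A = i \<and> sf A then (- 1) ^ i else 0) * (if size (M - A) = n - i then 1 else 0))"
   by (rule sum.swap)
  also have "\<dots> = (\<Sum>A | A \<subseteq># M. if size M = n \<and> sf A then (- 1) ^ size A else 0)"
  proof (rule sum.cong[OF refl])
   fix A assume "A \<in> {A. A \<subseteq># M}"
   then have A: "size (M - A) = size M - size A" "size A \<le> size M" by (auto simp: size_Diff_submset size_mset_mono)
   have "(\<Sum>i\<le>n. (if size A = i \<and> sf A then (- 1) ^ i else 0) * (if size (M - A) = n - i then 1 else 0)) =
    (\<Sum>i\<le>n. if i = size A then (if size M = n \<and> sf A then (- 1) ^ size A else 0 :: 'a) else 0)"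
    using A by (intro sum.cong refl) auto
   then show "(\<Sum>i\<le>n. (if size A = i \<and> sf A then (- 1) ^ i else 0) * (if size (M - A) = n - i then 1 else 0)) =
    (if size M = n \<and> sf A then (- 1) ^ size A else 0 :: 'a)" using A by auto
  qed
  also have "\<dots> = (if size M = n then \<Sum>A | A \<subseteq># M \<and> sf A. (- 1) ^ size A else 0)"
   by (auto intro!: sum.mono_neutral_cong_right simp: finite_submultisets split: if_splits)
  also have "(\<Sum>A | A \<subseteq># M \<and> sf A. (- 1) ^ size A) = (\<Sum>S\<in>Pow (set_mset M). (- 1) ^ card S :: 'a)"
  proof (rule sum.reindex_bij_witness[of _ mset_set set_mset])
   fix A assume "A \<in> {A. A \<subseteq># M \<and> sf A}"
   then have A: "A \<subseteq># M" "\<And>i. count A i \<le> 1" by (auto simp: sf_def)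
   show eq: "mset_set (set_mset A) = A"
   proof (rule multiset_eqI)
    fix x show "count (mset_set (set_mset A)) x = count A x"
     using A(2)[of x] by (cases "x \<in># A") (auto simp: not_in_iff[symmetric] le_Suc_eq count_eq_zero_iff)
   qed
   show "set_mset A \<in> Pow (set_mset M)" using A(1) set_mset_mono by blast
   show "(- 1) ^ card (set_mset A) = (- 1 :: 'a) ^ size A" using eq by (metis size_mset_set)
  next
   fix S assume S: "S \<in> Pow (set_mset M)"
   then have fin: "finite S" using finite_subset by auto
   show "set_mset (mset_set S) = S" using fin by simp
   have "mset_set S \<subseteq># M" using S fin by (auto intro!: mset_subset_eqI simp: count_mset_set' Suc_le_eq count_greater_zero_iff)
   then show "mset_set S \<in> {A. A \<subseteq># M \<and> sf A}" using fin by (auto simp: sf_def count_mset_set')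
  qed
  also have "\<dots> = (if M = {#} then 1 else 0)" by (simp add: sum_Pow_alternating)
  finally show "mcoeff (\<Sum>i\<le>n. E i * sym_exp (%_. 1) (n - i)) M = mcoeff (if n = 0 then 1 else 0) M"
   by (auto simp: one_symfun.rep_eq zero_symfun.rep_eq)
 qed
 let ?H = "Abs_fps (sym_exp (%_. 1 :: 'a))" and ?E = "Abs_fps E" and ?E' = "Abs_fps (sym_exp (%_. - 1 :: 'a))"
 have 1: "?E * ?H = 1" using conv by (simp add: fps_eq_iff fps_mult_nth atLeast0AtMost)
 have 2: "?H * ?E' = 1"
  using sym_exp_mult[of "%_. 1 :: 'a" "%_. - 1"] sym_exp_zero[where 'a = 'a]
  by (simp add: fps_eq_iff fps_mult_nth atLeast0AtMost)
 have "?E = ?E * (?H * ?E')" by (simp only: 2 mult_1_right)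
 also have "\<dots> = ?E'" by (simp only: mult.assoc[symmetric] 1 mult_1_left)
 finally have "fps_nth ?E n = fps_nth ?E' n" by simp
 then show ?thesis by (simp add: E_def)
qed

section \<open>Translation operators\<close>

text \<open>\<open>translate a k f\<close> is the coefficient of \<open>v\<^sup>k\<close> in \<open>f[X + vA]\<close>, where \<open>p\<^sub>r[A] = a r\<close>.\<close>

definition translation :: "(nat => 'a :: field_char_0) => 'a symfun => 'a symfun poly" where
 "translation a = (SOME \<phi>. is_sym_hom (%c. [:scale_sym c 1:]) \<phi> \<and>
   (\<forall>r\<ge>1. \<phi> (power_sum_sym r) = [:power_sum_sym r:] + monom (scale_sym (a r) 1) r))"

definition translate :: "(nat => 'a :: field_char_0) => nat => 'a symfun => 'a symfun" where
 "translate a k f = coeff (translation a f) k"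

lemma translation:
 "is_sym_hom (%c. [:scale_sym c 1:]) (translation a)"
 "r \<ge> 1 ==> translation a (power_sum_sym r) = [:power_sum_sym r:] + monom (scale_sym (a r) 1) r"
proof -
 have "is_ring_hom (%c :: 'a. [:scale_sym c 1:])"
  by (simp add: is_ring_hom_def symfun.scale_left_distrib scale_sym_times one_pCons)
 from someI_ex[OF ex_sym_hom[OF this, of "%r. [:power_sum_sym r:] + monom (scale_sym (a r) 1) r"]]
 show "is_sym_hom (%c. [:scale_sym c 1:]) (translation a)"
  "r \<ge> 1 ==> translation a (power_sum_sym r) = [:power_sum_sym r:] + monom (scale_sym (a r) 1) r"
  unfolding translation_def[symmetric] by auto
qed

lemma translate_one: "translate a k 1 = (if k = 0 then 1 else 0)"
 by (simp add: translate_def is_sym_homD[OF translation(1)])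

lemma translate_add: "translate a k (f + g) = translate a k f + translate a k g"
 by (simp add: translate_def is_sym_homD[OF translation(1)])

lemma translate_scale: "translate a k (scale_sym c f) = scale_sym c (translate a k f)"
 by (simp add: translate_def is_sym_homD[OF translation(1)] scale_sym_times)

lemma translate_0 [simp]: "translate a k 0 = 0" by (simp add: translate_def is_sym_homD[OF translation(1)])

lemma translate_mult: "translate a k (f * g) = (\<Sum>i\<le>k. translate a i f * translate a (k - i) g)"
 by (simp add: translate_def is_sym_homD[OF translation(1)] coeff_mult)

lemma translate_sum: "translate a k (sum f A) = (\<Sum>x\<in>A. translate a k (f x))"
 by (induction A rule: infinite_finite_induct) (simp_all add: translate_add)

lemma translate_power_sum_times:
 assumes "r \<ge> 1"
 shows "translate a k (power_sum_sym r * f) = power_sum_sym r * translate a k f +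
  (if r \<le> k then scale_sym (a r) (translate a (k - r) f) else 0)"
proof -
 have "translation a (power_sum_sym r * f) =
  smult (power_sum_sym r) (translation a f) + monom (scale_sym (a r) 1) r * translation a f"
  by (simp add: is_sym_homD[OF translation(1)] translation(2)[OF assms] distrib_right)
 then show ?thesis by (simp add: translate_def coeff_monom_mult scale_sym_times)
qed

lemma translate_zero: "translate a 0 f = f" by (induction f rule: sym_induct)
  (simp_all add: translate_one translate_power_sum_times translate_add translate_scale)

lemma translate_eq_0: "k > degree (translation a f) ==> translate a k f = 0"
 by (simp add: translate_def coeff_eq_0)

lemma translate_cong:
 assumes "\<And>r. r \<ge> 1 ==> a r = b r"
 shows "translate a k f = translate b k f" by (induction f arbitrary: k rule: sym_induct)
  (simp_all add: translate_one translate_power_sum_times translate_add translate_scale assms)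

lemma translate_commute: "translate a i (translate b j f) = translate b j (translate a i f)"
proof (induction f arbitrary: i j rule: sym_induct)
 case (power_sum r f)
 then show ?case by (cases "r \<le> i"; cases "r \<le> j")
   (simp_all add: translate_power_sum_times translate_add translate_scale add_ac mult.commute[of "a r" "b r"])
qed (simp_all add: translate_one translate_add translate_scale)

lemma translate_plus:
 "(\<Sum>i\<le>k. translate a i (translate b (k - i) f)) = translate (%r. a r + b r) k f"
proof (induction f arbitrary: k rule: sym_induct)
 case one
 have "(\<Sum>i\<le>k. translate a i (translate b (k - i) 1)) = (\<Sum>i\<le>k. if i = k then (if k = 0 then 1 else 0) else 0)"
  by (rule sum.cong) (auto simp: translate_one)
 then show ?case by (simp add: translate_one)
next
 case (power_sum r f)
 have 1: "(\<Sum>i\<le>k. if r \<le> k - i then scale_sym (b r) (translate a i (translate b (k - i - r) f)) else 0) =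
  (if r \<le> k then scale_sym (b r) (\<Sum>i\<le>k - r. translate a i (translate b (k - r - i) f)) else 0)"
 proof (cases "r \<le> k")
  case True
  have "(\<Sum>i\<le>k. if r \<le> k - i then scale_sym (b r) (translate a i (translate b (k - i - r) f)) else 0) =
   (\<Sum>i\<le>k - r. scale_sym (b r) (translate a i (translate b (k - r - i) f)))"
   using True by (intro sum.mono_neutral_cong_right) (auto simp: add.commute)
  then show ?thesis using True by (simp add: scale_sym_sum)
 qed (auto intro: sum.neutral)
 have 2: "(\<Sum>i\<le>k. if r \<le> i then scale_sym (a r) (translate a (i - r) (translate b (k - i) f)) else 0) =
  (if r \<le> k then scale_sym (a r) (\<Sum>i\<le>k - r. translate a i (translate b (k - r - i) f)) else 0)"
 proof (cases "r \<le> k")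
  case True
  have "(\<Sum>i\<le>k. if r \<le> i then scale_sym (a r) (translate a (i - r) (translate b (k - i) f)) else 0) =
   (\<Sum>i\<in>{r..k}. scale_sym (a r) (translate a (i - r) (translate b (k - i) f)))"
   by (intro sum.mono_neutral_cong_right) auto
  also have "\<dots> = (\<Sum>i\<le>k - r. scale_sym (a r) (translate a i (translate b (k - r - i) f)))"
   using True by (intro sum.reindex_bij_witness[of _ "%i. i + r" "%i. i - r"]) auto
  finally show ?thesis using True by (simp add: scale_sym_sum)
 qed (auto intro: sum.neutral)
 have "(\<Sum>i\<le>k. translate a i (translate b (k - i) (power_sum_sym r * f))) =
  (\<Sum>i\<le>k. power_sum_sym r * translate a i (translate b (k - i) f)) +
  (\<Sum>i\<le>k. if r \<le> i then scale_sym (a r) (translate a (i - r) (translate b (k - i) f)) else 0) +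
  (\<Sum>i\<le>k. if r \<le> k - i then scale_sym (b r) (translate a i (translate b (k - i - r) f)) else 0)"
  unfolding sum.distrib[symmetric] using power_sum(1)
  by (intro sum.cong refl) (simp add: translate_power_sum_times translate_add translate_scale)
 also have "\<dots> = translate (%r. a r + b r) k (power_sum_sym r * f)"
  unfolding 1 2 sum_distrib_left[symmetric] power_sum(2) using power_sum(1)
  by (simp add: translate_power_sum_times symfun.scale_left_distrib)
 finally show ?case .
qed (simp_all add: translate_add translate_scale sum.distrib scale_sym_sum[symmetric])

lemma translate_rescale: "translate (%r. s ^ r * a r) k f = scale_sym (s ^ k) (translate a k f)"
proof (induction f arbitrary: k rule: sym_induct)
 case (power_sum r f)
 have "s ^ r * a r * s ^ (k - r) = s ^ k * a r" if "r \<le> k"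
  using that by (simp add: mult.commute mult.left_commute power_add[symmetric])
 then show ?case using power_sum
  by (simp add: translate_power_sum_times symfun.scale_right_distrib scale_sym_times)
qed (simp_all add: translate_one translate_add translate_scale symfun.scale_right_distrib mult.commute)

lemma translate_trivial: "translate (%_. 0) k f = (if k = 0 then f else 0)"
 by (induction f arbitrary: k rule: sym_induct)
  (simp_all add: translate_one translate_power_sum_times translate_add translate_scale)

text \<open>Coefficients of Exp[C (X + v A)] = Exp[C X] Exp[v C A]. In Newton's recursion the
  untranslated power sums account for n - k and the translated ones for k of the factor n.\<close>

lemma translate_sym_exp:
 "translate a k (sym_exp c n) =
  (if k \<le> n then scale_sym (scalar_exp (%i. c i * a i) k) (sym_exp c (n - k)) else 0)"
proof (induction n arbitrary: k rule: less_induct)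
 case (less n)
 define \<eta> where "\<eta> = scalar_exp (%i. c i * a i)"
 show ?case
 proof (cases n)
  case 0
  have "translate a k 1 = (if k \<le> 0 then scale_sym (\<eta> k) 1 else 0)" by (simp add: translate_one \<eta>_def)
  then show ?thesis by (simp add: 0 \<eta>_def)
 next
  case (Suc m)
  have 1: "(\<Sum>i\<le>m. scale_sym (c (Suc i)) (power_sum_sym (Suc i) * translate a k (sym_exp c (m - i)))) =
   (if k \<le> m then scale_sym (of_nat (Suc m - k) * \<eta> k) (sym_exp c (Suc m - k)) else 0)"
  proof (cases "k \<le> m")
   case True
   have "(\<Sum>i\<le>m. scale_sym (c (Suc i)) (power_sum_sym (Suc i) * translate a k (sym_exp c (m - i)))) =
    (\<Sum>i\<le>m. if i \<le> m - k then scale_sym (\<eta> k) (scale_sym (c (Suc i)) (power_sum_sym (Suc i) * sym_exp c (m - k - i))) else 0)"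
    using True less.IH by (intro sum.cong refl) (auto simp: Suc \<eta>_def scale_sym_times mult.commute add.commute)
   also have "\<dots> = (\<Sum>i\<le>m - k. scale_sym (\<eta> k) (scale_sym (c (Suc i)) (power_sum_sym (Suc i) * sym_exp c (m - k - i))))"
    by (rule sum.mono_neutral_cong_right) auto
   also have "\<dots> = scale_sym (\<eta> k) (of_nat (Suc (m - k)) * sym_exp c (Suc (m - k)))"
    by (simp add: scale_sym_sum of_nat_symfun del: of_nat_Suc)
   also have "Suc (m - k) = Suc m - k" using True by simp
   finally show ?thesis using True by (simp add: of_nat_symfun mult.commute del: of_nat_diff)
  next
   case False
   then show ?thesis using less.IH by (auto simp: Suc intro!: sum.neutral)
  qed
  have 2: "(\<Sum>i\<le>m. scale_sym (c (Suc i)) (if Suc i \<le> k then scale_sym (a (Suc i)) (translate a (k - Suc i) (sym_exp c (m - i))) else 0)) =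
   (if k \<le> Suc m then scale_sym (of_nat k * \<eta> k) (sym_exp c (Suc m - k)) else 0)"
  proof (cases "k \<le> Suc m \<and> k \<noteq> 0")
   case True
   then obtain l where l: "k = Suc l" "l \<le> m" by (cases k) auto
   have "(\<Sum>i\<le>m. scale_sym (c (Suc i)) (if Suc i \<le> k then scale_sym (a (Suc i)) (translate a (k - Suc i) (sym_exp c (m - i))) else 0)) =
    (\<Sum>i\<le>l. scale_sym (c (Suc i) * a (Suc i) * \<eta> (l - i)) (sym_exp c (m - l)))"
   proof (rule sum.mono_neutral_cong_right)
    fix i assume "i \<in> {..l}"
    then have i: "i \<le> l" by simp
    have "m - i - (l - i) = m - l" using i by simp
    then show "scale_sym (c (Suc i)) (if Suc i \<le> k then scale_sym (a (Suc i)) (translate a (k - Suc i) (sym_exp c (m - i))) else 0) =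
     scale_sym (c (Suc i) * a (Suc i) * \<eta> (l - i)) (sym_exp c (m - l))"
     using i l less.IH[of "m - i" "l - i"] by (simp add: Suc \<eta>_def mult.assoc)
   qed (use l in auto)
   also have "\<dots> = scale_sym (\<Sum>i\<le>l. c (Suc i) * a (Suc i) * \<eta> (l - i)) (sym_exp c (m - l))"
    by (rule sum_scale_sym)
   also have "(\<Sum>i\<le>l. c (Suc i) * a (Suc i) * \<eta> (l - i)) = of_nat k * \<eta> k"
    by (simp add: l \<eta>_def del: of_nat_Suc)
   finally show ?thesis using l by simp
  next
   case False
   then show ?thesis using less.IH by (auto simp: Suc intro!: sum.neutral)
  qed
  have "translate a k (sym_exp c (Suc m)) = scale_sym (1 / of_nat (Suc m))
    ((\<Sum>i\<le>m. scale_sym (c (Suc i)) (power_sum_sym (Suc i) * translate a k (sym_exp c (m - i)))) +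
    (\<Sum>i\<le>m. scale_sym (c (Suc i)) (if Suc i \<le> k then scale_sym (a (Suc i)) (translate a (k - Suc i) (sym_exp c (m - i))) else 0)))"
   by (simp add: translate_scale translate_sum translate_power_sum_times symfun.scale_right_distrib sum.distrib del: of_nat_Suc)
  also have "\<dots> = scale_sym (1 / of_nat (Suc m)) (if k \<le> Suc m then scale_sym (of_nat (Suc m) * \<eta> k) (sym_exp c (Suc m - k)) else 0)"
  proof -
   have "of_nat (Suc m - k) * \<eta> k + of_nat k * \<eta> k = of_nat (Suc m) * \<eta> k" if "k \<le> Suc m"
    using that by (simp add: of_nat_diff algebra_simps)
   moreover have "k \<le> Suc m ==> \<not> k \<le> m ==> of_nat (Suc m - k) * \<eta> k = 0" by simp
   ultimately show ?thesis unfolding 1 2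
    by (cases "k \<le> m") (auto simp: symfun.scale_left_distrib[symmetric] le_Suc_eq simp del: of_nat_Suc)
  qed
  finally show ?thesis by (simp add: Suc \<eta>_def del: of_nat_Suc)
 qed
qed

section \<open>Vertex operators and their triangularity\<close>

lemma sum_atMost_split: "(\<Sum>a\<le>(b :: nat). F a) = F 0 + (\<Sum>a\<in>{1..b}. F a :: 'a :: comm_monoid_add)"
 by (simp add: atLeast0AtMost[symmetric] sum.atLeast_Suc_atMost)

text \<open>With \<open>G(z) = \<Sum> G\<^sub>i z\<^sup>i\<close>, \<open>vertex_op G a j f\<close> is the coefficient of \<open>z\<^sup>-\<^sup>j\<close> in \<open>f[X + A/z] G(z)\<close>.\<close>

definition vertex_op :: "(nat => 'a symfun) => (nat => 'a :: field_char_0) => nat => 'a symfun => 'a symfun" where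
 "vertex_op G a j f = (\<Sum>i\<le>degree (translation a f). if j \<le> i then G (i - j) * translate a i f else 0)"

text \<open>The number of summands in the definition depends on \<open>f\<close>; identities that
  involve several arguments are compared with a common bound \<open>N\<close>.\<close>

lemma vertex_op_eq:
 assumes "degree (translation a f) \<le> N"
 shows "vertex_op G a j f = (\<Sum>i\<le>N. if j \<le> i then G (i - j) * translate a i f else 0)"
 unfolding vertex_op_def using assms by (intro sum.mono_neutral_left) (auto simp: translate_eq_0)

lemma vertex_op_add: "vertex_op G a j (f + g) = vertex_op G a j f + vertex_op G a j g"
proof -
 define N where "N = Max {degree (translation a f), degree (translation a g), degree (translation a (f + g))}"
 show ?thesis by (subst (1 2 3) vertex_op_eq[where N = N])
   (auto simp: N_def translate_add distrib_left sum.distrib[symmetric] intro!: sum.cong)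
qed

lemma vertex_op_scale: "vertex_op G a j (scale_sym c f) = scale_sym c (vertex_op G a j f)"
proof -
 define N where "N = max (degree (translation a f)) (degree (translation a (scale_sym c f)))"
 show ?thesis by (subst (1 2) vertex_op_eq[where N = N])
   (auto simp: N_def translate_scale scale_sym_times scale_sym_sum intro!: sum.cong)
qed

lemma linear_vertex_op: "sym_linear (vertex_op G a j)"
 unfolding Vector_Spaces.linear_iff by (simp add: vertex_op_add vertex_op_scale vector_space_scale_sym)

lemma vertex_op_cong:
 assumes "\<And>n. G n = G' n" "\<And>r. r \<ge> 1 ==> a r = a' r"
 shows "vertex_op G a j f = vertex_op G' a' j f"
proof -
 define N where "N = max (degree (translation a f)) (degree (translation a' f))"
 show ?thesis
  by (subst (1 2) vertex_op_eq[where N = N]) (auto simp: N_def assms translate_cong[OF assms(2)] intro!: sum.cong)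
qed

lemma vertex_op_one: "vertex_op G a j 1 = (if j = 0 then G 0 else 0)"
 by (simp add: vertex_op_def is_sym_homD[OF translation(1)] translate_one)

lemma translate_hom:
 assumes "is_sym_hom (%c. scale_sym c 1) \<phi>" "\<And>r. r \<ge> 1 ==> \<phi> (power_sum_sym r) = scale_sym (b r) (power_sum_sym r)"
  and "\<And>r. r \<ge> 1 ==> a r = b r * a' r"
 shows "\<phi> (translate a k f) = translate a' k (\<phi> f)" by (induction f arbitrary: k rule: sym_induct)
  (simp_all add: translate_one translate_power_sum_times translate_add translate_scale is_sym_homD[OF assms(1)]
   assms(2,3) scale_sym_times symfun.scale_right_distrib)

text \<open>Serves for the plethysms X (1 - u), where b_r = 1 - u^r, and for the projection that
  kills the even power sums, where b_r is 0 or 1.\<close>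

lemma vertex_op_hom:
 assumes "is_sym_hom (%c. scale_sym c 1) \<phi>" "\<And>r. r \<ge> 1 ==> \<phi> (power_sum_sym r) = scale_sym (b r) (power_sum_sym r)"
  and "\<And>r. r \<ge> 1 ==> a r = b r * a' r"
 shows "\<phi> (vertex_op G a j f) = vertex_op (%n. \<phi> (G n)) a' j (\<phi> f)"
proof -
 define N where "N = max (degree (translation a f)) (degree (translation a' (\<phi> f)))"
 note \<phi> = is_sym_homD[OF assms(1)] is_sym_hom_sum[OF assms(1)]
 have "\<phi> (vertex_op G a j f) = (\<Sum>i\<le>N. \<phi> (if j \<le> i then G (i - j) * translate a i f else 0))"
  by (subst vertex_op_eq[where N = N]) (auto simp: N_def \<phi>)
 also have "\<dots> = (\<Sum>i\<le>N. if j \<le> i then \<phi> (G (i - j)) * translate a' i (\<phi> f) else 0)"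
  by (intro sum.cong refl) (auto simp: \<phi> translate_hom[OF assms])
 also have "\<dots> = vertex_op (%n. \<phi> (G n)) a' j (\<phi> f)"
  by (rule vertex_op_eq[symmetric]) (simp add: N_def)
 finally show ?thesis .
qed

lemma scalar_exp_one_minus: "scalar_exp (%i. 1 - t ^ i) n = (if n = 0 then 1 else 1 - t)"
proof -
 have "is_exp (%i. 1 ^ i + - (t ^ i)) (%n. \<Sum>i\<le>n. 1 ^ i * (if n - i = 0 then 1 else if n - i = 1 then - t else 0))"
  by (rule is_exp_mult[OF is_exp_geometric is_exp_neg_geometric])
 moreover have "(\<Sum>i\<le>n. 1 ^ i * (if n - i = 0 then 1 else if n - i = 1 then - t else 0)) = (if n = 0 then 1 else 1 - t)" for n
 proof (cases n)
  case (Suc m)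
  have "(\<Sum>i\<le>n. 1 ^ i * (if n - i = 0 then 1 else if n - i = 1 then - t else 0)) =
    (\<Sum>i\<in>{m, n}. if n - i = 0 then 1 else if n - i = 1 then - t else 0)"
   by (rule sum.mono_neutral_cong_right) (auto simp: Suc)
  then show ?thesis by (simp add: Suc)
 qed simp
 ultimately have "is_exp (%i. 1 - t ^ i) (%n. if n = 0 then 1 else 1 - t)" by simp
 then show ?thesis by (rule scalar_exp_unique) simp
qed

text \<open>The Macdonald operator after the substitution \<open>X \<mapsto> X(1-q)\<close>.\<close>

definition reduced_op :: "'a :: field_char_0 => 'a => nat => 'a symfun => 'a symfun" where
 "reduced_op q t = vertex_op (sym_exp (%i. q ^ i - 1)) (%i. 1 - t ^ i)"

lemma translate_complete_times:
 "translate (%i. 1 - t ^ i) k (complete_sym b * f) =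
  (\<Sum>a\<le>k. if a \<le> b then scale_sym (if a = 0 then 1 else 1 - t) (complete_sym (b - a) * translate (%i. 1 - t ^ i) (k - a) f) else 0)"
 unfolding translate_mult
 by (intro sum.cong refl) (simp add: complete_sym_eq_exp translate_sym_exp scalar_exp_one_minus scale_sym_times)

lemma sum_translate_mult:
 assumes "\<And>i. i > N ==> translate a i f = 0" "\<And>l. l > m ==> translate a l g = 0" "N + m \<le> N'"
 shows "(\<Sum>k\<le>N'. F k * translate a k (g * f)) = (\<Sum>i\<le>N. \<Sum>l\<le>m. F (i + l) * (translate a l g * translate a i f))"
proof -
 have "(\<Sum>k\<le>N'. F k * translate a k (g * f)) = (\<Sum>k\<le>N'. \<Sum>l\<le>k. F k * (translate a l g * translate a (k - l) f))"
  by (simp add: translate_mult sum_distrib_left)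
 also have "\<dots> = (\<Sum>(k, l)\<in>(SIGMA k:{..N'}. {..k}). F k * (translate a l g * translate a (k - l) f))"
  by (rule sum.Sigma) auto
 also have "\<dots> = (\<Sum>(k, l)\<in>{(k, l). l \<le> k \<and> k - l \<le> N \<and> l \<le> m}. F k * (translate a l g * translate a (k - l) f))"
 proof (rule sum.mono_neutral_right)
  have "F k * (translate a l g * translate a (k - l) f) = 0" if "\<not> (k - l \<le> N \<and> l \<le> m)" for k l
   using that assms(1)[of "k - l"] assms(2)[of l] by (cases "l \<le> m") auto
  then show "\<forall>x\<in>(SIGMA k:{..N'}. {..k}) - {(k, l). l \<le> k \<and> k - l \<le> N \<and> l \<le> m}.
    (case x of (k, l) => F k * (translate a l g * translate a (k - l) f)) = 0" by auto
 qed (use assms(3) in auto)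
 also have "\<dots> = (\<Sum>(i, l)\<in>{..N} \<times> {..m}. F (i + l) * (translate a l g * translate a i f))"
  by (rule sum.reindex_bij_witness[where i = "%(i, l). (i + l, l)" and j = "%(k, l). (k - l, l)"]) auto
 finally show ?thesis by (simp only: sum.cartesian_product)
qed

text \<open>The terms \<open>a \<ge> 1\<close> of \<open>h(w) O(z) = \<Sum> \<dots> (w/z)\<^sup>a\<close> are traded for terms with \<open>a \<le> 0\<close>, which are triangular,
 and for the product at \<open>z = w\<close>, in which \<open>Exp[wX]\<close> becomes \<open>Exp[qwX]\<close>.\<close>

lemma reduced_op_complete_times:
 assumes N: "degree (translation (%i. 1 - t ^ i) f) \<le> N"
 shows "reduced_op q t j (complete_sym b * f) = complete_sym b * reduced_op q t j f +
  scale_sym (1 - t) ((\<Sum>i\<le>N. if j \<le> b + i then scale_sym (q ^ (b + i - j)) (complete_sym (b + i - j) * translate (%i. 1 - t ^ i) i f) else 0)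
   - (\<Sum>a\<le>N. complete_sym (b + a) * reduced_op q t (j + a) f))"
proof -
 define \<tau> where "\<tau> = translate (%i. 1 - t ^ i)"
 define G where "G = sym_exp (%i. q ^ i - 1)"
 define h where "h = (complete_sym :: nat => 'a symfun)"
 define \<eta> where "\<eta> a = (if a = 0 then 1 else 1 - t)" for a :: nat
 define N' where "N' = Max {N + b, degree (translation (%i. 1 - t ^ i) (h b * f))}"
 have \<tau>0: "\<tau> i f = 0" if "i > N" for i using that N by (simp add: \<tau>_def translate_eq_0)
 have op: "reduced_op q t j f = (\<Sum>i\<le>N. if j \<le> i then G (i - j) * \<tau> i f else 0)" for j
  unfolding reduced_op_def G_def \<tau>_def by (rule vertex_op_eq[OF N])
 have \<tau>h: "\<tau> a (h b) = (if a \<le> b then scale_sym (\<eta> a) (h (b - a)) else 0)" for a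
  by (simp add: \<tau>_def h_def \<eta>_def complete_sym_eq_exp translate_sym_exp scalar_exp_one_minus)
 have "reduced_op q t j (h b * f) = (\<Sum>k\<le>N'. (if j \<le> k then G (k - j) else 0) * \<tau> k (h b * f))"
  unfolding reduced_op_def G_def \<tau>_def
  by (subst vertex_op_eq[where N = N']) (auto simp: N'_def intro!: sum.cong)
 also have "\<dots> = (\<Sum>i\<le>N. \<Sum>a\<le>b. (if j \<le> i + a then G (i + a - j) else 0) * (\<tau> a (h b) * \<tau> i f))"
  unfolding \<tau>_def by (rule sum_translate_mult) (use \<tau>0 \<tau>h in \<open>auto simp: \<tau>_def N'_def\<close>)
 also have "\<dots> = (\<Sum>i\<le>N. \<Sum>a\<le>b. if j \<le> i + a then scale_sym (\<eta> a) (G (i + a - j) * h (b - a) * \<tau> i f) else 0)"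
  by (auto simp: \<tau>h scale_sym_times mult.assoc intro!: sum.cong)
 also have "\<dots> = (\<Sum>i\<le>N. (if j \<le> i then h b * (G (i - j) * \<tau> i f) else 0) + scale_sym (1 - t)
   ((if j \<le> b + i then scale_sym (q ^ (b + i - j)) (h (b + i - j) * \<tau> i f) else 0) -
    (\<Sum>a\<le>N. h (b + a) * (if j + a \<le> i then G (i - (j + a)) * \<tau> i f else 0))))"
 proof (rule sum.cong[OF refl])
  fix i assume i: "i \<in> {..N}"
  \<comment> \<open>Both sums are parts of the convolution of \<open>G\<close> and \<open>h\<close>
    in degree n = b + i - j, cut at index i - j of \<open>G\<close>. The whole convolution is q^n
    h_n because (q^r - 1) + 1 = q^r.\<close>
  have A: "(\<Sum>a\<in>{1..b}. if j \<le> i + a then G (i + a - j) * h (b - a) else 0) +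
   (\<Sum>a\<le>N. if j + a \<le> i then G (i - (j + a)) * h (b + a) else 0) =
   (if j \<le> b + i then scale_sym (q ^ (b + i - j)) (h (b + i - j)) else 0)"
  proof (cases "j \<le> b + i")
   case True
   define n where "n = b + i - j"
   have 1: "(\<Sum>a\<in>{1..b}. if j \<le> i + a then G (i + a - j) * h (b - a) else 0) = (\<Sum>m | m \<le> n \<and> i < m + j. G m * h (n - m))"
   proof -
    have "(\<Sum>a\<in>{1..b}. if j \<le> i + a then G (i + a - j) * h (b - a) else 0) =
     (\<Sum>a | a \<in> {1..b} \<and> j \<le> i + a. G (i + a - j) * h (b - a))"
     by (rule sum.mono_neutral_cong_right) auto
    also have "\<dots> = (\<Sum>m | m \<le> n \<and> i < m + j. G m * h (n - m))"
     by (rule sum.reindex_bij_witness[of _ "%m. m + j - i" "%a. i + a - j"])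
      (use True in \<open>auto simp: n_def intro!: arg_cong[where f = h] arg_cong2[where f = "(*)"]\<close>)
    finally show ?thesis .
   qed
   have 2: "(\<Sum>a\<le>N. if j + a \<le> i then G (i - (j + a)) * h (b + a) else 0) = (\<Sum>m | m \<le> n \<and> m + j \<le> i. G m * h (n - m))"
   proof -
    have "(\<Sum>a\<le>N. if j + a \<le> i then G (i - (j + a)) * h (b + a) else 0) =
     (\<Sum>a | a \<le> N \<and> j + a \<le> i. G (i - (j + a)) * h (b + a))"
     by (rule sum.mono_neutral_cong_right) auto
    also have "\<dots> = (\<Sum>m | m \<le> n \<and> m + j \<le> i. G m * h (n - m))"
     by (rule sum.reindex_bij_witness[of _ "%m. i - j - m" "%a. i - (j + a)"])
      (use True i in \<open>auto simp: n_def intro!: arg_cong[where f = h] arg_cong2[where f = "(*)"]\<close>)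
    finally show ?thesis .
   qed
   have "(\<Sum>m | m \<le> n \<and> i < m + j. G m * h (n - m)) + (\<Sum>m | m \<le> n \<and> m + j \<le> i. G m * h (n - m)) =
    (\<Sum>m\<le>n. G m * h (n - m))" by (subst sum.union_disjoint[symmetric]) (auto intro!: sum.cong)
   also have "\<dots> = sym_exp (%i. q ^ i * 1) n"
    unfolding G_def h_def complete_sym_eq_exp sym_exp_mult by simp
   also have "\<dots> = scale_sym (q ^ n) (h n)" unfolding sym_exp_scale h_def complete_sym_eq_exp ..
   finally show ?thesis unfolding 1 2 using True by (simp add: n_def)
  next
   case False
   then show ?thesis by (auto intro!: sum.neutral)
  qed
  have "(\<Sum>a\<le>b. if j \<le> i + a then scale_sym (\<eta> a) (G (i + a - j) * h (b - a) * \<tau> i f) else 0) =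
   (if j \<le> i then h b * (G (i - j) * \<tau> i f) else 0) +
   (\<Sum>a\<in>{1..b}. if j \<le> i + a then scale_sym (\<eta> a) (G (i + a - j) * h (b - a) * \<tau> i f) else 0)"
   unfolding sum_atMost_split by (simp add: \<eta>_def mult_ac)
  also have "(\<Sum>a\<in>{1..b}. if j \<le> i + a then scale_sym (\<eta> a) (G (i + a - j) * h (b - a) * \<tau> i f) else 0) =
   scale_sym (1 - t) ((\<Sum>a\<in>{1..b}. if j \<le> i + a then G (i + a - j) * h (b - a) else 0) * \<tau> i f)"
   unfolding sum_distrib_right scale_sym_sum by (intro sum.cong refl) (auto simp: \<eta>_def)
  also have "(\<Sum>a\<in>{1..b}. if j \<le> i + a then G (i + a - j) * h (b - a) else 0) =
   (if j \<le> b + i then scale_sym (q ^ (b + i - j)) (h (b + i - j)) else 0) -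
   (\<Sum>a\<le>N. if j + a \<le> i then G (i - (j + a)) * h (b + a) else 0)"
   using A by (simp add: algebra_simps)
  also have "\<dots> * \<tau> i f = (if j \<le> b + i then scale_sym (q ^ (b + i - j)) (h (b + i - j) * \<tau> i f) else 0) -
   (\<Sum>a\<le>N. h (b + a) * (if j + a \<le> i then G (i - (j + a)) * \<tau> i f else 0))"
  proof -
   have "(\<Sum>a\<le>N. if j + a \<le> i then G (i - (j + a)) * h (b + a) else 0) * \<tau> i f =
    (\<Sum>a\<le>N. h (b + a) * (if j + a \<le> i then G (i - (j + a)) * \<tau> i f else 0))"
    unfolding sum_distrib_right by (intro sum.cong refl) (simp add: mult_ac)
   then show ?thesis by (auto simp: left_diff_distrib scale_sym_times)
  qed
  finally show "(\<Sum>a\<le>b. if j \<le> i + a then scale_sym (\<eta> a) (G (i + a - j) * h (b - a) * \<tau> i f) else 0) =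
   (if j \<le> i then h b * (G (i - j) * \<tau> i f) else 0) + scale_sym (1 - t)
   ((if j \<le> b + i then scale_sym (q ^ (b + i - j)) (h (b + i - j) * \<tau> i f) else 0) -
    (\<Sum>a\<le>N. h (b + a) * (if j + a \<le> i then G (i - (j + a)) * \<tau> i f else 0)))" .
 qed
 also have "\<dots> = h b * reduced_op q t j f + scale_sym (1 - t)
  ((\<Sum>i\<le>N. if j \<le> b + i then scale_sym (q ^ (b + i - j)) (h (b + i - j) * \<tau> i f) else 0) -
   (\<Sum>i\<le>N. \<Sum>a\<le>N. h (b + a) * (if j + a \<le> i then G (i - (j + a)) * \<tau> i f else 0)))"
 proof -
  have "h b * reduced_op q t j f = (\<Sum>i\<le>N. if j \<le> i then h b * (G (i - j) * \<tau> i f) else 0)"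
   unfolding op sum_distrib_left by (intro sum.cong refl) simp
  then show ?thesis by (simp only: sum.distrib scale_sym_sum[symmetric] sum_subtractf)
 qed
 also have "(\<Sum>i\<le>N. \<Sum>a\<le>N. h (b + a) * (if j + a \<le> i then G (i - (j + a)) * \<tau> i f else 0)) =
  (\<Sum>a\<le>N. h (b + a) * reduced_op q t (j + a) f)" unfolding op sum_distrib_left by (rule sum.swap)
 finally show ?thesis by (simp only: h_def \<tau>_def)
qed

text \<open>Dominance up to a loss of \<open>j\<close> boxes.\<close>

definition lossy_span :: "nat list => nat => 'a :: field symfun set" where
 "lossy_span \<nu> j = symfun.span (complete_list ` {xs. sum_list xs + j = sum_list \<nu> \<and>
   (\<forall>k. sum_list (take k \<nu>) \<le> sum_list (take k xs) + j)})"

definition strict_complete_span :: "nat list => 'a :: field symfun set" where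
 "strict_complete_span \<nu> = symfun.span (complete_list ` {xs. sum_list xs = sum_list \<nu> \<and>
   (\<forall>k. sum_list (take k \<nu>) \<le> sum_list (take k xs)) \<and> (\<exists>k. sum_list (take k \<nu>) < sum_list (take k xs))})"

lemma span_times_mono:
 assumes "f \<in> symfun.span S" "\<And>x. x \<in> S ==> g * x \<in> symfun.span T"
 shows "g * f \<in> symfun.span T" using assms(1)
proof (induction rule: symfun.span_induct_alt)
 case (step c x y)
 have "g * (scale_sym c x + y) = scale_sym c (g * x) + g * y" by (simp add: distrib_left scale_sym_times)
 then show ?case using step assms(2) by (metis symfun.span_add symfun.span_scale)
qed (simp add: symfun.span_zero)

text \<open>Putting \<open>c\<close> in place of \<open>b\<close> as first part changes the loss
  from \<open>j'\<close> to \<open>j' + b - c\<close>.\<close>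

lemma lossy_span_Cons:
 assumes "f \<in> lossy_span \<nu> j'" "c + j = b + j'"
 shows "complete_sym c * f \<in> lossy_span (b # \<nu>) j" using assms(1) unfolding lossy_span_def
proof (rule span_times_mono)
 fix x :: "'a symfun"
 assume "x \<in> complete_list ` {xs. sum_list xs + j' = sum_list \<nu> \<and> (\<forall>k. sum_list (take k \<nu>) \<le> sum_list (take k xs) + j')}"
 then obtain xs where xs: "x = complete_list xs" "sum_list xs + j' = sum_list \<nu>"
  "\<And>k. sum_list (take k \<nu>) \<le> sum_list (take k xs) + j'" by auto
 have "sum_list (take k (b # \<nu>)) \<le> sum_list (take k (c # xs)) + j" for k
  using xs(3)[of "k - 1"] assms(2) by (cases k) auto
 then show "complete_sym c * x \<in> symfun.span (complete_list ` {xs. sum_list xs + j = sum_list (b # \<nu>) \<and>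
   (\<forall>k. sum_list (take k (b # \<nu>)) \<le> sum_list (take k xs) + j)})"
  using xs assms(2) by (intro symfun.span_base image_eqI[of _ _ "c # xs"]) auto
qed

text \<open>The surplus \<open>a\<close> in the first part repays the loss in the tail, and it makes
  the first partial sum strictly larger.\<close>

lemma strict_complete_span_Cons:
 assumes "f \<in> lossy_span \<nu> a" "a \<ge> 1"
 shows "complete_sym (b + a) * f \<in> strict_complete_span (b # \<nu>)"
 using assms(1) unfolding lossy_span_def strict_complete_span_def
proof (rule span_times_mono)
 fix x :: "'a symfun"
 assume "x \<in> complete_list ` {xs. sum_list xs + a = sum_list \<nu> \<and> (\<forall>k. sum_list (take k \<nu>) \<le> sum_list (take k xs) + a)}"
 then obtain xs where xs: "x = complete_list xs" "sum_list xs + a = sum_list \<nu>"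
  "\<And>k. sum_list (take k \<nu>) \<le> sum_list (take k xs) + a" by auto
 have "sum_list (take k (b # \<nu>)) \<le> sum_list (take k ((b + a) # xs))" for k
  using xs(3)[of "k - 1"] by (cases k) auto
 moreover have "sum_list (take 1 (b # \<nu>)) < sum_list (take 1 ((b + a) # xs))" using assms(2) by simp
 then have "\<exists>k. sum_list (take k (b # \<nu>)) < sum_list (take k ((b + a) # xs))" by blast
 ultimately show "complete_sym (b + a) * x \<in> symfun.span (complete_list ` {xs. sum_list xs = sum_list (b # \<nu>) \<and>
   (\<forall>k. sum_list (take k (b # \<nu>)) \<le> sum_list (take k xs)) \<and> (\<exists>k. sum_list (take k (b # \<nu>)) < sum_list (take k xs))})"
  using xs by (intro symfun.span_base image_eqI[of _ _ "(b + a) # xs"]) auto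
qed

lemma strict_complete_span_Cons':
 assumes "f \<in> strict_complete_span \<nu>"
 shows "complete_sym b * f \<in> strict_complete_span (b # \<nu>)"
 using assms(1) unfolding strict_complete_span_def
proof (rule span_times_mono)
 fix x :: "'a symfun"
 assume "x \<in> complete_list ` {xs. sum_list xs = sum_list \<nu> \<and> (\<forall>k. sum_list (take k \<nu>) \<le> sum_list (take k xs)) \<and>
  (\<exists>k. sum_list (take k \<nu>) < sum_list (take k xs))}"
 then obtain xs k where xs: "x = complete_list xs" "sum_list xs = sum_list \<nu>"
  "\<And>k. sum_list (take k \<nu>) \<le> sum_list (take k xs)" "sum_list (take k \<nu>) < sum_list (take k xs)" by auto
 have "sum_list (take k (b # \<nu>)) \<le> sum_list (take k (b # xs))" for k
  using xs(3)[of "k - 1"] by (cases k) auto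
 moreover have "sum_list (take (Suc k) (b # \<nu>)) < sum_list (take (Suc k) (b # xs))" using xs(4) by simp
 then have "\<exists>k. sum_list (take k (b # \<nu>)) < sum_list (take k (b # xs))" by blast
 ultimately show "complete_sym b * x \<in> symfun.span (complete_list ` {xs. sum_list xs = sum_list (b # \<nu>) \<and>
   (\<forall>k. sum_list (take k (b # \<nu>)) \<le> sum_list (take k xs)) \<and> (\<exists>k. sum_list (take k (b # \<nu>)) < sum_list (take k xs))})"
  using xs(1,2) by (intro symfun.span_base image_eqI[of _ _ "b # xs"]) auto
qed

lemma lossy_span_closed:
 "f \<in> lossy_span \<nu> j ==> g \<in> lossy_span \<nu> j ==> f + g \<in> lossy_span \<nu> j"
 "f \<in> lossy_span \<nu> j ==> g \<in> lossy_span \<nu> j ==> f - g \<in> lossy_span \<nu> j"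
 "f \<in> lossy_span \<nu> j ==> scale_sym c f \<in> lossy_span \<nu> j" "0 \<in> lossy_span \<nu> j"
 "(\<And>x. x \<in> A ==> F x \<in> lossy_span \<nu> j) ==> sum F A \<in> lossy_span \<nu> j"
 unfolding lossy_span_def
 by (auto intro: symfun.span_add symfun.span_diff symfun.span_scale symfun.span_zero symfun.span_sum)

lemma strict_complete_span_closed:
 "f \<in> strict_complete_span \<nu> ==> g \<in> strict_complete_span \<nu> ==> f + g \<in> strict_complete_span \<nu>"
 "f \<in> strict_complete_span \<nu> ==> g \<in> strict_complete_span \<nu> ==> f - g \<in> strict_complete_span \<nu>"
 "f \<in> strict_complete_span \<nu> ==> scale_sym c f \<in> strict_complete_span \<nu>" "0 \<in> strict_complete_span \<nu>"
 "(\<And>x. x \<in> A ==> F x \<in> strict_complete_span \<nu>) ==> sum F A \<in> strict_complete_span \<nu>"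
 unfolding strict_complete_span_def
 by (auto intro: symfun.span_add symfun.span_diff symfun.span_scale symfun.span_zero symfun.span_sum)

lemma translate_in_lossy_span: "translate (%i. 1 - t ^ i) j (complete_list \<nu>) \<in> lossy_span \<nu> j"
proof (induction \<nu> arbitrary: j)
 case Nil
 then show ?case
  by (auto simp: translate_one lossy_span_closed lossy_span_def intro!: symfun.span_base image_eqI[of _ _ "[]"])
next
 case (Cons b \<nu>)
 show ?case unfolding list.map prod_list.Cons translate_complete_times
  by (intro lossy_span_closed(5)) (auto intro!: lossy_span_closed(3,4) lossy_span_Cons[OF Cons])
qed

lemma reduced_op_in_lossy_span: "reduced_op q t j (complete_list \<nu>) \<in> lossy_span \<nu> j"
proof (induction \<nu> arbitrary: j)
 case Nil
 then show ?case
  by (auto simp: reduced_op_def vertex_op_one lossy_span_closed lossy_span_def intro!: symfun.span_base image_eqI[of _ _ "[]"])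
next
 case (Cons b \<nu>)
 show ?case unfolding list.map prod_list.Cons reduced_op_complete_times[OF order.refl]
  by (intro lossy_span_closed(1-3) lossy_span_closed(5) lossy_span_Cons[OF Cons])
   (auto intro!: lossy_span_closed(3,4) lossy_span_Cons[OF translate_in_lossy_span] lossy_span_Cons[OF Cons])
qed

text \<open>The recursion is what the operator produces row by row;
  \<open>op_eigenvalue_box_sum\<close> relates it to the sum of the box weights.\<close>

fun op_eigenvalue :: "'a :: comm_ring_1 => 'a => nat list => 'a" where
 "op_eigenvalue q t [] = 1"
| "op_eigenvalue q t (b # \<nu>) = t * op_eigenvalue q t \<nu> + (1 - t) * q ^ b"

text \<open>In the formula for the operator O on h_b f, the terms with shift 0 give t h_b O(f) and
  (1 - t) q^b h_b f, hence the recursion of the eigenvalue; all other terms enlarge the first part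
  and are strictly higher.\<close>

lemma reduced_op_triangular:
 "reduced_op q t 0 (complete_list \<nu>) - scale_sym (op_eigenvalue q t \<nu>) (complete_list \<nu>) \<in> strict_complete_span \<nu>"
proof (induction \<nu>)
 case Nil
 then show ?case by (simp add: reduced_op_def vertex_op_one strict_complete_span_closed)
next
 case (Cons b \<nu>)
 define f where "f = (complete_list \<nu> :: 'a symfun)"
 define N where "N = degree (translation (%i. 1 - t ^ i) f)"
 define A where "A = (\<Sum>i\<in>{1..N}. scale_sym (q ^ (b + i)) (complete_sym (b + i) * translate (%i. 1 - t ^ i) i f))"
 define B where "B = (\<Sum>a\<in>{1..N}. complete_sym (b + a) * reduced_op q t a f)"
 have "reduced_op q t 0 (complete_list (b # \<nu>)) = complete_sym b * reduced_op q t 0 f +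
  scale_sym (1 - t) ((\<Sum>i\<le>N. scale_sym (q ^ (b + i)) (complete_sym (b + i) * translate (%i. 1 - t ^ i) i f))
   - (\<Sum>a\<le>N. complete_sym (b + a) * reduced_op q t a f))"
  using reduced_op_complete_times[of t f N q 0 b] by (simp add: N_def f_def)
 also have "(\<Sum>i\<le>N. scale_sym (q ^ (b + i)) (complete_sym (b + i) * translate (%i. 1 - t ^ i) i f)) =
  scale_sym (q ^ b) (complete_sym b * f) + A" unfolding sum_atMost_split by (simp add: A_def translate_zero)
 also have "(\<Sum>a\<le>N. complete_sym (b + a) * reduced_op q t a f) = complete_sym b * reduced_op q t 0 f + B"
  unfolding sum_atMost_split by (simp add: B_def)
 finally have "reduced_op q t 0 (complete_list (b # \<nu>)) - scale_sym (op_eigenvalue q t (b # \<nu>)) (complete_list (b # \<nu>)) =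
  scale_sym t (complete_sym b * (reduced_op q t 0 f - scale_sym (op_eigenvalue q t \<nu>) f)) + scale_sym (1 - t) (A - B)"
  by (simp add: f_def[symmetric] algebra_simps symfun.scale_left_distrib symfun.scale_right_distrib
    symfun.scale_left_diff_distrib symfun.scale_right_diff_distrib scale_sym_times)
 also have "\<dots> \<in> strict_complete_span (b # \<nu>)" unfolding A_def B_def f_def
  by (intro strict_complete_span_closed strict_complete_span_Cons' Cons strict_complete_span_Cons
    translate_in_lossy_span reduced_op_in_lossy_span) auto
 finally show ?case .
qed

lemma reduced_op_schur:
 assumes "\<mu> \<in> partitions n"
 shows "reduced_op q t 0 (schur \<mu>) - scale_sym (op_eigenvalue q t \<mu>) (schur \<mu>) \<in> strict_span \<mu>"
proof (rule triangular_on_schur[OF _ _ assms])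
 show "sym_linear (reduced_op q t 0)"
  unfolding reduced_op_def by (rule linear_vertex_op)
 fix \<mu> assume \<mu>: "\<mu> \<in> partitions n"
 have "strict_complete_span \<mu> \<subseteq> strict_span \<mu>" unfolding strict_complete_span_def
 proof (rule symfun.span_minimal)
  show "symfun.subspace (strict_span \<mu>)" by (simp add: strict_span_def)
 qed (use complete_list_in_strict_span[OF \<mu>] sum_list_partition[OF \<mu>] in \<open>auto simp: dominates_def\<close>)
 then show "reduced_op q t 0 (complete_list \<mu>) - scale_sym (op_eigenvalue q t \<mu>) (complete_list \<mu>) \<in> strict_span \<mu>"
  using reduced_op_triangular by blast
qed

section \<open>The operators \<open>D\<^sub>0\<close>, \<open>D\<^sub>-\<^sub>1\<close> and their duals\<close>

text \<open>The series (1 - b z) / (1 - a z).\<close>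

lemma scalar_exp_diff: "scalar_exp (%i. a ^ i - b ^ i) n = (if n = 0 then 1 else a ^ (n - 1) * (a - b))"
proof -
 have "is_exp (%i. a ^ i + - (b ^ i)) (%n. \<Sum>i\<le>n. a ^ i * (if n - i = 0 then 1 else if n - i = 1 then - b else 0))"
  by (rule is_exp_mult[OF is_exp_geometric is_exp_neg_geometric])
 moreover have "(\<Sum>i\<le>n. a ^ i * (if n - i = 0 then 1 else if n - i = 1 then - b else 0)) =
  (if n = 0 then 1 else a ^ (n - 1) * (a - b))" for n
 proof (cases n)
  case (Suc m)
  have "(\<Sum>i\<le>n. a ^ i * (if n - i = 0 then 1 else if n - i = 1 then - b else 0)) =
    (\<Sum>i\<in>{m, n}. a ^ i * (if n - i = 0 then 1 else if n - i = 1 then - b else 0))"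
   by (rule sum.mono_neutral_right) (auto simp: Suc)
  then show ?thesis by (simp add: Suc algebra_simps)
 qed simp
 ultimately have "is_exp (%i. a ^ i - b ^ i) (%n. if n = 0 then 1 else a ^ (n - 1) * (a - b))" by simp
 then show ?thesis by (rule scalar_exp_unique) simp
qed

text \<open>The series (1 - q z) (1 - t z) / ((1 - z) (1 - q t z)), obtained as a product of two
  series of the previous kind with s = q t.\<close>

lemma scalar_exp_qt:
 fixes q t :: "'a :: field_char_0"
 assumes "q * t \<noteq> 1"
 shows "scalar_exp (%i. (1 - q ^ i) * (1 - t ^ i)) n =
  (if n = 0 then 1 else (1 - q) * (1 - t) / (1 - q * t) * (1 - (q * t) ^ n))"
proof -
 define s where "s = q * t"
 have s: "1 - s \<noteq> 0" using assms by (simp add: s_def)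
 have "is_exp (%i. (1 ^ i - q ^ i) + (s ^ i - t ^ i))
   (%n. \<Sum>i\<le>n. scalar_exp (%i. 1 ^ i - q ^ i) i * scalar_exp (%i. s ^ i - t ^ i) (n - i))"
  by (rule is_exp_mult[OF scalar_exp scalar_exp])
 moreover have "(1 ^ i - q ^ i) + (s ^ i - t ^ i) = (1 - q ^ i) * (1 - t ^ i)" for i
  by (simp add: s_def power_mult_distrib algebra_simps)
 ultimately have "scalar_exp (%i. (1 - q ^ i) * (1 - t ^ i)) n =
  (\<Sum>i\<le>n. scalar_exp (%i. 1 ^ i - q ^ i) i * scalar_exp (%i. s ^ i - t ^ i) (n - i))"
  by (intro scalar_exp_unique) auto
 also have "\<dots> = (if n = 0 then 1 else (1 - q) * (1 - t) / (1 - s) * (1 - s ^ n))"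
 proof (cases n)
  case (Suc m)
  have "(\<Sum>i\<le>n. scalar_exp (%i. 1 ^ i - q ^ i) i * scalar_exp (%i. s ^ i - t ^ i) (n - i)) =
   s ^ m * (s - t) + ((\<Sum>i\<in>{1..m}. (1 - q) * s ^ (m - i) * (s - t)) + (1 - q))"
  proof -
   have *: "(\<Sum>i\<in>{1..Suc m}. F i) = (\<Sum>i\<in>{1..m}. F i) + F (Suc m)" for F :: "nat => 'a" by simp
   have "(\<Sum>i\<in>{1..m}. scalar_exp (%i. 1 ^ i - q ^ i) i * scalar_exp (%i. s ^ i - t ^ i) (Suc m - i)) =
    (\<Sum>i\<in>{1..m}. (1 - q) * s ^ (m - i) * (s - t))"
    unfolding scalar_exp_diff by (intro sum.cong refl) (auto simp: Suc_diff_le)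
   note mid = this
   show ?thesis unfolding Suc sum_atMost_split * unfolding mid unfolding scalar_exp_diff by simp
  qed
  also have "(\<Sum>i\<in>{1..m}. (1 - q) * s ^ (m - i) * (s - t)) = (\<Sum>i<m. (1 - q) * s ^ i * (s - t))"
   by (rule sum.reindex_bij_witness[of _ "%i. m - i" "%i. m - i"]) auto
  also have "\<dots> = (1 - q) * (s - t) * (\<Sum>i<m. s ^ i)" by (simp add: sum_distrib_left mult_ac)
  also have "(\<Sum>i<m. s ^ i) = (1 - s ^ m) / (1 - s)" using s by (subst geometric_sum) (auto simp: field_simps)
  finally show ?thesis using s by (simp add: Suc field_simps) (simp add: s_def algebra_simps)
 qed simp
 finally show ?thesis by (simp only: s_def)
qed

text \<open>The derivative with respect to p_1, as the linear term of the substitution p_1 -> p_1 +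
  v; in this form it commutes with all translations.\<close>

definition pd :: "'a :: field_char_0 symfun => 'a symfun" where
 "pd = translate (%r. if r = 1 then 1 else 0) 1"

lemma pd_add: "pd (f + g) = pd f + pd g" and pd_scale: "pd (scale_sym c f) = scale_sym c (pd f)"
 and pd_one [simp]: "pd 1 = 0" and pd_0 [simp]: "pd 0 = 0" and pd_sum: "pd (sum h A) = (\<Sum>x\<in>A. pd (h x))"
 by (simp_all add: pd_def translate_add translate_scale translate_one translate_sum)

lemma pd_mult: "pd (f * g) = pd f * g + f * pd g"
 by (simp add: pd_def translate_mult translate_zero add.commute)

lemma pd_power_sum_times: "r \<ge> 1 ==> pd (power_sum_sym r * f) = power_sum_sym r * pd f + (if r = 1 then f else 0)"
 by (auto simp: pd_def translate_power_sum_times translate_zero)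

lemma translate_1: "translate a 1 f = scale_sym (a 1) (pd f)"
proof (induction f rule: sym_induct)
 case (power_sum r f)
 then show ?case by (auto simp: translate_power_sum_times pd_power_sum_times translate_zero symfun.scale_right_distrib scale_sym_times)
qed (simp_all add: translate_one translate_add translate_scale pd_add pd_scale symfun.scale_right_distrib mult.commute)

lemma pd_translate: "pd (translate a i f) = translate a i (pd f)" unfolding pd_def by (rule translate_commute)

lemma pd_sym_exp: "pd (sym_exp c n) = (if n \<ge> 1 then scale_sym (c 1) (sym_exp c (n - 1)) else 0)"
 by (simp add: pd_def translate_sym_exp)

lemma pd_vertex_op:
 "pd (vertex_op (sym_exp c) a j f) = scale_sym (c 1) (vertex_op (sym_exp c) a (Suc j) f) + vertex_op (sym_exp c) a j (pd f)"
proof -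
 define N where "N = max (degree (translation a f)) (degree (translation a (pd f)))"
 have "pd (vertex_op (sym_exp c) a j f) = (\<Sum>i\<le>N. pd (if j \<le> i then sym_exp c (i - j) * translate a i f else 0))"
  by (subst vertex_op_eq[where N = N]) (auto simp: N_def pd_sum)
 also have "\<dots> = (\<Sum>i\<le>N. scale_sym (c 1) (if Suc j \<le> i then sym_exp c (i - Suc j) * translate a i f else 0) +
   (if j \<le> i then sym_exp c (i - j) * translate a i (pd f) else 0))"
  by (intro sum.cong refl) (auto simp: pd_mult pd_sym_exp pd_translate scale_sym_times Suc_le_eq)
 also have "\<dots> = scale_sym (c 1) (vertex_op (sym_exp c) a (Suc j) f) + vertex_op (sym_exp c) a j (pd f)"
  by (subst (1 2) vertex_op_eq[where N = N]) (auto simp: N_def sum.distrib scale_sym_sum)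
 finally show ?thesis .
qed

text \<open>Normal ordering: moving the translation of the outer operator past the generating
  function of the inner one leaves a scalar series in the ratio of the two variables, indexed by
  \<open>l\<close>.\<close>

lemma vertex_op_comp:
 assumes "degree (translation a f) \<le> N" "degree (translation b f) \<le> N"
 shows "vertex_op (sym_exp c) a j (vertex_op (sym_exp d) b k f) = (\<Sum>i\<le>N. \<Sum>m\<le>N.
  (\<Sum>l\<le>N. if l + k \<le> m \<and> j \<le> i + l then scale_sym (scalar_exp (%i. d i * a i) l)
   (sym_exp c (i + l - j) * sym_exp d (m - k - l)) else 0) * translate a i (translate b m f))"
proof -
 define C where "C n = (if j \<le> n then sym_exp c (n - j) else 0)" for n
 define N' where "N' = max (N + N) (degree (translation a (vertex_op (sym_exp d) b k f)))"
 have "vertex_op (sym_exp d) b k f = (\<Sum>m\<le>N. if k \<le> m then sym_exp d (m - k) * translate b m f else 0)"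
  by (rule vertex_op_eq[OF assms(2)])
 then have tr: "translate a n (vertex_op (sym_exp d) b k f) =
   (\<Sum>m\<le>N. if k \<le> m then translate a n (sym_exp d (m - k) * translate b m f) else 0)" for n
  by (auto simp: translate_sum intro!: sum.cong)
 have "vertex_op (sym_exp c) a j (vertex_op (sym_exp d) b k f) = (\<Sum>n\<le>N'. C n * translate a n (vertex_op (sym_exp d) b k f))"
  by (subst vertex_op_eq[where N = N']) (auto simp: N'_def C_def intro!: sum.cong)
 also have "\<dots> = (\<Sum>m\<le>N. if k \<le> m then \<Sum>n\<le>N'. C n * translate a n (sym_exp d (m - k) * translate b m f) else 0)"
  unfolding tr sum_distrib_left by (subst sum.swap) (auto intro!: sum.cong)
 also have "\<dots> = (\<Sum>m\<le>N. \<Sum>i\<le>N. \<Sum>l\<le>N. if k \<le> m then C (i + l) *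
   (translate a l (sym_exp d (m - k)) * translate a i (translate b m f)) else 0)"
 proof (rule sum.cong[OF refl])
  fix m assume "m \<in> {..N}"
  have "translate a i (translate b m f) = 0" if "i > N" for i
   using that assms(1) unfolding translate_commute[of a] by (simp add: translate_eq_0)
  moreover have "translate a l (sym_exp d (m - k)) = 0" if "l > N" for l
   using that \<open>m \<in> {..N}\<close> by (simp add: translate_sym_exp)
  ultimately have "(\<Sum>n\<le>N'. C n * translate a n (sym_exp d (m - k) * translate b m f)) =
    (\<Sum>i\<le>N. \<Sum>l\<le>N. C (i + l) * (translate a l (sym_exp d (m - k)) * translate a i (translate b m f)))"
   by (rule sum_translate_mult[where N' = N']) (simp_all add: N'_def)
  then show "(if k \<le> m then \<Sum>n\<le>N'. C n * translate a n (sym_exp d (m - k) * translate b m f) else 0) =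
    (\<Sum>i\<le>N. \<Sum>l\<le>N. if k \<le> m then C (i + l) * (translate a l (sym_exp d (m - k)) * translate a i (translate b m f)) else 0)"
   by simp
 qed
 also have "\<dots> = (\<Sum>i\<le>N. \<Sum>m\<le>N. \<Sum>l\<le>N. if k \<le> m then C (i + l) *
   (translate a l (sym_exp d (m - k)) * translate a i (translate b m f)) else 0)" by (rule sum.swap)
 finally show ?thesis unfolding sum_distrib_right
  by (auto simp: C_def translate_sym_exp scale_sym_times le_diff_conv2 mult.assoc intro!: sum.cong)
qed

context
 fixes q t :: "'a :: field_char_0"
begin

definition M_alphabet :: "nat => 'a" where
 "M_alphabet r = (1 - q ^ r) * (1 - t ^ r)"

definition dual_M_alphabet :: "nat => 'a" where
 "dual_M_alphabet r = - ((1 - inverse q ^ r) * (1 - inverse t ^ r))"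

text \<open>With index \<open>j\<close> this is the operator usually called D_(-j).\<close>

definition D_op :: "nat => 'a symfun => 'a symfun" where
 "D_op = vertex_op (sym_exp (%_. - 1)) M_alphabet"

definition dual_D_op :: "nat => 'a symfun => 'a symfun" where
 "dual_D_op = vertex_op (sym_exp (%_. 1)) dual_M_alphabet"

lemma pd_D_op: "pd (D_op j f) = D_op j (pd f) - D_op (Suc j) f" unfolding D_op_def pd_vertex_op by simp

lemma pd_dual_D_op: "pd (dual_D_op j f) = dual_D_op j (pd f) + dual_D_op (Suc j) f"
 unfolding dual_D_op_def pd_vertex_op by simp

text \<open>After normal ordering the two products differ by the residues of one rational function
  at two poles. At one pole the series of the e_n and h_n cancel, and the terms of degree 1 give
  \<partial>/\<partial>p_1; at the other one the two translations cancel each other.\<close>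

lemma D_dual_D_commutator:
 assumes qt: "q \<noteq> 0" "t \<noteq> 0" "q * t \<noteq> 1"
 shows "D_op 0 (dual_D_op 1 f) - dual_D_op 1 (D_op 0 f) =
  scale_sym (- (((1 - q) * (1 - t))\<^sup>2 / (q * t))) (pd f)"
proof -
 define s where "s = q * t"
 define c where "c = (1 - q) * (1 - t) / (1 - s)"
 define E where "E = sym_exp (%_. - 1 :: 'a)"
 define H where "H = sym_exp (%_. 1 :: 'a)"
 define \<tau> where "\<tau> = translate M_alphabet"
 define \<sigma> where "\<sigma> = translate dual_M_alphabet"
 define \<eta> where "\<eta> = scalar_exp M_alphabet"
 define \<zeta> where "\<zeta> = scalar_exp (%i. - dual_M_alphabet i)"
 \<comment> \<open>The successor puts the index pairs (0, 1) and (1, 0), which survive at the end,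
   inside the summation range.\<close>
 define N where "N = Suc (max (degree (translation M_alphabet f)) (degree (translation dual_M_alphabet f)))"
 have s: "s \<noteq> 0" "1 - s \<noteq> 0" using qt by (auto simp: s_def)
 have comm: "\<sigma> j (\<tau> i f) = \<tau> i (\<sigma> j f)" for i j unfolding \<sigma>_def \<tau>_def by (rule translate_commute)
 have \<tau>0: "\<tau> i f = 0" and \<sigma>0: "\<sigma> i f = 0" if "i > N" for i using that by (simp_all add: \<tau>_def \<sigma>_def N_def translate_eq_0)
 have \<tau>\<sigma>0: "\<tau> i (\<sigma> j f) = 0" if "i > N \<or> j > N" for i j
  using that \<tau>0[of i] \<sigma>0[of j] comm[of j i] by (auto simp: \<tau>_def \<sigma>_def)
 have \<eta>: "\<eta> k = (if k = 0 then 1 else c * (1 - s ^ k))" for k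
  unfolding \<eta>_def M_alphabet_def c_def s_def by (rule scalar_exp_qt[OF qt(3)])
 have \<zeta>: "\<zeta> k = (if k = 0 then 1 else - c * (1 - inverse s ^ k))" for k
 proof -
  have "inverse q * inverse t \<noteq> 1" using qt by (simp add: field_simps)
  from scalar_exp_qt[OF this, of k] have "\<zeta> k = (if k = 0 then 1 else
   (1 - inverse q) * (1 - inverse t) / (1 - inverse s) * (1 - inverse s ^ k))"
   by (simp add: \<zeta>_def dual_M_alphabet_def s_def)
  moreover have "(1 - inverse q) * (1 - inverse t) / (1 - inverse s) = - c"
  proof -
   have "1 - inverse s = - ((1 - s) / s)" using s by (simp add: field_simps)
   moreover have "(1 - inverse q) * (1 - inverse t) = (1 - q) * (1 - t) / s" using qt by (simp add: s_def field_simps)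
   ultimately show ?thesis using s by (simp add: c_def)
  qed
  ultimately show ?thesis by simp
 qed
 have N: "degree (translation M_alphabet f) \<le> N" "degree (translation dual_M_alphabet f) \<le> N" by (simp_all add: N_def)
 have 1: "D_op 0 (dual_D_op 1 f) = (\<Sum>i\<le>N. \<Sum>j\<le>N.
   (\<Sum>l\<le>N. if l + 1 \<le> j then scale_sym (\<eta> l) (E (i + l) * H (j - 1 - l)) else 0) * \<tau> i (\<sigma> j f))"
  unfolding D_op_def dual_D_op_def vertex_op_comp[OF N]
  by (simp add: E_def H_def \<tau>_def \<sigma>_def \<eta>_def cong: if_cong)
 have 2: "dual_D_op 1 (D_op 0 f) = (\<Sum>i\<le>N. \<Sum>j\<le>N.
   (\<Sum>l\<le>N. if l \<le> i \<and> 1 \<le> j + l then scale_sym (\<zeta> l) (H (j + l - 1) * E (i - l)) else 0) * \<tau> i (\<sigma> j f))"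
  unfolding D_op_def dual_D_op_def vertex_op_comp[OF N(2,1)] comm[symmetric]
  by (subst sum.swap) (simp add: E_def H_def \<tau>_def \<sigma>_def \<zeta>_def add.commute cong: if_cong)
 define W where "W n = (\<Sum>a\<le>n. scale_sym (s ^ a) (E a * H (n - a)))" for n
 have EH: "(\<Sum>a\<le>n. E a * H (n - a)) = (if n = 0 then 1 else 0)" for n
  unfolding E_def H_def sym_exp_mult by (simp add: sym_exp_zero)
 \<comment> \<open>For a > i and a < i the coefficients \<open>\<eta> (a - i)\<close> and
   \<open>- \<zeta> (i - a)\<close> are given by one function, c (1 - s^(a - i)), whose value 0 at a
   = i is also right. Its two terms are the two residues.\<close>
 have C: "(\<Sum>l\<le>N. if l + 1 \<le> j then scale_sym (\<eta> l) (E (i + l) * H (j - 1 - l)) else 0) -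
   (\<Sum>l\<le>N. if l \<le> i \<and> 1 \<le> j + l then scale_sym (\<zeta> l) (H (j + l - 1) * E (i - l)) else 0) =
   (if i + j = 1 then scale_sym c 1 else 0) - (if i + j \<ge> 1 then scale_sym (c * inverse s ^ i) (W (i + j - 1)) else 0)"
  if ij: "i \<le> N" "j \<le> N" for i j
 proof (cases "i + j \<ge> 1")
  case True
  define n where "n = i + j - 1"
  have A: "(\<Sum>l\<le>N. if l + 1 \<le> j then scale_sym (\<eta> l) (E (i + l) * H (j - 1 - l)) else 0) =
   (\<Sum>a\<le>n. if i \<le> a then scale_sym (\<eta> (a - i)) (E a * H (n - a)) else 0)"
  proof -
   have "(\<Sum>l\<le>N. if l + 1 \<le> j then scale_sym (\<eta> l) (E (i + l) * H (j - 1 - l)) else 0) =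
    (\<Sum>l | l + 1 \<le> j. scale_sym (\<eta> l) (E (i + l) * H (j - 1 - l)))"
    using ij by (intro sum.mono_neutral_cong_right) auto
   also have "\<dots> = (\<Sum>a | a \<le> n \<and> i \<le> a. scale_sym (\<eta> (a - i)) (E a * H (n - a)))"
    by (rule sum.reindex_bij_witness[of _ "%a. a - i" "%l. i + l"]) (use True in \<open>auto simp: n_def intro!: arg_cong2[where f = "(*)"] arg_cong[where f = H]\<close>)
   also have "\<dots> = (\<Sum>a\<le>n. if i \<le> a then scale_sym (\<eta> (a - i)) (E a * H (n - a)) else 0)"
    by (intro sum.mono_neutral_cong_left) auto
   finally show ?thesis .
  qed
  have B: "(\<Sum>l\<le>N. if l \<le> i \<and> 1 \<le> j + l then scale_sym (\<zeta> l) (H (j + l - 1) * E (i - l)) else 0) =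
   (\<Sum>a\<le>n. if a \<le> i then scale_sym (\<zeta> (i - a)) (E a * H (n - a)) else 0)"
  proof -
   have "(\<Sum>l\<le>N. if l \<le> i \<and> 1 \<le> j + l then scale_sym (\<zeta> l) (H (j + l - 1) * E (i - l)) else 0) =
    (\<Sum>l | l \<le> i \<and> 1 \<le> j + l. scale_sym (\<zeta> l) (H (j + l - 1) * E (i - l)))"
    using ij by (intro sum.mono_neutral_cong_right) auto
   also have "\<dots> = (\<Sum>a | a \<le> n \<and> a \<le> i. scale_sym (\<zeta> (i - a)) (E a * H (n - a)))"
    by (rule sum.reindex_bij_witness[of _ "%a. i - a" "%l. i - l"]) (use True in \<open>auto simp: n_def mult.commute intro!: arg_cong2[where f = "(*)"] arg_cong[where f = H]\<close>)
   also have "\<dots> = (\<Sum>a\<le>n. if a \<le> i then scale_sym (\<zeta> (i - a)) (E a * H (n - a)) else 0)"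
    by (intro sum.mono_neutral_cong_left) auto
   finally show ?thesis .
  qed
  have "(if i \<le> a then scale_sym (\<eta> (a - i)) (E a * H (n - a)) else 0) - (if a \<le> i then scale_sym (\<zeta> (i - a)) (E a * H (n - a)) else 0) =
   scale_sym c (E a * H (n - a)) - scale_sym (c * inverse s ^ i) (scale_sym (s ^ a) (E a * H (n - a)))" for a
  proof -
   have 1: "inverse s ^ i * s ^ a = s ^ (a - i)" if "i \<le> a"
    using that s by (simp add: power_diff field_simps power_inverse)
   have 2: "inverse s ^ i * s ^ a = inverse s ^ (i - a)" if "a \<le> i"
    using that s by (simp add: power_diff field_simps power_inverse)
   have "scale_sym c X - scale_sym (c * inverse s ^ i) (scale_sym (s ^ a) X) = scale_sym (c * (1 - inverse s ^ i * s ^ a)) X" for X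
    by (simp add: symfun.scale_left_diff_distrib right_diff_distrib mult.assoc)
   moreover have "(if i \<le> a then scale_sym (\<eta> (a - i)) X else 0) - (if a \<le> i then scale_sym (\<zeta> (i - a)) X else 0) =
    scale_sym (c * (1 - inverse s ^ i * s ^ a)) X" for X
   proof (cases a i rule: linorder_cases)
    case less
    then have "scale_sym (\<zeta> (i - a)) X = - scale_sym (c * (1 - inverse s ^ i * s ^ a)) X"
     using 2 by (simp add: \<zeta>)
    then show ?thesis using less by simp
   next
    case equal
    then show ?thesis using 1 by (simp add: \<eta> \<zeta>)
   next
    case greater
    then show ?thesis using 1 by (simp add: \<eta>)
   qed
   ultimately show ?thesis by simp
  qed
  then have "(\<Sum>a\<le>n. if i \<le> a then scale_sym (\<eta> (a - i)) (E a * H (n - a)) else 0) -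
   (\<Sum>a\<le>n. if a \<le> i then scale_sym (\<zeta> (i - a)) (E a * H (n - a)) else 0) =
   scale_sym c (\<Sum>a\<le>n. E a * H (n - a)) - scale_sym (c * inverse s ^ i) (W n)"
   unfolding W_def scale_sym_sum sum_subtractf[symmetric] by (intro sum.cong refl) simp
  then show ?thesis unfolding A B EH using True by (auto simp: n_def)
 next
  case False
  then show ?thesis by (auto intro!: sum.neutral)
 qed
 have "D_op 0 (dual_D_op 1 f) - dual_D_op 1 (D_op 0 f) = (\<Sum>i\<le>N. \<Sum>j\<le>N.
   ((if i + j = 1 then scale_sym c 1 else 0) - (if i + j \<ge> 1 then scale_sym (c * inverse s ^ i) (W (i + j - 1)) else 0)) * \<tau> i (\<sigma> j f))"
 proof -
  define A where "A i j = (\<Sum>l\<le>N. if l + 1 \<le> j then scale_sym (\<eta> l) (E (i + l) * H (j - 1 - l)) else 0)" for i j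
  define B where "B i j = (\<Sum>l\<le>N. if l \<le> i \<and> 1 \<le> j + l then scale_sym (\<zeta> l) (H (j + l - 1) * E (i - l)) else 0)" for i j
  have "D_op 0 (dual_D_op 1 f) - dual_D_op 1 (D_op 0 f) = (\<Sum>i\<le>N. \<Sum>j\<le>N. (A i j - B i j) * \<tau> i (\<sigma> j f))"
   unfolding 1[folded A_def] 2[folded B_def] by (simp only: sum_subtractf[symmetric] left_diff_distrib)
  also have "\<dots> = (\<Sum>i\<le>N. \<Sum>j\<le>N.
   ((if i + j = 1 then scale_sym c 1 else 0) - (if i + j \<ge> 1 then scale_sym (c * inverse s ^ i) (W (i + j - 1)) else 0)) * \<tau> i (\<sigma> j f))"
   by (intro sum.cong refl arg_cong2[where f = "(*)"]) (use C[folded A_def B_def] in simp)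
  finally show ?thesis .
 qed
 also have "\<dots> = (\<Sum>i\<le>N. \<Sum>j\<le>N. if i + j = 1 then scale_sym c (\<tau> i (\<sigma> j f)) else 0) -
   (\<Sum>i\<le>N. \<Sum>j\<le>N. if i + j \<ge> 1 then scale_sym c (W (i + j - 1) * scale_sym (inverse s ^ i) (\<tau> i (\<sigma> j f))) else 0)"
  unfolding sum_subtractf[symmetric] by (intro sum.cong refl) (auto simp: left_diff_distrib scale_sym_times)
 also have "(\<Sum>i\<le>N. \<Sum>j\<le>N. if i + j \<ge> 1 then scale_sym c (W (i + j - 1) * scale_sym (inverse s ^ i) (\<tau> i (\<sigma> j f))) else 0) = 0"
 proof -
  have "(\<Sum>i\<le>N. \<Sum>j\<le>N. if i + j \<ge> 1 then scale_sym c (W (i + j - 1) * scale_sym (inverse s ^ i) (\<tau> i (\<sigma> j f))) else 0) =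
   (\<Sum>(i, j)\<in>{..N} \<times> {..N}. if i + j \<ge> 1 then scale_sym c (W (i + j - 1) * scale_sym (inverse s ^ i) (\<tau> i (\<sigma> j f))) else 0)"
   by (rule sum.cartesian_product)
  also have "\<dots> = (\<Sum>(n, i)\<in>(SIGMA n:{..N + N}. {..n}). if n \<ge> 1 then scale_sym c (W (n - 1) * scale_sym (inverse s ^ i) (\<tau> i (\<sigma> (n - i) f))) else 0)"
  proof (rule sum.reindex_bij_witness_not_neutral[where j = "%(i, j). (i + j, i)" and i = "%(n, i). (i, n - i)" and
    T' = "(SIGMA n:{..N + N}. {..n}) - {(n, i). i \<le> n \<and> n - i \<le> N \<and> i \<le> N}" and S' = "{}"])
   fix x assume "x \<in> (SIGMA n:{..N + N}. {..n}) - {(n, i). i \<le> n \<and> n - i \<le> N \<and> i \<le> N}"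
   then show "(case x of (n, i) => if n \<ge> 1 then scale_sym c (W (n - 1) * scale_sym (inverse s ^ i) (\<tau> i (\<sigma> (n - i) f))) else 0) = 0"
    using \<tau>\<sigma>0 by (cases x) auto
  qed auto
  also have "\<dots> = (\<Sum>n\<le>N + N. \<Sum>i\<le>n. if n \<ge> 1 then scale_sym c (W (n - 1) * scale_sym (inverse s ^ i) (\<tau> i (\<sigma> (n - i) f))) else 0)"
   by (rule sum.Sigma[symmetric]) auto
  also have "\<dots> = 0"
  proof (rule sum.neutral, rule ballI)
   fix n
   have "(\<Sum>i\<le>n. scale_sym (inverse s ^ i) (\<tau> i (\<sigma> (n - i) f))) = 0" if "n \<ge> 1"
   proof -
    have "(\<Sum>i\<le>n. scale_sym (inverse s ^ i) (\<tau> i (\<sigma> (n - i) f))) =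
     translate (%r. inverse s ^ r * M_alphabet r + dual_M_alphabet r) n f"
     unfolding \<tau>_def \<sigma>_def translate_rescale[symmetric] by (rule translate_plus)
    also have "\<dots> = translate (%_. 0) n f"
    proof (rule translate_cong)
     fix r
     have "inverse s ^ r * (1 - q ^ r) * (1 - t ^ r) = (1 - inverse q ^ r) * (1 - inverse t ^ r)"
      using qt by (simp add: s_def power_mult_distrib power_inverse field_simps)
     then show "inverse s ^ r * M_alphabet r + dual_M_alphabet r = 0"
      by (simp add: M_alphabet_def dual_M_alphabet_def mult.assoc)
    qed
    finally show ?thesis using that by (simp add: translate_trivial)
   qed
   then show "(\<Sum>i\<le>n. if n \<ge> 1 then scale_sym c (W (n - 1) * scale_sym (inverse s ^ i) (\<tau> i (\<sigma> (n - i) f))) else 0) = 0"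
    by (cases "n \<ge> 1") (simp_all add: scale_sym_sum[symmetric] sum_distrib_left[symmetric])
  qed
  finally show ?thesis .
 qed
 also have "(\<Sum>i\<le>N. \<Sum>j\<le>N. if i + j = 1 then scale_sym c (\<tau> i (\<sigma> j f)) else 0) = scale_sym c (\<tau> 0 (\<sigma> 1 f) + \<tau> 1 (\<sigma> 0 f))"
 proof -
  have N1: "1 \<le> N" by (simp add: N_def)
  have "(\<Sum>i\<le>N. \<Sum>j\<le>N. if i + j = 1 then scale_sym c (\<tau> i (\<sigma> j f)) else 0) =
   (\<Sum>(i, j)\<in>{..N} \<times> {..N}. if i + j = 1 then scale_sym c (\<tau> i (\<sigma> j f)) else 0)"
   by (rule sum.cartesian_product)
  also have "\<dots> = (\<Sum>(i, j)\<in>{(0, 1), (1, 0)}. scale_sym c (\<tau> i (\<sigma> j f)))"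
   by (rule sum.mono_neutral_cong_right) (use N1 in \<open>auto split: if_splits\<close>)
  finally show ?thesis by (simp add: symfun.scale_right_distrib)
 qed
 also have "\<dots> = scale_sym (c * (dual_M_alphabet 1 + M_alphabet 1)) (pd f)"
  unfolding \<tau>_def \<sigma>_def translate_zero translate_1
  by (simp add: symfun.scale_left_distrib symfun.scale_right_distrib distrib_left)
 also have "c * (dual_M_alphabet 1 + M_alphabet 1) = - (((1 - q) * (1 - t))\<^sup>2 / (q * t))"
 proof -
  have "dual_M_alphabet 1 + M_alphabet 1 = (1 - q) * (1 - t) * (- ((1 - s) / s))"
   using qt by (simp add: dual_M_alphabet_def M_alphabet_def s_def field_simps)
  then have "c * (dual_M_alphabet 1 + M_alphabet 1) = (1 - q) * (1 - t) / (1 - s) * ((1 - q) * (1 - t) * (- ((1 - s) / s)))"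
   by (simp add: c_def)
  also have "\<dots> = - (((1 - q) * (1 - t))\<^sup>2 / s)" using s by (simp add: power2_eq_square)
  finally show ?thesis by (simp add: s_def)
 qed
 finally show ?thesis by simp
qed

end

section \<open>The plethysm\<close>

lemma ex_sym_endo:
 "\<exists>\<phi>. is_sym_hom (%c :: 'a :: field_char_0. scale_sym c 1) \<phi> \<and> (\<forall>r\<ge>1. \<phi> (power_sum_sym r) = y r)"
 by (rule ex_sym_hom) (simp add: is_ring_hom_def symfun.scale_left_distrib scale_sym_times)

lemma plethysm_one_minus:
 "is_sym_hom (%c. scale_sym c 1) (plethysm_one_minus u)"
 "r \<ge> 1 ==> plethysm_one_minus u (power_sum_sym r) = scale_sym (1 - u ^ r) (power_sum_sym r)"
proof -
 define P where "P \<phi> \<longleftrightarrow> Vector_Spaces.linear scale_sym scale_sym \<phi> \<and>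
   \<phi> 1 = 1 \<and> (\<forall>f g. \<phi> (f * g) = \<phi> f * \<phi> g) \<and>
   (\<forall>r\<ge>1. \<phi> (power_sum_sym r) = scale_sym (1 - u ^ r) (power_sum_sym r))" for \<phi> :: "qt symfun => qt symfun"
 have P: "P \<phi> \<longleftrightarrow> is_sym_hom (%c. scale_sym c 1) \<phi> \<and> (\<forall>r\<ge>1. \<phi> (power_sum_sym r) = scale_sym (1 - u ^ r) (power_sum_sym r))" for \<phi>
  unfolding P_def is_sym_hom_def Vector_Spaces.linear_iff
  by (auto simp: vector_space_scale_sym scale_sym_times)
 obtain \<phi> where "P \<phi>" unfolding P using ex_sym_endo[of "%r. scale_sym (1 - u ^ r) (power_sum_sym r)"] by blast
 moreover have "\<psi> = \<phi>" if "P \<psi>" for \<psi>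
  using that \<open>P \<phi>\<close> unfolding P by (intro ext) (rule sym_hom_unique, auto)
 ultimately have "P (plethysm_one_minus u)" unfolding plethysm_one_minus_def P_def[symmetric] by (rule theI)
 then show "is_sym_hom (%c. scale_sym c 1) (plethysm_one_minus u)"
  "r \<ge> 1 ==> plethysm_one_minus u (power_sum_sym r) = scale_sym (1 - u ^ r) (power_sum_sym r)"
  unfolding P by auto
qed

lemma is_sym_hom_comp:
 assumes "is_sym_hom (%c. scale_sym c 1) \<phi>" "is_sym_hom (%c. scale_sym c 1) \<psi>"
 shows "is_sym_hom (%c. scale_sym c 1) (%f. \<phi> (\<psi> f))" unfolding is_sym_hom_def
 by (simp add: is_sym_homD(1-3)[OF assms(1)] is_sym_homD(1-3)[OF assms(2)] is_sym_homD(4)[OF assms(1)] is_sym_homD(4)[OF assms(2)] scale_sym_times)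

lemma is_sym_hom_id: "is_sym_hom (%c. scale_sym c 1) (%f. f)"
 by (simp add: is_sym_hom_def scale_sym_times)

lemma plethysm_one_minus_bij:
 assumes u: "\<And>r. r \<ge> 1 ==> u ^ r \<noteq> 1"
 shows "bij (plethysm_one_minus u)"
proof -
 obtain \<psi> where \<psi>: "is_sym_hom (%c. scale_sym c 1) \<psi>"
  "\<And>r. r \<ge> 1 ==> \<psi> (power_sum_sym r) = scale_sym (inverse (1 - u ^ r)) (power_sum_sym r)"
  using ex_sym_endo[of "%r. scale_sym (inverse (1 - u ^ r)) (power_sum_sym r)"] by blast
 note \<phi> = plethysm_one_minus(1)[of u]
 have "\<psi> (plethysm_one_minus u f) = f" for f
  by (rule sym_hom_unique[OF is_sym_hom_comp[OF \<psi>(1) \<phi>] is_sym_hom_id])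
   (use u in \<open>simp add: plethysm_one_minus(2) \<psi>(2) is_sym_homD(4)[OF \<psi>(1)] scale_sym_times\<close>)
 moreover have "plethysm_one_minus u (\<psi> f) = f" for f
  by (rule sym_hom_unique[OF is_sym_hom_comp[OF \<phi> \<psi>(1)] is_sym_hom_id])
   (use u in \<open>simp add: plethysm_one_minus(2) \<psi>(2) is_sym_homD(4)[OF \<phi>] scale_sym_times\<close>)
 ultimately show ?thesis by (intro o_bij[of \<psi>]) (auto simp: fun_eq_iff)
qed

text \<open>Replacing X by X (1 - q) turns Exp[- z X] into Exp[z X (q - 1)] and removes the factor 1
  - q^r from the alphabet.\<close>

lemma plethysm_D_op: "plethysm_one_minus q (D_op q t 0 f) = reduced_op q t 0 (plethysm_one_minus q f)"
proof -
 note \<phi> = plethysm_one_minus(1)[of q] plethysm_one_minus(2)[of _ q]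
 have "plethysm_one_minus q (D_op q t 0 f) =
  vertex_op (%n. plethysm_one_minus q (sym_exp (%_. - 1) n)) (%i. 1 - t ^ i) 0 (plethysm_one_minus q f)"
  unfolding D_op_def by (rule vertex_op_hom[OF \<phi>(1) \<phi>(2)]) (simp_all add: M_alphabet_def)
 also have "\<dots> = reduced_op q t 0 (plethysm_one_minus q f)"
  unfolding reduced_op_def by (rule vertex_op_cong) (simp_all add: sym_exp_hom[OF \<phi>(1) \<phi>(2)])
 finally show ?thesis .
qed

lemma D_op_swap: "D_op q t = D_op t q" by (simp add: D_op_def M_alphabet_def[abs_def] mult.commute)

lemma dual_D_op_swap: "dual_D_op q t = dual_D_op t q"
 by (simp add: dual_D_op_def dual_M_alphabet_def[abs_def] mult.commute)

text \<open>The same computation up to rescaling the variable z by q, which does not affect the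
  coefficient of z^0.\<close>

lemma plethysm_dual_D_op:
 assumes "q \<noteq> 0"
 shows "plethysm_one_minus q (dual_D_op q t 0 f) = reduced_op (inverse q) (inverse t) 0 (plethysm_one_minus q f)"
proof -
 note \<phi> = plethysm_one_minus(1)[of q] plethysm_one_minus(2)[of _ q]
 define g where "g = plethysm_one_minus q f"
 have "plethysm_one_minus q (dual_D_op q t 0 f) =
  vertex_op (%n. plethysm_one_minus q (sym_exp (%_. 1) n)) (%i. inverse q ^ i * (1 - inverse t ^ i)) 0 g"
  unfolding dual_D_op_def g_def
 proof (rule vertex_op_hom[OF \<phi>(1) \<phi>(2)])
  fix r
  show "dual_M_alphabet q t r = (1 - q ^ r) * (inverse q ^ r * (1 - inverse t ^ r))"
  proof -
   have "(1 - q ^ r) * inverse q ^ r = - (1 - inverse q ^ r)"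
    using assms by (simp add: left_diff_distrib power_inverse)
   then show ?thesis by (simp only: dual_M_alphabet_def mult.assoc[symmetric] mult_minus_left)
  qed
 qed
 also have "\<dots> = vertex_op (sym_exp (%i. 1 - q ^ i)) (%i. inverse q ^ i * (1 - inverse t ^ i)) 0 g"
  by (rule vertex_op_cong) (simp_all add: sym_exp_hom[OF \<phi>(1) \<phi>(2)])
 also have "\<dots> = reduced_op (inverse q) (inverse t) 0 g"
 proof -
  define N where "N = max (degree (translation (%i. inverse q ^ i * (1 - inverse t ^ i)) g)) (degree (translation (%i. 1 - inverse t ^ i) g))"
  have "sym_exp (%i. inverse q ^ i - 1) i = scale_sym (inverse q ^ i) (sym_exp (%i. 1 - q ^ i) i)" for i
  proof -
   have "sym_exp (%i. inverse q ^ i - 1) i = sym_exp (%i. inverse q ^ i * (1 - q ^ i)) i"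
    by (rule sym_exp_cong) (use assms in \<open>simp add: field_simps power_inverse\<close>)
   then show ?thesis by (simp add: sym_exp_scale)
  qed
  then show ?thesis unfolding reduced_op_def
   by (subst (1 2) vertex_op_eq[where N = N]) (auto simp: N_def translate_rescale scale_sym_times intro!: sum.cong)
 qed
 finally show ?thesis by (simp add: g_def)
qed

section \<open>Box weights\<close>

definition box_sum :: "'a :: comm_ring_1 => 'a => nat list => 'a" where
 "box_sum q t \<mu> = (\<Sum>(i, j)\<in>diagram \<mu>. q ^ j * t ^ i)"

lemma diagram_Cons: "diagram (b # \<nu>) = Pair 0 ` {..<b} \<union> (%(i, j). (Suc i, j)) ` diagram \<nu>"
proof (intro set_eqI iffI)
 fix x assume "x \<in> diagram (b # \<nu>)"
 then show "x \<in> Pair 0 ` {..<b} \<union> (%(i, j). (Suc i, j)) ` diagram \<nu>"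
  by (cases x; cases "fst x") (auto simp: diagram_def image_iff)
qed (auto simp: diagram_def)

lemma sum_diagram_Cons:
 "(\<Sum>x\<in>diagram (b # \<nu>). f x) = (\<Sum>j<b. f (0, j)) + (\<Sum>(i, j)\<in>diagram \<nu>. f (Suc i, j))"
proof -
 have "(\<Sum>x\<in>diagram (b # \<nu>). f x) = sum f (Pair 0 ` {..<b}) + sum f ((%(i, j). (Suc i, j)) ` diagram \<nu>)"
  unfolding diagram_Cons by (rule sum.union_disjoint) auto
 also have "sum f (Pair 0 ` {..<b}) = (\<Sum>j<b. f (0, j))" by (subst sum.reindex) (auto simp: inj_on_def)
 also have "sum f ((%(i, j). (Suc i, j)) ` diagram \<nu>) = (\<Sum>(i, j)\<in>diagram \<nu>. f (Suc i, j))"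
  by (subst sum.reindex) (auto simp: inj_on_def intro!: sum.cong)
 finally show ?thesis .
qed

lemma op_eigenvalue_box_sum: "op_eigenvalue q t \<mu> = 1 - (1 - q) * (1 - t) * box_sum q t \<mu>"
proof (induction \<mu>)
 case Nil
 then show ?case by (simp add: box_sum_def diagram_def)
next
 case (Cons b \<nu>)
 define G where "G = (\<Sum>j<b. q ^ j)"
 have "(\<Sum>(i, j)\<in>diagram \<nu>. q ^ j * t ^ Suc i) = t * box_sum q t \<nu>"
  by (simp add: box_sum_def sum_distrib_left case_prod_unfold mult_ac)
 then have B: "box_sum q t (b # \<nu>) = G + t * box_sum q t \<nu>"
  using sum_diagram_Cons[of "%(i, j). q ^ j * t ^ i" b \<nu>] by (simp add: box_sum_def case_prod_unfold G_def)
 have G: "(1 - q) * G = 1 - q ^ b" unfolding G_def by (rule one_diff_power_eq[symmetric])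
 have "1 - (1 - q) * (1 - t) * (G + t * box_sum q t \<nu>) =
  t * (1 - (1 - q) * (1 - t) * box_sum q t \<nu>) + (1 - t) * (1 - (1 - q) * G)"
  by (simp add: algebra_simps)
 then show ?case unfolding B G Cons[symmetric] by simp
qed

lemma part_stat_diagram: "part_stat \<mu> = (\<Sum>(i, j)\<in>diagram \<mu>. i)"
 unfolding part_stat_def diagram_Sigma by (subst sum.Sigma[symmetric]) (simp_all add: mult.commute)

lemma card_diagram: "card (diagram \<mu>) = sum_list \<mu>"
 by (simp add: diagram_Sigma sum_list_sum_nth atLeast0LessThan)

lemma diagram_inj:
 assumes "\<mu> \<in> all_partitions" "\<nu> \<in> all_partitions" "diagram \<mu> = diagram \<nu>"
 shows "\<mu> = \<nu>"
proof -
 have len: "{i. (i, 0) \<in> diagram \<mu>} = {..<length \<mu>}" if "\<mu> \<in> all_partitions" for \<mu>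
  using that by (auto simp: all_partitions_def partitions_def diagram_def intro!: Nat.gr0I) (metis nth_mem)
 have row: "{j. (i, j) \<in> diagram \<mu>} = {..<\<mu> ! i}" if "i < length \<mu>" for i \<mu>
  using that by (auto simp: diagram_def)
 have "{..<length \<mu>} = {..<length \<nu>}" using len assms by metis
 then have l: "length \<mu> = length \<nu>" by simp
 moreover have "\<mu> ! i = \<nu> ! i" if "i < length \<mu>" for i
 proof -
  have "{..<\<mu> ! i} = {..<\<nu> ! i}" using row assms(3) that l by metis
  then show ?thesis by simp
 qed
 ultimately show ?thesis by (rule nth_equalityI)
qed

lemma conjugate_partition:
 assumes "\<mu> \<in> partitions n"
 shows "conjugate_partition \<mu> \<in> partitions n" and "diagram (conjugate_partition \<mu>) = prod.swap ` diagram \<mu>"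
proof -
 define L where "L = (if \<mu> = [] then 0 else hd \<mu>)"
 define c where "c j = card {i. i < length \<mu> \<and> j < \<mu> ! i}" for j
 have conj: "conjugate_partition \<mu> = map c [0..<L]" by (simp add: conjugate_partition_def c_def[abs_def] L_def)
 have sorted: "\<mu> ! k \<le> \<mu> ! i" if "i \<le> k" "k < length \<mu>" for i k
  using that assms sorted_wrt_nth_less[of "(\<ge>)" \<mu> i k] by (cases "i = k") (auto simp: partitions_def)
 have c: "i < c j \<longleftrightarrow> i < length \<mu> \<and> j < \<mu> ! i" for i j
 proof -
  have "j < \<mu> ! i" if "Suc i < length \<mu>" "j < \<mu> ! Suc i" for i
   using sorted[of i "Suc i"] that by simp
  from down_closed_nat[of "length \<mu>" "%i. j < \<mu> ! i", OF this]
  have "\<exists>m\<le>length \<mu>. \<forall>i<length \<mu>. j < \<mu> ! i \<longleftrightarrow> i < m" by blast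
  then obtain m where m: "m \<le> length \<mu>" "\<And>i. i < length \<mu> ==> j < \<mu> ! i \<longleftrightarrow> i < m" by blast
  then have "{i. i < length \<mu> \<and> j < \<mu> ! i} = {..<m}" by auto
  then show ?thesis using m by (auto simp: c_def)
 qed
 have L: "j < L" if "i < length \<mu>" "j < \<mu> ! i" for i j
  using that sorted[of 0 i] by (auto simp: L_def hd_conv_nth)
 show d: "diagram (conjugate_partition \<mu>) = prod.swap ` diagram \<mu>"
  unfolding conj using L by (auto simp: diagram_def c image_iff)
 have "sorted_wrt (\<ge>) (map c [0..<L])" unfolding sorted_wrt_iff_nth_less
 proof (intro allI impI)
  fix i k assume "i < k" "k < length (map c [0..<L])"
  moreover have "c k \<le> c i" using \<open>i < k\<close> unfolding c_def by (intro card_mono) auto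
  ultimately show "map c [0..<L] ! i \<ge> map c [0..<L] ! k" by simp
 qed
 moreover have "0 \<notin> set (map c [0..<L])"
 proof
  assume "0 \<in> set (map c [0..<L])"
  then obtain j where j: "j < L" "c j = 0" by auto
  then have "0 < c j" by (subst c) (auto simp: L_def hd_conv_nth split: if_splits)
  then show False using j by simp
 qed
 moreover have "sum_list (conjugate_partition \<mu>) = n"
  using assms unfolding card_diagram[symmetric] d by (simp add: card_image card_diagram sum_list_partition)
 ultimately show "conjugate_partition \<mu> \<in> partitions n" by (simp add: conj partitions_def)
qed

lemma conjugate_conjugate:
 assumes "\<mu> \<in> partitions n"
 shows "conjugate_partition (conjugate_partition \<mu>) = \<mu>"
proof (rule diagram_inj)
 note 1 = conjugate_partition[OF assms]
 show "conjugate_partition (conjugate_partition \<mu>) \<in> all_partitions" "\<mu> \<in> all_partitions"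
  using conjugate_partition(1)[OF 1(1)] assms by (auto simp: all_partitions_def)
 show "diagram (conjugate_partition (conjugate_partition \<mu>)) = diagram \<mu>"
  unfolding conjugate_partition(2)[OF 1(1)] 1(2) by (simp add: image_image)
qed

lemma op_eigenvalue_conjugate:
 assumes "\<mu> \<in> partitions n"
 shows "op_eigenvalue t q (conjugate_partition \<mu>) = op_eigenvalue q t \<mu>"
 unfolding op_eigenvalue_box_sum box_sum_def conjugate_partition(2)[OF assms]
 by (subst sum.reindex) (auto simp: case_prod_unfold mult.commute)

text \<open>The eigenvalue of nabla, written so that adding a box multiplies it by the weight of
  that box.\<close>

definition box_prod :: "nat list => qt" where
 "box_prod \<mu> = (\<Prod>(i, j)\<in>diagram \<mu>. q_var ^ j * t_var ^ i)"

lemma box_prod_eq: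
 assumes "\<mu> \<in> partitions n"
 shows "q_var ^ part_stat (conjugate_partition \<mu>) * t_var ^ part_stat \<mu> = box_prod \<mu>"
proof -
 have "part_stat (conjugate_partition \<mu>) = (\<Sum>(i, j)\<in>diagram \<mu>. j)"
  unfolding part_stat_diagram conjugate_partition(2)[OF assms]
  by (subst sum.reindex) (auto simp: case_prod_unfold)
 then show ?thesis unfolding box_prod_def part_stat_diagram
  by (simp add: case_prod_unfold prod.distrib power_sum)
qed

text \<open>The monomial q^j t^i in Q[t][q]: equations in the fraction field are reduced to
  comparing coefficients of polynomials.\<close>

definition qt_monom :: "nat => nat => rat poly poly" where
 "qt_monom i j = monom (monom 1 i) j"

lemma qt_monom: "to_fract (qt_monom i j) = q_var ^ j * t_var ^ i"
proof -
 have p: "to_fract (P ^ n) = to_fract P ^ n" for P :: "rat poly poly" and n by (induction n) simp_all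
 have "[:[:0, 1 :: rat:]:] ^ i = [:monom 1 i:]" by (induction i) (simp_all add: monom_Suc monom_0 one_pCons)
 then have "qt_monom i j = [:0, 1:] ^ j * [:[:0, 1:]:] ^ i"
  by (simp add: qt_monom_def monom_altdef[of "monom 1 i"])
 then show ?thesis by (simp add: q_var_def t_var_def p)
qed

lemma coeff_qt_monom: "coeff (coeff (qt_monom i j) l) k = (if k = i \<and> l = j then 1 else 0)"
 by (simp add: qt_monom_def)

lemma q_var_t_var [simp]: "q_var \<noteq> 0" "t_var \<noteq> 0" by (simp_all add: q_var_def t_var_def)

lemma q_t_power_neq:
 assumes "r \<ge> 1"
 shows "q_var ^ r \<noteq> 1" "t_var ^ r \<noteq> 1" "q_var ^ r * t_var ^ r \<noteq> 1"
proof -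
 have *: "q_var ^ j * t_var ^ i \<noteq> 1" if "i \<noteq> 0 \<or> j \<noteq> 0" for i j
 proof
  assume "q_var ^ j * t_var ^ i = 1"
  then have "to_fract (qt_monom i j) = to_fract (qt_monom 0 0)" by (simp add: qt_monom)
  then have "qt_monom i j = qt_monom 0 0" by simp
  then have "coeff (coeff (qt_monom i j) 0) 0 = (1 :: rat)" by (simp add: coeff_qt_monom)
  then show False using that by (simp add: coeff_qt_monom split: if_splits)
 qed
 show "q_var ^ r \<noteq> 1" "t_var ^ r \<noteq> 1" "q_var ^ r * t_var ^ r \<noteq> 1"
  using *[of 0 r] *[of r 0] *[of r r] assms by auto
qed

text \<open>Distinct boxes have distinct monomials as weights, so the sum determines the
  diagram.\<close>

lemma box_sum_inj:
 assumes "\<mu> \<in> all_partitions" "\<nu> \<in> all_partitions" "box_sum q_var t_var \<mu> = box_sum q_var t_var \<nu>"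
 shows "\<mu> = \<nu>"
proof (rule diagram_inj[OF assms(1,2)])
 have b: "box_sum q_var t_var \<mu> = to_fract (\<Sum>(i, j)\<in>diagram \<mu>. qt_monom i j)" for \<mu>
  by (simp add: box_sum_def to_fract_sum qt_monom case_prod_unfold)
 have c: "coeff (coeff (\<Sum>(i, j)\<in>diagram \<mu>. qt_monom i j) l) k = (if (k, l) \<in> diagram \<mu> then 1 else 0)" for \<mu> k l
 proof -
  have "coeff (coeff (\<Sum>(i, j)\<in>diagram \<mu>. qt_monom i j) l) k = (\<Sum>x\<in>diagram \<mu>. if x = (k, l) then 1 else 0)"
   by (auto simp: coeff_sum coeff_qt_monom case_prod_unfold prod_eq_iff intro!: sum.cong)
  then show ?thesis by simp
 qed
 have "(\<Sum>(i, j)\<in>diagram \<mu>. qt_monom i j) = (\<Sum>(i, j)\<in>diagram \<nu>. qt_monom i j)"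
  using assms(3) unfolding b by (simp only: to_fract_eq_iff)
 then have "(if (k, l) \<in> diagram \<mu> then 1 else 0 :: rat) = (if (k, l) \<in> diagram \<nu> then 1 else 0)" for k l
  using c by metis
 then have "(k, l) \<in> diagram \<mu> \<longleftrightarrow> (k, l) \<in> diagram \<nu>" for k l by (metis zero_neq_one)
 then show "diagram \<mu> = diagram \<nu>" by auto
qed

text \<open>The constant term of \<open>D(q, t) D(1/q, 1/t)\<close> is the sum of the squares of the coefficients of \<open>D\<close>.\<close>

lemma box_sum_difference_unit:
 assumes "(box_sum q_var t_var \<mu> - box_sum q_var t_var \<nu>) *
  (box_sum (inverse q_var) (inverse t_var) \<mu> - box_sum (inverse q_var) (inverse t_var) \<nu>) = 1"
  and size: "sum_list \<nu> < sum_list \<mu>"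
 obtains i j where "(i, j) \<notin> diagram \<nu>" "diagram \<mu> = insert (i, j) (diagram \<nu>)"
proof -
 define U where "U = diagram \<mu> \<union> diagram \<nu>"
 define \<epsilon> where "\<epsilon> x = (if x \<in> diagram \<mu> then 1 else 0) - (if x \<in> diagram \<nu> then 1 else 0 :: int)" for x
 have fU: "finite U" by (simp add: U_def)
 obtain N where N: "\<And>i j. (i, j) \<in> U ==> i \<le> N \<and> j \<le> N"
 proof -
  have "finite (fst ` U \<union> snd ` U)" using fU by simp
  then obtain N where "\<forall>x\<in>fst ` U \<union> snd ` U. x \<le> N" using finite_nat_set_iff_bounded_le by blast
  then show thesis using that[of N] by force
 qed
 have diff: "box_sum q t \<mu> - box_sum q t \<nu> = (\<Sum>(i, j)\<in>U. of_int (\<epsilon> (i, j)) * (q ^ j * t ^ i))" for q t :: qt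
 proof -
  have *: "box_sum q t \<kappa> = (\<Sum>(i, j)\<in>U. if (i, j) \<in> diagram \<kappa> then q ^ j * t ^ i else 0)" if "diagram \<kappa> \<subseteq> U" for \<kappa>
   unfolding box_sum_def using that fU by (intro sum.mono_neutral_cong_left) auto
  have "diagram \<mu> \<subseteq> U" "diagram \<nu> \<subseteq> U" by (auto simp: U_def)
  from this[THEN *] show ?thesis
   by (simp only: sum_subtractf[symmetric]) (rule sum.cong, auto simp: \<epsilon>_def)
 qed
 \<comment> \<open>Multiplying by (q t)^N clears the negative exponents, so the constant term of the
   product becomes the coefficient at (N, N).\<close>
 define P where "P = (\<Sum>x\<in>U. \<Sum>y\<in>U. of_int (\<epsilon> x * \<epsilon> y) * qt_monom (N + fst x - fst y) (N + snd x - snd y))"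
 have ofn: "to_fract (of_nat k) = of_nat k" for k by (induction k) simp_all
 have ofi: "to_fract (of_int k) = of_int k" for k by (cases k rule: int_diff_cases) (simp add: ofn)
 have "to_fract P = (\<Sum>x\<in>U. \<Sum>y\<in>U. of_int (\<epsilon> x) * of_int (\<epsilon> y) *
   (q_var ^ (N + snd x - snd y) * t_var ^ (N + fst x - fst y)))"
  by (simp add: P_def to_fract_sum qt_monom ofi)
 also have "\<dots> = (\<Sum>x\<in>U. \<Sum>y\<in>U. (of_int (\<epsilon> x) * (q_var ^ snd x * t_var ^ fst x)) *
   ((of_int (\<epsilon> y) * (inverse q_var ^ snd y * inverse t_var ^ fst y)) * (q_var ^ N * t_var ^ N)))"
 proof (intro sum.cong refl)
  fix x y assume "x \<in> U" "y \<in> U"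
  then have "fst y \<le> N" "snd y \<le> N" using N by (metis prod.collapse)+
  then have "q_var ^ (N + snd x - snd y) = q_var ^ N * q_var ^ snd x * inverse q_var ^ snd y"
   "t_var ^ (N + fst x - fst y) = t_var ^ N * t_var ^ fst x * inverse t_var ^ fst y"
   by (simp_all add: power_diff power_add power_inverse divide_inverse)
  then show "of_int (\<epsilon> x) * of_int (\<epsilon> y) * (q_var ^ (N + snd x - snd y) * t_var ^ (N + fst x - fst y)) =
   (of_int (\<epsilon> x) * (q_var ^ snd x * t_var ^ fst x)) *
   ((of_int (\<epsilon> y) * (inverse q_var ^ snd y * inverse t_var ^ fst y)) * (q_var ^ N * t_var ^ N))"
   by (simp add: mult_ac)
 qed
 also have "\<dots> = (\<Sum>x\<in>U. of_int (\<epsilon> x) * (q_var ^ snd x * t_var ^ fst x)) *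
   ((\<Sum>y\<in>U. of_int (\<epsilon> y) * (inverse q_var ^ snd y * inverse t_var ^ fst y)) * (q_var ^ N * t_var ^ N))"
  unfolding sum_distrib_right[of _ _ "q_var ^ N * t_var ^ N"] sum_product ..
 also have "\<dots> = q_var ^ N * t_var ^ N"
  using assms(1) unfolding diff by (simp add: case_prod_unfold mult.assoc[symmetric])
 also have "\<dots> = to_fract (qt_monom N N)" by (simp add: qt_monom)
 finally have "P = qt_monom N N" by simp
 then have "coeff (coeff P N) N = 1" by (simp add: coeff_qt_monom)
 moreover have "coeff (coeff P N) N = of_int (\<Sum>x\<in>U. \<epsilon> x ^ 2)"
 proof -
  have ci: "coeff (coeff (of_int k * Q) l) m = of_int k * coeff (coeff Q l) m" for k l m and Q :: "rat poly poly"
   by (simp add: of_int_poly)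
  have "coeff (coeff P N) N = (\<Sum>x\<in>U. \<Sum>y\<in>U. of_int (\<epsilon> x * \<epsilon> y) *
    (if N = N + fst x - fst y \<and> N = N + snd x - snd y then 1 else 0))"
   unfolding P_def by (simp only: coeff_sum ci coeff_qt_monom)
  also have "\<dots> = (\<Sum>x\<in>U. \<Sum>y\<in>U. if y = x then of_int (\<epsilon> x ^ 2) else 0)"
  proof (intro sum.cong refl)
   fix x y assume "x \<in> U" "y \<in> U"
   then have "fst y \<le> N" "snd y \<le> N" using N by (metis prod.collapse)+
   then have "(N = N + fst x - fst y \<and> N = N + snd x - snd y) \<longleftrightarrow> y = x" by (auto simp: prod_eq_iff)
   then show "of_int (\<epsilon> x * \<epsilon> y) * (if N = N + fst x - fst y \<and> N = N + snd x - snd y then 1 else 0 :: rat) =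
    (if y = x then of_int (\<epsilon> x ^ 2) else 0)" by (simp add: power2_eq_square)
  qed
  finally show ?thesis using fU by simp
 qed
 ultimately have one: "(\<Sum>x\<in>U. \<epsilon> x ^ 2) = 1" by (metis of_int_eq_1_iff)
 have "(\<Sum>x\<in>U. \<epsilon> x ^ 2) = (\<Sum>x\<in>U. if x \<in> (diagram \<mu> - diagram \<nu>) \<union> (diagram \<nu> - diagram \<mu>) then 1 else 0)"
  by (rule sum.cong) (auto simp: \<epsilon>_def)
 also have "\<dots> = int (card ((diagram \<mu> - diagram \<nu>) \<union> (diagram \<nu> - diagram \<mu>)))"
 proof -
  have "U \<inter> {x. x \<in> (diagram \<mu> - diagram \<nu>) \<union> (diagram \<nu> - diagram \<mu>)} = (diagram \<mu> - diagram \<nu>) \<union> (diagram \<nu> - diagram \<mu>)"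
   by (auto simp: U_def)
  then show ?thesis using fU by (simp only: sum.If_cases) simp
 qed
 also have "card ((diagram \<mu> - diagram \<nu>) \<union> (diagram \<nu> - diagram \<mu>)) = card (diagram \<mu> - diagram \<nu>) + card (diagram \<nu> - diagram \<mu>)"
  by (rule card_Un_disjoint) auto
 finally have c1: "card (diagram \<mu> - diagram \<nu>) + card (diagram \<nu> - diagram \<mu>) = 1" using one by simp
 have "card (diagram \<nu>) < card (diagram \<mu>)" using size by (simp add: card_diagram)
 then have "\<not> diagram \<mu> \<subseteq> diagram \<nu>" using card_mono[of "diagram \<nu>" "diagram \<mu>"] by auto
 then have "card (diagram \<mu> - diagram \<nu>) \<noteq> 0" by simp
 then have "card (diagram \<mu> - diagram \<nu>) = 1" and "card (diagram \<nu> - diagram \<mu>) = 0" using c1 by linarith+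
 moreover from this(2) have "diagram \<nu> \<subseteq> diagram \<mu>" by simp
 ultimately obtain x where "diagram \<mu> - diagram \<nu> = {x}" "diagram \<nu> \<subseteq> diagram \<mu>"
  using card_1_singletonE by metis
 then have "x \<notin> diagram \<nu>" "diagram \<mu> = insert x (diagram \<nu>)" by auto
 then show thesis using that[of "fst x" "snd x"] by simp
qed

section \<open>Eigenvectors\<close>

text \<open>Coefficients are indexed by \<open>I\<close> instead of by vectors, so that two
  expansions can be subtracted index by index.\<close>

lemma span_explicit_family:
 assumes "v \<in> symfun.span (f ` I)"
 shows "\<exists>S c. finite S \<and> S \<subseteq> I \<and> v = (\<Sum>i\<in>S. scale_sym (c i) (f i))"
 using assms
proof (induction rule: symfun.span_induct_alt)
 case base
 show ?case by (intro exI[of _ "{}"]) auto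
next
 case (step c0 x y)
 then obtain i S c where i: "x = f i" "i \<in> I" and S: "finite S" "S \<subseteq> I" "y = (\<Sum>i\<in>S. scale_sym (c i) (f i))" by blast
 define c' where "c' j = (if j \<in> S then c j else 0) + (if j = i then c0 else 0)" for j
 have "(\<Sum>j\<in>insert i S. scale_sym (c' j) (f j)) = (\<Sum>j\<in>insert i S. scale_sym (if j \<in> S then c j else 0) (f j)) +
   (\<Sum>j\<in>insert i S. if j = i then scale_sym c0 (f i) else 0)"
  unfolding sum.distrib[symmetric] by (intro sum.cong refl) (auto simp: c'_def symfun.scale_left_distrib)
 also have "(\<Sum>j\<in>insert i S. scale_sym (if j \<in> S then c j else 0) (f j)) = y"
  unfolding S(3) using S(1) by (intro sum.mono_neutral_cong_right) auto
 also have "(\<Sum>j\<in>insert i S. if j = i then scale_sym c0 (f i) else 0) = scale_sym c0 x" using S(1) i by simp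
 finally have "scale_sym c0 x + y = (\<Sum>j\<in>insert i S. scale_sym (c' j) (f j))" by (simp add: add.commute)
 then show ?case using S i by (intro exI[of _ "insert i S"] exI[of _ c']) auto
qed

lemma eigenvectors_independent:
 assumes L: "sym_linear L"
  and eig: "\<And>i. i \<in> I ==> L (f i) = scale_sym (e i) (f i)" "inj_on e I" "\<And>i. i \<in> I ==> f i \<noteq> 0"
  and S: "finite S" "S \<subseteq> I" "(\<Sum>i\<in>S. scale_sym (c i) (f i)) = 0"
 shows "\<forall>i\<in>S. c i = (0 :: 'a :: field)" using S
proof (induction S arbitrary: c)
 case (insert j S)
 interpret L: Vector_Spaces.linear scale_sym scale_sym L by (rule L)
 have j: "j \<in> I" "S \<subseteq> I" using insert.prems by auto
 have z: "scale_sym (c j) (f j) + (\<Sum>i\<in>S. scale_sym (c i) (f i)) = 0" using insert by simp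
 then have "L (scale_sym (c j) (f j) + (\<Sum>i\<in>S. scale_sym (c i) (f i))) = 0" by simp
 then have "scale_sym (c j * e j) (f j) + (\<Sum>i\<in>S. scale_sym (c i * e i) (f i)) = 0"
  using j eig(1) by (simp add: L.add L.scale L.sum subset_iff)
 moreover have "scale_sym (c j * e j) (f j) + (\<Sum>i\<in>S. scale_sym (c i * e j) (f i)) = 0"
 proof -
  have "scale_sym (e j) (scale_sym (c j) (f j) + (\<Sum>i\<in>S. scale_sym (c i) (f i))) = 0" by (simp add: z)
  then show ?thesis by (simp add: symfun.scale_right_distrib scale_sym_sum mult.commute)
 qed
 ultimately have "(\<Sum>i\<in>S. scale_sym (c i * e i) (f i)) - (\<Sum>i\<in>S. scale_sym (c i * e j) (f i)) = 0"
  by (metis add_left_cancel diff_self)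
 then have "(\<Sum>i\<in>S. scale_sym (c i * (e i - e j)) (f i)) = 0"
  by (simp add: sum_subtractf[symmetric] symfun.scale_left_diff_distrib right_diff_distrib)
 then have 0: "\<forall>i\<in>S. c i * (e i - e j) = 0" by (rule insert.IH[OF j(2)])
 have cS: "c i = 0" if "i \<in> S" for i
 proof -
  have "e i \<noteq> e j" using eig(2) j that insert.hyps(2) by (metis inj_onD subsetD)
  then show ?thesis using 0 that by auto
 qed
 then have "scale_sym (c j) (f j) = 0" using z by simp
 then show ?case using cS eig(3)[OF j(1)] by simp
qed simp

lemma span_family_Int:
 assumes indep: "\<And>S c. finite S ==> S \<subseteq> I ==> (\<Sum>i\<in>S. scale_sym (c i) (f i)) = 0 ==> \<forall>i\<in>S. c i = (0 :: 'a :: field)"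
  and AB: "A \<subseteq> I" "B \<subseteq> I" "v \<in> symfun.span (f ` A)" "v \<in> symfun.span (f ` B)"
 shows "v \<in> symfun.span (f ` (A \<inter> B))"
proof -
 obtain S c where S: "finite S" "S \<subseteq> A" "v = (\<Sum>i\<in>S. scale_sym (c i) (f i))"
  using span_explicit_family[OF AB(3)] by blast
 obtain S' c' where S': "finite S'" "S' \<subseteq> B" "v = (\<Sum>i\<in>S'. scale_sym (c' i) (f i))"
  using span_explicit_family[OF AB(4)] by blast
 define d where "d i = (if i \<in> S then c i else 0) - (if i \<in> S' then c' i else 0)" for i
 have "(\<Sum>i\<in>S \<union> S'. scale_sym (d i) (f i)) = (\<Sum>i\<in>S \<union> S'. scale_sym (if i \<in> S then c i else 0) (f i)) -
  (\<Sum>i\<in>S \<union> S'. scale_sym (if i \<in> S' then c' i else 0) (f i))"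
  unfolding sum_subtractf[symmetric] by (intro sum.cong refl) (simp add: d_def symfun.scale_left_diff_distrib)
 also have "(\<Sum>i\<in>S \<union> S'. scale_sym (if i \<in> S then c i else 0) (f i)) = v"
  unfolding S(3) using S(1) S'(1) by (intro sum.mono_neutral_cong_right) auto
 also have "(\<Sum>i\<in>S \<union> S'. scale_sym (if i \<in> S' then c' i else 0) (f i)) = v"
  unfolding S'(3) using S(1) S'(1) by (intro sum.mono_neutral_cong_right) auto
 finally have "\<forall>i\<in>S \<union> S'. d i = 0" using S S' AB(1,2) by (intro indep) auto
 then have z: "c i = 0" if "i \<in> S" "i \<notin> S'" for i using that by (auto simp: d_def split: if_splits)
 have "v = (\<Sum>i\<in>S \<inter> S'. scale_sym (c i) (f i))"
  unfolding S(3) using S(1) z by (intro sum.mono_neutral_cong_right) auto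
 also have "\<dots> \<in> symfun.span (f ` (A \<inter> B))"
  using S(2) S'(2) by (intro symfun.span_sum symfun.span_scale symfun.span_base) auto
 finally show ?thesis .
qed

lemma eigenvector_in_span:
 assumes L: "sym_linear L"
  and eig: "\<And>i. i \<in> I ==> L (f i) = scale_sym (e i) (f i)" "inj_on e I" "\<And>i. i \<in> I ==> f i \<noteq> 0"
  and v: "v \<in> symfun.span (f ` I)" "L v = scale_sym (e j) v" "j \<in> I"
 shows "\<exists>c. v = scale_sym (c :: 'a :: field) (f j)"
proof -
 interpret L: Vector_Spaces.linear scale_sym scale_sym L by (rule L)
 obtain S c where S: "finite S" "S \<subseteq> I" "v = (\<Sum>i\<in>S. scale_sym (c i) (f i))"
  using span_explicit_family[OF v(1)] by blast
 have "L v = (\<Sum>i\<in>S. scale_sym (c i * e i) (f i))"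
  unfolding S(3) using S(2) eig(1) by (simp add: L.sum L.scale subset_iff)
 moreover have "scale_sym (e j) v = (\<Sum>i\<in>S. scale_sym (c i * e j) (f i))"
  unfolding S(3) by (simp add: scale_sym_sum mult.commute)
 ultimately have s: "(\<Sum>i\<in>S. scale_sym (c i * (e i - e j)) (f i)) = 0"
  using v(2) by (simp add: right_diff_distrib symfun.scale_left_diff_distrib sum_subtractf)
 have z: "\<forall>i\<in>S. c i * (e i - e j) = 0"
  by (rule eigenvectors_independent[of L I f e S, OF L _ _ _ S(1,2) s]) (use eig in auto)
 have cz: "c i = 0" if "i \<in> S" "i \<noteq> j" for i
 proof -
  have "e i \<noteq> e j" using that S(2) v(3) eig(2) by (meson inj_onD subsetD)
  then show ?thesis using z that by auto
 qed
 show ?thesis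
 proof (cases "j \<in> S")
  case True
  have "v = (\<Sum>i\<in>{j}. scale_sym (c i) (f i))"
   unfolding S(3) using S(1) True cz by (intro sum.mono_neutral_right) auto
  then show ?thesis by auto
 next
  case False
  then have "v = 0" unfolding S(3) using cz by (intro sum.neutral) auto
  then show ?thesis by (intro exI[of _ 0]) simp
 qed
qed

text \<open>The inductive step of back substitution: solutions for the Schur functions strictly
  above \<kappa> are combined linearly.\<close>

lemma solve_triangular:
 assumes L: "sym_linear L"
  and r: "r \<in> strict_span \<kappa>" and \<kappa>: "\<kappa> \<in> partitions n"
  and sol: "\<And>\<mu>. \<mu> \<in> partitions n ==> dominates \<mu> \<kappa> ==> \<mu> \<noteq> \<kappa> ==>
   \<exists>w\<in>dominance_span \<mu>. L w - scale_sym c w = schur \<mu>"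
 shows "\<exists>w\<in>strict_span \<kappa>. L w - scale_sym c w = r"
 using r unfolding strict_span_def[of \<kappa>]
proof (induction rule: symfun.span_induct_alt)
 interpret L: Vector_Spaces.linear scale_sym scale_sym L by (rule L)
 case base
 show ?case by (intro bexI[of _ 0]) (simp_all add: symfun.span_zero)
next
 interpret L: Vector_Spaces.linear scale_sym scale_sym L by (rule L)
 case (step a x y)
 then obtain \<mu> where \<mu>: "x = schur \<mu>" "\<mu> \<in> partitions n" "dominates \<mu> \<kappa>" "\<mu> \<noteq> \<kappa>"
  using sum_list_partition[OF \<kappa>] by auto
 then obtain w where w: "w \<in> dominance_span \<mu>" "L w - scale_sym c w = x" using sol by blast
 have "w \<in> strict_span \<kappa>" using w(1) dominance_span_subset_strict[OF \<mu>(2) \<kappa> \<mu>(3,4)] by blast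
 moreover obtain w' where w': "w' \<in> strict_span \<kappa>" "L w' - scale_sym c w' = y"
  using step by (auto simp: strict_span_def)
 moreover have "L (scale_sym a w + w') - scale_sym c (scale_sym a w + w') = scale_sym a x + y"
  unfolding w(2)[symmetric] w'(2)[symmetric]
  by (simp add: L.add L.scale symfun.scale_right_distrib symfun.scale_right_diff_distrib mult.commute)
 ultimately show ?case
  by (intro bexI[of _ "scale_sym a w + w'"]) (simp_all add: symfun.span_add symfun.span_scale strict_span_def)
qed

text \<open>The eigenvector is s_\<mu> - w, where \<open>w\<close> lies strictly above \<mu> and
  solves (L - e) w = L s_\<mu> - e s_\<mu>. The equation is solvable because the eigenvalue e of
  \<mu> does not occur strictly above \<mu>.\<close>

lemma triangular_eigenvector:
 assumes L: "sym_linear L"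
  and tri: "\<And>\<mu>. \<mu> \<in> partitions n ==> L (schur \<mu>) - scale_sym (e \<mu>) (schur \<mu>) \<in> strict_span \<mu>"
  and inj: "inj_on e (partitions n)" and \<mu>: "\<mu> \<in> partitions n"
 shows "\<exists>g. g - schur \<mu> \<in> strict_span \<mu> \<and> L g = scale_sym (e \<mu>) g"
proof -
 interpret L: Vector_Spaces.linear scale_sym scale_sym L by (rule L)
 have sol: "\<exists>w\<in>dominance_span \<kappa>. L w - scale_sym c w = schur \<kappa>"
  if "\<kappa> \<in> partitions n" "\<And>\<nu>. \<nu> \<in> partitions n ==> dominates \<nu> \<kappa> ==> e \<nu> \<noteq> c" for \<kappa> c
  using that
 proof (induction "part_stat \<kappa>" arbitrary: \<kappa> rule: less_induct)
  case less
  have "\<exists>w\<in>strict_span \<kappa>. L w - scale_sym c w = L (schur \<kappa>) - scale_sym (e \<kappa>) (schur \<kappa>)"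
  proof (rule solve_triangular[OF L tri[OF less.prems(1)] less.prems(1)])
   fix \<mu> assume \<mu>: "\<mu> \<in> partitions n" "dominates \<mu> \<kappa>" "\<mu> \<noteq> \<kappa>"
   show "\<exists>w\<in>dominance_span \<mu>. L w - scale_sym c w = schur \<mu>"
   proof (rule less.hyps[OF _ \<mu>(1)])
    show "part_stat \<mu> < part_stat \<kappa>" by (rule dominates_part_stat(2)[OF \<mu>(1) less.prems(1) \<mu>(2,3)])
    show "e \<nu> \<noteq> c" if "\<nu> \<in> partitions n" "dominates \<nu> \<mu>" for \<nu>
     using less.prems(2)[OF that(1) dominates_trans[OF that(2) \<mu>(2)]] .
   qed
  qed
  then obtain w where w: "w \<in> strict_span \<kappa>" "L w - scale_sym c w = L (schur \<kappa>) - scale_sym (e \<kappa>) (schur \<kappa>)"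
   by blast
  have ne: "e \<kappa> - c \<noteq> 0" using less.prems by simp
  define u where "u = scale_sym (inverse (e \<kappa> - c)) (schur \<kappa> - w)"
  have "L (schur \<kappa> - w) - scale_sym c (schur \<kappa> - w) = scale_sym (e \<kappa> - c) (schur \<kappa>)"
   using w(2) by (simp add: L.diff symfun.scale_right_diff_distrib symfun.scale_left_diff_distrib algebra_simps)
  moreover have "L u - scale_sym c u =
    scale_sym (inverse (e \<kappa> - c)) (L (schur \<kappa> - w) - scale_sym c (schur \<kappa> - w))"
   unfolding u_def L.scale by (simp only: symfun.scale_left_commute[of c] symfun.scale_right_diff_distrib)
  ultimately have "L u - scale_sym c u = schur \<kappa>" using ne by simp
  moreover have "u \<in> dominance_span \<kappa>"
   unfolding u_def using w(1) strict_span_subset schur_in_dominance_span[OF less.prems(1)]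
   by (intro dominance_span_scale dominance_span_diff) auto
  ultimately show ?case by blast
 qed
 have "\<exists>w\<in>strict_span \<mu>. L w - scale_sym (e \<mu>) w = L (schur \<mu>) - scale_sym (e \<mu>) (schur \<mu>)"
 proof (rule solve_triangular[OF L tri[OF \<mu>] \<mu>])
  fix \<kappa> assume \<kappa>: "\<kappa> \<in> partitions n" "dominates \<kappa> \<mu>" "\<kappa> \<noteq> \<mu>"
  show "\<exists>w\<in>dominance_span \<kappa>. L w - scale_sym (e \<mu>) w = schur \<kappa>"
  proof (rule sol[OF \<kappa>(1)])
   fix \<nu> assume \<nu>: "\<nu> \<in> partitions n" "dominates \<nu> \<kappa>"
   then have "\<nu> \<noteq> \<mu>" using dominates_antisym[OF \<kappa>(1) \<mu> \<kappa>(2)] \<kappa>(3) by auto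
   then show "e \<nu> \<noteq> e \<mu>" using inj \<mu> \<nu>(1) by (auto dest: inj_onD)
  qed
 qed
 then obtain w where w: "w \<in> strict_span \<mu>" "L w - scale_sym (e \<mu>) w = L (schur \<mu>) - scale_sym (e \<mu>) (schur \<mu>)"
  by blast
 have "L (schur \<mu> - w) = scale_sym (e \<mu>) (schur \<mu> - w)"
  using w(2) by (simp add: L.diff symfun.scale_right_diff_distrib algebra_simps)
 moreover have "(schur \<mu> - w) - schur \<mu> \<in> strict_span \<mu>"
  using strict_span_scale[OF w(1), of "- 1"] by simp
 ultimately show ?thesis by blast
qed

text \<open>A unitriangular change of basis; it lets the dominance spans be written in terms of the
  plethystic images of eigenvectors.\<close>

lemma dominance_span_unitriangular:
 assumes g: "\<And>\<kappa>. \<kappa> \<in> partitions n ==> g \<kappa> - schur \<kappa> \<in> strict_span \<kappa>"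
  and \<mu>: "\<mu> \<in> partitions n"
 shows "dominance_span \<mu> = symfun.span (g ` {\<nu> \<in> partitions n. dominates \<nu> \<mu>})"
proof
 have schur: "schur \<kappa> \<in> symfun.span (g ` {\<nu> \<in> partitions n. dominates \<nu> \<kappa>})" if "\<kappa> \<in> partitions n" for \<kappa>
  using that
 proof (induction "part_stat \<kappa>" arbitrary: \<kappa> rule: less_induct)
  case less
  let ?V = "symfun.span (g ` {\<nu> \<in> partitions n. dominates \<nu> \<kappa>})"
  have "schur \<nu> \<in> ?V" if "\<nu> \<in> partitions n" "dominates \<nu> \<kappa>" "\<nu> \<noteq> \<kappa>" for \<nu>
  proof -
   have "part_stat \<nu> < part_stat \<kappa>" by (rule dominates_part_stat(2)[OF that(1) less.prems(1) that(2,3)])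
   then have "schur \<nu> \<in> symfun.span (g ` {\<nu>' \<in> partitions n. dominates \<nu>' \<nu>})" using less.hyps that(1) by blast
   also have "\<dots> \<subseteq> ?V" using dominates_trans[OF _ that(2)] by (intro symfun.span_mono) blast
   finally show ?thesis .
  qed
  then have "schur ` {\<nu> \<in> partitions (sum_list \<kappa>). dominates \<nu> \<kappa> \<and> \<nu> \<noteq> \<kappa>} \<subseteq> ?V"
   using sum_list_partition[OF less.prems] by auto
  then have "strict_span \<kappa> \<subseteq> ?V"
   unfolding strict_span_def by (rule symfun.span_minimal) (rule symfun.subspace_span)
  then have "g \<kappa> - schur \<kappa> \<in> ?V" using g[OF less.prems] by blast
  moreover have "g \<kappa> \<in> ?V" using less.prems by (intro symfun.span_base) auto
  ultimately have "g \<kappa> - (g \<kappa> - schur \<kappa>) \<in> ?V" by (rule symfun.span_diff[rotated])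
  then show ?case by simp
 qed
 show "dominance_span \<mu> \<subseteq> symfun.span (g ` {\<nu> \<in> partitions n. dominates \<nu> \<mu>})"
  unfolding dominance_span_def
 proof (rule symfun.span_minimal[OF _ symfun.subspace_span], safe)
  fix \<nu> assume "\<nu> \<in> partitions (sum_list \<mu>)" and d: "dominates \<nu> \<mu>"
  then have "\<nu> \<in> partitions n" using sum_list_partition[OF \<mu>] by simp
  from schur[OF this] have "schur \<nu> \<in> symfun.span (g ` {\<nu>' \<in> partitions n. dominates \<nu>' \<nu>})" .
  also have "\<dots> \<subseteq> symfun.span (g ` {\<nu>' \<in> partitions n. dominates \<nu>' \<mu>})"
   using dominates_trans[OF _ d] by (intro symfun.span_mono) blast
  finally show "schur \<nu> \<in> symfun.span (g ` {\<nu>' \<in> partitions n. dominates \<nu>' \<mu>})" .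
 qed
 have "g \<nu> \<in> dominance_span \<mu>" if "\<nu> \<in> partitions n" "dominates \<nu> \<mu>" for \<nu>
 proof -
  have "g \<nu> - schur \<nu> \<in> dominance_span \<nu>" using g[OF that(1)] strict_span_subset by blast
  then have "g \<nu> - schur \<nu> + schur \<nu> \<in> dominance_span \<nu>"
   by (rule dominance_span_add) (rule schur_in_dominance_span[OF that(1)])
  then show ?thesis using dominance_span_mono[OF that(1) \<mu> that(2)] by auto
 qed
 then show "symfun.span (g ` {\<nu> \<in> partitions n. dominates \<nu> \<mu>}) \<subseteq> dominance_span \<mu>"
  unfolding dominance_span_def by (intro symfun.span_minimal symfun.subspace_span) auto
qed

section \<open>Conjugation reverses the dominance order\<close>

lemma diagram_take: "diagram (take l \<mu>) = {x \<in> diagram \<mu>. fst x < l}" by (auto simp: diagram_def)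

text \<open>Let l be the number of rows of \<mu> longer than k. The first l rows and the first k
  columns cover \<mu> and meet in the full l by k rectangle; for \<nu> they cover at most n boxes
  and meet in at most l k. So a gain of \<nu> in the rows is a loss in the columns.\<close>

lemma dominates_conjugate:
 assumes \<mu>: "\<mu> \<in> partitions n" and \<nu>: "\<nu> \<in> partitions n" and dom: "dominates \<nu> \<mu>"
 shows "dominates (conjugate_partition \<mu>) (conjugate_partition \<nu>)" unfolding dominates_def
proof
 fix k
 define R where "R \<kappa> l = {x \<in> diagram \<kappa>. fst x < l}" for \<kappa> l
 define C where "C \<kappa> = {x \<in> diagram \<kappa>. snd x < k}" for \<kappa>
 have fin [simp]: "finite (R \<kappa> l)" "finite (C \<kappa>)" for \<kappa> l by (simp_all add: R_def C_def)
 have R: "sum_list (take l \<kappa>) = card (R \<kappa> l)" for \<kappa> l by (simp add: R_def diagram_take[symmetric] card_diagram)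
 have C: "sum_list (take k (conjugate_partition \<kappa>)) = card (C \<kappa>)" if "\<kappa> \<in> partitions n" for \<kappa>
 proof -
  have "{x \<in> prod.swap ` diagram \<kappa>. fst x < k} = prod.swap ` C \<kappa>" by (auto simp: C_def image_iff)
  then show ?thesis unfolding card_diagram[symmetric] diagram_take conjugate_partition(2)[OF that]
   by (simp add: card_image)
 qed
 have "\<exists>m\<le>length \<mu>. \<forall>i<length \<mu>. k < \<mu> ! i \<longleftrightarrow> i < m"
 proof (rule down_closed_nat)
  fix i assume i: "Suc i < length \<mu>" "k < \<mu> ! Suc i"
  have "\<mu> ! Suc i \<le> \<mu> ! i" using \<mu> i sorted_wrt_nth_less[of "(\<ge>)" \<mu> i "Suc i"] by (auto simp: partitions_def)
  then show "k < \<mu> ! i" using i by simp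
 qed
 then obtain l where l: "l \<le> length \<mu>" "\<And>i. i < length \<mu> ==> k < \<mu> ! i \<longleftrightarrow> i < l" by blast
 have "R \<mu> l \<union> C \<mu> = diagram \<mu>" using l(2) by (fastforce simp: R_def C_def diagram_def)
 moreover have "R \<mu> l \<inter> C \<mu> = {..<l} \<times> {..<k}"
 proof -
  have "i < length \<mu> \<and> j < \<mu> ! i" if "i < l" "j < k" for i j using that l(1) l(2)[of i] by auto
  then show ?thesis by (auto simp: R_def C_def diagram_def)
 qed
 ultimately have 1: "card (R \<mu> l) + card (C \<mu>) = n + l * k"
  using card_Un_Int[of "R \<mu> l" "C \<mu>"] by (simp add: card_diagram sum_list_partition[OF \<mu>])
 have "card (R \<nu> l \<union> C \<nu>) \<le> card (diagram \<nu>)" by (rule card_mono) (auto simp: R_def C_def)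
 moreover have "card (R \<nu> l \<inter> C \<nu>) \<le> card ({..<l} \<times> {..<k})" by (rule card_mono) (auto simp: R_def C_def)
 ultimately have 2: "card (R \<nu> l) + card (C \<nu>) \<le> n + l * k"
  using card_Un_Int[of "R \<nu> l" "C \<nu>"] by (simp add: card_diagram sum_list_partition[OF \<nu>])
 have "card (R \<mu> l) \<le> card (R \<nu> l)" using dom unfolding dominates_def R by blast
 then show "sum_list (take k (conjugate_partition \<nu>)) \<le> sum_list (take k (conjugate_partition \<mu>))"
  using 1 2 unfolding C[OF \<mu>] C[OF \<nu>] by simp
qed

section \<open>Common eigenvectors of the two triangularities\<close>

abbreviation "D_0 \<equiv> D_op q_var t_var 0"
abbreviation "e_val \<equiv> op_eigenvalue q_var t_var"

lemma linear_D_op: "sym_linear (D_op q t j)"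
 and linear_dual_D_op: "sym_linear (dual_D_op q t j)"
 and linear_reduced_op: "sym_linear (reduced_op q t j)"
 unfolding D_op_def dual_D_op_def reduced_op_def by (rule linear_vertex_op)+

lemma is_sym_hom_linear:
 "is_sym_hom (%c. scale_sym c 1) \<phi> ==> Vector_Spaces.linear scale_sym (scale_sym :: 'a :: field => _) \<phi>"
 unfolding Vector_Spaces.linear_iff
 by (simp add: is_sym_homD vector_space_scale_sym scale_sym_eq_mult[symmetric])

lemma linear_plethysm: "sym_linear (plethysm_one_minus u)"
 by (rule is_sym_hom_linear[OF plethysm_one_minus(1)])

lemma bij_plethysm: "bij (plethysm_one_minus q_var)" "bij (plethysm_one_minus t_var)"
 using q_t_power_neq by (auto intro!: plethysm_one_minus_bij)

lemma e_val_inj: "inj_on e_val all_partitions"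
proof (rule inj_onI)
 fix \<mu> \<nu> assume p: "\<mu> \<in> all_partitions" "\<nu> \<in> all_partitions" and "e_val \<mu> = e_val \<nu>"
 then have "(1 - q_var) * (1 - t_var) * box_sum q_var t_var \<mu> = (1 - q_var) * (1 - t_var) * box_sum q_var t_var \<nu>"
  unfolding op_eigenvalue_box_sum by simp
 moreover have "(1 - q_var) * (1 - t_var) \<noteq> 0" using q_t_power_neq(1,2)[of 1] by auto
 ultimately have "box_sum q_var t_var \<mu> = box_sum q_var t_var \<nu>" by (metis mult_left_cancel)
 then show "\<mu> = \<nu>" by (rule box_sum_inj[OF p])
qed

lemma ex_plethystic_eigenvector:
 assumes u: "bij (plethysm_one_minus q)" and e: "inj_on (op_eigenvalue q t) (partitions n)"
  and \<mu>: "\<mu> \<in> partitions n"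
 shows "\<exists>f. plethysm_one_minus q f - schur \<mu> \<in> strict_span \<mu> \<and>
  D_op q t 0 f = scale_sym (op_eigenvalue q t \<mu>) f"
proof -
 interpret P: Vector_Spaces.linear scale_sym scale_sym "plethysm_one_minus q" by (rule linear_plethysm)
 obtain g where g: "g - schur \<mu> \<in> strict_span \<mu>" "reduced_op q t 0 g = scale_sym (op_eigenvalue q t \<mu>) g"
  using triangular_eigenvector[OF linear_reduced_op reduced_op_schur[of _ n] e \<mu>] by blast
 obtain f where f: "g = plethysm_one_minus q f" using bij_is_surj[OF u] by (metis surjD)
 have "plethysm_one_minus q (D_op q t 0 f) = plethysm_one_minus q (scale_sym (op_eigenvalue q t \<mu>) f)"
  unfolding plethysm_D_op f[symmetric] g(2) P.scale by (rule refl)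
 then have "D_op q t 0 f = scale_sym (op_eigenvalue q t \<mu>) f" using bij_is_inj[OF u] by (metis injD)
 then show ?thesis using g(1) f by blast
qed

text \<open>Normalised by its leading term s_\<mu> after the substitution X -> X (1 - q). It differs
  from \<open>macdonald \<mu>\<close> by a nonzero scalar (\<open>macdonald_eig\<close>), which the
  eigenvalue equation of nabla does not see.\<close>

definition eig :: "nat list => qt symfun" where
 "eig \<mu> = (SOME f. plethysm_one_minus q_var f - schur \<mu> \<in> strict_span \<mu> \<and> D_0 f = scale_sym (e_val \<mu>) f)"

lemma eig:
 assumes "\<mu> \<in> partitions n"
 shows "plethysm_one_minus q_var (eig \<mu>) - schur \<mu> \<in> strict_span \<mu>"
  and D_0_eig: "D_0 (eig \<mu>) = scale_sym (e_val \<mu>) (eig \<mu>)"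
proof -
 have "inj_on e_val (partitions n)" by (rule inj_on_subset[OF e_val_inj]) (auto simp: all_partitions_def)
 from someI_ex[OF ex_plethystic_eigenvector[OF bij_plethysm(1) this assms]]
 show "plethysm_one_minus q_var (eig \<mu>) - schur \<mu> \<in> strict_span \<mu>"
  "D_0 (eig \<mu>) = scale_sym (e_val \<mu>) (eig \<mu>)" unfolding eig_def[symmetric] by blast+
qed

lemma schur_not_in_strict_span:
 assumes "\<mu> \<in> partitions n"
 shows "schur \<mu> \<notin> strict_span \<mu>"
proof
 assume "schur \<mu> \<in> strict_span \<mu>"
 from span_explicit_family[OF this[unfolded strict_span_def]]
 obtain S and c :: "nat list => qt" where S: "finite S"
  "S \<subseteq> {\<nu> \<in> partitions (sum_list \<mu>). dominates \<nu> \<mu> \<and> \<nu> \<noteq> \<mu>}"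
  "schur \<mu> = (\<Sum>\<nu>\<in>S. scale_sym (c \<nu>) (schur \<nu>))" by blast
 have "hall (schur \<mu>) (schur \<mu>) = (\<Sum>\<nu>\<in>S. c \<nu> * hall (schur \<mu>) (schur \<nu>))"
  by (subst (2) S(3)) (simp add: hall_sum_right hall_linear)
 also have "\<dots> = 0"
 proof (intro sum.neutral ballI)
  fix \<nu> assume "\<nu> \<in> S"
  then have "\<mu> \<in> all_partitions" "\<nu> \<in> all_partitions" "\<nu> \<noteq> \<mu>" using S(2) assms by (auto simp: all_partitions_def)
  then show "c \<nu> * hall (schur \<mu>) (schur \<nu>) = 0" by (simp add: hall_schur)
 qed
 finally have "hall (schur \<mu>) (schur \<mu>) = 0" .
 moreover have "\<mu> \<in> all_partitions" using assms by (auto simp: all_partitions_def)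
 ultimately show False using hall_schur[of \<mu> \<mu>] by simp
qed

lemma eig_nonzero: "\<mu> \<in> partitions n ==> eig \<mu> \<noteq> 0"
proof
 assume \<mu>: "\<mu> \<in> partitions n" and "eig \<mu> = 0"
 then have "- schur \<mu> \<in> strict_span \<mu>"
  using eig(1)[OF \<mu>] by (simp add: is_sym_homD[OF plethysm_one_minus(1)])
 from strict_span_scale[OF this, of "- 1"] show False
  using schur_not_in_strict_span[OF \<mu>] by simp
qed

lemma linear_inj_span:
 assumes "sym_linear \<phi>" "inj \<phi>"
 shows "\<phi> f \<in> symfun.span ((%x. \<phi> (g x)) ` A) \<longleftrightarrow> f \<in> symfun.span (g ` A)"
proof -
 interpret L: Vector_Spaces.linear scale_sym scale_sym \<phi> by (rule assms)
 have "symfun.span (\<phi> ` (g ` A)) = \<phi> ` symfun.span (g ` A)" by (rule L.span_image)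
 then show ?thesis using assms(2) by (auto simp: image_image inj_def)
qed

lemma dominance_span_eig:
 "\<mu> \<in> partitions n ==> dominance_span \<mu> =
  symfun.span ((%\<nu>. plethysm_one_minus q_var (eig \<nu>)) ` {\<nu> \<in> partitions n. dominates \<nu> \<mu>})"
 by (rule dominance_span_unitriangular[OF eig(1)])

lemma plethysm_dominance_span_iff:
 assumes "\<mu> \<in> partitions n"
 shows "plethysm_one_minus q_var f \<in> dominance_span \<mu> \<longleftrightarrow> f \<in> symfun.span (eig ` {\<nu> \<in> partitions n. dominates \<nu> \<mu>})"
 unfolding dominance_span_eig[OF assms]
 by (rule linear_inj_span[OF linear_plethysm bij_is_inj[OF bij_plethysm(1)]])

lemma span_eig: "symfun.span (eig ` all_partitions) = UNIV"
proof -
 have "schur \<mu> \<in> symfun.span ((%\<mu>. plethysm_one_minus q_var (eig \<mu>)) ` all_partitions)"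
  if \<mu>: "\<mu> \<in> partitions n" for \<mu> n
 proof -
  have "schur \<mu> \<in> symfun.span ((%\<mu>. plethysm_one_minus q_var (eig \<mu>)) ` {\<nu> \<in> partitions n. dominates \<nu> \<mu>})"
   using schur_in_dominance_span[OF \<mu>] unfolding dominance_span_eig[OF \<mu>] .
  also have "\<dots> \<subseteq> symfun.span ((%\<mu>. plethysm_one_minus q_var (eig \<mu>)) ` all_partitions)"
   by (rule symfun.span_mono) (auto simp: all_partitions_def)
  finally show ?thesis .
 qed
 then have "symfun.span (schur ` all_partitions) \<subseteq> symfun.span ((%\<mu>. plethysm_one_minus q_var (eig \<mu>)) ` all_partitions)"
  by (intro symfun.span_minimal symfun.subspace_span) (auto simp: all_partitions_def)
 then have "plethysm_one_minus q_var f \<in> symfun.span ((%\<mu>. plethysm_one_minus q_var (eig \<mu>)) ` all_partitions)" for f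
  unfolding span_schur by blast
 then show ?thesis unfolding linear_inj_span[OF linear_plethysm bij_is_inj[OF bij_plethysm(1)]] by blast
qed

text \<open>D_0 is symmetric in q and t, so eigenvectors triangular for X (1 - t) exist too.
  Transposing the diagram exchanges q and t in the eigenvalues, which are distinct; hence the
  eigenvector for the conjugate of \<nu> is a multiple of \<open>eig \<nu>\<close>.\<close>

lemma plethysm_t_dominance_span_iff:
 assumes "\<mu> \<in> partitions n"
 shows "plethysm_one_minus t_var f \<in> dominance_span (conjugate_partition \<mu>) \<longleftrightarrow>
  f \<in> symfun.span (eig ` {\<nu> \<in> partitions n. dominates (conjugate_partition \<nu>) (conjugate_partition \<mu>)})"
proof -
 have e: "inj_on (op_eigenvalue t_var q_var) (partitions n)"
 proof (rule inj_onI)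
  fix \<mu> \<nu> assume p: "\<mu> \<in> partitions n" "\<nu> \<in> partitions n" and "op_eigenvalue t_var q_var \<mu> = op_eigenvalue t_var q_var \<nu>"
  then have "e_val (conjugate_partition \<mu>) = e_val (conjugate_partition \<nu>)" by (simp add: op_eigenvalue_conjugate)
  moreover have "conjugate_partition \<mu> \<in> all_partitions" "conjugate_partition \<nu> \<in> all_partitions"
   using p[THEN conjugate_partition(1)] by (auto simp: all_partitions_def)
  ultimately have "conjugate_partition \<mu> = conjugate_partition \<nu>" by (rule inj_onD[OF e_val_inj])
  then show "\<mu> = \<nu>" using conjugate_conjugate p by metis
 qed
 have "\<forall>\<kappa>\<in>partitions n. \<exists>f. plethysm_one_minus t_var f - schur \<kappa> \<in> strict_span \<kappa> \<and>
   D_0 f = scale_sym (op_eigenvalue t_var q_var \<kappa>) f"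
  using ex_plethystic_eigenvector[OF bij_plethysm(2) e] by (simp add: D_op_swap[of q_var])
 then obtain f' where f': "\<And>\<kappa>. \<kappa> \<in> partitions n ==> plethysm_one_minus t_var (f' \<kappa>) - schur \<kappa> \<in> strict_span \<kappa>"
  "\<And>\<kappa>. \<kappa> \<in> partitions n ==> D_0 (f' \<kappa>) = scale_sym (op_eigenvalue t_var q_var \<kappa>) (f' \<kappa>)" by metis
 have f'_eig: "\<exists>c. c \<noteq> 0 \<and> f' (conjugate_partition \<nu>) = scale_sym c (eig \<nu>)" if \<nu>: "\<nu> \<in> partitions n" for \<nu>
 proof -
  note \<nu>' = conjugate_partition(1)[OF \<nu>]
  have ev: "D_0 (f' (conjugate_partition \<nu>)) = scale_sym (e_val \<nu>) (f' (conjugate_partition \<nu>))"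
   using f'(2)[OF \<nu>'] \<nu> by (simp add: op_eigenvalue_conjugate)
  have "\<exists>c. f' (conjugate_partition \<nu>) = scale_sym c (eig \<nu>)"
   by (rule eigenvector_in_span[OF linear_D_op _ e_val_inj _ _ ev])
    (use \<nu> D_0_eig eig_nonzero span_eig in \<open>auto simp: all_partitions_def\<close>)
  moreover have "f' (conjugate_partition \<nu>) \<noteq> 0"
  proof
   assume "f' (conjugate_partition \<nu>) = 0"
   then have "- schur (conjugate_partition \<nu>) \<in> strict_span (conjugate_partition \<nu>)"
    using f'(1)[OF \<nu>'] by (simp add: is_sym_homD[OF plethysm_one_minus(1)])
   from strict_span_scale[OF this, of "- 1"] show False
    using schur_not_in_strict_span[OF \<nu>'] by simp
  qed
  ultimately show ?thesis by force
 qed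
 have span_f': "dominance_span (conjugate_partition \<mu>) = symfun.span ((%\<kappa>. plethysm_one_minus t_var (f' \<kappa>)) `
   {\<kappa> \<in> partitions n. dominates \<kappa> (conjugate_partition \<mu>)})"
  by (rule dominance_span_unitriangular[OF f'(1) conjugate_partition(1)[OF assms]])
 have "plethysm_one_minus t_var f \<in> dominance_span (conjugate_partition \<mu>) \<longleftrightarrow>
   f \<in> symfun.span (f' ` {\<kappa> \<in> partitions n. dominates \<kappa> (conjugate_partition \<mu>)})"
  unfolding span_f' by (rule linear_inj_span[OF linear_plethysm bij_is_inj[OF bij_plethysm(2)]])
 also have "symfun.span (f' ` {\<kappa> \<in> partitions n. dominates \<kappa> (conjugate_partition \<mu>)}) =
  symfun.span (eig ` {\<nu> \<in> partitions n. dominates (conjugate_partition \<nu>) (conjugate_partition \<mu>)})"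
 proof (rule antisym; rule symfun.span_minimal[OF _ symfun.subspace_span]; safe)
  fix \<kappa> assume \<kappa>: "\<kappa> \<in> partitions n" "dominates \<kappa> (conjugate_partition \<mu>)"
  note \<kappa>' = conjugate_partition(1)[OF \<kappa>(1)] conjugate_conjugate[OF \<kappa>(1)]
  obtain c where "f' \<kappa> = scale_sym c (eig (conjugate_partition \<kappa>))" using f'_eig[OF \<kappa>'(1)] unfolding \<kappa>'(2) by blast
  then show "f' \<kappa> \<in> symfun.span (eig ` {\<nu> \<in> partitions n. dominates (conjugate_partition \<nu>) (conjugate_partition \<mu>)})"
   using \<kappa>' \<kappa>(2) by (simp only:) (rule symfun.span_scale, rule symfun.span_base, simp)
 next
  fix \<nu> assume \<nu>: "\<nu> \<in> partitions n" "dominates (conjugate_partition \<nu>) (conjugate_partition \<mu>)"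
  obtain c where c: "c \<noteq> 0" "f' (conjugate_partition \<nu>) = scale_sym c (eig \<nu>)" using f'_eig[OF \<nu>(1)] by blast
  have "eig \<nu> = scale_sym (inverse c) (f' (conjugate_partition \<nu>))" using c by simp
  moreover have "f' (conjugate_partition \<nu>) \<in> symfun.span (f' ` {\<kappa> \<in> partitions n. dominates \<kappa> (conjugate_partition \<mu>)})"
   using \<nu> conjugate_partition(1)[OF \<nu>(1)] by (intro symfun.span_base) simp
  ultimately show "eig \<nu> \<in> symfun.span (f' ` {\<kappa> \<in> partitions n. dominates \<kappa> (conjugate_partition \<mu>)})"
   by (simp only: symfun.span_scale)
 qed
 finally show ?thesis .
qed

lemma eig_independent:
 "finite S ==> S \<subseteq> all_partitions ==> (\<Sum>i\<in>S. scale_sym (c i) (eig i)) = 0 ==> \<forall>i\<in>S. c i = 0"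
 by (rule eigenvectors_independent[of D_0 all_partitions eig e_val, OF linear_D_op _ e_val_inj])
  (auto simp: all_partitions_def D_0_eig dest: eig_nonzero)

text \<open>In the basis \<open>eig\<close> both conditions become spans of index sets; as
  conjugation reverses dominance, these sets have only \<mu> in common.\<close>

lemma eig_characterization:
 assumes "\<mu> \<in> partitions n"
 shows "plethysm_one_minus q_var f \<in> dominance_span \<mu> \<and>
   plethysm_one_minus t_var f \<in> dominance_span (conjugate_partition \<mu>) \<longleftrightarrow> (\<exists>c. f = scale_sym c (eig \<mu>))"
proof -
 let ?A = "{\<nu> \<in> partitions n. dominates \<nu> \<mu>}"
  and ?B = "{\<nu> \<in> partitions n. dominates (conjugate_partition \<nu>) (conjugate_partition \<mu>)}"
 have "\<nu> = \<mu>" if "\<nu> \<in> ?A \<inter> ?B" for \<nu>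
 proof -
  have \<nu>: "\<nu> \<in> partitions n" using that by simp
  have "conjugate_partition \<nu> = conjugate_partition \<mu>"
   using that dominates_conjugate[OF assms \<nu>]
   by (intro dominates_antisym[OF conjugate_partition(1)[OF \<nu>] conjugate_partition(1)[OF assms]]) auto
  then show ?thesis using conjugate_conjugate assms \<nu> by metis
 qed
 then have AB: "?A \<inter> ?B = {\<mu>}" using assms by auto
 have "f \<in> symfun.span (eig ` ?A) \<and> f \<in> symfun.span (eig ` ?B) \<longleftrightarrow> (\<exists>c. f = scale_sym c (eig \<mu>))"
 proof
  assume "f \<in> symfun.span (eig ` ?A) \<and> f \<in> symfun.span (eig ` ?B)"
  then have "f \<in> symfun.span (eig ` (?A \<inter> ?B))"
   using eig_independent by (intro span_family_Int[where I = all_partitions]) (auto simp: all_partitions_def)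
  then show "\<exists>c. f = scale_sym c (eig \<mu>)" unfolding AB by (auto simp: symfun.span_singleton)
 next
  have "eig \<mu> \<in> symfun.span (eig ` ?A)" "eig \<mu> \<in> symfun.span (eig ` ?B)"
   using assms by (auto intro: symfun.span_base)
  then show "f \<in> symfun.span (eig ` ?A) \<and> f \<in> symfun.span (eig ` ?B)" if "\<exists>c. f = scale_sym c (eig \<mu>)"
   using that by (auto simp only: symfun.span_scale)
 qed
 then show ?thesis unfolding plethysm_dominance_span_iff[OF assms] plethysm_t_dominance_span_iff[OF assms] .
qed

section \<open>Operators on products of elementary functions\<close>

text \<open>(q^a - t^a) / (q - t) as a polynomial.\<close>

definition qt_num :: "'a :: comm_ring_1 => 'a => nat => 'a" where
 "qt_num q t a = (\<Sum>i<a. q ^ i * t ^ (a - 1 - i))"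

lemma qt_num_Suc: "qt_num q t (Suc a) = t * qt_num q t a + q ^ a"
proof -
 have "(\<Sum>i<a. q ^ i * t ^ (a - i)) = t * qt_num q t a" unfolding qt_num_def sum_distrib_left
 proof (rule sum.cong[OF refl])
  fix i assume "i \<in> {..<a}"
  then have "a - i = Suc (a - 1 - i)" by auto
  then show "q ^ i * t ^ (a - i) = t * (q ^ i * t ^ (a - 1 - i))" by (simp add: mult_ac)
 qed
 then show ?thesis by (simp add: qt_num_def)
qed

lemma qt_num_0 [simp]: "qt_num q t 0 = 0" by (simp add: qt_num_def)

text \<open>The series (1 - z) (1 - q t z) / ((1 - q z) (1 - t z)), with \<open>\<alpha>\<close> and
  \<open>\<beta>\<close> the coefficients of the factors (1 - z) / (1 - q z) and (1 - q t z) / (1 -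
  t z).\<close>

lemma scalar_exp_minus_M:
 "scalar_exp (%i. - ((1 - q ^ i) * (1 - t ^ i))) n = (if n = 0 then 1 else - ((1 - q) * (1 - t) * qt_num q t n))"
proof -
 define \<alpha> where "\<alpha> = scalar_exp (%i. q ^ i - 1 ^ i)"
 define \<beta> where "\<beta> = scalar_exp (%i. t ^ i - (q * t) ^ i)"
 have \<alpha>: "\<alpha> n = (if n = 0 then 1 else q ^ (n - 1) * (q - 1))" for n unfolding \<alpha>_def scalar_exp_diff by simp
 have \<beta>: "\<beta> n = (if n = 0 then 1 else t ^ (n - 1) * (t - q * t))" for n unfolding \<beta>_def scalar_exp_diff by simp
 have rec: "(\<Sum>i\<le>Suc n. \<alpha> i * \<beta> (Suc n - i)) = - ((1 - q) * (1 - t) * qt_num q t (Suc n))" for n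
 proof (induction n)
  case 0
  then show ?case by (simp add: \<alpha> \<beta> qt_num_def algebra_simps)
 next
  case (Suc n)
  have "(\<Sum>i\<le>Suc (Suc n). \<alpha> i * \<beta> (Suc (Suc n) - i)) =
   (\<Sum>i\<le>n. \<alpha> i * \<beta> (Suc (Suc n) - i)) + \<alpha> (Suc n) * \<beta> 1 + \<alpha> (Suc (Suc n))"
   by (simp add: \<beta>[of 0])
  also have "(\<Sum>i\<le>n. \<alpha> i * \<beta> (Suc (Suc n) - i)) = t * (\<Sum>i\<le>n. \<alpha> i * \<beta> (Suc n - i))"
   unfolding sum_distrib_left
  proof (rule sum.cong[OF refl])
   fix i assume "i \<in> {..n}"
   then have "Suc (Suc n) - i = Suc (Suc (n - i))" "Suc n - i = Suc (n - i)" by auto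
   then show "\<alpha> i * \<beta> (Suc (Suc n) - i) = t * (\<alpha> i * \<beta> (Suc n - i))" by (simp add: \<beta> mult_ac)
  qed
  also have "(\<Sum>i\<le>n. \<alpha> i * \<beta> (Suc n - i)) = (\<Sum>i\<le>Suc n. \<alpha> i * \<beta> (Suc n - i)) - \<alpha> (Suc n)"
   by (simp add: \<beta>[of 0])
  finally show ?case unfolding Suc.IH qt_num_Suc[of q t "Suc n"]
   by (simp add: \<alpha> \<beta> algebra_simps)
 qed
 have "is_exp (%i. (q ^ i - 1 ^ i) + (t ^ i - (q * t) ^ i)) (%n. \<Sum>i\<le>n. \<alpha> i * \<beta> (n - i))"
  unfolding \<alpha>_def \<beta>_def by (rule is_exp_mult[OF scalar_exp scalar_exp])
 from scalar_exp_unique[OF this, of "%i. - ((1 - q ^ i) * (1 - t ^ i))" n]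
 have "scalar_exp (%i. - ((1 - q ^ i) * (1 - t ^ i))) n = (\<Sum>i\<le>n. \<alpha> i * \<beta> (n - i))"
  by (simp add: power_mult_distrib algebra_simps)
 then show ?thesis using rec by (cases n) (auto simp: \<alpha> \<beta>)
qed

text \<open>\<open>quo\<close> describes \<open>(1 - D) / ((1 - q) (1 - t))\<close> on products of the \<open>(- 1)\<^sup>n e\<^sub>n\<close>, which makes
 sense over any ring and commutes with specialisations of \<open>q\<close> and \<open>t\<close>.\<close>

fun quo :: "'a :: comm_ring_1 => 'a => nat list => (nat => nat list => 'a) => 'a" where
 "quo q t [] F = 0"
| "quo q t (b # v) F = quo q t v (%k xs. F k (b # xs)) +
  (\<Sum>a\<in>{1..b}. qt_num q t a * (F a ((b - a) # v) - (1 - q) * (1 - t) * quo q t v (%k xs. F (k + a) ((b - a) # xs))))"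

text \<open>Covers the specialisations of the parameters as well as the linear functionals that turn
  multiplication by the constant symmetric functions q and t into multiplication by scalars.\<close>

lemma quo_natural:
 fixes T :: "'a :: comm_ring_1 => 'b :: comm_ring_1"
 assumes add: "\<And>x y. T (x + y) = T x + T y" and q: "\<And>x. T (q * x) = q' * T x" and t: "\<And>x. T (t * x) = t' * T x"
 shows "T (quo q t l F) = quo q' t' l (%k xs. T (F k xs))"
proof -
 have 0: "T 0 = 0" using add[of 0 0] by simp
 have minus: "T (x - y) = T x - T y" for x y using add[of "x - y" y] by simp
 have sum: "T (sum f A) = (\<Sum>x\<in>A. T (f x))" for f and A :: "nat set"
  by (induction A rule: infinite_finite_induct) (simp_all add: 0 add)
 have qp: "T (q ^ i * x) = q' ^ i * T x" "T (t ^ i * x) = t' ^ i * T x" for i x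
  by (induction i) (simp_all add: q t mult.assoc)
 have num: "T (qt_num q t a * x) = qt_num q' t' a * T x" for a x
  by (simp add: qt_num_def sum_distrib_right sum mult.assoc qp)
 have M: "T ((1 - q) * (1 - t) * x) = (1 - q') * (1 - t') * T x" for x
 proof -
  have "T ((1 - q) * (1 - t) * x) = T (x - q * x - t * x + q * (t * x))" by (simp add: algebra_simps)
  then show ?thesis by (simp add: add minus q t algebra_simps)
 qed
 show ?thesis by (induction l arbitrary: F) (simp_all add: 0 add sum num minus M)
qed

lemma quo_cong:
 assumes "\<And>k xs. k + sum_list xs = sum_list l ==> F k xs = G k xs"
 shows "quo q t l F = quo q t l G" using assms
proof (induction l arbitrary: F G)
 case (Cons b v)
 have "quo q t v (%k xs. F k (b # xs)) = quo q t v (%k xs. G k (b # xs))"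
  by (rule Cons.IH) (simp add: Cons.prems)
 moreover have "F a ((b - a) # v) = G a ((b - a) # v)" if "a \<in> {1..b}" for a
  using that by (intro Cons.prems) simp
 moreover have "quo q t v (%k xs. F (k + a) ((b - a) # xs)) = quo q t v (%k xs. G (k + a) ((b - a) # xs))"
  if "a \<in> {1..b}" for a using that by (intro Cons.IH Cons.prems) simp
 ultimately show ?case by simp
qed simp

definition elem :: "nat => 'a :: field_char_0 symfun" where
 "elem = sym_exp (%_. - 1)"

abbreviation elem_list :: "nat list => 'a :: field_char_0 symfun" where
 "elem_list l \<equiv> prod_list (map elem l)"

lemma translate_elem:
 "translate (M_alphabet q t) k (elem n) =
  (if k \<le> n then scale_sym (if k = 0 then 1 else - ((1 - q) * (1 - t) * qt_num q t k)) (elem (n - k)) else 0)"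
proof -
 have "(%i. - 1 * M_alphabet q t i) = (%i. - ((1 - q ^ i) * (1 - t ^ i)))"
  by (rule ext) (simp add: M_alphabet_def)
 then show ?thesis unfolding elem_def translate_sym_exp by (simp add: scalar_exp_minus_M)
qed

abbreviation "const_sym c \<equiv> scale_sym c 1"

lemma const_sym_simps:
 "const_sym (a + b) = const_sym a + const_sym b" "const_sym (a * b) = const_sym a * const_sym (b :: 'a :: field)"
 "const_sym (a - b) = const_sym a - const_sym b" "const_sym (1 :: 'a) = 1" "const_sym (- a) = - const_sym a"
 by (simp_all add: symfun.scale_left_distrib symfun.scale_left_diff_distrib scale_sym_times)

lemma const_sym_qt_num: "const_sym (qt_num q t n) = qt_num (const_sym q) (const_sym (t :: 'a :: field)) n"
 by (induction n) (simp_all add: qt_num_Suc const_sym_simps scale_sym_power)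

text \<open>The origin of \<open>quo\<close>: each factor that is really translated contributes a
  multiple of (1 - q) (1 - t). So all terms but the untranslated one are divisible by it, and the
  recursion distinguishes whether the first factor is translated.\<close>

lemma translate_elem_list:
 assumes "sum_list l \<le> N"
 shows "(\<Sum>i\<le>N. G i * translate (M_alphabet q t) i (elem_list l)) = G 0 * elem_list l -
  (1 - const_sym q) * (1 - const_sym t) * quo (const_sym q) (const_sym t) l (%k xs. G k * elem_list xs)"
 using assms
proof (induction l arbitrary: G N)
 case Nil
 have "(\<Sum>i\<le>N. G i * translate (M_alphabet q t) i 1) = (\<Sum>i\<le>N. if i = 0 then G 0 else 0)"
  by (rule sum.cong) (simp_all add: translate_one)
 then show ?case by simp
next
 case (Cons b v)
 define m where "m = (1 - const_sym q) * (1 - const_sym t)"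
 define X where "X a = G a * elem_list ((b - a) # v) -
  m * quo (const_sym q) (const_sym t) v (%k xs. G (k + a) * elem_list ((b - a) # xs))" for a
 define \<zeta> where "\<zeta> a = (if a = 0 then 1 else - (m * qt_num (const_sym q) (const_sym t) a))" for a
 have \<zeta>: "translate (M_alphabet q t) a (elem b) = (if a \<le> b then \<zeta> a * elem (b - a) else 0)" for a
  unfolding translate_elem \<zeta>_def m_def
  by (simp add: scale_sym_eq_mult[of _ "elem _"] const_sym_simps const_sym_qt_num)
 let ?\<tau> = "translate (M_alphabet q t)"
 have "(\<Sum>i\<le>N. G i * ?\<tau> i (elem b * elem_list v)) =
   (\<Sum>i\<le>N. \<Sum>a\<le>i. G (a + (i - a)) * (?\<tau> a (elem b) * ?\<tau> (i - a) (elem_list v)))"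
  by (intro sum.cong refl) (simp add: translate_mult sum_distrib_left)
 also have "\<dots> = (\<Sum>(a, i)\<in>{(a, i). a + i \<le> N}. G (a + i) * (?\<tau> a (elem b) * ?\<tau> i (elem_list v)))"
  by (rule sum.triangle_reindex_eq[symmetric])
 also have "{(a, i). a + i \<le> N} = (SIGMA a:{..N}. {..N - a})" by auto
 also have "(\<Sum>(a, i)\<in>(SIGMA a:{..N}. {..N - a}). G (a + i) * (?\<tau> a (elem b) * ?\<tau> i (elem_list v))) =
   (\<Sum>a\<le>N. \<Sum>i\<le>N - a. G (a + i) * (?\<tau> a (elem b) * ?\<tau> i (elem_list v)))"
  by (rule sum.Sigma[symmetric]) auto
 also have "\<dots> = (\<Sum>a\<le>b. \<zeta> a * (\<Sum>i\<le>N - a. (G (i + a) * elem (b - a)) * ?\<tau> i (elem_list v)))"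
  using Cons.prems by (intro sum.mono_neutral_cong_right) (auto simp: \<zeta> sum_distrib_left mult_ac add.commute intro!: sum.cong)
 also have "\<dots> = (\<Sum>a\<le>b. \<zeta> a * (G a * elem_list ((b - a) # v) -
   m * quo (const_sym q) (const_sym t) v (%k xs. G (k + a) * elem_list ((b - a) # xs))))"
 proof (intro sum.cong refl)
  fix a assume "a \<in> {..b}"
  then have "sum_list v \<le> N - a" using Cons.prems by simp
  from Cons.IH[OF this, of "%i. G (i + a) * elem (b - a)"]
  show "\<zeta> a * (\<Sum>i\<le>N - a. (G (i + a) * elem (b - a)) * ?\<tau> i (elem_list v)) =
    \<zeta> a * (G a * elem_list ((b - a) # v) -
    m * quo (const_sym q) (const_sym t) v (%k xs. G (k + a) * elem_list ((b - a) # xs)))"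
   by (simp add: m_def mult.assoc)
 qed
 also have "\<dots> = (\<Sum>a\<le>b. \<zeta> a * X a)" by (simp add: X_def)
 also have "\<dots> = X 0 - m * (\<Sum>a\<in>{1..b}. qt_num (const_sym q) (const_sym t) a * X a)"
  unfolding sum_atMost_split by (simp add: \<zeta>_def sum_distrib_left sum_negf mult.assoc)
 also have "\<dots> = G 0 * elem_list (b # v) - m * quo (const_sym q) (const_sym t) (b # v) (%k xs. G k * elem_list xs)"
  unfolding quo.simps m_def[symmetric] X_def by (simp add: distrib_left)
 finally show ?case by (simp add: m_def)
qed

lemma D_op_elem_list:
 "D_op q t j (elem_list l) = (if j = 0 then elem_list l else 0) - (1 - const_sym q) * (1 - const_sym t) *
  quo (const_sym q) (const_sym t) l (%k xs. (if j \<le> k then elem (k - j) else 0) * elem_list xs)"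
proof -
 define N where "N = max (degree (translation (M_alphabet q t) (elem_list l))) (sum_list l)"
 have "D_op q t j (elem_list l) = (\<Sum>i\<le>N. if j \<le> i then elem (i - j) * translate (M_alphabet q t) i (elem_list l) else 0)"
  unfolding D_op_def elem_def[symmetric] by (rule vertex_op_eq) (simp add: N_def)
 also have "\<dots> = (\<Sum>i\<le>N. (if j \<le> i then elem (i - j) else 0) * translate (M_alphabet q t) i (elem_list l))"
  by (intro sum.cong) auto
 also have "\<dots> = (if j \<le> 0 then elem (0 - j) else 0) * elem_list l - (1 - const_sym q) * (1 - const_sym t) *
  quo (const_sym q) (const_sym t) l (%k xs. (if j \<le> k then elem (k - j) else 0) * elem_list xs)"
  by (rule translate_elem_list) (simp add: N_def)
 finally show ?thesis by (simp add: elem_def)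
qed

section \<open>Homogeneous symmetric functions\<close>

definition homogeneous :: "nat => 'a :: comm_ring_1 symfun => bool" where
 "homogeneous n f \<longleftrightarrow> (\<forall>M. size M \<noteq> n --> mcoeff f M = 0)"

lemma homogeneous_add: "homogeneous n f ==> homogeneous n g ==> homogeneous n (f + g)"
 and homogeneous_scale: "homogeneous n f ==> homogeneous n (scale_sym c f)"
 and homogeneous_0 [simp]: "homogeneous n 0" and homogeneous_1: "homogeneous 0 1"
 by (auto simp: homogeneous_def plus_symfun.rep_eq scale_sym.rep_eq zero_symfun.rep_eq one_symfun.rep_eq)

lemma homogeneous_mult:
 assumes "homogeneous m f" "homogeneous n g"
 shows "homogeneous (m + n) (f * g)" unfolding homogeneous_def
proof (intro allI impI)
 fix M :: "nat multiset" assume M: "size M \<noteq> m + n"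
 show "mcoeff (f * g) M = 0" unfolding times_symfun.rep_eq
 proof (intro sum.neutral ballI)
  fix A assume "A \<in> {A. A \<subseteq># M}"
  then have "size M = size A + size (M - A)" by (metis mem_Collect_eq size_union subset_mset.add_diff_inverse)
  then have "size A \<noteq> m \<or> size (M - A) \<noteq> n" using M by auto
  then show "mcoeff f A * mcoeff g (M - A) = 0" using assms by (auto simp: homogeneous_def)
 qed
qed

lemma homogeneous_span:
 assumes "f \<in> symfun.span B" "\<And>b. b \<in> B ==> homogeneous n b"
 shows "homogeneous n f"
 using assms by (induction rule: symfun.span_induct_alt) (auto intro: homogeneous_add homogeneous_scale)

lemma homogeneous_elem_list: "homogeneous (sum_list l) (elem_list l)"
proof (induction l)
 case (Cons b l)
 have "homogeneous b (scale_sym ((- 1) ^ b) (elementary_sym b) :: 'a symfun)"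
  by (rule homogeneous_scale) (auto simp: homogeneous_def elementary_sym.rep_eq)
 then have "homogeneous b (elem b :: 'a symfun)" unfolding elem_def elementary_sym_eq_exp .
 then show ?case using homogeneous_mult Cons by simp
qed (simp add: homogeneous_1)

lemma homogeneous_schur: "\<mu> \<in> partitions n ==> homogeneous n (schur \<mu>)"
 unfolding homogeneous_def using mcoeff_schur_size sum_list_partition by metis

lemma homogeneous_iff_schur:
 "homogeneous n f \<longleftrightarrow> f \<in> symfun.span (schur ` partitions n :: 'a :: field_char_0 symfun set)"
 using span_schur_degree[of n f] homogeneous_span[of f "schur ` partitions n" n] homogeneous_schur
 by (auto simp: homogeneous_def[of n f])

lemma homogeneous_power_sum_list:
 "\<mu> \<in> partitions n ==> homogeneous n (power_sum_list \<mu> :: 'a :: field_char_0 symfun)"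
 unfolding homogeneous_def using power_sum_basis_rules(3) sum_list_partition
 by (metis UN_I UNIV_I all_partitions_def)

lemma homogeneous_iff_power_sum:
 "homogeneous n f \<longleftrightarrow> f \<in> symfun.span (power_sum_list ` partitions n :: 'a :: field_char_0 symfun set)"
proof
 assume "homogeneous n f"
 then have "mcoeff f M = 0" if "size M \<notin> {n}" for M using that by (simp add: homogeneous_def)
 then have "f \<in> symfun.span (power_sum_list ` {\<mu> \<in> all_partitions. sum_list \<mu> \<in> {n}})"
  by (intro triangular_span_degrees[where r = "%\<mu>. sum_list \<mu> - length \<mu>"])
   (rule power_sum_basis_rules finite.intros; assumption?)+
 also have "{\<mu> \<in> all_partitions. sum_list \<mu> \<in> {n}} = partitions n"
  by (auto simp: all_partitions_iff) (auto simp: partitions_def)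
 finally show "f \<in> symfun.span (power_sum_list ` partitions n)" .
next
 assume "f \<in> symfun.span (power_sum_list ` partitions n)"
 then show "homogeneous n f" by (rule homogeneous_span) (auto simp: homogeneous_power_sum_list)
qed

lemma homogeneous_pd:
 assumes "homogeneous (Suc n) f"
 shows "homogeneous n (pd f)"
proof -
 have "homogeneous n (pd (power_sum_list \<alpha>) :: 'a symfun)" if "sum_list \<alpha> = Suc n" "0 \<notin> set \<alpha>" for \<alpha>
  using that
 proof (induction \<alpha> arbitrary: n)
  case (Cons r \<alpha>)
  have pl: "homogeneous (sum_list \<alpha>) (power_sum_list \<alpha> :: 'a symfun)"
   using power_sum_basis_rules(3) homogeneous_def mcoeff_power_sum_list_nonzero Cons.prems(2)
   by (metis list.set_intros(2))
  have "homogeneous n (power_sum_sym r * pd (power_sum_list \<alpha>) :: 'a symfun)"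
  proof (cases "sum_list \<alpha>")
   case 0
   then have "\<alpha> = []" using Cons.prems(2) by (cases \<alpha>) auto
   then show ?thesis by simp
  next
   case (Suc m)
   have "homogeneous r (power_sum_sym r :: 'a symfun)" by (auto simp: homogeneous_def power_sum_sym.rep_eq)
   from homogeneous_mult[OF this Cons.IH[OF Suc]] show ?thesis using Cons.prems Suc by simp
  qed
  moreover have "homogeneous n (if r = 1 then power_sum_list \<alpha> else 0 :: 'a symfun)"
   using pl Cons.prems(1) by auto
  ultimately have "homogeneous n (power_sum_sym r * pd (power_sum_list \<alpha>) +
    (if r = 1 then power_sum_list \<alpha> else 0) :: 'a symfun)" by (rule homogeneous_add)
  moreover have "r \<ge> 1" using Cons.prems(2) by (cases r) auto
  ultimately show ?case by (simp only: pd_power_sum_times list.map prod_list.Cons)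
 qed simp
 then have pl: "homogeneous n (pd (power_sum_list \<alpha>) :: 'a symfun)" if "\<alpha> \<in> partitions (Suc n)" for \<alpha>
  using that by (auto simp: partitions_def)
 have "f \<in> symfun.span (power_sum_list ` partitions (Suc n))" using assms homogeneous_iff_power_sum by blast
 then show ?thesis
  by (induction rule: symfun.span_induct_alt) (auto simp: pd_add pd_scale intro: homogeneous_add homogeneous_scale pl)
qed

lemma homogeneous_pd_0:
 assumes "homogeneous 0 f"
 shows "pd f = 0"
proof -
 have "f \<in> symfun.span (power_sum_list ` partitions 0)" using assms homogeneous_iff_power_sum by blast
 moreover have "\<mu> \<in> partitions 0 \<longleftrightarrow> \<mu> = []" for \<mu> by (cases \<mu>) (auto simp: partitions_def)
 then have "partitions 0 = {[]}" by blast
 ultimately have "f \<in> symfun.span {1}" by simp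
 then obtain c where "f = scale_sym c 1" unfolding symfun.span_singleton by blast
 then show ?thesis by (simp add: pd_scale)
qed

lemma plethysm_power_sum_list:
 "0 \<notin> set \<alpha> ==> plethysm_one_minus u (power_sum_list \<alpha>) = scale_sym (\<Prod>r\<leftarrow>\<alpha>. 1 - u ^ r) (power_sum_list \<alpha>)"
 by (induction \<alpha>) (auto simp: is_sym_homD[OF plethysm_one_minus(1)] plethysm_one_minus(2) scale_sym_times)

lemma homogeneous_plethysm:
 assumes "homogeneous n (plethysm_one_minus q_var f)"
 shows "homogeneous n f"
proof -
 have c: "(\<Prod>r\<leftarrow>\<alpha>. 1 - q_var ^ r) \<noteq> 0" if "0 \<notin> set \<alpha>" for \<alpha>
  using that q_t_power_neq(1) by (induction \<alpha>) (auto simp: Suc_le_eq)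
 have "power_sum_list \<alpha> \<in> symfun.span ((%\<alpha>. plethysm_one_minus q_var (power_sum_list \<alpha>)) ` partitions n)"
  if "\<alpha> \<in> partitions n" for \<alpha>
 proof -
  have 0: "0 \<notin> set \<alpha>" using that by (simp add: partitions_def)
  have "power_sum_list \<alpha> = scale_sym (inverse (\<Prod>r\<leftarrow>\<alpha>. 1 - q_var ^ r)) (plethysm_one_minus q_var (power_sum_list \<alpha>))"
   unfolding plethysm_power_sum_list[OF 0] using c[OF 0] by simp
  moreover have "plethysm_one_minus q_var (power_sum_list \<alpha>) \<in>
    symfun.span ((%\<alpha>. plethysm_one_minus q_var (power_sum_list \<alpha>)) ` partitions n)"
   using that by (intro symfun.span_base) simp
  ultimately show ?thesis by (metis symfun.span_scale)
 qed
 then have "symfun.span (power_sum_list ` partitions n) \<subseteq>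
   symfun.span ((%\<alpha>. plethysm_one_minus q_var (power_sum_list \<alpha>)) ` partitions n)"
  by (intro symfun.span_minimal symfun.subspace_span) auto
 then have "plethysm_one_minus q_var f \<in> symfun.span ((%\<alpha>. plethysm_one_minus q_var (power_sum_list \<alpha>)) ` partitions n)"
  using assms homogeneous_iff_power_sum by blast
 then show ?thesis
  unfolding homogeneous_iff_power_sum linear_inj_span[OF linear_plethysm bij_is_inj[OF bij_plethysm(1)]] .
qed

lemma homogeneous_plethysm':
 "homogeneous n f ==> homogeneous n (plethysm_one_minus u f)"
 unfolding homogeneous_iff_power_sum
proof (induction rule: symfun.span_induct_alt)
 case base
 show ?case by (simp add: is_sym_homD[OF plethysm_one_minus(1)] symfun.span_zero)
next
 case (step c x y)
 then obtain \<alpha> where \<alpha>: "x = power_sum_list \<alpha>" "\<alpha> \<in> partitions n" by blast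
 then have "0 \<notin> set \<alpha>" by (simp add: partitions_def)
 then have x: "plethysm_one_minus u x \<in> symfun.span (power_sum_list ` partitions n)"
  unfolding \<alpha>(1) plethysm_power_sum_list[OF \<open>0 \<notin> set \<alpha>\<close>] using \<alpha>(2) by (intro symfun.span_scale symfun.span_base) simp
 have "plethysm_one_minus u (scale_sym c x + y) = scale_sym c (plethysm_one_minus u x) + plethysm_one_minus u y"
  by (simp add: is_sym_homD[OF plethysm_one_minus(1)] scale_sym_times)
 then show ?case using x step by (simp add: symfun.span_add symfun.span_scale)
qed

lemma homogeneous_eig:
 assumes "\<mu> \<in> partitions n"
 shows "homogeneous n (eig \<mu>)"
proof -
 have "plethysm_one_minus q_var (eig \<mu>) \<in> dominance_span \<mu>"
  using eig_characterization[OF assms, of "eig \<mu>"] by (metis symfun.scale_one)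
 then have "homogeneous n (plethysm_one_minus q_var (eig \<mu>))"
  unfolding dominance_span_def using sum_list_partition[OF assms] homogeneous_schur
  by (elim homogeneous_span) auto
 then show ?thesis by (rule homogeneous_plethysm)
qed

lemma homogeneous_iff_eig: "homogeneous n f \<longleftrightarrow> f \<in> symfun.span (eig ` partitions n)"
proof
 assume "homogeneous n f"
 then have "plethysm_one_minus q_var f \<in> symfun.span (schur ` partitions n)"
  using homogeneous_plethysm' homogeneous_iff_schur by blast
 also have "\<dots> \<subseteq> symfun.span ((%\<mu>. plethysm_one_minus q_var (eig \<mu>)) ` partitions n)"
 proof (intro symfun.span_minimal symfun.subspace_span, safe)
  fix \<mu> assume \<mu>: "\<mu> \<in> partitions n"
  have "schur \<mu> \<in> symfun.span ((%\<mu>. plethysm_one_minus q_var (eig \<mu>)) ` {\<nu> \<in> partitions n. dominates \<nu> \<mu>})"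
   using schur_in_dominance_span[OF \<mu>] unfolding dominance_span_eig[OF \<mu>] .
  also have "\<dots> \<subseteq> symfun.span ((%\<mu>. plethysm_one_minus q_var (eig \<mu>)) ` partitions n)"
   by (rule symfun.span_mono) auto
  finally show "schur \<mu> \<in> symfun.span ((%\<mu>. plethysm_one_minus q_var (eig \<mu>)) ` partitions n)" .
 qed
 finally show "f \<in> symfun.span (eig ` partitions n)"
  unfolding linear_inj_span[OF linear_plethysm bij_is_inj[OF bij_plethysm(1)]] .
next
 assume "f \<in> symfun.span (eig ` partitions n)"
 then show "homogeneous n f" by (rule homogeneous_span) (auto simp: homogeneous_eig)
qed

section \<open>The normalisation does not vanish\<close>

lemma is_ring_homD:
 assumes "is_ring_hom \<rho>"
 shows "\<rho> 1 = 1" "\<rho> (a + b) = \<rho> a + \<rho> b" "\<rho> (a * b) = \<rho> a * \<rho> b" "\<rho> 0 = 0" "\<rho> (a - b) = \<rho> a - \<rho> b" "\<rho> (a ^ n) = \<rho> a ^ n"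
proof -
 show 1: "\<rho> 1 = 1" "\<rho> (a + b) = \<rho> a + \<rho> b" "\<rho> (a * b) = \<rho> a * \<rho> b" for a b using assms by (simp_all add: is_ring_hom_def)
 show "\<rho> 0 = 0" using 1(2)[of 0 0] by simp
 show "\<rho> (a - b) = \<rho> a - \<rho> b" using 1(2)[of "a - b" b] by simp
 show "\<rho> (a ^ n) = \<rho> a ^ n" by (induction n) (simp_all add: 1)
qed

lemma is_ring_hom_sum: "is_ring_hom \<rho> ==> \<rho> (sum f A) = (\<Sum>x\<in>A. \<rho> (f x))"
 by (induction A rule: infinite_finite_induct) (simp_all add: is_ring_homD)

lemma box_sum_hom: "is_ring_hom \<rho> ==> \<rho> (box_sum q t \<mu>) = box_sum (\<rho> q) (\<rho> t) \<mu>"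
 by (simp add: box_sum_def is_ring_hom_sum case_prod_unfold is_ring_homD)

text \<open>The shadow on words of applying A - b for all b in the list and then a linear
  functional; see \<open>iter_quo_op_chain\<close>.\<close>

fun iter_quo :: "'a :: comm_ring_1 => 'a => 'a list => (nat list => 'a) => nat list => 'a" where
 "iter_quo q t [] f l = f l"
| "iter_quo q t (b # bs) f l = quo q t l (%k xs. iter_quo q t bs f (k # xs)) - b * iter_quo q t bs f l"

lemma iter_quo_hom:
 assumes "is_ring_hom \<rho>"
 shows "\<rho> (iter_quo q t bs f l) = iter_quo (\<rho> q) (\<rho> t) (map \<rho> bs) (%l. \<rho> (f l)) l"
proof (induction bs arbitrary: l)
 case (Cons b bs)
 have "\<rho> (quo q t l F) = quo (\<rho> q) (\<rho> t) l (%k xs. \<rho> (F k xs))" for F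
  by (rule quo_natural) (simp_all add: is_ring_homD[OF assms])
 then show ?case by (simp add: is_ring_homD[OF assms] Cons)
qed simp

text \<open>If the list consists of all eigenvalues but one, this is a multiple of the projection to
  the remaining eigenspace.\<close>

fun op_chain :: "('k => 'r :: comm_ring_1) => ('r => 'r) => 'k list => 'r => 'r" where
 "op_chain \<iota> A [] g = g"
| "op_chain \<iota> A (b # bs) g = op_chain \<iota> A bs (A g - \<iota> b * g)"

lemma op_chain_linear:
 assumes "\<And>x y. A (x + y) = A x + A y" "\<And>c x. A (\<iota> c * x) = \<iota> c * A x"
 shows "op_chain \<iota> A bs (x + y) = op_chain \<iota> A bs x + op_chain \<iota> A bs y"
  and "op_chain \<iota> A bs (\<iota> c * x) = \<iota> c * op_chain \<iota> A bs x"
proof -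
 have "op_chain \<iota> A bs (x + y) = op_chain \<iota> A bs x + op_chain \<iota> A bs y \<and>
   op_chain \<iota> A bs (\<iota> c * x) = \<iota> c * op_chain \<iota> A bs x" for x y c
 proof (induction bs arbitrary: x y)
  case (Cons b bs)
  have "A (x + y) - \<iota> b * (x + y) = (A x - \<iota> b * x) + (A y - \<iota> b * y)"
   "A (\<iota> c * x) - \<iota> b * (\<iota> c * x) = \<iota> c * (A x - \<iota> b * x)"
   unfolding assms by (simp_all add: algebra_simps)
  then show ?case using Cons by simp
 qed simp
 then show "op_chain \<iota> A bs (x + y) = op_chain \<iota> A bs x + op_chain \<iota> A bs y"
  "op_chain \<iota> A bs (\<iota> c * x) = \<iota> c * op_chain \<iota> A bs x" by blast+
qed

lemma op_chain_eigenvector: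
 assumes "A v = \<iota> e * v" "\<And>c x. A (\<iota> c * x) = \<iota> c * A x" "is_ring_hom \<iota>"
 shows "op_chain \<iota> A bs (\<iota> c * v) = \<iota> (c * (\<Prod>b\<leftarrow>bs. e - b)) * v"
proof (induction bs arbitrary: c)
 case (Cons b bs)
 have "A (\<iota> c * v) - \<iota> b * (\<iota> c * v) = \<iota> (c * (e - b)) * v"
  unfolding assms(1,2) by (simp add: is_ring_homD[OF assms(3)] algebra_simps)
 then show ?case by (simp add: Cons mult.assoc)
qed simp

text \<open>The result depends on \<open>L\<close> only through its values on words. The generic
  operator and its limit at q = 1 are therefore images of one computation over Q[t][q].\<close>

lemma iter_quo_op_chain:
 fixes L :: "'r :: comm_ring_1 => 'k :: comm_ring_1"
 assumes A: "\<And>x y. A (x + y) = A x + A y" "\<And>c x. A (\<iota> c * x) = \<iota> c * A x"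
  and L: "\<And>x y. L (x + y) = L x + L y" "\<And>c x. L (\<iota> c * x) = c * L x"
  and E: "\<And>l. A (E l) = quo (\<iota> q) (\<iota> t) l (%k xs. E (k # xs))"
 shows "L (op_chain \<iota> A bs (E l)) = iter_quo q t bs (%l. L (E l)) l"
proof (induction bs arbitrary: l)
 case (Cons b bs)
 note lin = op_chain_linear[of A \<iota>, OF A]
 have add: "L (op_chain \<iota> A bs (x + y)) = L (op_chain \<iota> A bs x) + L (op_chain \<iota> A bs y)" for x y by (simp add: lin L)
 have minus: "L (op_chain \<iota> A bs (x - y)) = L (op_chain \<iota> A bs x) - L (op_chain \<iota> A bs y)" for x y
  using add[of "x - y" y] by simp
 have scale: "L (op_chain \<iota> A bs (\<iota> c * x)) = c * L (op_chain \<iota> A bs x)" for c x by (simp add: lin L)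
 have "L (op_chain \<iota> A bs (A (E l))) = quo q t l (%k xs. L (op_chain \<iota> A bs (E (k # xs))))"
  unfolding E by (rule quo_natural) (rule add scale)+
 then show ?case by (simp add: minus scale Cons)
qed simp

subsection \<open>The limit \<open>q = 1\<close>\<close>

text \<open>At \<open>q = 1\<close> the operator becomes the derivation with \<open>h\<^sub>n[X / (1 - t)] \<mapsto> (1 + t + \<dots> + t\<^sup>n\<^sup>-\<^sup>1) h\<^sub>n[X / (1 - t)]\<close>.
 For an integer \<open>t\<close> it is modelled by the Euler operator on polynomials in one variable, with
 \<open>h\<^sub>n[X / (1 - t)]\<close> a multiple of the monomial of degree \<open>1 + t + \<dots> + t\<^sup>n\<^sup>-\<^sup>1\<close>.\<close>

definition euler_op :: "rat poly => rat poly" where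
 "euler_op p = [:0, 1:] * pderiv p"

lemma euler_op_add: "euler_op (p + p') = euler_op p + euler_op p'"
 and euler_op_scale: "euler_op ([:c:] * p) = [:c:] * euler_op p"
 and euler_op_mult: "euler_op (p * p') = euler_op p * p' + p * euler_op p'"
 and euler_op_1 [simp]: "euler_op 1 = 0"
 by (simp_all add: euler_op_def pderiv_add pderiv_smult pderiv_mult algebra_simps)

lemma euler_op_monom: "euler_op (monom c n) = [:of_nat n:] * monom c n"
 by (cases n) (simp_all add: euler_op_def pderiv_monom monom_Suc[symmetric] smult_monom monom_0)

lemma euler_op_sum: "euler_op (sum f A) = (\<Sum>x\<in>A. euler_op (f x))"
 by (induction A rule: infinite_finite_induct) (simp_all add: euler_op_add, simp_all add: euler_op_def)

text \<open>h_n[1 / (1 - t)] = 1 / ((1 - t) ... (1 - t^n)). With this factor, setting the polynomial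
  variable to 1 models the evaluation of symmetric functions at a single variable equal to
  1.\<close>

fun complete_limit_coeff :: "nat => nat => rat" where
 "complete_limit_coeff t 0 = 1"
| "complete_limit_coeff t (Suc n) = complete_limit_coeff t n / (1 - of_nat t ^ Suc n)"

definition complete_limit :: "nat => nat => rat poly" where
 "complete_limit t n = monom (complete_limit_coeff t n) (\<Sum>i<n. t ^ i)"

text \<open>The model of (-1)^n e_n, solved from Exp[- X] Exp[X / (1 - t)] =
  Exp[t X / (1 - t)].\<close>

fun elem_limit :: "nat => nat => rat poly" where
 "elem_limit t 0 = 1"
| "elem_limit t (Suc n) = smult (of_nat t ^ Suc n) (complete_limit t (Suc n)) -
  (\<Sum>i\<le>n. elem_limit t i * complete_limit t (Suc n - i))"

lemma complete_limit_0 [simp]: "complete_limit t 0 = 1" by (simp add: complete_limit_def monom_0 one_pCons)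

lemma elem_limit_conv: "(\<Sum>i\<le>n. elem_limit t i * complete_limit t (n - i)) = smult (of_nat t ^ n) (complete_limit t n)"
 by (cases n) simp_all

lemma qt_num_1: "(1 - t) * qt_num 1 t a = 1 - t ^ a"
proof (induction a)
 case (Suc a)
 have "(1 - t) * qt_num 1 t (Suc a) = t * ((1 - t) * qt_num 1 t a) + (1 - t)"
  by (simp add: qt_num_Suc algebra_simps)
 then show ?case unfolding Suc by (simp add: algebra_simps)
qed simp

lemma euler_op_complete_limit:
 assumes "t \<noteq> 1"
 shows "smult (1 - of_nat t) (euler_op (complete_limit t n)) = complete_limit t n - smult (of_nat t ^ n) (complete_limit t n)"
proof -
 have "(1 - of_nat t) * of_nat (\<Sum>i<n. t ^ i) = (1 - of_nat t ^ n :: rat)"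
  using one_diff_power_eq[of "of_nat t :: rat" n] by simp
 then show ?thesis
  by (simp add: complete_limit_def euler_op_monom smult_monom diff_monom[symmetric] left_diff_distrib flip: mult.assoc)
qed

text \<open>Let \<open>V\<close> be the series of the h_n[X / (1 - t)] and \<open>s\<close> the
  substitution z -> t z. Applying the derivation to E V = s V and using (1 - t) d V = V - s V gives
  (1 - t) d E = (E - s E) E.\<close>

lemma euler_op_elem_limit:
 assumes t: "t \<noteq> 1"
 shows "euler_op (elem_limit t n) = (\<Sum>a\<le>n. qt_num 1 [:of_nat t:] a * (elem_limit t a * elem_limit t (n - a)))"
proof -
 define d :: "rat poly fps => rat poly fps" where "d F = Abs_fps (%n. euler_op (fps_nth F n))" for F
 define s :: "rat poly fps => rat poly fps" where "s F = Abs_fps (%n. [:of_nat t ^ n:] * fps_nth F n)" for F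
 have d_mult: "d (F * G) = d F * G + F * d G" for F G
  by (rule fps_ext) (simp add: d_def fps_mult_nth euler_op_sum euler_op_mult sum.distrib)
 have d_minus: "d (F - G) = d F - d G" for F G
 proof (rule fps_ext)
  fix n
  have "euler_op (p - p') = euler_op p - euler_op p'" for p p' using euler_op_add[of "p - p'" p'] by simp
  then show "fps_nth (d (F - G)) n = fps_nth (d F - d G) n" by (simp add: d_def)
 qed
 have s_mult: "s (F * G) = s F * s G" for F G
 proof (rule fps_ext)
  fix n
  have "[:of_nat t ^ n:] * (\<Sum>i=0..n. fps_nth F i * fps_nth G (n - i)) =
   (\<Sum>i=0..n. ([:of_nat t ^ i:] * fps_nth F i) * ([:of_nat t ^ (n - i):] * fps_nth G (n - i)))"
   unfolding sum_distrib_left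
  proof (rule sum.cong[OF refl])
   fix i assume "i \<in> {0..n}"
   then have "(of_nat t :: rat) ^ n = of_nat t ^ i * of_nat t ^ (n - i)" by (simp add: power_add[symmetric])
   then show "[:of_nat t ^ n:] * (fps_nth F i * fps_nth G (n - i)) =
    ([:of_nat t ^ i:] * fps_nth F i) * ([:of_nat t ^ (n - i):] * fps_nth G (n - i))" by (simp add: mult_ac)
  qed
  then show "fps_nth (s (F * G)) n = fps_nth (s F * s G) n" by (simp add: s_def fps_mult_nth)
 qed
 define k :: "rat poly fps" where "k = fps_const [:1 - of_nat t:]"
 define V where "V = Abs_fps (complete_limit t)"
 define E where "E = Abs_fps (elem_limit t)"
 have EV: "E * V = s V"
  by (rule fps_ext) (simp add: E_def V_def s_def fps_mult_nth elem_limit_conv atLeast0AtMost)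
 have dV: "k * d V = V - s V"
  by (rule fps_ext) (use euler_op_complete_limit[OF t] in \<open>simp add: k_def d_def V_def s_def\<close>)
 have dsV: "k * d (s V) = s (k * d V)"
  by (rule fps_ext) (simp add: k_def d_def V_def s_def euler_op_scale[simplified] mult.commute)
 have "k * d (E * V) = (k * d E) * V + E * (k * d V)" by (simp add: d_mult algebra_simps)
 then have "s V - s (s V) = (k * d E) * V + E * (V - s V)"
  unfolding EV dsV dV by (simp add: s_def[of "_ - _"] fps_eq_iff s_def algebra_simps)
 moreover have "s V - s (s V) = E * V - s E * (E * V)" unfolding EV[symmetric] s_mult by (simp add: EV)
 ultimately have "(k * d E) * V = E * (E - s E) * V" unfolding EV[symmetric] by (simp add: algebra_simps)
 moreover have "V \<noteq> 0"
 proof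
  assume "V = 0"
  then have "fps_nth V 0 = 0" by simp
  then show False by (simp add: V_def)
 qed
 ultimately have *: "k * d E = (E - s E) * E" by (simp add: mult.commute)
 define T :: "rat poly" where "T = [:of_nat t:]"
 have k: "k = fps_const (1 - T)" by (simp add: k_def T_def one_pCons)
 have Tp: "[:of_nat t ^ a:] = T ^ a" for a by (simp add: T_def poly_const_pow)
 have "(1 - T) * euler_op (elem_limit t n) = (\<Sum>a\<le>n. (elem_limit t a - T ^ a * elem_limit t a) * elem_limit t (n - a))"
  using arg_cong[OF *, of "%F. fps_nth F n"]
  unfolding k fps_mult_left_const_nth by (simp add: d_def E_def s_def fps_mult_nth atLeast0AtMost Tp)
 also have "\<dots> = (1 - T) * (\<Sum>a\<le>n. qt_num 1 T a * (elem_limit t a * elem_limit t (n - a)))"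
  unfolding sum_distrib_left
  by (intro sum.cong refl) (simp add: mult.assoc[symmetric] qt_num_1, simp add: algebra_simps)
 finally have "(1 - T) * euler_op (elem_limit t n) =
   (1 - T) * (\<Sum>a\<le>n. qt_num 1 T a * (elem_limit t a * elem_limit t (n - a)))" .
 moreover have "1 - T \<noteq> 0" using t by (simp add: T_def one_pCons)
 ultimately show ?thesis by (simp add: T_def)
qed

abbreviation elem_limit_list :: "nat => nat list => rat poly" where
 "elem_limit_list t l \<equiv> prod_list (map (elem_limit t) l)"

text \<open>At q = 1 the correction term of \<open>quo\<close> has the factor 1 - q = 0, and what is
  left is the Leibniz rule.\<close>

lemma euler_op_elem_limit_list:
 assumes "t \<noteq> 1"
 shows "euler_op (elem_limit_list t l) = quo 1 [:of_nat t:] l (%k xs. elem_limit_list t (k # xs))"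
proof (induction l)
 case (Cons b v)
 have "elem_limit t b * quo 1 [:of_nat t:] v (%k xs. elem_limit_list t (k # xs)) =
   quo 1 [:of_nat t:] v (%k xs. elem_limit t b * elem_limit_list t (k # xs))"
  by (rule quo_natural) (simp_all add: algebra_simps)
 then have "elem_limit t b * euler_op (elem_limit_list t v) =
   quo 1 [:of_nat t:] v (%k xs. elem_limit_list t (k # b # xs))"
  unfolding Cons by (simp add: mult.left_commute)
 moreover have "euler_op (elem_limit t b) * elem_limit_list t v =
   (\<Sum>a\<in>{1..b}. qt_num 1 [:of_nat t:] a * elem_limit_list t (a # (b - a) # v))"
  unfolding euler_op_elem_limit[OF assms] sum_atMost_split by (simp add: sum_distrib_right mult.assoc)
 ultimately show ?case by (simp add: euler_op_mult add.commute)
qed simp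

definition elem_at_one :: "nat => 'a :: comm_ring_1" where
 "elem_at_one n = (if n = 0 then 1 else if n = 1 then - 1 else 0)"

lemma poly_elem_limit_1:
 assumes "t \<ge> 2"
 shows "poly (elem_limit t n) 1 = elem_at_one n"
proof (induction n rule: less_induct)
 case (less n)
 define a where "a = complete_limit_coeff t"
 have a: "a n - a (n - 1) = of_nat t ^ n * a n" if "n \<ge> 1"
 proof -
  have "(of_nat t :: rat) ^ n \<noteq> 1" using assms that power_eq_1_iff[of t n] by (simp flip: of_nat_power)
  then have "a n * (1 - of_nat t ^ n) = a (n - 1)" using that by (cases n) (simp_all add: a_def)
  then show ?thesis by (simp add: algebra_simps)
 qed
 have conv: "(\<Sum>i\<le>n. poly (elem_limit t i) 1 * a (n - i)) = of_nat t ^ n * a n"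
  using arg_cong[OF elem_limit_conv[where n = n and t = t], of "%p. poly p 1"]
  by (simp add: poly_sum complete_limit_def poly_monom a_def)
 consider "n = 0" | "n = 1" | m where "n = Suc (Suc m)" by (metis One_nat_def not0_implies_Suc)
 then show ?case
 proof cases
  case 3
  have "(\<Sum>i\<le>n. poly (elem_limit t i) 1 * a (n - i)) =
    (\<Sum>i\<le>Suc m. poly (elem_limit t i) 1 * a (n - i)) + poly (elem_limit t n) 1"
   unfolding 3 by (subst sum.atMost_Suc) (simp add: a_def)
  also have "(\<Sum>i\<le>Suc m. poly (elem_limit t i) 1 * a (n - i)) = (\<Sum>i\<le>Suc m. elem_at_one i * a (n - i))"
   using less 3 by (intro sum.cong) auto
  also have "\<dots> = (\<Sum>i\<in>{0, 1}. elem_at_one i * a (n - i))"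
   by (rule sum.mono_neutral_right) (auto simp: elem_at_one_def)
  finally show ?thesis using conv a 3 by (simp add: elem_at_one_def)
 next
  case 2
  then show ?thesis using conv a by (simp add: elem_at_one_def a_def)
 qed (simp add: elem_at_one_def)
qed

section \<open>Evaluation at a single variable equal to 1\<close>

lemma ex_eval_first:
 "\<exists>\<psi>. is_sym_hom (%c :: 'a :: field_char_0. [:c:]) \<psi> \<and> (\<forall>r\<ge>1. \<psi> (power_sum_sym r) = monom 1 r)"
 by (rule ex_sym_hom) (simp add: is_ring_hom_def one_pCons)

lemma mcoeff_eval_first:
 fixes \<psi> :: "'a :: field_char_0 symfun => 'a poly"
 assumes "is_sym_hom (%c. [:c:]) \<psi>" "\<And>r. r \<ge> 1 ==> \<psi> (power_sum_sym r) = monom 1 r"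
 shows "coeff (\<psi> f) k = mcoeff f (replicate_mset k 0)"
proof (induction f arbitrary: k rule: sym_induct)
 case one
 then show ?case by (auto simp: is_sym_homD[OF assms(1)] one_symfun.rep_eq)
next
 case (power_sum r f)
 have "mcoeff (power_sum_sym r * f) (replicate_mset k 0) =
   (\<Sum>x | r \<le> count (replicate_mset k 0) x. mcoeff f (replicate_mset k 0 - replicate_mset r x))"
  by (rule mcoeff_power_sum_times[OF power_sum(1)])
 also have "{x. r \<le> count (replicate_mset k 0) x} = (if r \<le> k then {0} else {})"
  using power_sum(1) by auto
 also have "replicate_mset k 0 - replicate_mset r 0 = replicate_mset (k - r) (0 :: nat)"
  by (rule multiset_eqI) simp
 then have "(\<Sum>x\<in>(if r \<le> k then {0} else {}). mcoeff f (replicate_mset k 0 - replicate_mset r x)) =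
   (if r \<le> k then coeff (\<psi> f) (k - r) else 0)" by (simp add: power_sum)
 also have "\<dots> = coeff (\<psi> (power_sum_sym r * f)) k"
  by (auto simp: is_sym_homD[OF assms(1)] assms(2)[OF power_sum(1)] coeff_monom_mult)
 finally show ?case by simp
qed (simp_all add: is_sym_homD[OF assms(1)] plus_symfun.rep_eq scale_sym.rep_eq)

text \<open>On degree n this is the coefficient of x_0^n, hence the Hall product with h_n, and up to
  a factor what \<open>macdonald\<close> normalises. Being a ring homomorphism, it is computable on
  words.\<close>

definition at_one :: "'a :: field_char_0 symfun => 'a" where
 "at_one = (SOME L. is_sym_hom (%c. c) L \<and> (\<forall>n f. homogeneous n f --> L f = mcoeff f (replicate_mset n 0)) \<and>
   (\<forall>r\<ge>1. L (power_sum_sym r) = 1))"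

lemma at_one:
 fixes f :: "'a :: field_char_0 symfun"
 shows "is_sym_hom (%c. c) (at_one :: 'a symfun => 'a)" "homogeneous n f ==> at_one f = mcoeff f (replicate_mset n 0)"
 "r \<ge> 1 ==> at_one (power_sum_sym r) = (1 :: 'a)"
proof -
 obtain \<psi> :: "'a symfun => 'a poly" where \<psi>: "is_sym_hom (%c. [:c:]) \<psi>" "\<And>r. r \<ge> 1 ==> \<psi> (power_sum_sym r) = monom 1 r"
  using ex_eval_first by blast
 define L where "L f = poly (\<psi> f) 1" for f
 have 1: "is_sym_hom (%c. c) L" by (simp add: is_sym_hom_def L_def is_sym_homD[OF \<psi>(1)])
 have 2: "L f = mcoeff f (replicate_mset n 0)" if "homogeneous n f" for n f
 proof -
  have "\<psi> f = monom (mcoeff f (replicate_mset n 0)) n"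
   using that by (intro poly_eqI) (auto simp: mcoeff_eval_first[OF \<psi>] homogeneous_def)
  then show ?thesis by (simp add: L_def poly_monom)
 qed
 have 3: "L (power_sum_sym r) = 1" if "r \<ge> 1" for r
  using \<psi>(2)[OF that] by (simp add: L_def poly_monom)
 have "\<exists>L :: 'a symfun => 'a. is_sym_hom (%c. c) L \<and>
   (\<forall>n f. homogeneous n f --> L f = mcoeff f (replicate_mset n 0)) \<and> (\<forall>r\<ge>1. L (power_sum_sym r) = 1)"
  using 1 2 3 by blast
 from someI_ex[OF this, folded at_one_def]
 show "is_sym_hom (%c. c) (at_one :: 'a symfun => 'a)" "homogeneous n f ==> at_one f = mcoeff f (replicate_mset n 0)"
  "r \<ge> 1 ==> at_one (power_sum_sym r) = (1 :: 'a)" by blast+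
qed

lemma at_one_elem: "at_one (elem n) = elem_at_one n"
proof -
 have "scalar_exp (%_. - 1) n = at_one (elem n :: 'a symfun)"
  unfolding elem_def by (rule scalar_exp_unique[OF is_exp_hom[OF at_one(1)]]) (simp add: at_one(3))
 moreover have "scalar_exp (%_. - 1) n = (elem_at_one n :: 'a)"
  by (rule scalar_exp_unique[OF is_exp_neg_geometric[of 1], THEN trans]) (auto simp: elem_at_one_def)
 ultimately show ?thesis by simp
qed

text \<open>D_0 shifted and rescaled to have the box sums as eigenvalues. D_0 itself degenerates to
  the identity at q = 1, whereas this quotient has a nontrivial limit.\<close>

definition Delta :: "qt symfun => qt symfun" where
 "Delta f = scale_sym (inverse ((1 - q_var) * (1 - t_var))) (f - D_0 f)"

lemma Delta_linear: "Delta (f + g) = Delta f + Delta g" "Delta (const_sym c * f) = const_sym c * Delta f"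
proof -
 interpret L: Vector_Spaces.linear scale_sym scale_sym D_0 by (rule linear_D_op)
 show "Delta (f + g) = Delta f + Delta g"
  unfolding Delta_def symfun.scale_right_distrib[symmetric] by (simp add: L.add)
 have "Delta (scale_sym c f) = scale_sym c (Delta f)"
  unfolding Delta_def by (simp add: L.scale symfun.scale_right_diff_distrib mult.commute)
 then show "Delta (const_sym c * f) = const_sym c * Delta f" by (simp add: scale_sym_times)
qed

lemma M_nonzero: "(1 - q_var) * (1 - t_var) \<noteq> 0" using q_t_power_neq(1,2)[of 1] by auto

lemma Delta_eig:
 assumes "\<mu> \<in> partitions n"
 shows "Delta (eig \<mu>) = const_sym (box_sum q_var t_var \<mu>) * eig \<mu>"
proof -
 define m where "m = (1 - q_var) * (1 - t_var)"
 have "eig \<mu> - D_0 (eig \<mu>) = scale_sym (m * box_sum q_var t_var \<mu>) (eig \<mu>)"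
  unfolding D_0_eig[OF assms] op_eigenvalue_box_sum m_def by (simp add: symfun.scale_left_diff_distrib)
 then show ?thesis using M_nonzero unfolding Delta_def m_def[symmetric] by (simp add: scale_sym_times)
qed

lemma const_sym_M: "(1 - const_sym q) * (1 - const_sym t) = const_sym ((1 - q) * (1 - t :: 'a :: field))"
 by (simp add: const_sym_simps)

lemma Delta_elem_list:
 "Delta (elem_list l) = quo (const_sym q_var) (const_sym t_var) l (%k xs. elem_list (k # xs))"
proof -
 define m where "m = (1 - q_var) * (1 - t_var)"
 show ?thesis
  using M_nonzero unfolding Delta_def D_op_elem_list const_sym_M m_def[symmetric] by (simp add: scale_sym_times)
qed

section \<open>Lifting the computation at q = 1 to generic q and t\<close>

definition rat_const :: "rat => rat poly poly" where
 "rat_const c = [:[:c:]:]"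

definition eval_1 :: "nat => rat poly poly => rat" where
 "eval_1 t P = poly (poly P 1) (of_nat t)"

lemma is_ring_hom_eval_1: "is_ring_hom (eval_1 t)" by (simp add: is_ring_hom_def eval_1_def)

lemma is_ring_hom_to_fract: "is_ring_hom (to_fract :: rat poly poly => qt)"
 by (simp add: is_ring_hom_def)

lemma is_ring_hom_const_sym: "is_ring_hom (%c :: 'a :: field. const_sym c)"
 by (simp add: is_ring_hom_def const_sym_simps)

lemma is_ring_hom_const_poly: "is_ring_hom (%c :: 'a :: comm_ring_1. [:c:])"
 by (simp add: is_ring_hom_def one_pCons)

text \<open>Pairs of a value in the limit \<open>q = 1\<close> and an element over \<open>\<rat>(q, t)\<close> that arise from the same
 rational polynomial in the elementary functions.\<close>

inductive lifts_to :: "nat => nat => rat poly => qt symfun => bool" for t where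
 gen: "sum_list l = n ==> lifts_to t n (elem_limit_list t l) (elem_list l)"
| add: "lifts_to t n y w ==> lifts_to t n y' w' ==> lifts_to t n (y + y') (w + w')"
| scale: "lifts_to t n y w ==> lifts_to t n ([:c:] * y) (const_sym (to_fract (rat_const c)) * w)"

lemma lifts_to_0: "lifts_to t n 0 0"
 using lifts_to.scale[OF lifts_to.gen[of "[n]" n t], of 0] by (simp add: rat_const_def)

lemma lifts_to_mult:
 assumes "lifts_to t m y w" "lifts_to t n y' w'"
 shows "lifts_to t (m + n) (y * y') (w * w')" using assms(1)
proof induction
 case (gen l m)
 show ?case using assms(2)
 proof induction
  case (gen l' n)
  then show ?case using lifts_to.gen[of "l @ l'" "m + n" t] \<open>sum_list l = m\<close> by simp
 next
  case (add n y w y' w')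
  then show ?case by (simp add: distrib_left lifts_to.add)
 next
  case (scale n y w c)
  from lifts_to.scale[OF scale.IH, of c] show ?case by (simp only: mult.left_commute)
 qed
next
 case (add m y w y' w')
 then show ?case by (simp add: distrib_right lifts_to.add)
next
 case (scale m y w c)
 from lifts_to.scale[OF scale.IH, of c] show ?case by (simp only: mult.assoc)
qed

lemma lifts_to_sum:
 assumes "\<And>i. i \<in> A ==> lifts_to t n (f i) (g i)"
 shows "lifts_to t n (sum f A) (sum g A)"
 using assms by (induction A rule: infinite_finite_induct) (auto intro: lifts_to_0 lifts_to.add)

text \<open>The defining convolution expresses t^n - 1 times the limit of h_n[X / (1 - t)] through
  elementary functions and smaller n. The scalars are rational because t is an integer here.\<close>

lemma ex_lifts_complete_limit:
 assumes t: "t \<ge> 2"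
 shows "\<exists>w. lifts_to t n (complete_limit t n) w"
proof (induction n rule: less_induct)
 case (less n)
 show ?case
 proof (cases "n = 0")
  case True
  then show ?thesis using lifts_to.gen[of "[]" 0 t] by auto
 next
  case False
  have "\<forall>i<n. \<exists>w. lifts_to t i (complete_limit t i) w" using less by blast
  then obtain w where w: "\<And>i. i < n ==> lifts_to t i (complete_limit t i) (w i)" by metis
  have "lifts_to t n (elem_limit t i * complete_limit t (n - i)) (elem i * w (n - i))" if "i \<in> {1..n}" for i
   using lifts_to_mult[OF lifts_to.gen[of "[i]" i t] w[of "n - i"]] that by simp
  then have "lifts_to t n (\<Sum>i\<in>{1..n}. elem_limit t i * complete_limit t (n - i)) (\<Sum>i\<in>{1..n}. elem i * w (n - i))"
   by (rule lifts_to_sum)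
  from lifts_to.scale[OF this]
  have "\<exists>w. lifts_to t n ([:inverse (of_nat t ^ n - 1):] * (\<Sum>i\<in>{1..n}. elem_limit t i * complete_limit t (n - i))) w"
   by blast
  moreover have "(\<Sum>i\<in>{1..n}. elem_limit t i * complete_limit t (n - i)) = smult (of_nat t ^ n - 1) (complete_limit t n)"
   using elem_limit_conv[where n = n and t = t] unfolding sum_atMost_split
   by (simp add: smult_diff_left algebra_simps)
  moreover have "(of_nat t :: rat) ^ n - 1 \<noteq> 0"
   using t False power_eq_1_iff[of t n] by (simp flip: of_nat_power)
  ultimately show ?thesis by simp
 qed
qed

lemma ex_lifts_complete_limit_list:
 assumes "t \<ge> 2"
 shows "\<exists>w. lifts_to t (sum_list \<kappa>) (prod_list (map (complete_limit t) \<kappa>)) w"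
proof (induction \<kappa>)
 case Nil
 then show ?case using lifts_to.gen[of "[]" 0 t] by auto
next
 case (Cons k \<kappa>)
 then show ?case using lifts_to_mult ex_lifts_complete_limit[OF assms, of k] by fastforce
qed

lemma lifts_to_homogeneous: "lifts_to t n y w ==> homogeneous n w"
 by (induction rule: lifts_to.induct)
  (auto simp: scale_sym_times intro: homogeneous_add homogeneous_scale homogeneous_elem_list)

text \<open>One polynomial \<open>P\<close> computes both values: the generic one as an element of
  Q(q,t), the limit by setting q = 1 and t to the integer. So a nonzero limit forces a nonzero
  generic value.\<close>

lemma lifts_to_op_chain:
 assumes "lifts_to t n y w" and t: "t \<ge> 2"
 shows "\<exists>P. to_fract P = at_one (op_chain (%c. const_sym c) Delta (map to_fract bs) w) \<and>
  eval_1 t P = poly (op_chain (%c. [:c:]) euler_op (map (eval_1 t) bs) y) 1" using assms(1)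
proof induction
 case (gen l n)
 define P where "P = iter_quo [:0, 1:] [:[:0, 1:]:] bs (%l. prod_list (map elem_at_one l)) l"
 have sgn: "\<rho> (prod_list (map elem_at_one l)) = prod_list (map elem_at_one l)" if "is_ring_hom \<rho>"
  for l and \<rho> :: "rat poly poly => 'b :: comm_ring_1"
 proof -
  have "\<rho> (- 1) = - 1" using is_ring_homD(5)[OF that, of 0 1] by (simp add: is_ring_homD[OF that])
  then show ?thesis by (induction l) (auto simp: is_ring_homD[OF that] elem_at_one_def)
 qed
 have "to_fract P = iter_quo q_var t_var (map to_fract bs) (%l. prod_list (map elem_at_one l)) l"
  unfolding P_def iter_quo_hom[OF is_ring_hom_to_fract] sgn[OF is_ring_hom_to_fract] by (simp add: q_var_def t_var_def)
 also have "(%l. prod_list (map elem_at_one l)) = (%l. at_one (elem_list l :: qt symfun))"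
 proof
  fix l show "prod_list (map elem_at_one l) = at_one (elem_list l :: qt symfun)"
   by (induction l) (simp_all add: is_sym_homD[OF at_one(1)] at_one_elem)
 qed
 also have "iter_quo q_var t_var (map to_fract bs) \<dots> l = at_one (op_chain (%c. const_sym c) Delta (map to_fract bs) (elem_list l))"
  by (rule iter_quo_op_chain[symmetric])
   (simp_all add: Delta_linear Delta_elem_list is_sym_homD[OF at_one(1)])
 finally have 1: "to_fract P = at_one (op_chain (%c. const_sym c) Delta (map to_fract bs) (elem_list l))" .
 have "eval_1 t P = iter_quo 1 (of_nat t) (map (eval_1 t) bs) (%l. prod_list (map elem_at_one l)) l"
  unfolding P_def iter_quo_hom[OF is_ring_hom_eval_1] sgn[OF is_ring_hom_eval_1] by (simp add: eval_1_def)
 also have "(%l. prod_list (map elem_at_one l)) = (%l. poly (elem_limit_list t l) 1)"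
 proof
  fix l show "prod_list (map elem_at_one l) = poly (elem_limit_list t l) 1"
   by (induction l) (simp_all add: poly_elem_limit_1[OF t])
 qed
 also have "iter_quo 1 (of_nat t) (map (eval_1 t) bs) \<dots> l =
   poly (op_chain (%c. [:c:]) euler_op (map (eval_1 t) bs) (elem_limit_list t l)) 1"
  using t by (intro iter_quo_op_chain[symmetric])
   (simp_all add: euler_op_add euler_op_scale[simplified] euler_op_elem_limit_list one_pCons[symmetric])
 finally show ?case using 1 by blast
next
 case (add n y w y' w')
 then obtain P P' where P: "to_fract P = at_one (op_chain (%c. const_sym c) Delta (map to_fract bs) w)"
   "eval_1 t P = poly (op_chain (%c. [:c:]) euler_op (map (eval_1 t) bs) y) 1"
   "to_fract P' = at_one (op_chain (%c. const_sym c) Delta (map to_fract bs) w')"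
   "eval_1 t P' = poly (op_chain (%c. [:c:]) euler_op (map (eval_1 t) bs) y') 1" by blast
 show ?case by (rule exI[of _ "P + P'"], simp add: is_ring_homD[OF is_ring_hom_eval_1] P,
   subst (1 2) op_chain_linear(1))
   (simp_all add: Delta_linear euler_op_add euler_op_scale[simplified] is_sym_homD[OF at_one(1)])
next
 case (scale n y w c)
 then obtain P where P: "to_fract P = at_one (op_chain (%c. const_sym c) Delta (map to_fract bs) w)"
   "eval_1 t P = poly (op_chain (%c. [:c:]) euler_op (map (eval_1 t) bs) y) 1" by blast
 have 1: "op_chain (%c. const_sym c) Delta (map to_fract bs) (const_sym (to_fract (rat_const c)) * w) =
   const_sym (to_fract (rat_const c)) * op_chain (%c. const_sym c) Delta (map to_fract bs) w"
  by (rule op_chain_linear(2)) (rule Delta_linear)+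
 have 2: "op_chain (%c. [:c:]) euler_op (map (eval_1 t) bs) ([:c:] * y) =
   [:c:] * op_chain (%c. [:c:]) euler_op (map (eval_1 t) bs) y"
  by (rule op_chain_linear(2)) (rule euler_op_add euler_op_scale)+
 show ?case unfolding 1 2 by (rule exI[of _ "rat_const c * P"])
   (simp add: is_ring_homD[OF is_ring_hom_eval_1] P is_sym_homD[OF at_one(1)], simp add: eval_1_def rat_const_def)
qed

lemma box_sum_1_Cons: "box_sum 1 t (b # \<nu>) = of_nat b + t * box_sum 1 (t :: 'a :: comm_ring_1) \<nu>"
 using sum_diagram_Cons[of "%(i, j). t ^ i" b \<nu>]
 by (simp add: box_sum_def case_prod_unfold sum_distrib_left mult.commute)

lemma box_sum_Nil [simp]: "box_sum q t [] = 0" by (simp add: box_sum_def diagram_def)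

text \<open>At q = 1 the box sum is the number whose digits in base t are the parts.\<close>

lemma box_sum_digits_inj:
 assumes "\<forall>a\<in>set \<mu>. 0 < a \<and> a < t" "\<forall>a\<in>set \<nu>. 0 < a \<and> a < t" "box_sum 1 (int t) \<mu> = box_sum 1 (int t) \<nu>"
 shows "\<mu> = \<nu>"
proof -
 have nonneg: "box_sum 1 (int t) \<nu> \<ge> 0" for \<nu> by (simp add: box_sum_def case_prod_unfold sum_nonneg)
 have pos: "box_sum 1 (int t) (b # \<nu>) \<noteq> 0" if "b > 0" for b \<nu>
 proof -
  have "0 \<le> int t * box_sum 1 (int t) \<nu>" using nonneg[of \<nu>] by simp
  then show ?thesis unfolding box_sum_1_Cons using that by linarith
 qed
 show ?thesis using assms
 proof (induction \<mu> arbitrary: \<nu>)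
  case Nil
  then show ?case using pos by (cases \<nu>) auto
 next
  case Cons_mu: (Cons b \<mu>)
  show ?case
  proof (cases \<nu>)
   case Nil
   then show ?thesis using pos[of b \<mu>] Cons_mu.prems by auto
  next
   case (Cons c \<nu>')
   have eq: "int b + int t * box_sum 1 (int t) \<mu> = int c + int t * box_sum 1 (int t) \<nu>'"
    using Cons_mu.prems(3) unfolding Cons box_sum_1_Cons by simp
   have "int b = (int b + int t * box_sum 1 (int t) \<mu>) mod int t" using Cons_mu.prems(1) by simp
   also have "\<dots> = int c" unfolding eq using Cons_mu.prems(2) Cons by simp
   finally have "b = c" by simp
   moreover have "box_sum 1 (int t) \<mu> = box_sum 1 (int t) \<nu>'" using eq \<open>b = c\<close> Cons_mu.prems(1) by auto
   then have "\<mu> = \<nu>'" using Cons_mu.prems Cons by (intro Cons_mu.IH) auto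
   ultimately show ?thesis using Cons by simp
  qed
 qed
qed

lemma partition_parts: "\<mu> \<in> partitions n ==> a \<in> set \<mu> ==> 0 < a \<and> a \<le> n"
 unfolding partitions_def using member_le_sum_list[of a \<mu>] by (cases a) auto

text \<open>Counting by columns shows the box sum as the degree of the product of the
  \<open>complete_limit\<close> over the conjugate partition, that is, as its eigenvalue under
  \<open>euler_op\<close>.\<close>

lemma box_sum_conjugate_1:
 assumes "\<mu> \<in> partitions n"
 shows "box_sum 1 t \<mu> = (\<Sum>k\<leftarrow>conjugate_partition \<mu>. \<Sum>i<k. (t :: 'a :: comm_ring_1) ^ i)"
proof -
 have "box_sum t 1 \<kappa> = (\<Sum>k\<leftarrow>\<kappa>. \<Sum>i<k. t ^ i)" for \<kappa>
 proof (induction \<kappa>)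
  case (Cons b \<kappa>)
  then show ?case using sum_diagram_Cons[of "%(i, j). t ^ j" b \<kappa>] by (simp add: box_sum_def case_prod_unfold)
 qed simp
 moreover have "box_sum t 1 (conjugate_partition \<mu>) = box_sum 1 t \<mu>"
  unfolding box_sum_def conjugate_partition(2)[OF assms] by (subst sum.reindex) (auto simp: case_prod_unfold)
 ultimately show ?thesis by metis
qed

text \<open>The chain over all other eigenvalues maps every function of degree n to a multiple of
  \<open>eig \<mu>\<close>. It is applied to a lift of the limit eigenvector for \<mu>, where the
  limit value is a nonzero constant times differences of distinct box sums; so \<open>at_one\<close>
  does not vanish on that multiple.\<close>

theorem at_one_eig:
 assumes \<mu>: "\<mu> \<in> partitions n"
 shows "at_one (eig \<mu>) \<noteq> 0"
proof -
 \<comment> \<open>An integer above all parts and at least 2: the box sums at q = 1 are then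
   distinct, and no t^k with k > 0 is 1.\<close>
 define t where "t = n + 2"
 have t: "t \<ge> 2" by (simp add: t_def)
 obtain \<nu>s where \<nu>s: "set \<nu>s = partitions n - {\<mu>}" using finite_list[of "partitions n - {\<mu>}"] by auto
 define B :: "nat list => rat poly poly" where "B \<nu> = box_sum [:0, 1:] [:[:0, 1:]:] \<nu>" for \<nu>
 define bs where "bs = map B \<nu>s"
 have fB: "to_fract (B \<nu>) = box_sum q_var t_var \<nu>" for \<nu>
  unfolding B_def box_sum_hom[OF is_ring_hom_to_fract] by (simp add: q_var_def t_var_def)
 have eB: "eval_1 t (B \<nu>) = box_sum 1 (of_nat t) \<nu>" for \<nu>
  unfolding B_def box_sum_hom[OF is_ring_hom_eval_1] by (simp add: eval_1_def)
 define \<kappa> where "\<kappa> = conjugate_partition \<mu>"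
 have sum\<kappa>: "sum_list \<kappa> = n" unfolding \<kappa>_def by (rule sum_list_partition[OF conjugate_partition(1)[OF \<mu>]])
 define y where "y = prod_list (map (complete_limit t) \<kappa>)"
 obtain w where w: "lifts_to t n y w" using ex_lifts_complete_limit_list[OF t, of \<kappa>] sum\<kappa> unfolding y_def by auto
 obtain P where P: "to_fract P = at_one (op_chain (%c. const_sym c) Delta (map to_fract bs) w)"
  "eval_1 t P = poly (op_chain (%c. [:c:]) euler_op (map (eval_1 t) bs) y) 1"
  using lifts_to_op_chain[OF w t] by blast
 define chain where "chain = op_chain (%c. const_sym c) Delta (map to_fract bs)"
 have chain_lin: "chain (x + y) = chain x + chain y" "chain (scale_sym c x) = scale_sym c (chain x)" for x y c
 proof -
  show "chain (x + y) = chain x + chain y" unfolding chain_def by (rule op_chain_linear(1)) (rule Delta_linear)+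
  have "chain (const_sym c * x) = const_sym c * chain x" unfolding chain_def by (rule op_chain_linear(2)) (rule Delta_linear)+
  then show "chain (scale_sym c x) = scale_sym c (chain x)" by (simp add: scale_sym_times)
 qed
 have chain_eig: "chain (eig \<nu>) = scale_sym (\<Prod>b\<leftarrow>bs. box_sum q_var t_var \<nu> - to_fract b) (eig \<nu>)" if "\<nu> \<in> partitions n" for \<nu>
  using op_chain_eigenvector[of Delta "eig \<nu>" "%c. const_sym c" "box_sum q_var t_var \<nu>" "map to_fract bs" 1,
    OF Delta_eig[OF that] Delta_linear(2) is_ring_hom_const_sym]
  by (simp add: chain_def scale_sym_times o_def)
 have "w \<in> symfun.span (eig ` partitions n)" using lifts_to_homogeneous[OF w] homogeneous_iff_eig by blast
 then have "\<exists>c. chain w = scale_sym c (eig \<mu>)"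
 proof (induction rule: symfun.span_induct_alt)
  case base
  have "chain 0 = scale_sym 0 (eig \<mu>)" using chain_lin(2)[of 0 0] by simp
  then show ?case by blast
 next
  case (step a x y)
  then obtain \<nu> c where \<nu>: "x = eig \<nu>" "\<nu> \<in> partitions n" and c: "chain y = scale_sym c (eig \<mu>)" by blast
  obtain c' where "chain x = scale_sym c' (eig \<mu>)"
  proof (cases "\<nu> = \<mu>")
   case True
   then show thesis using that chain_eig \<nu> by blast
  next
   case False
   then have "0 \<in> set (map (%b. box_sum q_var t_var \<nu> - to_fract b) bs)"
    using \<nu>(2) \<nu>s by (auto simp: bs_def fB image_iff)
   then have "(\<Prod>b\<leftarrow>bs. box_sum q_var t_var \<nu> - to_fract b) = 0" by (simp add: prod_list_zero_iff)
   then have "chain x = scale_sym 0 (eig \<mu>)" using chain_eig[OF \<nu>(2)] \<nu>(1) by simp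
   then show thesis by (rule that)
  qed
  then have "chain (scale_sym a x + y) = scale_sym (a * c' + c) (eig \<mu>)"
   by (simp add: chain_lin c symfun.scale_left_distrib)
  then show ?case by blast
 qed
 then obtain c where c: "chain w = scale_sym c (eig \<mu>)" by blast
 have Pc: "to_fract P = c * at_one (eig \<mu>)"
  using P(1) c unfolding chain_def by (simp add: is_sym_homD[OF at_one(1)])
 have "euler_op y = [:box_sum 1 (of_nat t) \<mu>:] * y"
 proof -
  have "euler_op (prod_list (map (complete_limit t) \<kappa>)) =
    [:\<Sum>k\<leftarrow>\<kappa>. \<Sum>i<k. of_nat t ^ i:] * prod_list (map (complete_limit t) \<kappa>)" for \<kappa>
  proof (induction \<kappa>)
   case (Cons k \<kappa>)
   have "euler_op (complete_limit t k) = [:\<Sum>i<k. of_nat t ^ i:] * complete_limit t k"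
    by (simp add: complete_limit_def euler_op_monom)
   then show ?case using Cons by (simp add: euler_op_mult smult_add_left add.commute)
  qed simp
  then show ?thesis unfolding y_def box_sum_conjugate_1[OF \<mu>] \<kappa>_def .
 qed
 from op_chain_eigenvector[OF this euler_op_scale is_ring_hom_const_poly, of "map (eval_1 t) bs" 1]
 have "op_chain (%c. [:c:]) euler_op (map (eval_1 t) bs) y =
   [:\<Prod>b\<leftarrow>map (eval_1 t) bs. box_sum 1 (of_nat t) \<mu> - b:] * y" by (simp add: one_pCons[symmetric])
 then have "eval_1 t P = (\<Prod>b\<leftarrow>map (eval_1 t) bs. box_sum 1 (of_nat t) \<mu> - b) * poly y 1" using P(2) by simp
 moreover have "poly y 1 \<noteq> 0"
 proof -
  have pow: "(of_nat t :: rat) ^ Suc k \<noteq> 1" for k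
   using t power_eq_1_iff[of t "Suc k"] by (simp flip: of_nat_power of_nat_mult power_Suc)
  have "complete_limit_coeff t k \<noteq> 0" for k using pow by (induction k) auto
  then have "poly (complete_limit t k) 1 \<noteq> 0" for k by (simp add: complete_limit_def poly_monom)
  then show ?thesis unfolding y_def by (induction \<kappa>) auto
 qed
 moreover have "(\<Prod>b\<leftarrow>map (eval_1 t) bs. box_sum 1 (of_nat t) \<mu> - b) \<noteq> 0"
 proof -
  have "box_sum 1 (of_nat t) \<mu> \<noteq> (box_sum 1 (of_nat t) \<nu> :: rat)" if "\<nu> \<in> set \<nu>s" for \<nu>
  proof
   assume eq: "box_sum 1 (of_nat t) \<mu> = (box_sum 1 (of_nat t) \<nu> :: rat)"
   have oi: "of_int (box_sum 1 (int t) \<nu>) = (box_sum 1 (of_nat t) \<nu> :: rat)" for \<nu>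
    using box_sum_hom[of "of_int :: int => rat" 1 "int t" \<nu>] by (simp add: is_ring_hom_def)
   have "box_sum 1 (int t) \<mu> = box_sum 1 (int t) \<nu>" using eq unfolding oi[symmetric] by simp
   moreover have "\<nu> \<in> partitions n" "\<nu> \<noteq> \<mu>" using that \<nu>s by auto
   ultimately show False
    using box_sum_digits_inj[of \<mu> t \<nu>] partition_parts[OF \<mu>] partition_parts[of \<nu> n]
    unfolding t_def by (metis add.commute le_imp_less_Suc add_2_eq_Suc' less_SucI)
  qed
  then show ?thesis by (auto simp: prod_list_zero_iff bs_def eB)
 qed
 ultimately have "eval_1 t P \<noteq> 0" by simp
 then have "P \<noteq> 0" by (auto simp: eval_1_def)
 then have "to_fract P \<noteq> 0" by simp
 then show ?thesis using Pc by auto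
qed

section \<open>Macdonald polynomials and the nabla operator\<close>

lemma complete_list_singleton: "\<exists>c. complete_list [n] = scale_sym c (schur [n] :: qt symfun)"
proof -
 have "scale_sym (mcoeff (schur \<mu>) (list_monomial [n])) (schur \<mu>) =
   scale_sym (mcoeff (schur \<mu>) (list_monomial [n])) (schur [n] :: qt symfun)" if \<mu>: "\<mu> \<in> partitions n" for \<mu>
 proof (cases "mcoeff (schur \<mu> :: qt symfun) (list_monomial [n]) = 0")
  case False
  then have "dominates \<mu> [n]" by (rule mcoeff_schur_dominates)
  then have le: "n \<le> sum_list (take 1 \<mu>)" unfolding dominates_def by (drule_tac spec[of _ 1]) simp
  have "schur \<mu> = (schur [n] :: qt symfun)"
  proof (cases \<mu>)
   case Nil
   \<comment> \<open>Here n = 0, and the list [0] is the empty partition up to a trailing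
     zero.\<close>
   then show ?thesis using schur_append_zeros[of "[]" 1, where ?'a = qt] sum_list_partition[OF \<mu>] by simp
  next
   case (Cons a \<nu>)
   then have "a + sum_list \<nu> = n" "0 \<notin> set \<nu>" "n \<le> a" using \<mu> le by (auto simp: partitions_def)
   then show ?thesis using Cons by (cases \<nu>) auto
  qed
  then show ?thesis by simp
 qed simp
 then have "complete_list [n] = (\<Sum>\<mu>\<in>partitions n. scale_sym (mcoeff (schur \<mu>) (list_monomial [n])) (schur [n] :: qt symfun))"
  by (subst complete_list_schur[of "[n]" n]) (simp, rule sum.cong[OF refl])
 then show ?thesis unfolding sum_scale_sym by blast
qed

lemma hall_eig_nonzero:
 assumes "\<mu> \<in> partitions n"
 shows "hall (eig \<mu>) (schur [sum_list \<mu>]) \<noteq> 0"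
proof -
 obtain c where c: "complete_list [n] = scale_sym c (schur [n] :: qt symfun)" using complete_list_singleton by blast
 have "list_monomial [n] = replicate_mset n 0" by (simp add: list_monomial_def)
 then have "at_one (eig \<mu>) = hall (eig \<mu>) (complete_list [n])"
  unfolding hall_complete_list by (simp add: at_one(2)[OF homogeneous_eig[OF assms]])
 also have "\<dots> = c * hall (eig \<mu>) (schur [n])" unfolding c by (simp add: hall_linear)
 finally show ?thesis using at_one_eig[OF assms] sum_list_partition[OF assms] by auto
qed

text \<open>Membership in both spans leaves a line, and the normalisation picks one point of it
  because the product of \<open>eig \<mu>\<close> with s_(n) does not vanish.\<close>

lemma macdonald_eig:
 assumes "\<mu> \<in> partitions n"
 shows "\<exists>c. c \<noteq> 0 \<and> macdonald \<mu> = scale_sym c (eig \<mu>)"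
proof -
 define h where "h = hall (eig \<mu>) (schur [sum_list \<mu>])"
 have h: "h \<noteq> 0" unfolding h_def by (rule hall_eig_nonzero[OF assms])
 have "macdonald \<mu> = scale_sym (inverse h) (eig \<mu>)"
  unfolding macdonald_def conj_assoc[symmetric] eig_characterization[OF assms]
 proof (rule the_equality)
  show "(\<exists>c. scale_sym (inverse h) (eig \<mu>) = scale_sym c (eig \<mu>)) \<and>
    hall (scale_sym (inverse h) (eig \<mu>)) (schur [sum_list \<mu>]) = 1"
   using h by (auto simp: hall_linear h_def[symmetric])
 next
  fix H assume H: "(\<exists>c. H = scale_sym c (eig \<mu>)) \<and> hall H (schur [sum_list \<mu>]) = 1"
  then obtain c where c: "H = scale_sym c (eig \<mu>)" by blast
  then have "c * h = 1" using H by (simp add: hall_linear h_def)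
  then have "c = inverse h" using inverse_unique[of h c] by (simp add: mult.commute)
  then show "H = scale_sym (inverse h) (eig \<mu>)" using c by simp
 qed
 then show ?thesis using h by (intro exI[of _ "inverse h"]) simp
qed

lemma inj_eig: "inj_on eig all_partitions"
proof (rule inj_onI)
 fix \<mu> \<nu> assume p: "\<mu> \<in> all_partitions" "\<nu> \<in> all_partitions" and eq: "eig \<mu> = eig \<nu>"
 obtain m n where mn: "\<mu> \<in> partitions m" "\<nu> \<in> partitions n" using p by (auto simp: all_partitions_def)
 have "scale_sym (e_val \<mu>) (eig \<mu>) = scale_sym (e_val \<nu>) (eig \<mu>)"
  using D_0_eig[OF mn(1)] D_0_eig[OF mn(2)] unfolding eq by metis
 then have "e_val \<mu> = e_val \<nu>" using eig_nonzero[OF mn(1)] by simp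
 then show "\<mu> = \<nu>" by (rule inj_onD[OF e_val_inj _ p])
qed

lemma independent_eig: "symfun.independent (eig ` all_partitions)"
 unfolding symfun.independent_explicit_finite_subsets
proof (intro allI impI)
 fix S u assume S: "S \<subseteq> eig ` all_partitions" "finite S" "(\<Sum>v\<in>S. scale_sym (u v) v) = 0"
 obtain T where T: "T \<subseteq> all_partitions" "S = eig ` T" using S(1) by (meson subset_imageE)
 have inj: "inj_on eig T" by (rule inj_on_subset[OF inj_eig T(1)])
 have fT: "finite T" using S(2) T(2) inj finite_imageD by blast
 have "(\<Sum>i\<in>T. scale_sym (u (eig i)) (eig i)) = 0" using S(3) unfolding T(2) by (simp add: sum.reindex[OF inj])
 then have "\<forall>i\<in>T. u (eig i) = 0" by (rule eig_independent[OF fT T(1)])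
 then show "\<forall>v\<in>S. u v = 0" using T(2) by auto
qed

lemma linear_eqI_eig:
 assumes "sym_linear F" "sym_linear G"
  and "\<And>\<mu> n. \<mu> \<in> partitions n ==> F (eig \<mu>) = G (eig \<mu>)"
 shows "F f = G f"
proof -
 interpret vp: vector_space_pair "scale_sym :: qt => _" "scale_sym :: qt => _" ..
 show ?thesis
 proof (rule vp.linear_eq_on_span[OF assms(1,2), of "eig ` all_partitions"])
  show "F x = G x" if "x \<in> eig ` all_partitions" for x
   using that assms(3) by (auto simp: all_partitions_def)
 qed (simp add: span_eig)
qed

text \<open>Eigenvalue equations are invariant under scaling, so those for \<open>macdonald\<close>
  and for \<open>eig\<close> are equivalent; as the latter form a basis, they define exactly one
  linear map.\<close>

lemma nabla:
 shows linear_nabla: "sym_linear nabla"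
  and nabla_eig: "\<mu> \<in> partitions n ==> nabla (eig \<mu>) = scale_sym (box_prod \<mu>) (eig \<mu>)"
proof -
 interpret vp: vector_space_pair "scale_sym :: qt => _" "scale_sym :: qt => _" ..
 obtain F where F: "sym_linear F"
  "\<forall>x\<in>eig ` all_partitions. F x = scale_sym (box_prod (inv_into all_partitions eig x)) x"
  using vp.linear_independent_extend[OF independent_eig,
    of "%x. scale_sym (box_prod (inv_into all_partitions eig x)) x"] by blast
 have Fe: "F (eig \<mu>) = scale_sym (box_prod \<mu>) (eig \<mu>)" if "\<mu> \<in> partitions n" for \<mu> n
 proof -
  have "\<mu> \<in> all_partitions" using that by (auto simp: all_partitions_def)
  then show ?thesis using F(2) inv_into_f_f[OF inj_eig] by auto
 qed
 have mac: "(\<forall>n. \<forall>\<mu>\<in>partitions n. G (macdonald \<mu>) =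
    scale_sym (q_var ^ part_stat (conjugate_partition \<mu>) * t_var ^ part_stat \<mu>) (macdonald \<mu>)) \<longleftrightarrow>
   (\<forall>n. \<forall>\<mu>\<in>partitions n. G (eig \<mu>) = scale_sym (box_prod \<mu>) (eig \<mu>))"
  if "sym_linear G" for G
 proof -
  interpret G: Vector_Spaces.linear scale_sym scale_sym G by (rule that)
  have "G (macdonald \<mu>) = scale_sym (q_var ^ part_stat (conjugate_partition \<mu>) * t_var ^ part_stat \<mu>) (macdonald \<mu>) \<longleftrightarrow>
   G (eig \<mu>) = scale_sym (box_prod \<mu>) (eig \<mu>)" if \<mu>: "\<mu> \<in> partitions n" for \<mu> n
  proof -
   obtain c where c: "c \<noteq> 0" "macdonald \<mu> = scale_sym c (eig \<mu>)" using macdonald_eig[OF \<mu>] by blast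
   have "G (macdonald \<mu>) = scale_sym c (G (eig \<mu>))" unfolding c(2) G.scale ..
   moreover have "scale_sym (box_prod \<mu>) (macdonald \<mu>) = scale_sym c (scale_sym (box_prod \<mu>) (eig \<mu>))"
    unfolding c(2) by (rule symfun.scale_left_commute)
   ultimately show ?thesis unfolding box_prod_eq[OF \<mu>] using symfun.scale_left_imp_eq[OF c(1)] by metis
  qed
  then show ?thesis by blast
 qed
 have "nabla = F" unfolding nabla_def
 proof (rule the_equality)
  show "sym_linear F \<and> (\<forall>n. \<forall>\<mu>\<in>partitions n. F (macdonald \<mu>) =
    scale_sym (q_var ^ part_stat (conjugate_partition \<mu>) * t_var ^ part_stat \<mu>) (macdonald \<mu>))"
   using mac[OF F(1)] F(1) Fe by blast
 next
  fix G assume G: "sym_linear G \<and> (\<forall>n. \<forall>\<mu>\<in>partitions n. G (macdonald \<mu>) =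
    scale_sym (q_var ^ part_stat (conjugate_partition \<mu>) * t_var ^ part_stat \<mu>) (macdonald \<mu>))"
  then have Gl: "sym_linear G" by blast
  then have "\<forall>n. \<forall>\<mu>\<in>partitions n. G (eig \<mu>) = scale_sym (box_prod \<mu>) (eig \<mu>)" using G mac by blast
  then have "G (eig \<mu>) = F (eig \<mu>)" if "\<mu> \<in> partitions n" for \<mu> n using Fe[OF that] that by simp
  then have "G f = F f" for f by (rule linear_eqI_eig[OF Gl F(1)])
  then show "G = F" by blast
 qed
 then show "sym_linear nabla"
  "\<mu> \<in> partitions n ==> nabla (eig \<mu>) = scale_sym (box_prod \<mu>) (eig \<mu>)" using F(1) Fe by simp_all
qed

lemma reduced_op_dominance_span:
 assumes \<mu>: "\<mu> \<in> partitions n"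
 shows "f \<in> dominance_span \<mu> ==> reduced_op q t 0 f \<in> dominance_span \<mu>"
  and "f \<in> strict_span \<mu> ==> reduced_op q t 0 f \<in> strict_span \<mu>"
proof -
 interpret L: Vector_Spaces.linear scale_sym scale_sym "reduced_op q t 0" by (rule linear_reduced_op)
 have s: "reduced_op q t 0 (schur \<nu>) \<in> dominance_span \<nu>" if "\<nu> \<in> partitions n" for \<nu>
 proof -
  have "reduced_op q t 0 (schur \<nu>) - scale_sym (op_eigenvalue q t \<nu>) (schur \<nu>) \<in> dominance_span \<nu>"
   using reduced_op_schur[OF that] strict_span_subset by blast
  from dominance_span_add[OF this dominance_span_scale[OF schur_in_dominance_span[OF that], of "op_eigenvalue q t \<nu>"]]
  show ?thesis by simp
 qed
 show "reduced_op q t 0 f \<in> dominance_span \<mu>" if "f \<in> dominance_span \<mu>"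
  using that unfolding dominance_span_def[of \<mu>]
 proof (induction rule: symfun.span_induct_alt)
  case (step c x y)
  then obtain \<nu> where \<nu>: "x = schur \<nu>" "\<nu> \<in> partitions n" "dominates \<nu> \<mu>" using sum_list_partition[OF \<mu>] by auto
  have "reduced_op q t 0 x \<in> dominance_span \<mu>" using s[OF \<nu>(2)] dominance_span_mono[OF \<nu>(2) \<mu> \<nu>(3)] \<nu>(1) by blast
  then show ?case using step unfolding dominance_span_def[symmetric]
   by (simp only: L.add L.scale dominance_span_add dominance_span_scale)
 qed (simp add: symfun.span_zero)
 show "reduced_op q t 0 f \<in> strict_span \<mu>" if "f \<in> strict_span \<mu>"
  using that unfolding strict_span_def[of \<mu>]
 proof (induction rule: symfun.span_induct_alt)
  case (step c x y)
  then obtain \<nu> where \<nu>: "x = schur \<nu>" "\<nu> \<in> partitions n" "dominates \<nu> \<mu>" "\<nu> \<noteq> \<mu>" using sum_list_partition[OF \<mu>] by auto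
  have "reduced_op q t 0 x \<in> strict_span \<mu>"
   using s[OF \<nu>(2)] dominance_span_subset_strict[OF \<nu>(2) \<mu> \<nu>(3,4)] \<nu>(1) by blast
  then show ?case using step unfolding strict_span_def[symmetric]
   by (simp only: L.add L.scale strict_span_add strict_span_scale)
 qed (simp add: symfun.span_zero)
qed

abbreviation "dual_D_0 \<equiv> dual_D_op q_var t_var 0"
abbreviation "dual_e_val \<equiv> op_eigenvalue (inverse q_var) (inverse t_var)"

text \<open>The dual operator preserves the conditions on both dominance spans, so it maps
  \<open>eig \<mu>\<close> to a multiple of itself; the factor is read off at s_\<mu> after the
  substitution X -> X (1 - q).\<close>

lemma dual_D_0_eig:
 assumes \<mu>: "\<mu> \<in> partitions n"
 shows "dual_D_0 (eig \<mu>) = scale_sym (dual_e_val \<mu>) (eig \<mu>)"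
proof -
 let ?R = "reduced_op (inverse q_var) (inverse t_var) 0" and ?\<phi> = "plethysm_one_minus q_var"
 interpret R: Vector_Spaces.linear scale_sym scale_sym ?R by (rule linear_reduced_op)
 interpret P: Vector_Spaces.linear scale_sym scale_sym ?\<phi> by (rule linear_plethysm)
 have "\<exists>c. eig \<mu> = scale_sym c (eig \<mu>)" by (rule exI[of _ 1]) simp
 then have e: "?\<phi> (eig \<mu>) \<in> dominance_span \<mu>" "plethysm_one_minus t_var (eig \<mu>) \<in> dominance_span (conjugate_partition \<mu>)"
  using eig_characterization[OF \<mu>, of "eig \<mu>"] by blast+
 have 1: "?\<phi> (dual_D_0 (eig \<mu>)) = ?R (?\<phi> (eig \<mu>))" by (rule plethysm_dual_D_op) simp
 have "plethysm_one_minus t_var (dual_D_0 (eig \<mu>)) =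
   reduced_op (inverse t_var) (inverse q_var) 0 (plethysm_one_minus t_var (eig \<mu>))"
  unfolding dual_D_op_swap[of q_var] by (rule plethysm_dual_D_op) simp
 then have "plethysm_one_minus t_var (dual_D_0 (eig \<mu>)) \<in> dominance_span (conjugate_partition \<mu>)"
  using reduced_op_dominance_span(1)[OF conjugate_partition(1)[OF \<mu>] e(2)] by simp
 moreover have "?\<phi> (dual_D_0 (eig \<mu>)) \<in> dominance_span \<mu>"
  unfolding 1 by (rule reduced_op_dominance_span(1)[OF \<mu> e(1)])
 ultimately obtain c where c: "dual_D_0 (eig \<mu>) = scale_sym c (eig \<mu>)" using eig_characterization[OF \<mu>] by blast
 define r where "r = ?\<phi> (eig \<mu>) - schur \<mu>"
 have r: "r \<in> strict_span \<mu>" unfolding r_def by (rule eig(1)[OF \<mu>])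
 have phi: "?\<phi> (eig \<mu>) = schur \<mu> + r" by (simp add: r_def)
 have "scale_sym c (schur \<mu> + r) = ?R (schur \<mu>) + ?R r" using 1 unfolding c P.scale phi R.add .
 then have "scale_sym (c - dual_e_val \<mu>) (schur \<mu>) =
   (?R (schur \<mu>) - scale_sym (dual_e_val \<mu>) (schur \<mu>)) + (?R r - scale_sym c r)"
  by (simp add: symfun.scale_left_diff_distrib symfun.scale_right_distrib algebra_simps)
 also have "\<dots> \<in> strict_span \<mu>"
  by (intro strict_span_add strict_span_diff strict_span_scale reduced_op_schur[OF \<mu>]
    reduced_op_dominance_span(2)[OF \<mu>] r)
 finally have s: "scale_sym (c - dual_e_val \<mu>) (schur \<mu>) \<in> strict_span \<mu>" .
 have "c = dual_e_val \<mu>"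
 proof (rule ccontr)
  assume "c \<noteq> dual_e_val \<mu>"
  then have "schur \<mu> \<in> strict_span \<mu>"
   using strict_span_scale[OF s, of "inverse (c - dual_e_val \<mu>)"] by simp
  then show False using schur_not_in_strict_span[OF \<mu>] by blast
 qed
 then show ?thesis using c by simp
qed

text \<open>Commuting \<open>D\<^sub>0\<close> with the commutator of \<open>D\<^sub>0\<^sup>*\<close> and \<open>\<partial>/\<partial>p\<^sub>1\<close> gives back \<open>\<partial>/\<partial>p\<^sub>1\<close>; on eigenvectors
 this restricts the Pieri coefficients to the removal of a single box.\<close>

lemma pd_eig:
 assumes \<mu>: "\<mu> \<in> partitions n"
 obtains S c where "finite S" "S \<subseteq> all_partitions" "pd (eig \<mu>) = (\<Sum>\<nu>\<in>S. scale_sym (c \<nu>) (eig \<nu>))"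
  "\<And>\<nu>. \<nu> \<in> S ==> c \<nu> \<noteq> 0 ==> box_prod \<mu> = (box_sum q_var t_var \<mu> - box_sum q_var t_var \<nu>) * box_prod \<nu>"
proof (cases n)
 case 0
 then have "pd (eig \<mu>) = 0" using homogeneous_pd_0 homogeneous_eig[OF \<mu>] by simp
 then show thesis using that[of "{}"] by simp
next
 case (Suc m)
 have "pd (eig \<mu>) \<in> symfun.span (eig ` partitions m)"
  using homogeneous_pd homogeneous_eig[OF \<mu>] homogeneous_iff_eig unfolding Suc by blast
 from span_explicit_family[OF this] obtain S c where S: "finite S" "S \<subseteq> partitions m"
  "pd (eig \<mu>) = (\<Sum>\<nu>\<in>S. scale_sym (c \<nu>) (eig \<nu>))" by blast
 have Sp: "\<nu> \<in> partitions m" if "\<nu> \<in> S" for \<nu> using that S(2) by blast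
 interpret D: Vector_Spaces.linear scale_sym scale_sym D_0 by (rule linear_D_op)
 interpret D': Vector_Spaces.linear scale_sym scale_sym dual_D_0 by (rule linear_dual_D_op)
 define M where "M = (1 - q_var) * (1 - t_var)"
 have M: "M \<noteq> 0" unfolding M_def by (rule M_nonzero)
 have D1: "dual_D_op q_var t_var 1 f = pd (dual_D_0 f) - dual_D_0 (pd f)" for f
  using pd_dual_D_op[of q_var t_var 0 f] by simp
 have "dual_D_op q_var t_var 1 (eig \<mu>) = (\<Sum>\<nu>\<in>S. scale_sym (c \<nu> * (dual_e_val \<mu> - dual_e_val \<nu>)) (eig \<nu>))"
  unfolding D1 dual_D_0_eig[OF \<mu>] pd_scale S(3)
  by (simp add: D'.sum D'.scale scale_sym_sum sum_subtractf[symmetric] dual_D_0_eig[OF Sp]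
    symfun.scale_left_diff_distrib[symmetric] right_diff_distrib mult.commute cong: sum.cong)
 note d1 = this
 have l: "D_0 (dual_D_op q_var t_var 1 (eig \<mu>)) =
   (\<Sum>\<nu>\<in>S. scale_sym (c \<nu> * (dual_e_val \<mu> - dual_e_val \<nu>) * e_val \<nu>) (eig \<nu>))"
  unfolding d1 by (simp add: D.sum D.scale D_0_eig[OF Sp] cong: sum.cong)
 have r: "dual_D_op q_var t_var 1 (D_0 (eig \<mu>)) =
   (\<Sum>\<nu>\<in>S. scale_sym (c \<nu> * (dual_e_val \<mu> - dual_e_val \<nu>) * e_val \<mu>) (eig \<nu>))"
 proof -
  have "dual_D_op q_var t_var 1 (D_0 (eig \<mu>)) = scale_sym (e_val \<mu>) (dual_D_op q_var t_var 1 (eig \<mu>))"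
   unfolding D_0_eig[OF \<mu>] dual_D_op_def by (rule vertex_op_scale)
  then show ?thesis unfolding d1 by (simp add: scale_sym_sum mult.commute)
 qed
 have "q_var * t_var \<noteq> 1" using q_t_power_neq(3)[of 1] by simp
 then have comm: "D_0 (dual_D_op q_var t_var 1 (eig \<mu>)) - dual_D_op q_var t_var 1 (D_0 (eig \<mu>)) =
   scale_sym (- (M\<^sup>2 / (q_var * t_var))) (pd (eig \<mu>))"
  unfolding M_def by (intro D_dual_D_commutator) simp_all
 define K where "K = M\<^sup>2 / (q_var * t_var)"
 have "(\<Sum>\<nu>\<in>S. scale_sym (c \<nu> * ((dual_e_val \<mu> - dual_e_val \<nu>) * (e_val \<nu> - e_val \<mu>) + K)) (eig \<nu>)) =
   D_0 (dual_D_op q_var t_var 1 (eig \<mu>)) - dual_D_op q_var t_var 1 (D_0 (eig \<mu>)) + scale_sym K (pd (eig \<mu>))"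
  unfolding l r S(3) scale_sym_sum sum_subtractf[symmetric] sum.distrib[symmetric]
 proof (rule sum.cong[OF refl])
  fix \<nu>
  have "x * (y * (z - z') + K) = x * y * z - x * y * z' + K * x" for x y z z' :: qt by (simp add: algebra_simps)
  from this[of "c \<nu>" "dual_e_val \<mu> - dual_e_val \<nu>" "e_val \<nu>" "e_val \<mu>"]
  show "scale_sym (c \<nu> * ((dual_e_val \<mu> - dual_e_val \<nu>) * (e_val \<nu> - e_val \<mu>) + K)) (eig \<nu>) =
   scale_sym (c \<nu> * (dual_e_val \<mu> - dual_e_val \<nu>) * e_val \<nu>) (eig \<nu>) -
   scale_sym (c \<nu> * (dual_e_val \<mu> - dual_e_val \<nu>) * e_val \<mu>) (eig \<nu>) + scale_sym K (scale_sym (c \<nu>) (eig \<nu>))"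
   by (simp only: symfun.scale_scale symfun.scale_left_diff_distrib symfun.scale_left_distrib)
 qed
 also have "\<dots> = 0" unfolding comm K_def by simp
 finally have "(\<Sum>\<nu>\<in>S. scale_sym (c \<nu> * ((dual_e_val \<mu> - dual_e_val \<nu>) * (e_val \<nu> - e_val \<mu>) + M\<^sup>2 / (q_var * t_var))) (eig \<nu>)) = 0"
  unfolding K_def .
 then have z: "\<forall>\<nu>\<in>S. c \<nu> * ((dual_e_val \<mu> - dual_e_val \<nu>) * (e_val \<nu> - e_val \<mu>) + M\<^sup>2 / (q_var * t_var)) = 0"
  using S(1,2) by (intro eig_independent) (auto simp: all_partitions_def)
 show thesis
 proof (rule that[OF S(1) _ S(3)])
  show "S \<subseteq> all_partitions" using S(2) by (auto simp: all_partitions_def)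
  fix \<nu> assume \<nu>: "\<nu> \<in> S" "c \<nu> \<noteq> 0"
  define b where "b = box_sum q_var t_var \<mu> - box_sum q_var t_var \<nu>"
  define b' where "b' = box_sum (inverse q_var) (inverse t_var) \<mu> - box_sum (inverse q_var) (inverse t_var) \<nu>"
  have e: "e_val \<nu> - e_val \<mu> = M * b" unfolding op_eigenvalue_box_sum b_def M_def by (simp add: algebra_simps)
  have M': "(1 - inverse q_var) * (1 - inverse t_var) = M / (q_var * t_var)"
   unfolding M_def by (simp add: field_simps)
  have e': "dual_e_val \<mu> - dual_e_val \<nu> = - (M / (q_var * t_var) * b')"
   unfolding op_eigenvalue_box_sum M' b'_def by (simp add: algebra_simps)
  \<comment> \<open>As the eigenvalues are 1 minus multiples of the box sums, this says that the
    differences \<open>b\<close> and \<open>b'\<close> of box sums are inverse to each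
    other.\<close>
  have "(dual_e_val \<mu> - dual_e_val \<nu>) * (e_val \<nu> - e_val \<mu>) + M\<^sup>2 / (q_var * t_var) = 0" using z \<nu> by auto
  then have "M\<^sup>2 / (q_var * t_var) * (b * b') = M\<^sup>2 / (q_var * t_var) * 1"
   unfolding e e' by (simp add: power2_eq_square algebra_simps)
  moreover have "M\<^sup>2 / (q_var * t_var) \<noteq> 0" using M by simp
  ultimately have "b * b' = 1" by (metis mult_left_cancel)
  moreover have "sum_list \<nu> < sum_list \<mu>"
   using sum_list_partition[OF \<mu>] sum_list_partition[OF Sp[OF \<nu>(1)]] Suc by simp
  ultimately obtain i j where ij: "(i, j) \<notin> diagram \<nu>" "diagram \<mu> = insert (i, j) (diagram \<nu>)"
   unfolding b_def b'_def by (rule box_sum_difference_unit)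
  \<comment> \<open>The weight of the removed box is both the difference of the box sums and the
    quotient of the nabla eigenvalues; this coincidence is what makes \<open>pd_nabla\<close>
    work.\<close>
  have "b = q_var ^ j * t_var ^ i" unfolding b_def box_sum_def ij(2) using ij(1) by simp
  moreover have "box_prod \<mu> = q_var ^ j * t_var ^ i * box_prod \<nu>" unfolding box_prod_def ij(2) using ij(1) by simp
  ultimately show "box_prod \<mu> = (box_sum q_var t_var \<mu> - box_sum q_var t_var \<nu>) * box_prod \<nu>"
   unfolding b_def by simp
 qed
qed

section \<open>The derivative of nabla and a recursion for the Hilbert series\<close>

definition D_quot :: "qt symfun => qt symfun" where
 "D_quot f = scale_sym (- inverse ((1 - q_var) * (1 - t_var))) (D_op q_var t_var 1 f)"

lemma linear_D_quot: "sym_linear D_quot"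
 unfolding Vector_Spaces.linear_iff D_quot_def D_op_def
 by (simp add: vertex_op_add vertex_op_scale vector_space_scale_sym symfun.scale_right_distrib mult.commute)

text \<open>Expand \<partial> of an eigenvector. On the term of \<nu>, the commutator of D_0 and
  \<partial> contributes the difference of the box sums and nabla the eigenvalue of \<nu>; by
  \<open>pd_eig\<close> their product is the eigenvalue of \<mu>.\<close>

lemma pd_nabla: "pd (nabla f) = - nabla (D_quot f)"
proof -
 interpret N: Vector_Spaces.linear scale_sym scale_sym nabla by (rule linear_nabla)
 interpret Q: Vector_Spaces.linear scale_sym scale_sym D_quot by (rule linear_D_quot)
 interpret D: Vector_Spaces.linear scale_sym scale_sym D_0 by (rule linear_D_op)
 show ?thesis
 proof (rule linear_eqI_eig[of "%f. pd (nabla f)" "%f. - nabla (D_quot f)"])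
  show "sym_linear (%f. pd (nabla f))"
   "sym_linear (%f. - nabla (D_quot f))"
   unfolding Vector_Spaces.linear_iff
   by (simp_all add: N.add N.scale Q.add Q.scale pd_add pd_scale vector_space_scale_sym)
  fix \<mu> n assume \<mu>: "\<mu> \<in> partitions n"
  define M where "M = (1 - q_var) * (1 - t_var)"
  have M: "M \<noteq> 0" unfolding M_def by (rule M_nonzero)
  obtain S c where S: "finite S" "S \<subseteq> all_partitions" "pd (eig \<mu>) = (\<Sum>\<nu>\<in>S. scale_sym (c \<nu>) (eig \<nu>))"
   "\<And>\<nu>. \<nu> \<in> S ==> c \<nu> \<noteq> 0 ==> box_prod \<mu> = (box_sum q_var t_var \<mu> - box_sum q_var t_var \<nu>) * box_prod \<nu>"
   using pd_eig[OF \<mu>] by blast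
  have De: "D_0 (eig \<nu>) = scale_sym (e_val \<nu>) (eig \<nu>)" "nabla (eig \<nu>) = scale_sym (box_prod \<nu>) (eig \<nu>)"
   if "\<nu> \<in> S" for \<nu> using that S(2) D_0_eig nabla_eig by (auto simp: all_partitions_def)
  have "D_op q_var t_var 1 (eig \<mu>) = D_0 (pd (eig \<mu>)) - pd (D_0 (eig \<mu>))"
   using pd_D_op[of q_var t_var 0 "eig \<mu>"] by simp
  also have "\<dots> = (\<Sum>\<nu>\<in>S. scale_sym (c \<nu> * (e_val \<nu> - e_val \<mu>)) (eig \<nu>))"
   unfolding D_0_eig[OF \<mu>] pd_scale S(3)
   by (simp add: D.sum D.scale scale_sym_sum sum_subtractf[symmetric] De
    symfun.scale_left_diff_distrib[symmetric] right_diff_distrib mult.commute cong: sum.cong)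
  finally have "D_quot (eig \<mu>) = (\<Sum>\<nu>\<in>S. scale_sym (- inverse M * (c \<nu> * (e_val \<nu> - e_val \<mu>))) (eig \<nu>))"
   unfolding D_quot_def M_def[symmetric] by (simp add: scale_sym_sum)
  also have "\<dots> = (\<Sum>\<nu>\<in>S. scale_sym (- (c \<nu> * (box_sum q_var t_var \<mu> - box_sum q_var t_var \<nu>))) (eig \<nu>))"
  proof (intro sum.cong refl arg_cong2[of _ _ _ _ scale_sym])
   fix \<nu>
   have "e_val \<nu> - e_val \<mu> = M * (box_sum q_var t_var \<mu> - box_sum q_var t_var \<nu>)"
    unfolding op_eigenvalue_box_sum M_def by (simp add: algebra_simps)
   then show "- inverse M * (c \<nu> * (e_val \<nu> - e_val \<mu>)) = - (c \<nu> * (box_sum q_var t_var \<mu> - box_sum q_var t_var \<nu>))"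
    using M by simp
  qed
  finally have "nabla (D_quot (eig \<mu>)) =
    (\<Sum>\<nu>\<in>S. scale_sym (- (c \<nu> * ((box_sum q_var t_var \<mu> - box_sum q_var t_var \<nu>) * box_prod \<nu>))) (eig \<nu>))"
   by (simp add: N.sum N.scale N.neg De mult.assoc cong: sum.cong)
  also have "\<dots> = (\<Sum>\<nu>\<in>S. scale_sym (- (c \<nu> * box_prod \<mu>)) (eig \<nu>))"
   using S(4) by (intro sum.cong refl) (metis mult_zero_left)
  also have "\<dots> = - scale_sym (box_prod \<mu>) (pd (eig \<mu>))"
   unfolding S(3) by (simp add: scale_sym_sum sum_negf mult.commute)
  finally show "pd (nabla (eig \<mu>)) = - nabla (D_quot (eig \<mu>))" by (simp add: nabla_eig[OF \<mu>] pd_scale)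
 qed
qed

text \<open>When X is enlarged by a new variable x, only p_1 contributes to the first power of
  x.\<close>

lemma mcoeff_pd: "x \<notin># M ==> mcoeff (pd f) M = mcoeff f (add_mset x M)"
proof (induction f arbitrary: M rule: sym_induct)
 case one
 then show ?case by (simp add: one_symfun.rep_eq zero_symfun.rep_eq)
next
 case (power_sum r f)
 define A where "A = {y. r \<le> count M y}"
 have xA: "x \<notin> A" using power_sum by (simp add: A_def not_in_iff)
 have fA: "finite A" unfolding A_def by (rule finite_count_ge[OF power_sum(1)])
 have "mcoeff (power_sum_sym r * pd f) M = (\<Sum>y\<in>A. mcoeff (pd f) (M - replicate_mset r y))"
  unfolding A_def by (rule mcoeff_power_sum_times[OF power_sum(1)])
 also have "\<dots> = (\<Sum>y\<in>A. mcoeff f (add_mset x M - replicate_mset r y))"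
 proof (rule sum.cong[OF refl])
  fix y assume y: "y \<in> A"
  then have "y \<noteq> x" using xA by auto
  then have "add_mset x M - replicate_mset r y = add_mset x (M - replicate_mset r y)"
   by (intro multiset_eqI) auto
  moreover have "x \<notin># M - replicate_mset r y" using power_sum(3) by (meson in_diffD)
  ultimately show "mcoeff (pd f) (M - replicate_mset r y) = mcoeff f (add_mset x M - replicate_mset r y)"
   using power_sum(2) by simp
 qed
 finally have 1: "mcoeff (power_sum_sym r * pd f) M = (\<Sum>y\<in>A. mcoeff f (add_mset x M - replicate_mset r y))" .
 have "{y. r \<le> count (add_mset x M) y} = (if r = 1 then insert x A else A)"
  using power_sum(1,3) by (auto simp: A_def not_in_iff split: if_splits)
 then have "mcoeff (power_sum_sym r * f) (add_mset x M) =
   (\<Sum>y\<in>(if r = 1 then insert x A else A). mcoeff f (add_mset x M - replicate_mset r y))"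
  unfolding mcoeff_power_sum_times[OF power_sum(1)] by simp
 also have "\<dots> = mcoeff (power_sum_sym r * pd f) M + (if r = 1 then mcoeff f M else 0)"
  using xA fA by (simp add: 1)
 also have "\<dots> = mcoeff (pd (power_sum_sym r * f)) M"
  unfolding pd_power_sum_times[OF power_sum(1)] by (simp add: plus_symfun.rep_eq zero_symfun.rep_eq)
 finally show ?case by simp
qed (simp_all add: pd_add pd_scale plus_symfun.rep_eq scale_sym.rep_eq)

text \<open>The product with h_1^n is the coefficient of x_0 ... x_(n-1), and each derivative strips
  one of these variables.\<close>

lemma hall_complete_sym_1_power: "hall f (complete_sym 1 ^ n) = mcoeff ((pd ^^ n) f) {#}"
proof -
 have "mcoeff ((pd ^^ m) f) (list_monomial (replicate k 1)) = mcoeff f (list_monomial (replicate (m + k) 1))" for m k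
 proof (induction m arbitrary: k)
  case (Suc m)
  have "k \<notin># list_monomial (replicate k 1)" using set_list_monomial[of k "replicate k 1"] by auto
  then have "mcoeff ((pd ^^ Suc m) f) (list_monomial (replicate k 1)) =
    mcoeff ((pd ^^ m) f) (add_mset k (list_monomial (replicate k 1)))" by (simp add: mcoeff_pd)
  also have "add_mset k (list_monomial (replicate k 1)) = list_monomial (replicate (Suc k) 1)"
   using list_monomial_snoc[of "replicate k 1" 1] by (simp add: replicate_append_same)
  finally show ?case by (simp only: Suc.IH add_Suc_right add_Suc)
 qed simp
 from this[of n 0] have "mcoeff ((pd ^^ n) f) {#} = hall f (complete_list (replicate n 1))"
  unfolding hall_complete_list by simp
 then show ?thesis by (simp add: map_replicate_const prod_list_replicate)
qed

lemma mcoeff_nabla_empty: "mcoeff (nabla f) {#} = mcoeff f {#}"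
proof -
 interpret N: Vector_Spaces.linear scale_sym scale_sym nabla by (rule linear_nabla)
 have "f \<in> symfun.span (eig ` all_partitions)" by (simp add: span_eig)
 then show ?thesis
 proof (induction rule: symfun.span_induct_alt)
  case (step c x y)
  then obtain \<mu> n where \<mu>: "x = eig \<mu>" "\<mu> \<in> partitions n" by (auto simp: all_partitions_def)
  have "mcoeff (nabla x) {#} = mcoeff x {#}"
  proof (cases "\<mu> = []")
   case True
   then show ?thesis using nabla_eig[OF \<mu>(2)] \<mu>(1) by (simp add: box_prod_def diagram_def)
  next
   case False
   then have "n \<noteq> 0" using \<mu>(2) by (cases \<mu>) (auto simp: partitions_def)
   then have "mcoeff x {#} = 0" using homogeneous_eig[OF \<mu>(2)] \<mu>(1) by (simp add: homogeneous_def)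
   then show ?thesis using nabla_eig[OF \<mu>(2)] \<mu>(1) by (simp add: scale_sym.rep_eq)
  qed
  then show ?case using step by (simp add: N.add N.scale plus_symfun.rep_eq scale_sym.rep_eq)
 qed simp
qed

text \<open>The constant term of \<open>D_quot ^^ m\<close> on a product of elementary functions, as
  a recursion over any commutative ring. A translation by degree k leaves z^(-k), so the factor
  Exp[- z X] supplies \<open>elem (k - 1)\<close>, and nothing for k = 0.\<close>

fun hilb :: "'a :: comm_ring_1 => 'a => nat => nat list => 'a" where
 "hilb q t 0 l = (if set l \<subseteq> {0} then 1 else 0)"
| "hilb q t (Suc m) l = quo q t l (%k xs. if k = 0 then 0 else hilb q t m ((k - 1) # xs))"

lemma hilb_hom:
 assumes "is_ring_hom \<rho>"
 shows "\<rho> (hilb q t m l) = hilb (\<rho> q) (\<rho> t) m l"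
proof (induction m arbitrary: l)
 case (Suc m)
 have "\<rho> (quo q t l F) = quo (\<rho> q) (\<rho> t) l (%k xs. \<rho> (F k xs))" for F
  by (rule quo_natural) (simp_all add: is_ring_homD[OF assms])
 then show ?case by (simp add: if_distrib[of \<rho>] is_ring_homD[OF assms] Suc cong: if_cong)
qed (simp add: is_ring_homD[OF assms])

text \<open>The operator \<open>A\<close> is abstract because the recursion is used twice: for
  \<open>D_quot\<close> over Q(q,t), and for its analogue at q = -1 over a field that contains
  t.\<close>

lemma hilb_operator:
 fixes L :: "'a :: field_char_0 symfun => 'a"
 assumes A: "\<And>x y. A (x + y) = A x + A y" "\<And>c x. A (scale_sym c x) = scale_sym c (A x)"
  and L: "\<And>x y. L (x + y) = L x + L y" "\<And>c x. L (scale_sym c x) = c * L x"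
  and E: "\<And>l. A (E l) = quo (const_sym q) (const_sym t) l (%k xs. if k = 0 then 0 else E ((k - 1) # xs))"
  and L0: "\<And>l. L (E l) = (if set l \<subseteq> {0} then 1 else 0)"
 shows "L ((A ^^ m) (E l)) = hilb q t m l"
proof (induction m arbitrary: l)
 case (Suc m)
 have Am: "(A ^^ m) (x + y) = (A ^^ m) x + (A ^^ m) y" "(A ^^ m) (scale_sym c x) = scale_sym c ((A ^^ m) x)" for x y c
  by (induction m) (simp_all add: A)
 have 0: "L ((A ^^ m) 0) = 0" using Am(2)[of 0 0] L(2)[of 0 "(A ^^ m) 0"] by simp
 have "L ((A ^^ m) (A (E l))) = quo q t l (%k xs. L ((A ^^ m) (if k = 0 then 0 else E ((k - 1) # xs))))"
  unfolding E by (rule quo_natural) (simp_all add: Am L scale_sym_times)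
 also have "\<dots> = hilb q t (Suc m) l" by (simp add: if_distrib[of "%x. L ((A ^^ m) x)"] 0 Suc cong: if_cong)
 finally show ?case by (simp add: funpow_swap1)
qed (simp add: L0)

lemma mcoeff_times_empty: "mcoeff (f * g) {#} = mcoeff f {#} * mcoeff g {#}"
 by (simp add: times_symfun.rep_eq)

lemma mcoeff_elem_list_empty: "mcoeff (elem_list l) {#} = (if set l \<subseteq> {0} then 1 else 0)"
proof -
 have "mcoeff (elem n) {#} = (if n = 0 then 1 else 0 :: 'a :: field_char_0)" for n
  unfolding elem_def elementary_sym_eq_exp[symmetric] by (simp add: scale_sym.rep_eq elementary_sym.rep_eq)
 then show ?thesis by (induction l) (auto simp: mcoeff_times_empty one_symfun.rep_eq)
qed

theorem hall_nabla_elementary: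
 "hall (nabla (elementary_sym n)) (complete_sym 1 ^ n) = hilb q_var t_var n [n]"
proof -
 interpret N: Vector_Spaces.linear scale_sym scale_sym nabla by (rule linear_nabla)
 interpret Q: Vector_Spaces.linear scale_sym scale_sym D_quot by (rule linear_D_quot)
 \<comment> \<open>The sign (-1)^n produced here cancels the one between e_n and
   \<open>elem n\<close>.\<close>
 have pd_pow: "(pd ^^ m) (nabla f) = scale_sym ((- 1) ^ m) (nabla ((D_quot ^^ m) f))" for m f
  by (induction m) (simp_all add: pd_scale pd_nabla)
 have pow_scale: "(D_quot ^^ m) (scale_sym c f) = scale_sym c ((D_quot ^^ m) f)" for m c f
  by (induction m) (simp_all add: Q.scale)
 have "elementary_sym n = scale_sym ((- 1) ^ n) (scale_sym ((- 1) ^ n) (elementary_sym n :: qt symfun))"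
  by (simp flip: power_mult_distrib)
 then have e: "elementary_sym n = scale_sym ((- 1) ^ n) (elem_list [n] :: qt symfun)"
  unfolding elementary_sym_eq_exp by (simp add: elem_def)
 have "hall (nabla (elementary_sym n)) (complete_sym 1 ^ n) = mcoeff ((D_quot ^^ n) (elem_list [n])) {#}"
  unfolding hall_complete_sym_1_power pd_pow unfolding e pow_scale N.scale
  by (simp add: scale_sym.rep_eq mcoeff_nabla_empty flip: power_mult_distrib)
 also have "\<dots> = hilb q_var t_var n [n]"
 proof (rule hilb_operator[of D_quot "%f. mcoeff f {#}" elem_list q_var t_var])
  fix l
  define m where "m = (1 - q_var) * (1 - t_var)"
  have "D_quot (elem_list l) = quo (const_sym q_var) (const_sym t_var) l (%k xs. (if 1 \<le> k then elem (k - 1) else 0) * elem_list xs)"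
   using M_nonzero unfolding D_quot_def D_op_elem_list const_sym_M m_def[symmetric] by (simp add: scale_sym_times)
  also have "\<dots> = quo (const_sym q_var) (const_sym t_var) l (%k xs. if k = 0 then 0 else elem_list ((k - 1) # xs))"
   by (rule quo_cong) simp
  finally show "D_quot (elem_list l) = \<dots>" .
 qed (simp_all add: Q.add Q.scale plus_symfun.rep_eq scale_sym.rep_eq mcoeff_elem_list_empty)
 finally show ?thesis .
qed

section \<open>The specialisation \<open>q = -1\<close>\<close>

text \<open>For odd \<open>i\<close> this is the exponent of \<open>(- 1)\<^sup>m e\<^sub>m[X (1 - t\<^sup>k) / (1 - t)]\<close>; even power sums are set to
 zero, which is harmless since the operator at \<open>q = - 1\<close> does not translate them.\<close>

definition odd_exponent :: "'a :: field_char_0 => nat => nat => 'a" where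
 "odd_exponent t k i = (if odd i then - ((1 - t ^ (k * i)) / (1 - t ^ i)) else 0)"

definition odd_exp :: "'a :: field_char_0 => nat => nat => 'a symfun" where
 "odd_exp t k = sym_exp (odd_exponent t k)"

text \<open>Constant terms for the family e_n[X (1 - t^k) / (1 - t)] at q = -1, with the sign
  (-1)^n; see \<open>mcoeff_odd_op_power\<close>. For k = 0 the prefactor vanishes, so the truncated
  k - 1 does no harm.\<close>

fun minus_one_rec :: "'a :: field => nat => nat => 'a" where
 "minus_one_rec t 0 k = 1"
| "minus_one_rec t (Suc n) k = (1 - t ^ k) / ((1 - t) * (1 + t ^ k)) *
  (t ^ n * minus_one_rec t n (k - 1) + t ^ k * minus_one_rec t n (Suc k))"

lemma qt_num_minus_one: "(1 + t) * qt_num (- 1) t i = t ^ i - (- 1) ^ i"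
proof (induction i)
 case (Suc i)
 have "(1 + t) * qt_num (- 1) t (Suc i) = t * ((1 + t) * qt_num (- 1) t i) + (1 + t) * (- 1) ^ i"
  by (simp add: qt_num_Suc algebra_simps)
 then show ?case unfolding Suc by (simp add: algebra_simps)
qed simp

context
 fixes t :: "'a :: field_char_0"
 assumes t_pow: "\<And>r. r \<ge> 1 ==> t ^ r \<noteq> 1" and t_pow_minus: "\<And>r. 1 + t ^ r \<noteq> 0" and t0: "t \<noteq> 0"
begin

definition odd_op :: "'a symfun => 'a symfun" where
 "odd_op f = scale_sym (- inverse (2 * (1 - t))) (vertex_op (odd_exp t 1) (M_alphabet (- 1) t) 1 f)"

text \<open>With u = t^k the translation of degree i + 1 contributes a multiple of (u^(i+1) +
  (-1)^i) / (1 + u). The two terms rescale the first series by u and by -1; added to the exponent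
  for k, they give those for k + 1 and, up to the factor t^m, for k - 1.\<close>

lemma vertex_op_odd_exp:
 "vertex_op (odd_exp t 1) (M_alphabet (- 1) t) 1 (odd_exp t k (Suc m)) =
  scale_sym (- (2 * (1 - t ^ k) / (1 + t ^ k)))
   (scale_sym (t ^ k) (odd_exp t (Suc k) m) + scale_sym (t ^ m) (odd_exp t (k - 1) m))"
proof (cases "k = 0")
 case True
 have "odd_exp t 0 n = (if n = 0 then 1 else 0)" for n
  unfolding odd_exp_def by (subst sym_exp_cong[of _ "%_. 0"]) (simp_all add: odd_exponent_def sym_exp_zero)
 then show ?thesis using True by (auto simp: vertex_op_def intro!: sum.neutral)
next
 case False
 let ?M = "M_alphabet (- 1) t"
 define u where "u = t ^ k"
 have u: "1 + u \<noteq> 0" unfolding u_def by (rule t_pow_minus)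
 \<comment> \<open>For odd i the denominator 1 - t^i of the exponent cancels against the alphabet;
   for even i both sides vanish.\<close>
 have sc: "scalar_exp (%i. odd_exponent t k i * ?M i) n =
   (if n = 0 then 1 else - (2 * (1 - u) * qt_num (- 1) u n))" for n
 proof -
  have "scalar_exp (%i. odd_exponent t k i * ?M i) n = scalar_exp (%i. - ((1 - (- 1) ^ i) * (1 - u ^ i))) n"
  proof (rule scalar_exp_unique[OF scalar_exp])
   fix i :: nat assume "i \<ge> 1"
   then have "1 - t ^ i \<noteq> 0" using t_pow[of i] by simp
   have "- (c * x) = - (x / y) * (c * y)" if "y \<noteq> 0" for c x y :: 'a using that by simp
   from this[OF \<open>1 - t ^ i \<noteq> 0\<close>, of 2 "1 - u ^ i"] show "- ((1 - (- 1) ^ i) * (1 - u ^ i)) = odd_exponent t k i * ?M i"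
    unfolding odd_exponent_def M_alphabet_def power_mult u_def[symmetric]
    by (cases "odd i") (simp_all only: if_True if_False power_minus_odd power_minus_even not_not not_False_eq_True
     power_one diff_minus_eq_add one_add_one diff_self mult_zero_left mult_zero_right minus_zero)
  qed
  then show ?thesis by (simp add: scalar_exp_minus_M)
 qed
 have tr: "translate ?M i (odd_exp t k n) = (if i \<le> n then scale_sym (if i = 0 then 1 else - (2 * (1 - u) * qt_num (- 1) u i)) (odd_exp t k (n - i)) else 0)" for i n
  unfolding odd_exp_def translate_sym_exp sc by simp
 define N where "N = max (degree (translation ?M (odd_exp t k (Suc m)))) (Suc m)"
 have "vertex_op (odd_exp t 1) ?M 1 (odd_exp t k (Suc m)) =
   (\<Sum>i\<le>N. if 1 \<le> i then odd_exp t 1 (i - 1) * translate ?M i (odd_exp t k (Suc m)) else 0)"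
  by (rule vertex_op_eq) (simp add: N_def)
 also have "\<dots> = (\<Sum>i\<in>{1..Suc m}. odd_exp t 1 (i - 1) * translate ?M i (odd_exp t k (Suc m)))"
  by (rule sum.mono_neutral_cong_right) (auto simp: N_def tr)
 also have "\<dots> = (\<Sum>i\<le>m. odd_exp t 1 i * translate ?M (Suc i) (odd_exp t k (Suc m)))"
  by (rule sum.reindex_bij_witness[of _ Suc "%i. i - 1"]) auto
 also have "\<dots> = (\<Sum>i\<le>m. scale_sym (- (2 * (1 - u) / (1 + u)))
   (scale_sym u (scale_sym (u ^ i) (odd_exp t 1 i) * odd_exp t k (m - i)) + scale_sym ((- 1) ^ i) (odd_exp t 1 i) * odd_exp t k (m - i)))"
 proof (rule sum.cong[OF refl])
  fix i assume "i \<in> {..m}"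
  have "qt_num (- 1) u (Suc i) = (u * u ^ i + (- 1) ^ i) / (1 + u)"
   using qt_num_minus_one[of u "Suc i"] u by (simp add: field_simps)
  then have "- (2 * (1 - u) * qt_num (- 1) u (Suc i)) = - (2 * (1 - u) / (1 + u)) * (u * u ^ i + (- 1) ^ i)" by simp
  then show "odd_exp t 1 i * translate ?M (Suc i) (odd_exp t k (Suc m)) =
   scale_sym (- (2 * (1 - u) / (1 + u))) (scale_sym u (scale_sym (u ^ i) (odd_exp t 1 i) * odd_exp t k (m - i)) +
    scale_sym ((- 1) ^ i) (odd_exp t 1 i) * odd_exp t k (m - i))"
   using \<open>i \<in> {..m}\<close> unfolding tr
   by (simp add: scale_sym_times symfun.scale_left_distrib[symmetric] distrib_left)
 qed
 also have "\<dots> = scale_sym (- (2 * (1 - u) / (1 + u))) (scale_sym u (\<Sum>i\<le>m. scale_sym (u ^ i) (odd_exp t 1 i) * odd_exp t k (m - i)) +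
   (\<Sum>i\<le>m. scale_sym ((- 1) ^ i) (odd_exp t 1 i) * odd_exp t k (m - i)))"
  by (simp only: scale_sym_sum sum.distrib symfun.scale_right_distrib)
 also have "(\<Sum>i\<le>m. scale_sym (u ^ i) (odd_exp t 1 i) * odd_exp t k (m - i)) = odd_exp t (Suc k) m"
  unfolding odd_exp_def sym_exp_scale[symmetric] sym_exp_mult
 proof (rule sym_exp_cong)
  fix i :: nat assume "i \<ge> 1"
  then have "1 - t ^ i \<noteq> 0" using t_pow[of i] by simp
  moreover have "t ^ (Suc k * i) = t ^ i * u ^ i" "t ^ (k * i) = u ^ i" "t ^ (1 * i) = t ^ i"
   by (simp_all add: u_def power_mult[symmetric] power_add)
  ultimately show "u ^ i * odd_exponent t 1 i + odd_exponent t k i = odd_exponent t (Suc k) i"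
   unfolding odd_exponent_def by (simp add: field_simps)
 qed
 also have "(\<Sum>i\<le>m. scale_sym ((- 1) ^ i) (odd_exp t 1 i) * odd_exp t k (m - i)) = scale_sym (t ^ m) (odd_exp t (k - 1) m)"
  unfolding odd_exp_def sym_exp_scale[symmetric] sym_exp_mult
 proof (rule sym_exp_cong)
  fix i :: nat assume "i \<ge> 1"
  then have "1 - t ^ i \<noteq> 0" using t_pow[of i] by simp
  moreover have "t ^ (k * i) = t ^ i * t ^ ((k - 1) * i)" using False by (cases k) (simp_all add: power_add)
  ultimately show "(- 1) ^ i * odd_exponent t 1 i + odd_exponent t k i = t ^ i * odd_exponent t (k - 1) i"
   by (simp add: odd_exponent_def field_simps)
 qed
 finally show ?thesis unfolding u_def .
qed

lemma odd_op_add: "odd_op (f + g) = odd_op f + odd_op g" and odd_op_scale: "odd_op (scale_sym c f) = scale_sym c (odd_op f)"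
 by (simp_all add: odd_op_def vertex_op_add vertex_op_scale symfun.scale_right_distrib mult.commute)

lemma odd_op_odd_exp:
 "odd_op (odd_exp t k (Suc m)) = scale_sym ((1 - t ^ k) / ((1 - t) * (1 + t ^ k)))
  (scale_sym (t ^ m) (odd_exp t (k - 1) m) + scale_sym (t ^ k) (odd_exp t (Suc k) m))"
proof -
 have "- inverse (2 * a) * - (2 * b / c) = b / (a * c)" for a b c :: 'a
  by (cases "a = 0"; cases "c = 0") (simp_all add: field_simps)
 then have "- inverse (2 * (1 - t)) * - (2 * (1 - t ^ k) / (1 + t ^ k)) = (1 - t ^ k) / ((1 - t) * (1 + t ^ k))" .
 then show ?thesis unfolding odd_op_def vertex_op_odd_exp by (simp only: symfun.scale_scale add.commute)
qed

lemma mcoeff_odd_op_power: "mcoeff ((odd_op ^^ n) (odd_exp t k n)) {#} = minus_one_rec t n k"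
proof (induction n arbitrary: k)
 case 0
 then show ?case by (simp add: odd_exp_def one_symfun.rep_eq)
next
 case (Suc n)
 have lin: "(odd_op ^^ m) (f + g) = (odd_op ^^ m) f + (odd_op ^^ m) g" "(odd_op ^^ m) (scale_sym c f) = scale_sym c ((odd_op ^^ m) f)" for m f g c
  by (induction m) (simp_all add: odd_op_add odd_op_scale)
 have "(odd_op ^^ Suc n) (odd_exp t k (Suc n)) = (odd_op ^^ n) (odd_op (odd_exp t k (Suc n)))" by (simp only: funpow_Suc_right o_apply)
 then show ?case unfolding odd_op_odd_exp lin by (simp add: plus_symfun.rep_eq scale_sym.rep_eq Suc)
qed

text \<open>The projection \<open>\<pi>\<close> kills the even power sums. The alphabet at q = -1
  vanishes in even degrees, so \<open>\<pi>\<close> intertwines the two operators, and it preserves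
  constant terms.\<close>

lemma hilb_minus_one: "hilb (- 1) t n [n] = minus_one_rec t n 1"
proof -
 obtain \<pi> where \<pi>: "is_sym_hom (%c :: 'a. scale_sym c 1) \<pi>"
  "\<And>r. r \<ge> 1 ==> \<pi> (power_sum_sym r) = scale_sym (if odd r then 1 else 0) (power_sum_sym r)"
  using ex_sym_endo[of "%r. scale_sym (if odd r then 1 else 0) (power_sum_sym r)"] by blast
 have \<pi>_exp: "\<pi> (sym_exp c m) = sym_exp (%i. c i * (if odd i then 1 else 0)) m" for c m
  by (rule sym_exp_hom[OF \<pi>(1)]) (rule \<pi>(2))
 have \<pi>_elem: "\<pi> (elem m) = odd_exp t 1 m" for m unfolding elem_def odd_exp_def \<pi>_exp
 proof (rule sym_exp_cong)
  fix i :: nat assume "i \<ge> 1"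
  then have "1 - t ^ i \<noteq> 0" using t_pow[of i] by simp
  then show "- 1 * (if odd i then 1 else 0) = odd_exponent t 1 i" by (simp add: odd_exponent_def)
 qed
 define A where "A f = scale_sym (- inverse (2 * (1 - t))) (D_op (- 1) t 1 f)" for f
 have \<pi>_A: "\<pi> (A f) = odd_op (\<pi> f)" for f
 proof -
  have "\<pi> (D_op (- 1) t 1 f) = vertex_op (%n. \<pi> (elem n)) (M_alphabet (- 1) t) 1 (\<pi> f)"
   unfolding D_op_def elem_def[symmetric]
   by (rule vertex_op_hom[OF \<pi>(1), where b = "%r. if odd r then 1 else 0"]) (simp_all add: \<pi>(2) M_alphabet_def)
  then show ?thesis
   unfolding A_def odd_op_def \<pi>_elem is_sym_homD(4)[OF \<pi>(1)] scale_sym_eq_mult[symmetric] by (simp only:)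
 qed
 have \<pi>_const: "mcoeff (\<pi> f) {#} = mcoeff f {#}" for f
 proof (induction f rule: sym_induct)
  case (power_sum r f)
  then show ?case by (simp add: is_sym_homD[OF \<pi>(1)] mcoeff_times_empty \<pi>(2) scale_sym.rep_eq power_sum_sym.rep_eq)
 qed (simp_all add: is_sym_homD[OF \<pi>(1)] plus_symfun.rep_eq scale_sym.rep_eq scale_sym_times)
 have M: "2 * (1 - t) \<noteq> 0" using t_pow[of 1] by simp
 have "mcoeff ((A ^^ n) (elem_list [n])) {#} = hilb (- 1) t n [n]"
 proof (rule hilb_operator[of A "%f. mcoeff f {#}" elem_list "- 1" t])
  fix l
  define m where "m = 2 * (1 - t)"
  have m: "(1 - - 1) * (1 - t) = m" by (simp add: m_def)
  have "A (elem_list l) = quo (const_sym (- 1)) (const_sym t) l (%k xs. (if 1 \<le> k then elem (k - 1) else 0) * elem_list xs)"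
   using M unfolding A_def D_op_elem_list const_sym_M m_def[symmetric] m by (simp add: scale_sym_times)
  also have "\<dots> = quo (const_sym (- 1)) (const_sym t) l (%k xs. if k = 0 then 0 else elem_list ((k - 1) # xs))"
   by (rule quo_cong) simp
  finally show "A (elem_list l) = \<dots>" .
 qed (simp_all add: A_def D_op_def vertex_op_add vertex_op_scale symfun.scale_right_distrib mult.commute
    plus_symfun.rep_eq scale_sym.rep_eq mcoeff_elem_list_empty)
 moreover have "\<pi> ((A ^^ m) f) = (odd_op ^^ m) (\<pi> f)" for m f
  by (induction m) (simp_all add: \<pi>_A)
 ultimately show ?thesis
  using mcoeff_odd_op_power[of n 1] \<pi>_const[of "(A ^^ n) (elem n)"] by (simp add: \<pi>_elem)
qed

end

subsection \<open>Solving the recursion\<close>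

definition num :: "'a :: comm_ring_1 => nat => 'a" where
 "num t k = (\<Sum>l<k. t ^ l)"

text \<open>Weighted lattice paths with \<open>i\<close> steps from height 0 to height
  \<open>j\<close> that stay nonnegative; \<open>s\<close> distinguishes the parity of n and enters
  through the weights of the down steps.\<close>

fun path_count :: "'a :: comm_ring_1 => nat => nat => nat => 'a" where
 "path_count t s 0 j = (if j = 0 then 1 else 0)"
| "path_count t s (Suc i) j = (if j = 0 then 0 else num t j * path_count t s i (j - 1)) +
   num t (j + 1 + s) * path_count t s i (Suc j)"

text \<open>The exponents run from -(j - 1) to j - 1 in steps of 2. Replacing x by t x or x / t in
  the product with j + 1 factors gives the product with j factors and one additional factor.\<close>

definition balanced_prod :: "'a :: field => nat => 'a => 'a" where
 "balanced_prod t j x = (\<Prod>i<j. 1 - x * t powi (2 * int i - int j + 1))"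

lemma balanced_prod_up:
 assumes "t \<noteq> 0"
 shows "balanced_prod t (Suc j) (t * x) = balanced_prod t j x * (1 - x * t ^ Suc j)"
proof -
 have *: "t * x * t powi (2 * int i - int (Suc j) + 1) = x * t powi (2 * int i - int j + 1)" for i
  using assms power_int_add[of t "2 * int i - int j" 1] by (simp add: mult_ac)
 have "2 * int j - int j + 1 = int (Suc j)" by simp
 then show ?thesis unfolding balanced_prod_def * prod.lessThan_Suc by (simp only: power_int_of_nat)
qed

lemma balanced_prod_down:
 assumes "t \<noteq> 0"
 shows "balanced_prod t (Suc j) (x / t) = balanced_prod t j x * (1 - x / t ^ Suc j)"
proof -
 have *: "x / t * t powi e = x * t powi (e - 1)" for e using assms by (simp add: power_int_diff)
 have "2 * int 0 - int (Suc j) + 1 - 1 = - int (Suc j)" by simp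
 then have "t powi (2 * int 0 - int (Suc j) + 1 - 1) = inverse (t ^ Suc j)"
  by (simp only: power_int_minus power_int_of_nat)
 moreover have "2 * int (Suc i) - int (Suc j) + 1 - 1 = 2 * int i - int j + 1" for i by simp
 ultimately show ?thesis
  unfolding balanced_prod_def * prod.lessThan_Suc_shift o_def by (simp only: divide_inverse mult.commute)
qed

lemma balanced_prod_Suc_Suc:
 assumes "t \<noteq> 0"
 shows "balanced_prod t (Suc (Suc j)) x = balanced_prod t j x * (1 - x * t ^ Suc j) * (1 - x / t ^ Suc j)"
proof -
 have "balanced_prod t (Suc (Suc j)) (t * (x / t)) = balanced_prod t (Suc j) (x / t) * (1 - x / t * t ^ Suc (Suc j))"
  by (rule balanced_prod_up[OF assms])
 then show ?thesis unfolding balanced_prod_down[OF assms] using assms by (simp add: mult_ac)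
qed

lemma balanced_prod_0 [simp]: "balanced_prod t 0 x = 1" and balanced_prod_1 [simp]: "balanced_prod t (Suc 0) x = 1 - x"
 by (simp_all add: balanced_prod_def)

text \<open>For even j > 0 the exponent -1 occurs. The point x = t is the value k = 1 that is
  wanted.\<close>

lemma balanced_prod_zero:
 assumes "t \<noteq> 0"
 shows "balanced_prod t (2 * Suc l) t = 0"
proof -
 have "2 * int l - int (2 * Suc l) + 1 = - 1" by simp
 then have "1 - t * t powi (2 * int l - int (2 * Suc l) + 1) = 0" using assms by simp
 then show ?thesis unfolding balanced_prod_def by (intro prod_zero) (auto intro!: bexI[of _ l])
qed

text \<open>Functions of x = t^k that the recursion maps to combinations of two functions of the
  same kind. The pair (m, j) belongs to n = 2 m + j + s; the powers of t and the denominator are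
  chosen so that the two coefficients become the step weights of \<open>path_count\<close>.\<close>

definition rec_basis :: "'a :: field => nat => nat => nat => 'a => 'a" where
 "rec_basis t s m j x = t ^ (m * m + m * j + (\<Sum>{..<j}) + s * (m + j)) * (x / t) ^ m * (1 - x) ^ s * balanced_prod t j x /
   ((1 - t) ^ s * (\<Prod>l<j. 1 - t ^ Suc l))"

text \<open>The step of \<open>minus_one_rec\<close> in terms of x = t^k, with k - 1 and k + 1
  turned into x / t and t x.\<close>

definition rec_op :: "'a :: field => nat => ('a => 'a) => 'a => 'a" where
 "rec_op t n f x = (1 - x) / ((1 - t) * (1 + x)) * (t ^ n * f (x / t) + x * f (t * x))"

text \<open>Once the common factors are divided out, what remains is the identity
  \<open>key\<close>, verified for s = 0 and s = 1 separately; its factor 1 + x cancels the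
  denominator of \<open>rec_op\<close>.\<close>

lemma rec_op_basis:
 fixes t :: "'a :: field"
 assumes t: "t \<noteq> 0" "\<And>r. t ^ Suc r \<noteq> 1" and x: "1 + x \<noteq> 0" and s: "s \<le> 1"
 shows "rec_op t (2 * m + s + j) (rec_basis t s m j) x = num t (Suc j) * rec_basis t s m (Suc j) x +
  (if j = 0 then 0 else num t (j + s) * rec_basis t s (Suc m) (j - 1) x)"
proof -
 have t1: "1 - t \<noteq> 0" "1 - t ^ Suc j \<noteq> 0" for j using t(2)[of 0] t(2)[of j] by auto
 have num: "num t k = (1 - t ^ k) / (1 - t)" for k
  using one_diff_power_eq[of t k] t1(1) by (simp add: num_def field_simps)
 have s01: "s = 0 \<or> s = 1" using s by auto
 define X where "X = (x / t) ^ m"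
 have xm: "x ^ m = t ^ m * X" unfolding X_def using t(1) by (simp add: power_divide)
 have xtm: "t ^ m * (x / t / t) ^ m = X" unfolding X_def using t(1) by (simp add: power_divide power_mult_distrib)
 define G where "G j = (1 - t) ^ s * (\<Prod>l<j. 1 - t ^ Suc l)" for j
 have G_Suc: "G (Suc j) = G j * (1 - t ^ Suc j)" for j by (simp add: G_def)
 have Gnz: "G j \<noteq> 0" for j unfolding G_def using t1 by auto
 define ex where "ex m j = m * m + m * j + (\<Sum>{..<j}) + s * (m + j)" for m j :: nat
 have basis: "rec_basis t s m j y = t ^ ex m j * (y / t) ^ m * (1 - y) ^ s * balanced_prod t j y / G j" for m j y
  unfolding rec_basis_def G_def ex_def ..
 have exS: "ex m (Suc j) = ex m j + (m + j + s)" "ex (Suc m) j = ex m (Suc j) + m + 1 " for m j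
  by (simp_all add: ex_def algebra_simps)
 show ?thesis
 proof (cases j)
  case 0
  have key: "(1 - x) * (t ^ s * (1 - x / t) ^ s + x * (1 - t * x) ^ s) = (1 + x) * (t ^ s * ((1 - x) ^ s * (1 - x)))"
   using s01 t(1) by (auto simp: field_simps)
  have "rec_op t (2 * m + s + 0) (rec_basis t s m 0) x =
    t ^ ex m 0 * t ^ m * X / ((1 - t) * (1 + x) * G 0) * ((1 - x) * (t ^ s * (1 - x / t) ^ s + x * (1 - t * x) ^ s))"
  proof -
   have "t ^ (2 * m + s + 0) * (x / t / t) ^ m = t ^ m * t ^ s * X"
    unfolding xtm[symmetric] by (simp add: power_add power_mult power2_eq_square mult_ac power_mult_distrib)
   then have "t ^ (2 * m + s + 0) * rec_basis t s m 0 (x / t) = t ^ ex m 0 * t ^ m * X / G 0 * (t ^ s * (1 - x / t) ^ s)"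
    unfolding basis by (simp add: mult_ac)
   moreover have "x * rec_basis t s m 0 (t * x) = t ^ ex m 0 * t ^ m * X / G 0 * (x * (1 - t * x) ^ s)"
    unfolding basis using t(1) by (simp add: xm)
   ultimately show ?thesis unfolding rec_op_def by (simp add: distrib_left mult_ac)
  qed
  also have "\<dots> = t ^ ex m 0 * t ^ m * X / ((1 - t) * G 0) * (t ^ s * ((1 - x) ^ s * (1 - x)))"
   unfolding key using x by simp
  also have "\<dots> = num t (Suc 0) * rec_basis t s m (Suc 0) x"
   unfolding basis exS G_Suc num X_def[symmetric] using t1 by (simp add: power_add mult_ac)
  finally show ?thesis using 0 by simp
 next
  case (Suc j')
  define T where "T = t ^ Suc j'"
  have T: "T \<noteq> 0" "1 - T \<noteq> 0" using t(1) t1 by (auto simp: T_def)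
  define P where "P = balanced_prod t j' x"
  have key: "(1 - x) * (T * t ^ s * (1 - x / t) ^ s * (1 - x / T) + x * (1 - t * x) ^ s * (1 - x * T)) =
   (1 + x) * (1 - x) ^ s * (T * t ^ s * ((1 - x * T) * (1 - x / T)) + (1 - T) * (1 - T * t ^ s) * x)"
   using s01 t(1) T(1) by (auto simp: field_simps)
  have P_up: "balanced_prod t j (t * x) = P * (1 - x * T)" and P_down: "balanced_prod t j (x / t) = P * (1 - x / T)"
   and P_Suc: "balanced_prod t (Suc j) x = P * ((1 - x * T) * (1 - x / T))"
   unfolding Suc balanced_prod_up[OF t(1)] balanced_prod_down[OF t(1)] balanced_prod_Suc_Suc[OF t(1)] P_def T_def
   by (simp_all add: mult.assoc)
  have "rec_op t (2 * m + s + j) (rec_basis t s m j) x = t ^ ex m j * t ^ m * X * P / ((1 - t) * (1 + x) * G j) *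
    ((1 - x) * (T * t ^ s * (1 - x / t) ^ s * (1 - x / T) + x * (1 - t * x) ^ s * (1 - x * T)))"
  proof -
   have "t ^ (2 * m + s + j) * (x / t / t) ^ m = t ^ m * (T * t ^ s) * X"
    unfolding xtm[symmetric] Suc T_def by (simp add: power_add power_mult power2_eq_square mult_ac power_mult_distrib)
   then have "t ^ (2 * m + s + j) * rec_basis t s m j (x / t) =
     t ^ ex m j * t ^ m * X * P / G j * (T * t ^ s * (1 - x / t) ^ s * (1 - x / T))"
    unfolding basis P_down by (simp add: mult_ac)
   moreover have "x * rec_basis t s m j (t * x) = t ^ ex m j * t ^ m * X * P / G j * (x * (1 - t * x) ^ s * (1 - x * T))"
    unfolding basis P_up using t(1) by (simp add: xm mult_ac)
   ultimately show ?thesis unfolding rec_op_def by (simp add: distrib_left mult_ac)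
  qed
  also have "\<dots> = t ^ ex m j * t ^ m * X * P / ((1 - t) * G j) *
    ((1 - x) ^ s * (T * t ^ s * ((1 - x * T) * (1 - x / T)) + (1 - T) * (1 - T * t ^ s) * x))"
   unfolding key using x by simp
  also have "\<dots> = num t (Suc j) * rec_basis t s m (Suc j) x + num t (j + s) * rec_basis t s (Suc m) j' x"
  proof -
   have "num t (Suc j) * rec_basis t s m (Suc j) x =
     t ^ ex m j * t ^ m * X * P / ((1 - t) * G j) * ((1 - x) ^ s * (T * t ^ s * ((1 - x * T) * (1 - x / T))))"
    unfolding basis exS G_Suc num P_Suc X_def[symmetric] using t1(2)[of j]
    by (simp add: power_add T_def Suc mult_ac)
   moreover have "num t (j + s) * rec_basis t s (Suc m) j' x =
     t ^ ex m j * t ^ m * X * P / ((1 - t) * G j) * ((1 - x) ^ s * ((1 - T) * (1 - T * t ^ s) * x))"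
   proof -
    have "(x / t) ^ Suc m = x / t * X" by (simp add: X_def)
    moreover have "1 / G j' = (1 - T) / G j" unfolding Suc G_Suc T_def[symmetric] using T(2) by simp
    then have "y / G j' = y * (1 - T) / G j" for y by (metis divide_inverse mult.assoc mult.left_neutral)
    moreover have "t ^ (j + s) = T * t ^ s" unfolding Suc T_def by (simp add: power_add)
    ultimately show ?thesis
     unfolding basis exS(2) num P_def[symmetric] Suc[symmetric] using t(1) by (simp add: power_add mult_ac X_def)
   qed
   ultimately show ?thesis by (simp add: distrib_left)
  qed
  finally show ?thesis using Suc by simp
 qed
qed

lemma path_count_zero: "i < j \<or> odd (i + j) ==> path_count t s i j = 0"
proof (induction i arbitrary: j)
 case (Suc i)
 have "path_count t s i (Suc j) = 0" by (rule Suc.IH) (use Suc.prems in auto)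
 moreover have "path_count t s i j' = 0" if "j = Suc j'" for j' by (rule Suc.IH) (use Suc.prems that in auto)
 ultimately show ?case by (cases j) simp_all
qed (auto elim: oddE)

lemma rec_op_sum: "rec_op t n (%x. \<Sum>j\<in>J. c j * f j x) x = (\<Sum>j\<in>J. c j * rec_op t n (f j) x)"
 unfolding rec_op_def by (simp add: sum_distrib_left sum.distrib distrib_left sum_divide_distrib mult_ac)

text \<open>At n = s the value is ((1 - x) / (1 - t))^s for x = t^k. Each further step applies
  \<open>rec_op_basis\<close>, so the coefficients obey the recursion of
  \<open>path_count\<close>.\<close>

lemma minus_one_rec_closed_form:
 fixes t :: "'a :: field"
 assumes t: "t \<noteq> 0" "\<And>r. t ^ Suc r \<noteq> 1" "\<And>r. 1 + t ^ r \<noteq> 0" and s: "s \<le> 1"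
 shows "minus_one_rec t (i + s) k = (\<Sum>j\<le>i. path_count t s i j * rec_basis t s ((i - j) div 2) j (t ^ k))"
proof (induction i arbitrary: k)
 case 0
 have "s = 0 \<or> s = 1" using s by auto
 moreover have "a / (b * c) * c = a / b" if "c \<noteq> 0" for a b c :: 'a using that by simp
 from this[OF t(3), of "1 - t ^ k" "1 - t"] have "minus_one_rec t (Suc 0) k = (1 - t ^ k) / (1 - t)" by simp
 ultimately show ?case by (auto simp: rec_basis_def simp del: minus_one_rec.simps(2))
next
 case (Suc i)
 define x where "x = t ^ k"
 define F where "F y = (\<Sum>j\<le>i. path_count t s i j * rec_basis t s ((i - j) div 2) j y)" for y
 define N where "N = path_count t s i"
 have "minus_one_rec t (Suc i + s) k = rec_op t (i + s) F x"
 proof (cases k)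
  \<comment> \<open>For k = 0 the truncated k - 1 does not correspond to x / t, but the prefactor 1
    - x is zero.\<close>
  case 0
  then show ?thesis by (simp add: rec_op_def x_def)
 next
  case (Suc k')
  then have "x / t = t ^ (k - 1)" "t * x = t ^ Suc k" using t(1) by (simp_all add: x_def)
  then show ?thesis using Suc.IH[of "k - 1"] Suc.IH[of "Suc k"]
   by (simp add: rec_op_def F_def x_def[symmetric])
 qed
 also have "\<dots> = (\<Sum>j\<le>i. N j * rec_op t (i + s) (rec_basis t s ((i - j) div 2) j) x)"
  unfolding F_def N_def by (rule rec_op_sum)
 also have "\<dots> = (\<Sum>j\<le>i. N j * (num t (Suc j) * rec_basis t s ((i - j) div 2) (Suc j) x +
   (if j = 0 then 0 else num t (j + s) * rec_basis t s (Suc ((i - j) div 2)) (j - 1) x)))"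
 proof (rule sum.cong[OF refl])
  fix j assume j: "j \<in> {..i}"
  show "N j * rec_op t (i + s) (rec_basis t s ((i - j) div 2) j) x = N j * (num t (Suc j) * rec_basis t s ((i - j) div 2) (Suc j) x +
   (if j = 0 then 0 else num t (j + s) * rec_basis t s (Suc ((i - j) div 2)) (j - 1) x))"
  \<comment> \<open>The division by 2 in the index is exact for even i - j only; otherwise there is
    no path.\<close>
  proof (cases "odd (i + j)")
   case True
   then show ?thesis by (simp add: N_def path_count_zero)
  next
   case False
   then have "even (i - j)" using j by simp
   then have e: "2 * ((i - j) div 2) + s + j = i + s" using j by auto
   have "1 + x \<noteq> 0" using t(3) by (simp add: x_def)
   from rec_op_basis[OF t(1,2) this s, of "(i - j) div 2" j] show ?thesis unfolding e by (simp only:)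
  qed
 qed
 also have "\<dots> = (\<Sum>j\<le>i. num t (Suc j) * N j * rec_basis t s ((Suc i - Suc j) div 2) (Suc j) x) +
   (\<Sum>j\<le>i. if j = 0 then 0 else num t (j + s) * N j * rec_basis t s ((Suc i - (j - 1)) div 2) (j - 1) x)"
  unfolding sum.distrib[symmetric]
 proof (rule sum.cong[OF refl])
  fix j assume "j \<in> {..i}"
  then have "j \<noteq> 0 ==> (Suc i - (j - 1)) div 2 = Suc ((i - j) div 2)" by (simp add: Suc_diff_le)
  then show "N j * (num t (Suc j) * rec_basis t s ((i - j) div 2) (Suc j) x +
    (if j = 0 then 0 else num t (j + s) * rec_basis t s (Suc ((i - j) div 2)) (j - 1) x)) =
   num t (Suc j) * N j * rec_basis t s ((Suc i - Suc j) div 2) (Suc j) x +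
   (if j = 0 then 0 else num t (j + s) * N j * rec_basis t s ((Suc i - (j - 1)) div 2) (j - 1) x)"
   by (cases "j = 0") (simp_all add: distrib_left mult_ac)
 qed
 also have "(\<Sum>j\<le>i. num t (Suc j) * N j * rec_basis t s ((Suc i - Suc j) div 2) (Suc j) x) =
   (\<Sum>j\<le>Suc i. if j = 0 then 0 else num t j * N (j - 1) * rec_basis t s ((Suc i - j) div 2) j x)"
  by (subst sum.atMost_Suc_shift) simp
 also have "(\<Sum>j\<le>i. if j = 0 then 0 else num t (j + s) * N j * rec_basis t s ((Suc i - (j - 1)) div 2) (j - 1) x) =
   (\<Sum>j\<le>Suc i. num t (j + 1 + s) * N (Suc j) * rec_basis t s ((Suc i - j) div 2) j x)"
 proof -
  have "(\<Sum>j\<le>i. if j = 0 then 0 else num t (j + s) * N j * rec_basis t s ((Suc i - (j - 1)) div 2) (j - 1) x) =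
    (\<Sum>j\<in>{1..i}. num t (j + s) * N j * rec_basis t s ((Suc i - (j - 1)) div 2) (j - 1) x)"
   by (rule sum.mono_neutral_cong_right) auto
  also have "\<dots> = (\<Sum>j<i. num t (j + 1 + s) * N (Suc j) * rec_basis t s ((Suc i - j) div 2) j x)"
   by (rule sum.reindex_bij_witness[of _ Suc "%j. j - 1"]) auto
  also have "\<dots> = (\<Sum>j\<le>Suc i. num t (j + 1 + s) * N (Suc j) * rec_basis t s ((Suc i - j) div 2) j x)"
   by (rule sum.mono_neutral_left) (auto simp: N_def path_count_zero)
  finally show ?thesis .
 qed
 finally show ?case unfolding x_def N_def
  by (simp add: sum.distrib[symmetric] distrib_right if_distrib[of "%x. x * _"] cong: if_cong)
qed

text \<open>At x = t only j = 0 survives: odd j drop out by the parity of paths, even j > 0 by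
  \<open>balanced_prod_zero\<close>. For n = 2 m + s the remaining power of t is m^2 + s m, the
  floor of n^2 / 4.\<close>

theorem minus_one_rec_1:
 fixes t :: "'a :: field"
 assumes t: "t \<noteq> 0" "\<And>r. t ^ Suc r \<noteq> 1" "\<And>r. 1 + t ^ r \<noteq> 0" and n: "n \<ge> 1"
 shows "minus_one_rec t n 1 = t ^ (n\<^sup>2 div 4) * (if even n then path_count t 0 n 0 else path_count t 1 (n - 1) 0)"
proof -
 have main: "minus_one_rec t (2 * m + s) 1 = t ^ (m * m + s * m) * path_count t s (2 * m) 0" if s: "s \<le> 1" for m s
 proof -
  have "minus_one_rec t (2 * m + s) 1 = (\<Sum>j\<le>2 * m. path_count t s (2 * m) j * rec_basis t s ((2 * m - j) div 2) j (t ^ 1))"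
   by (rule minus_one_rec_closed_form[OF t s])
  also have "\<dots> = (\<Sum>j\<in>{0}. path_count t s (2 * m) j * rec_basis t s ((2 * m - j) div 2) j (t ^ 1))"
  proof (rule sum.mono_neutral_right)
   show "\<forall>j\<in>{..2 * m} - {0}. path_count t s (2 * m) j * rec_basis t s ((2 * m - j) div 2) j (t ^ 1) = 0"
   proof
    fix j assume j: "j \<in> {..2 * m} - {0}"
    show "path_count t s (2 * m) j * rec_basis t s ((2 * m - j) div 2) j (t ^ 1) = 0"
    proof (cases "odd j")
     case False
     then obtain l where "j = 2 * l" by (auto elim: evenE)
     then obtain l' where "j = 2 * Suc l'" using j by (cases l) auto
     then show ?thesis using balanced_prod_zero[OF t(1), of l'] by (simp add: rec_basis_def)
    qed (simp add: path_count_zero)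
   qed
  qed auto
  also have "\<dots> = path_count t s (2 * m) 0 * (t ^ (m * m + s * m) * ((1 - t) ^ s / (1 - t) ^ s))"
   using t(1) by (simp add: rec_basis_def)
  finally show ?thesis using t(2)[of 0] by simp
 qed
 show ?thesis
 proof (cases "even n")
  case True
  then obtain m where "n = 2 * m" by (auto elim: evenE)
  then show ?thesis using main[of 0 m] by (simp add: power2_eq_square)
 next
  case False
  then obtain m where m: "n = 2 * m + 1" by (auto elim: oddE)
  have "n\<^sup>2 = 4 * (m * m + m) + 1" unfolding m by (simp add: power2_eq_square algebra_simps)
  moreover have "(4 * k + 1) div 4 = k" for k :: nat by simp
  ultimately have "n\<^sup>2 div 4 = m * m + m" by (simp only:)
  then show ?thesis using main[of 1 m] m by simp
 qed
qed

section \<open>Alternating permutations\<close>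

fun alt :: "bool => nat list => bool" where
 "alt d (x # y # r) \<longleftrightarrow> (if d then y < x else x < y) \<and> alt (\<not> d) (y # r)"
| "alt d w \<longleftrightarrow> True"

text \<open>The 31-2 patterns of a word, grouped by the adjacent pair that plays the role of
  31.\<close>

fun stat :: "nat list => nat" where
 "stat (x # y # r) = length (filter (%z. y < z \<and> z < x) r) + stat (y # r)"
| "stat w = 0"

section \<open>Replacing a placeholder Z by the next letter\<close>

lemma alt_Z_even:
 assumes "alt d (a @ Z # b)" "\<forall>c\<in>set a. c \<le> Z" "a \<noteq> []"
 shows "d \<longleftrightarrow> even (length a)" using assms
proof (induction a arbitrary: d)
 case (Cons y a)
 then show ?case by (cases a) (auto split: if_splits)
qed simp

text \<open>All other letters are at most \<open>v\<close> or equal to \<open>Z\<close>, so a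
  neighbour is below \<open>Suc v\<close> exactly if it is below \<open>Z\<close>.\<close>

lemma alt_peak:
 assumes "\<forall>c\<in>set a \<union> set b. c \<le> v \<or> c = Z" "Suc v < Z" "d \<longleftrightarrow> even (length a)"
 shows "alt d (a @ Suc v # b) \<longleftrightarrow> alt d (a @ Z # b)" using assms
proof (induction a arbitrary: d)
 case Nil
 then show ?case by (cases b) auto
next
 case (Cons y a)
 have "alt (\<not> d) (a @ Suc v # b) \<longleftrightarrow> alt (\<not> d) (a @ Z # b)" using Cons by (intro Cons.IH) auto
 then show ?case using Cons.prems by (cases a) auto
qed

lemma alt_valley:
 assumes "x < Z" "d \<longleftrightarrow> even (length a)"
 shows "alt d (a @ Z # x # Z # b) \<longleftrightarrow> alt d (a @ Z # b)" using assms
proof (induction a arbitrary: d)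
 case (Cons y a)
 have "alt (\<not> d) (a @ Z # x # Z # b) \<longleftrightarrow> alt (\<not> d) (a @ Z # b)" using Cons by (intro Cons.IH) auto
 then show ?case by (cases a) auto
qed simp

text \<open>An earlier \<open>Z\<close> is followed by a letter at most \<open>v\<close>, and this
  pair forms one new pattern with \<open>Suc v\<close>. The replaced \<open>Z\<close> was never the
  letter 2 of a pattern, and as the letter 3 it takes part in the same patterns as
  \<open>Suc v\<close>.\<close>

lemma stat_peak:
 assumes "\<forall>c\<in>set a \<union> set b. c \<le> v \<or> c = Z" "Suc v < Z" "alt d (a @ Z # b)"
 shows "stat (a @ Suc v # b) = stat (a @ Z # b) + count_list a Z" using assms
proof (induction a arbitrary: d)
 case Nil
 have "filter (%z. y < z \<and> z < Suc v) r = filter (%z. y < z \<and> z < Z) r" if "b = y # r" for y r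
  using Nil that by (intro filter_cong) auto
 then show ?case by (cases b) auto
next
 case (Cons y a)
 have alt: "alt (\<not> d) (a @ Z # b)" using Cons.prems(3) by (cases a) auto
 have IH: "stat (a @ Suc v # b) = stat (a @ Z # b) + count_list a Z"
  by (rule Cons.IH[OF _ Cons.prems(2) alt]) (use Cons.prems(1) in auto)
 have yZ: "y \<le> Z" using Cons.prems by auto
 show ?case
 proof (cases a)
  case Nil
  then have "y \<le> v" using Cons.prems by (auto split: if_splits)
  then show ?thesis using IH Nil Cons.prems(2) by (auto simp: filter_empty_conv)
 next
  case (Cons y2 a')
  show ?thesis
  proof (cases "y = Z")
   case True
   then have "y2 < Z" using Cons.prems Cons by (auto split: if_splits)
   then have "y2 \<le> v" using Cons.prems(1) Cons by auto
   then show ?thesis using IH Cons True Cons.prems(2) by simp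
  next
   case False
   then have "y \<le> v" using Cons.prems(1) by auto
   then show ?thesis using IH Cons False Cons.prems(2) by simp
  qed
 qed
qed

text \<open>Again each earlier \<open>Z\<close> gives one new pattern. No letter lies strictly
  between \<open>Suc v\<close> and \<open>Z\<close>, so the new adjacent pair \<open>Z\<close>,
  \<open>Suc v\<close> starts none.\<close>

lemma stat_valley:
 assumes "\<forall>c\<in>set a. c \<le> v \<or> c = Z" "Suc v < Z" "alt d (a @ Z # b)"
  and b: "\<forall>c\<in>set b. c \<le> v \<or> c = Z"
 shows "stat (a @ Z # Suc v # Z # b) = stat (a @ Z # b) + count_list a Z" using assms(1-3)
proof (induction a arbitrary: d)
 case Nil
 have "filter (%z. Suc v < z \<and> z < Z) b = []" using b by (auto simp: filter_empty_conv)
 moreover have "filter (%z. Z < z \<and> z < Suc v) b = []" using Nil by (auto simp: filter_empty_conv)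
 ultimately show ?case using Nil by simp
next
 case (Cons y a)
 have alt: "alt (\<not> d) (a @ Z # b)" using Cons.prems(3) by (cases a) auto
 have IH: "stat (a @ Z # Suc v # Z # b) = stat (a @ Z # b) + count_list a Z"
  by (rule Cons.IH[OF _ Cons.prems(2) alt]) (use Cons.prems(1) in auto)
 have yZ: "y \<le> Z" using Cons.prems by auto
 show ?case
 proof (cases a)
  case Nil
  then have "y < Z" using Cons.prems by (auto split: if_splits)
  then show ?thesis using IH Nil by (auto simp: filter_empty_conv)
 next
  case (Cons y2 a')
  show ?thesis
  proof (cases "y = Z")
   case True
   then have "y2 < Z" using Cons.prems Cons by (auto split: if_splits)
   then have "y2 \<le> v" using Cons.prems(1) Cons by auto
   then show ?thesis using IH Cons True Cons.prems(2) by simp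
  next
   case False
   then have "y \<le> v" using Cons.prems(1) by auto
   then show ?thesis using IH Cons False Cons.prems(2) by simp
  qed
 qed
qed

text \<open>Alternating words in \<open>1, \<dots>, v\<close>, each used once, and \<open>k\<close> letters \<open>Z\<close>, which stand for the maximal
 blocks of letters greater than \<open>v\<close> of an alternating permutation. For \<open>s = 0\<close> the word ends in \<open>Z\<close>.\<close>

definition alt_words :: "nat => nat => nat => nat => nat list set" where
 "alt_words Z s v k = {w. mset w = mset_set {1..v} + replicate_mset k Z \<and> alt True w \<and> odd (length w) \<and>
   (s = 0 --> last w = Z)}"

definition splits :: "nat => nat list => (nat list \<times> nat list) set" where
 "splits Z u = {(a, b). a @ Z # b = u}"

lemma splits_snoc: "splits Z (u @ [y]) = (%(a, b). (a, b @ [y])) ` splits Z u \<union> (if y = Z then {(u, [])} else {})"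
proof (intro set_eqI iffI)
 fix p assume "p \<in> splits Z (u @ [y])"
 then obtain a b where p: "p = (a, b)" "a @ Z # b = u @ [y]" by (auto simp: splits_def)
 then show "p \<in> (%(a, b). (a, b @ [y])) ` splits Z u \<union> (if y = Z then {(u, [])} else {})"
  by (cases b rule: rev_cases) (auto simp: splits_def image_iff)
qed (auto simp: splits_def split: if_splits)

lemma finite_splits [simp]: "finite (splits Z u)"
proof (induction u rule: rev_induct)
 case Nil
 show ?case by (rule finite_subset[of _ "{}"]) (auto simp: splits_def)
qed (simp add: splits_snoc)

lemma sum_splits_snoc:
 "(\<Sum>(a, b)\<in>(%(a, b). (a, b @ [y])) ` splits Z u. F a) = (\<Sum>(a, b)\<in>splits Z u. F a)"
 by (subst sum.reindex) (auto simp: inj_on_def case_prod_unfold)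

text \<open>The successive occurrences of \<open>Z\<close> have 0, 1, 2, ... copies of
  \<open>Z\<close> to their left.\<close>

lemma sum_splits: "(\<Sum>(a, b)\<in>splits Z u. t ^ count_list a Z) = num t (count_list u Z)"
proof (induction u rule: rev_induct)
 case Nil
 have "splits Z [] = {}" by (auto simp: splits_def)
 then show ?case by (simp add: num_def)
next
 case (snoc y u)
 have "(\<Sum>(a, b)\<in>splits Z (u @ [y]). t ^ count_list a Z) =
   (\<Sum>(a, b)\<in>(%(a, b). (a, b @ [y])) ` splits Z u. t ^ count_list a Z) +
   (\<Sum>(a, b)\<in>(if y = Z then {(u, [] :: nat list)} else {}). t ^ count_list a Z)"
  unfolding splits_snoc by (rule sum.union_disjoint) (auto split: if_splits)
 then show ?case unfolding sum_splits_snoc snoc by (simp add: num_def)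
qed

text \<open>For s = 0 the final \<open>Z\<close> marks the end of the word and must not be
  replaced.\<close>

lemma sum_splits_nonempty:
 assumes "u \<noteq> []" "last u = Z"
 shows "(\<Sum>(a, b)\<in>{p \<in> splits Z u. snd p \<noteq> []}. t ^ count_list a Z) = num t (count_list u Z - 1)"
proof -
 obtain u' where u: "u = u' @ [Z]" using assms by (metis append_butlast_last_id)
 have "{p \<in> splits Z u. snd p \<noteq> []} = (%(a, b). (a, b @ [Z])) ` splits Z u'"
  unfolding u splits_snoc by auto
 then show ?thesis by (simp only: sum_splits_snoc sum_splits) (simp add: u)
qed

lemma mset_set_Suc: "mset_set {1..Suc v} = add_mset (Suc v) (mset_set {1..v})"
proof -
 have "{1..Suc v} = insert (Suc v) {1..v}" by auto
 then show ?thesis by simp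
qed

lemma alt_words_letters: "w \<in> alt_words Z s v k ==> c \<in> set w ==> c \<le> v \<or> c = Z"
proof -
 assume w: "w \<in> alt_words Z s v k" and c: "c \<in> set w"
 have m: "mset w = mset_set {1..v} + replicate_mset k Z" using w by (simp add: alt_words_def)
 have "c \<in># mset w" using c by simp
 then show ?thesis unfolding m by (auto split: if_splits)
qed

lemma finite_alt_words [simp]: "finite (alt_words Z s v k)"
proof (rule finite_subset)
 show "alt_words Z s v k \<subseteq> {w. mset w = mset_set {1..v} + replicate_mset k Z}" by (auto simp: alt_words_def)
 show "finite {w. mset w = mset_set {1..v} + replicate_mset k Z}" (is "finite {w. mset w = ?M}")
  by (rule finite_subset[OF _ finite_lists_length_eq[of "set_mset ?M" "size ?M"]])
   (auto simp del: set_mset_union size_union simp flip: size_mset set_mset_mset)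
qed

lemma alt_words_peak:
 assumes "Suc v < Z" and even: "even (length a)"
 shows "a @ Suc v # b \<in> alt_words Z s (Suc v) k \<longleftrightarrow> a @ Z # b \<in> alt_words Z s v (Suc k) \<and> (s = 0 --> b \<noteq> [])"
proof -
 have m: "mset (a @ Suc v # b) = mset_set {1..Suc v} + replicate_mset k Z \<longleftrightarrow>
   mset (a @ Z # b) = mset_set {1..v} + replicate_mset (Suc k) Z" unfolding mset_set_Suc by simp
 have "alt True (a @ Suc v # b) \<longleftrightarrow> alt True (a @ Z # b)"
  if "mset (a @ Z # b) = mset_set {1..v} + replicate_mset (Suc k) Z"
 proof (rule alt_peak[OF _ assms(1)])
  show "\<forall>c\<in>set a \<union> set b. c \<le> v \<or> c = Z"
  proof
   fix c assume "c \<in> set a \<union> set b"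
   then have "c \<in># mset (a @ Z # b)" by auto
   then show "c \<le> v \<or> c = Z" unfolding that by (auto split: if_splits)
  qed
 qed (simp add: even)
 then show ?thesis using m assms(1) unfolding alt_words_def by (cases b) auto
qed

lemma alt_words_valley:
 assumes "Suc v < Z" "even (length a)"
 shows "a @ Z # Suc v # Z # b \<in> alt_words Z s (Suc v) (Suc k) \<longleftrightarrow> a @ Z # b \<in> alt_words Z s v k"
proof -
 have "mset (a @ Z # Suc v # Z # b) = mset_set {1..Suc v} + replicate_mset (Suc k) Z \<longleftrightarrow>
   mset (a @ Z # b) = mset_set {1..v} + replicate_mset k Z" unfolding mset_set_Suc by simp
 moreover have "alt True (a @ Z # Suc v # Z # b) \<longleftrightarrow> alt True (a @ Z # b)" using assms by (intro alt_valley) simp_all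
 ultimately show ?thesis unfolding alt_words_def by auto
qed

lemma alt_words_split_even:
 assumes "a @ Z # b \<in> alt_words Z s v k" "v < Z"
 shows "even (length a)"
proof (cases "a = []")
 case False
 have "\<forall>c\<in>set a. c \<le> Z" using alt_words_letters[OF assms(1)] assms(2) by fastforce
 then show ?thesis using alt_Z_even[of True a Z b] assms(1) False by (auto simp: alt_words_def)
qed simp

text \<open>If an odd number of letters precedes \<open>Suc v\<close>, it is a valley; both
  neighbours exist because the length is odd, and they exceed \<open>Suc v\<close>, so they are
  \<open>Z\<close>.\<close>

lemma alt_words_cases:
 assumes w: "w \<in> alt_words Z s (Suc v) k" and v: "Suc v < Z"
 obtains (peak) a b where "w = a @ Suc v # b" "even (length a)"
 | (valley) a b where "w = a @ Z # Suc v # Z # b" "even (length a)" "k \<noteq> 0"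
proof -
 have m: "mset w = mset_set {1..Suc v} + replicate_mset k Z" using w by (simp add: alt_words_def)
 then have "Suc v \<in># mset w" by simp
 then obtain a b where ab: "w = a @ Suc v # b" by (auto dest: split_list)
 show thesis
 proof (cases "even (length a)")
  case True
  then show thesis using peak ab by blast
 next
  case False
  have mab: "mset a + mset b = mset_set {1..v} + replicate_mset k Z" using m unfolding ab mset_set_Suc by simp
  have letter: "c \<le> v \<or> c = Z" if "c \<in> set a \<union> set b" for c
  proof -
   have "c \<in># mset a + mset b" using that by auto
   then show ?thesis unfolding mab by (auto split: if_splits)
  qed
  obtain a' y where a: "a = a' @ [y]" using False by (cases a rule: rev_cases) auto
  have "odd (length w)" using w by (simp add: alt_words_def)
  then obtain z b' where b: "b = z # b'" using False unfolding ab by (cases b) auto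
  have split: "alt d (c @ y # x # z # b') ==> (d \<longleftrightarrow> even (length c)) ==> x < y \<and> x < z" for d c x
  proof (induction c arbitrary: d)
   case (Cons e c)
   then have "alt (\<not> d) (c @ y # x # z # b')" by (cases c) auto
   then show ?case using Cons by (intro Cons.IH[of "\<not> d"]) auto
  qed simp
  have "alt True (a' @ y # Suc v # z # b')" using w unfolding ab a b by (simp add: alt_words_def)
  then have "Suc v < y \<and> Suc v < z" using False unfolding a by (intro split[of True a']) auto
  then have "y = Z" "z = Z" using letter[of y] letter[of z] a b by auto
  moreover have "k \<noteq> 0"
  proof
   assume "k = 0"
   moreover have "Z \<in># mset a + mset b" using a \<open>y = Z\<close> by simp
   ultimately show False using v unfolding mab by simp
  qed
  ultimately show thesis using valley[of a' b'] ab a b False by simp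
 qed
qed

definition alt_gf :: "'a :: comm_ring_1 => nat => nat => nat => nat => 'a" where
 "alt_gf t Z s v k = (\<Sum>w\<in>alt_words Z s v k. t ^ stat w)"

lemma sum_alt_words_splits:
 assumes v: "v < Z"
 shows "(\<Sum>(u, a, b)\<in>(SIGMA u:alt_words Z s v k. {p \<in> splits Z u. r \<and> s = 0 --> snd p \<noteq> []}). t ^ (stat u + count_list a Z)) =
  num t (if r \<and> s = 0 then k - 1 else k) * alt_gf t Z s v k"
proof -
 have cnt: "count_list u Z = k" if "u \<in> alt_words Z s v k" for u
 proof -
  have "count (mset u) Z = count (mset_set {1..v} + replicate_mset k Z) Z" using that by (simp add: alt_words_def)
  then show ?thesis using v by (simp add: count_mset)
 qed
 have "(\<Sum>(a, b)\<in>{p \<in> splits Z u. r \<and> s = 0 --> snd p \<noteq> []}. t ^ count_list a Z) = num t (if r \<and> s = 0 then k - 1 else k)"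
  if u: "u \<in> alt_words Z s v k" for u
 proof (cases "r \<and> s = 0")
  case True
  then have "u \<noteq> []" "last u = Z" using u by (auto simp: alt_words_def)
  from sum_splits_nonempty[OF this, of t] show ?thesis using True cnt[OF u] by simp
 next
  case False
  then have "{p \<in> splits Z u. r \<and> s = 0 --> snd p \<noteq> []} = splits Z u" by blast
  then show ?thesis unfolding if_not_P[OF False] using sum_splits[of t Z u] cnt[OF u] by (simp only:)
 qed
 then have "(\<Sum>u\<in>alt_words Z s v k. \<Sum>(a, b)\<in>{p \<in> splits Z u. r \<and> s = 0 --> snd p \<noteq> []}. t ^ (stat u + count_list a Z)) =
   (\<Sum>u\<in>alt_words Z s v k. t ^ stat u * num t (if r \<and> s = 0 then k - 1 else k))"
  by (intro sum.cong refl) (simp add: power_add case_prod_unfold sum_distrib_left[symmetric])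
 then show ?thesis unfolding alt_gf_def by (simp add: sum.Sigma case_prod_unfold sum_distrib_right[symmetric] mult.commute)
qed

text \<open>Common to both replacements: \<open>f a b\<close> is the result at the occurrence of
  \<open>Z\<close> between \<open>a\<close> and \<open>b\<close>, and \<open>r\<close> says that
  this \<open>Z\<close> disappears, so that for s = 0 it must not be the last letter.\<close>

lemma sum_alt_words_insert:
 fixes Z s v :: nat and f :: "nat list => nat list => nat list"
 assumes v: "v < Z"
  and mem: "\<And>a b. even (length a) ==> f a b \<in> W \<longleftrightarrow> a @ Z # b \<in> alt_words Z s v k \<and> (r \<and> s = 0 --> b \<noteq> [])"
  and inj: "\<And>a b a' b'. f a b = f a' b' ==> f a b \<in> W ==> a = a' \<and> b = b'"
  and stat: "\<And>a b. a @ Z # b \<in> alt_words Z s v k ==> stat (f a b) = stat (a @ Z # b) + count_list a Z"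
 shows "(\<Sum>w\<in>{w \<in> W. \<exists>a b. w = f a b \<and> even (length a)}. t ^ stat w) =
  num t (if r \<and> s = 0 then k - 1 else k) * alt_gf t Z s v k"
proof -
 define S where "S = (SIGMA u:alt_words Z s v k. {p \<in> splits Z u. r \<and> s = 0 --> snd p \<noteq> []})"
 have S: "x \<in> S \<longleftrightarrow> (\<exists>a b. x = (a @ Z # b, a, b) \<and> even (length a) \<and> f a b \<in> W)" for x
 proof
  assume "x \<in> S"
  then obtain a b where x: "x = (a @ Z # b, a, b)" "a @ Z # b \<in> alt_words Z s v k" "r \<and> s = 0 --> b \<noteq> []"
   by (auto simp: S_def splits_def)
  moreover from alt_words_split_even[OF x(2) v] have "even (length a)" .
  ultimately show "\<exists>a b. x = (a @ Z # b, a, b) \<and> even (length a) \<and> f a b \<in> W" using mem by blast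
 qed (auto simp: S_def splits_def mem)
 have "bij_betw (%(u, a, b). f a b) S {w \<in> W. \<exists>a b. w = f a b \<and> even (length a)}"
 proof (rule bij_betwI')
  fix x y assume "x \<in> S" "y \<in> S"
  then obtain a b a' b' where "x = (a @ Z # b, a, b)" "y = (a' @ Z # b', a', b')" "f a b \<in> W" unfolding S by blast
  then show "((case x of (u, a, b) => f a b) = (case y of (u, a, b) => f a b)) = (x = y)"
   using inj[of a b a' b'] by auto
 next
  fix w assume "w \<in> {w \<in> W. \<exists>a b. w = f a b \<and> even (length a)}"
  then obtain a b where w: "w = f a b" "even (length a)" "f a b \<in> W" by blast
  then have "(a @ Z # b, a, b) \<in> S" unfolding S by blast
  then show "\<exists>x\<in>S. w = (case x of (u, a, b) => f a b)" using w(1) by force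
 qed (auto simp: S)
 from sum.reindex_bij_betw[OF this, of "%w. t ^ stat w", symmetric]
 have "(\<Sum>w\<in>{w \<in> W. \<exists>a b. w = f a b \<and> even (length a)}. t ^ stat w) = (\<Sum>(u, a, b)\<in>S. t ^ stat (f a b))"
  by (simp add: case_prod_unfold)
 also have "\<dots> = (\<Sum>(u, a, b)\<in>S. t ^ (stat u + count_list a Z))"
  by (rule sum.cong) (auto simp: S_def splits_def stat)
 also have "\<dots> = num t (if r \<and> s = 0 then k - 1 else k) * alt_gf t Z s v k"
  unfolding S_def by (rule sum_alt_words_splits[OF v])
 finally show ?thesis .
qed

text \<open>Either \<open>Suc v\<close> replaces one of k + 2 letters \<open>Z\<close> (for s = 0,
  one of the first k + 1), or it splits one of k letters \<open>Z\<close> into two. An occurrence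
  with i copies of \<open>Z\<close> to its left costs t^i, which sums to
  \<open>num t (Suc k + s)\<close> and \<open>num t k\<close>.\<close>

lemma alt_gf_Suc:
 assumes v: "Suc v < Z" and s: "s \<le> 1"
 shows "alt_gf t Z s (Suc v) (Suc k) = num t (Suc k + s) * alt_gf t Z s v (Suc (Suc k)) + num t k * alt_gf t Z s v k"
proof -
 define P where "P = {w \<in> alt_words Z s (Suc v) (Suc k). \<exists>a b. w = a @ Suc v # b \<and> even (length a)}"
 define V where "V = {w \<in> alt_words Z s (Suc v) (Suc k). \<exists>a b. w = a @ Z # Suc v # Z # b \<and> even (length a)}"
 have once: "Suc v \<notin> set a \<and> Suc v \<notin> set b" if "a @ Suc v # b \<in> alt_words Z s (Suc v) (Suc k)" for a b
 proof -
  have "mset a + mset b = mset_set {1..v} + replicate_mset (Suc k) Z"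
   using that unfolding alt_words_def mset_set_Suc by simp
  moreover have "Suc v \<notin># mset_set {1..v} + replicate_mset (Suc k) Z" using v by auto
  ultimately have "Suc v \<notin># mset a + mset b" by metis
  then show ?thesis by simp
 qed
 have uniq: "a = a' \<and> b = b'" if "a @ Suc v # b = a' @ Suc v # b'" "a @ Suc v # b \<in> alt_words Z s (Suc v) (Suc k)" for a b a' b'
  using once[of a b] once[of a' b'] that by (simp add: append_Cons_eq_iff)
 have "P \<inter> V = {}"
 proof (rule equals0I)
  fix w assume w: "w \<in> P \<inter> V"
  obtain a b where a: "w \<in> alt_words Z s (Suc v) (Suc k)" "w = a @ Suc v # b" "even (length a)"
   using w unfolding P_def by blast
  obtain a' b' where a': "w = a' @ Z # Suc v # Z # b'" "even (length a')" using w unfolding V_def by blast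
  have e: "a @ Suc v # b = (a' @ [Z]) @ Suc v # (Z # b')" using a'(1) unfolding a(2) by simp
  have "a = a' @ [Z]" using uniq[OF e a(1)[unfolded a(2)]] by blast
  then show False using a(3) a'(2) by simp
 qed
 moreover have "alt_words Z s (Suc v) (Suc k) = P \<union> V"
 proof (intro set_eqI iffI)
  fix w assume w: "w \<in> alt_words Z s (Suc v) (Suc k)"
  then show "w \<in> P \<union> V" by (rule alt_words_cases[OF _ v]) (use w in \<open>auto simp: P_def V_def\<close>)
 qed (auto simp: P_def V_def)
 moreover have "finite P" "finite V" by (simp_all add: P_def V_def)
 ultimately have "alt_gf t Z s (Suc v) (Suc k) = (\<Sum>w\<in>P. t ^ stat w) + (\<Sum>w\<in>V. t ^ stat w)"
  unfolding alt_gf_def by (simp add: sum.union_disjoint)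
 also have "(\<Sum>w\<in>P. t ^ stat w) = num t (if True \<and> s = 0 then Suc (Suc k) - 1 else Suc (Suc k)) * alt_gf t Z s v (Suc (Suc k))"
  unfolding P_def
 proof (rule sum_alt_words_insert)
  show "stat (a @ Suc v # b) = stat (a @ Z # b) + count_list a Z" if "a @ Z # b \<in> alt_words Z s v (Suc (Suc k))" for a b
   by (rule stat_peak[OF _ v, of _ _ True]) (use that alt_words_letters[OF that] in \<open>auto simp: alt_words_def\<close>)
  show "v < Z" using v by simp
  show "a @ Suc v # b \<in> alt_words Z s (Suc v) (Suc k) \<longleftrightarrow>
    a @ Z # b \<in> alt_words Z s v (Suc (Suc k)) \<and> (True \<and> s = 0 --> b \<noteq> [])" if "even (length a)" for a b
   unfolding simp_thms by (rule alt_words_peak[OF v that])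
 qed (rule uniq)
 also have "(if True \<and> s = 0 then Suc (Suc k) - 1 else Suc (Suc k)) = Suc k + s" using s by auto
 also have "(\<Sum>w\<in>V. t ^ stat w) = num t (if False \<and> s = 0 then k - 1 else k) * alt_gf t Z s v k"
  unfolding V_def
 proof (rule sum_alt_words_insert)
  show "stat (a @ Z # Suc v # Z # b) = stat (a @ Z # b) + count_list a Z" if "a @ Z # b \<in> alt_words Z s v k" for a b
   by (rule stat_valley[OF _ v, of _ True]) (use that alt_words_letters[OF that] in \<open>auto simp: alt_words_def\<close>)
  show "a = a' \<and> b = b'" if "a @ Z # Suc v # Z # b = a' @ Z # Suc v # Z # b'"
   "a @ Z # Suc v # Z # b \<in> alt_words Z s (Suc v) (Suc k)" for a b a' b'
   using uniq[of "a @ [Z]" "Z # b" "a' @ [Z]" "Z # b'"] that by simp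
  show "v < Z" using v by simp
  show "a @ Z # Suc v # Z # b \<in> alt_words Z s (Suc v) (Suc k) \<longleftrightarrow>
    a @ Z # b \<in> alt_words Z s v k \<and> (False \<and> s = 0 --> b \<noteq> [])" if "even (length a)" for a b
   unfolding simp_thms by (rule alt_words_valley[OF v that])
 qed
 finally show ?thesis by simp
qed

text \<open>Height j stands for j + 1 letters \<open>Z\<close>. For v = 0 the only admissible word
  is the single letter \<open>Z\<close>.\<close>

lemma alt_gf_path_count:
 assumes "v < Z" "s \<le> 1"
 shows "alt_gf t Z s v (Suc j) = path_count t s v j"
proof -
 have len: "length w = k" if "w \<in> alt_words Z s 0 k" for w k
 proof -
  have "mset w = replicate_mset k Z" using that by (simp add: alt_words_def)
  then have "size (mset w) = k" by simp
  then show ?thesis by simp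
 qed
 have small: "w = [Z]" if w: "w \<in> alt_words Z s 0 k" for w k
 proof -
  have c: "x = Z" if "x \<in> set w" for x
  proof -
   have m: "mset w = replicate_mset k Z" using w by (simp add: alt_words_def)
   have "x \<in># mset w" using that by simp
   then show ?thesis unfolding m by (simp split: if_splits)
  qed
  show ?thesis
  proof (cases w)
   case (Cons x r)
   then show ?thesis using c w by (cases r) (auto simp: alt_words_def)
  qed (use w in \<open>simp add: alt_words_def\<close>)
 qed
 have "alt_words Z s 0 1 = {[Z]}" using small[of _ 1] by (auto simp: alt_words_def)
 moreover have "alt_words Z s 0 k = {}" if "k \<noteq> 1" for k
  using small[of _ k] len[of _ k] that by fastforce
 ultimately have base: "alt_gf t Z s 0 k = (if k = 1 then 1 else 0)" for k by (auto simp: alt_gf_def)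
 show "alt_gf t Z s v (Suc j) = path_count t s v j" using assms(1)
 proof (induction v arbitrary: j)
  case 0
  then show ?case by (simp add: base)
 next
  case (Suc v)
  have "alt_gf t Z s (Suc v) (Suc j) = num t (Suc j + s) * alt_gf t Z s v (Suc (Suc j)) + num t j * alt_gf t Z s v j"
   by (rule alt_gf_Suc[OF Suc.prems assms(2)])
  moreover have "num t j * alt_gf t Z s v j = (if j = 0 then 0 else num t j * path_count t s v (j - 1))"
   using Suc.IH[of "j - 1"] Suc.prems by (cases j) (simp_all add: num_def)
  ultimately show ?case using Suc.IH[of "Suc j"] Suc.prems by (simp add: add.commute)
 qed
qed

section \<open>From permutations to words\<close>

lemma all_nat_split: "(\<forall>i. P i) \<longleftrightarrow> P 0 \<and> (\<forall>i. P (Suc i))"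
 by (metis not0_implies_Suc)

lemma alt_iff: "alt d w \<longleftrightarrow> (\<forall>i. Suc i < length w --> (if even i = d then w ! Suc i < w ! i else w ! i < w ! Suc i))"
proof (induction d w rule: alt.induct)
 case (1 d x y r)
 have "(\<forall>i. Suc i < length (x # y # r) --> (if even i = d then (x # y # r) ! Suc i < (x # y # r) ! i else (x # y # r) ! i < (x # y # r) ! Suc i)) \<longleftrightarrow>
  (if d then y < x else x < y) \<and> (\<forall>i. Suc i < length (y # r) -->
   (if even (Suc i) = d then (y # r) ! Suc i < (y # r) ! i else (y # r) ! i < (y # r) ! Suc i))"
  by (subst all_nat_split) auto
 then show ?case unfolding alt.simps 1 by simp
qed simp_all

lemma stat_card: "stat w = card {(i, j). Suc i < j \<and> j < length w \<and> w ! Suc i < w ! j \<and> w ! j < w ! i}"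
proof (induction w rule: stat.induct)
 case (1 x y r)
 define w where "w = x # y # r"
 define S where "S w = {(i, j). Suc i < j \<and> j < length w \<and> w ! Suc i < w ! j \<and> w ! j < (w ! i :: nat)}" for w
 have fin: "finite (S w)" for w
  by (rule finite_subset[of _ "{..<length w} \<times> {..<length w}"]) (auto simp: S_def)
 have "S w = (%k. (0, Suc (Suc k))) ` {k. k < length r \<and> y < r ! k \<and> r ! k < x} \<union> map_prod Suc Suc ` S (y # r)"
 proof (intro set_eqI iffI)
  fix p assume p: "p \<in> S w"
  obtain i j where ij: "p = (i, j)" by fastforce
  show "p \<in> (%k. (0, Suc (Suc k))) ` {k. k < length r \<and> y < r ! k \<and> r ! k < x} \<union> map_prod Suc Suc ` S (y # r)"
  proof (cases i)
   case 0
   then obtain k where "j = Suc (Suc k)" using p ij by (auto simp: S_def less_iff_Suc_add)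
   then show ?thesis using p ij 0 by (auto simp: S_def w_def)
  next
   case (Suc i')
   then obtain j' where "j = Suc j'" using p ij by (auto simp: S_def less_iff_Suc_add)
   then have "p = map_prod Suc Suc (i', j')" "(i', j') \<in> S (y # r)" using p ij Suc by (auto simp: S_def w_def)
   then show ?thesis by blast
  qed
 qed (auto simp: S_def w_def)
 then have "card (S w) = card ((%k. (0 :: nat, Suc (Suc k))) ` {k. k < length r \<and> y < r ! k \<and> r ! k < x}) + card (map_prod Suc Suc ` S (y # r))"
  by (simp only:) (rule card_Un_disjoint, auto simp: fin)
 also have "\<dots> = card {k. k < length r \<and> y < r ! k \<and> r ! k < x} + card (S (y # r))"
  by (subst (1 2) card_image) (auto simp: inj_on_def)
 finally show ?case using 1 by (simp add: S_def w_def length_filter_conv_card)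
qed (auto simp: card_eq_0_iff)

definition perm_list :: "nat => (nat => nat) => nat list" where
 "perm_list n \<sigma> = map \<sigma> [1..<Suc n]"

lemma perm_list_nth: "i < n ==> perm_list n \<sigma> ! i = \<sigma> (Suc i)" "length (perm_list n \<sigma>) = n"
 by (simp_all add: perm_list_def del: upt_Suc)

lemma bij_perm_list:
 "bij_betw (perm_list n) (alternating_permutations n) {w. mset w = mset_set {1..n} \<and> alt True w}"
proof -
 have mset: "mset (perm_list n \<sigma>) = mset_set {1..n}" if "\<sigma> permutes {1..n}" for \<sigma>
 proof -
  have "mset (perm_list n \<sigma>) = image_mset \<sigma> (mset_set {1..<Suc n})" by (simp add: perm_list_def del: upt_Suc)
  also have "\<dots> = mset_set (\<sigma> ` {1..<Suc n})" by (rule image_mset_mset_set) (rule permutes_inj_on[OF that])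
  also have "\<sigma> ` {1..<Suc n} = {1..n}" using permutes_image[OF that] by (simp add: atLeastLessThanSuc_atLeastAtMost)
  finally show ?thesis .
 qed
 have alt: "alt True (perm_list n \<sigma>) \<longleftrightarrow> (\<forall>i. 1 \<le> i \<and> i < n --> (if odd i then \<sigma> i > \<sigma> (i + 1) else \<sigma> i < \<sigma> (i + 1)))" for \<sigma>
 proof -
  have "(\<forall>i. 1 \<le> i \<and> i < n --> (if odd i then \<sigma> i > \<sigma> (i + 1) else \<sigma> i < \<sigma> (i + 1))) \<longleftrightarrow>
   (\<forall>i. Suc i < n --> (if even i then \<sigma> (Suc i) > \<sigma> (Suc (Suc i)) else \<sigma> (Suc i) < \<sigma> (Suc (Suc i))))"
   by (subst all_nat_split) auto
  then show ?thesis unfolding alt_iff perm_list_nth(2) by (auto simp: perm_list_nth)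
 qed
 show ?thesis unfolding bij_betw_def
 proof (intro conjI set_eqI iffI)
  show "inj_on (perm_list n) (alternating_permutations n)"
  proof (rule inj_onI)
   fix \<sigma> \<tau> assume p: "\<sigma> \<in> alternating_permutations n" "\<tau> \<in> alternating_permutations n" and e: "perm_list n \<sigma> = perm_list n \<tau>"
   show "\<sigma> = \<tau>"
   proof
    fix i show "\<sigma> i = \<tau> i"
    proof (cases "i \<in> {1..n}")
     case True
     then show ?thesis using perm_list_nth(1)[of "i - 1" n] e by (metis Suc_diff_1 Suc_le_eq atLeastAtMost_iff diff_less less_le_trans zero_less_one One_nat_def)
    next
     case False
     then show ?thesis using p by (auto simp: alternating_permutations_def permutes_def)
    qed
   qed
  qed
  fix w assume "w \<in> perm_list n ` alternating_permutations n"
  then show "w \<in> {w. mset w = mset_set {1..n} \<and> alt True w}" using mset alt by (auto simp: alternating_permutations_def)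
 next
  fix w assume w: "w \<in> {w. mset w = mset_set {1..n} \<and> alt True w}"
  have "size (mset w) = size (mset_set {1..n})" using w by simp
  then have len: "length w = n" by simp
  have m: "mset w = mset_set {1..n}" using w by simp
  have "set w = set_mset (mset w)" by simp
  then have set: "set w = {1..n}" unfolding m by simp
  define \<sigma> where "\<sigma> i = (if i \<in> {1..n} then w ! (i - 1) else i)" for i
  have wl: "perm_list n \<sigma> = w" by (rule nth_equalityI) (auto simp: perm_list_nth len \<sigma>_def)
  have "\<sigma> ` {1..n} = {1..n}"
  proof -
   have "\<sigma> ` {1..n} = set (perm_list n \<sigma>)" by (simp add: perm_list_def atLeastLessThanSuc_atLeastAtMost del: upt_Suc)
   then show ?thesis using wl set by simp
  qed
  then have "\<sigma> permutes {1..n}"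
   by (intro bij_imp_permutes) (auto simp: bij_betw_def \<sigma>_def intro: eq_card_imp_inj_on)
  then show "w \<in> perm_list n ` alternating_permutations n"
   using alt[of \<sigma>] w wl by (intro image_eqI[of _ _ \<sigma>]) (auto simp: alternating_permutations_def)
 qed
qed

lemma card_patterns: "card (patterns_31_2 n \<sigma>) = stat (perm_list n \<sigma>)"
proof -
 define w where "w = perm_list n \<sigma>"
 have nth: "w ! i = \<sigma> (Suc i)" if "i < n" for i unfolding w_def by (rule perm_list_nth(1)[OF that])
 have "patterns_31_2 n \<sigma> = map_prod Suc Suc ` {(i, j). Suc i < j \<and> j < length w \<and> w ! Suc i < w ! j \<and> w ! j < w ! i}"
 proof (intro set_eqI iffI)
  fix p assume p: "p \<in> patterns_31_2 n \<sigma>"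
  then obtain i j where ij: "p = (Suc i, Suc j)" by (cases p; cases "fst p"; cases "snd p") (auto simp: patterns_31_2_def)
  then show "p \<in> map_prod Suc Suc ` {(i, j). Suc i < j \<and> j < length w \<and> w ! Suc i < w ! j \<and> w ! j < w ! i}"
   using p by (intro image_eqI[of _ _ "(i, j)"]) (auto simp: patterns_31_2_def w_def perm_list_nth)
 next
  fix p assume "p \<in> map_prod Suc Suc ` {(i, j). Suc i < j \<and> j < length w \<and> w ! Suc i < w ! j \<and> w ! j < w ! i}"
  then show "p \<in> patterns_31_2 n \<sigma>" by (auto simp: patterns_31_2_def w_def perm_list_nth)
 qed
 then show ?thesis unfolding stat_card w_def[symmetric] by (simp only:) (subst card_image, auto simp: inj_on_def)
qed

lemma alt_snoc: "\<forall>c\<in>set w. c < Z ==> d \<longleftrightarrow> even (length w) ==> alt d (w @ [Z]) \<longleftrightarrow> alt d w"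
proof (induction w arbitrary: d)
 case (Cons x w)
 then have "alt (\<not> d) (w @ [Z]) \<longleftrightarrow> alt (\<not> d) w" by simp
 then show ?case using Cons.prems by (cases w) auto
qed simp

lemma stat_snoc: "\<forall>c\<in>set w. c < Z ==> stat (w @ [Z]) = stat w"
proof (induction w)
 case (Cons x w)
 then show ?case by (cases w) auto
qed simp

text \<open>For odd n the largest letter n itself serves as the single \<open>Z\<close>, and the
  word has odd length. For even n the permutation ends at a valley, and a final letter n + 1 is
  appended as \<open>Z\<close>; it affects neither alternation nor the statistic.\<close>

lemma euler_poly_path_count:
 assumes "n \<ge> 1"
 shows "euler_poly n = (if even n then path_count [:0, 1:] 0 n 0 else path_count [:0, 1:] 1 (n - 1) 0)"
proof -
 let ?W = "{w. mset w = mset_set {1..n} \<and> alt True w}" and ?t = "[:0, 1 :: rat:]"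
 have len: "length w = n" if "mset w = mset_set {1..n}" for w
 proof -
  have "size (mset w) = n" unfolding that by simp
  then show ?thesis by simp
 qed
 have "euler_poly n = (\<Sum>\<sigma>\<in>alternating_permutations n. ?t ^ stat (perm_list n \<sigma>))"
  unfolding euler_poly_def card_patterns by (simp add: monom_altdef)
 also have "\<dots> = (\<Sum>w\<in>?W. ?t ^ stat w)" by (rule sum.reindex_bij_betw[OF bij_perm_list])
 also have "\<dots> = (if even n then path_count ?t 0 n 0 else path_count ?t 1 (n - 1) 0)"
 proof (cases "even n")
  case True
  have lt: "\<forall>c\<in>set w. c < Suc n" if w: "mset w = mset_set {1..n}" for w
  proof
   fix c assume "c \<in> set w"
   then have "c \<in># mset w" by simp
   then show "c < Suc n" unfolding w by simp
  qed
  have W: "w @ [Suc n] \<in> alt_words (Suc n) 0 n 1 \<longleftrightarrow> w \<in> ?W" for w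
   using len[of w] lt[of w] alt_snoc[of w "Suc n" True] True by (auto simp: alt_words_def)
  have "alt_words (Suc n) 0 n 1 = (%w. w @ [Suc n]) ` ?W"
  proof (intro set_eqI iffI)
   fix u assume u: "u \<in> alt_words (Suc n) 0 n 1"
   then have "u \<noteq> []" "last u = Suc n" by (auto simp: alt_words_def)
   then obtain w where "u = w @ [Suc n]" by (metis append_butlast_last_id)
   then show "u \<in> (%w. w @ [Suc n]) ` ?W" using W u by blast
  qed (use W in blast)
  then have "alt_gf ?t (Suc n) 0 n 1 = (\<Sum>w\<in>?W. ?t ^ stat (w @ [Suc n]))"
   unfolding alt_gf_def by (simp only:) (subst sum.reindex, auto simp: inj_on_def)
  also have "\<dots> = (\<Sum>w\<in>?W. ?t ^ stat w)"
  proof (rule sum.cong[OF refl])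
   fix w assume "w \<in> ?W"
   then have "stat (w @ [Suc n]) = stat w" by (intro stat_snoc lt) simp
   then show "?t ^ stat (w @ [Suc n]) = ?t ^ stat w" by (simp only:)
  qed
  finally show ?thesis using alt_gf_path_count[of n "Suc n" 0 ?t 0] True by simp
 next
  case False
  have "mset_set {1..n} = mset_set {1..n - 1} + replicate_mset 1 n"
   using mset_set_Suc[of "n - 1"] assms by simp
  then have "alt_words n 1 (n - 1) 1 = ?W" using len False by (auto simp: alt_words_def)
  then show ?thesis using alt_gf_path_count[of "n - 1" n 1 ?t 0] False assms by (simp add: alt_gf_def)
 qed
 finally show ?thesis .
qed

lemma path_count_hom:
 assumes "is_ring_hom \<rho>"
 shows "\<rho> (path_count t s i j) = path_count (\<rho> t) s i j"
proof -
 have "\<rho> (num t k) = num (\<rho> t) k" for k by (simp add: num_def is_ring_hom_sum[OF assms] is_ring_homD[OF assms])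
 then show ?thesis by (induction i arbitrary: j) (auto simp: is_ring_homD[OF assms])
qed

lemma poly_eqI_nat:
 fixes p p' :: "rat poly"
 assumes "\<And>t. t \<ge> 2 ==> poly p (of_nat t) = poly p' (of_nat t)"
 shows "p = p'"
proof (rule ccontr)
 assume "p \<noteq> p'"
 then have "finite {x. poly (p - p') x = 0}" by (intro poly_roots_finite) simp
 moreover have "of_nat ` {2..} \<subseteq> {x. poly (p - p') x = 0}" using assms by auto
 ultimately have "finite (of_nat ` {2..} :: rat set)" by (rule rev_finite_subset)
 then have "finite {2 :: nat..}" by (rule finite_imageD) (simp add: inj_on_def)
 then show False using infinite_Ici by blast
qed

text \<open>The witness is \<open>hilb\<close> over Q[t][q]; a polynomial preimage is what gives q =
  -1 a meaning for an element of Q(q,t).\<close>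

theorem mainTheorem3:
  fixes n :: nat
  assumes "n \<ge> 1"
  shows "\<exists>P :: rat poly poly.
    to_fract P = hall (nabla (elementary_sym n)) (complete_sym 1 ^ n) \<and>
    poly P (- 1) = monom 1 (n ^ 2 div 4) * euler_poly n"
proof (intro exI conjI)
 let ?P = "hilb [:0, 1:] [:[:0, 1:]:] n [n] :: rat poly poly"
 show "to_fract ?P = hall (nabla (elementary_sym n)) (complete_sym 1 ^ n)"
  unfolding hilb_hom[OF is_ring_hom_to_fract] hall_nabla_elementary by (simp add: q_var_def t_var_def)
 show "poly ?P (- 1) = monom 1 (n ^ 2 div 4) * euler_poly n"
 proof (rule poly_eqI_nat)
  \<comment> \<open>The integers t >= 2 are enough to identify polynomials, and there no 1 - t^r
    with r > 0 and no 1 + t^r vanishes.\<close>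
  fix m :: nat assume m: "m \<ge> 2"
  define t where "t = (of_nat m :: rat)"
  have t: "t > 1" using m by (simp add: t_def)
  have t': "t \<noteq> 0" "\<And>r. t ^ Suc r \<noteq> 1" "\<And>r. 1 + t ^ r \<noteq> 0"
  proof -
   show "t \<noteq> 0" using t by simp
   show "t ^ Suc r \<noteq> 1" for r using one_less_power[OF t, of "Suc r"] by simp
   have "0 < t ^ r" for r using t by simp
   then show "1 + t ^ r \<noteq> 0" for r by (metis add_pos_pos less_irrefl zero_less_one)
  qed
  have pc: "poly (path_count [:0, 1:] s i j) t = path_count t s i j" for s i j
   using path_count_hom[of "%p. poly p t" "[:0, 1:]" s i j] by (simp add: is_ring_hom_def)
  have "poly (poly ?P (- 1)) t = hilb (- 1) t n [n]"
   using hilb_hom[of "%P. poly (poly P (- 1)) t" "[:0, 1:]" "[:[:0, 1:]:]" n "[n]"] by (simp add: is_ring_hom_def)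
  also have "\<dots> = minus_one_rec t n 1"
  proof (rule hilb_minus_one)
   show "t ^ r \<noteq> 1" if "r \<ge> 1" for r using t'(2)[of "r - 1"] that by simp
  qed (use t' in auto)
  also have "\<dots> = poly (monom 1 (n ^ 2 div 4) * euler_poly n) t"
   unfolding minus_one_rec_1[OF t' assms] euler_poly_path_count[OF assms] by (simp add: poly_monom pc)
  finally show "poly (poly ?P (- 1)) (of_nat m) = poly (monom 1 (n ^ 2 div 4) * euler_poly n) (of_nat m)"
   unfolding t_def .
 qed
qed

end
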